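(* Let $m\ge2$ be an integer and let $(\Omega,\varphi)$ be admissible of order $m$ (see context). Then for every integer $0\le k\le m$, $W^{k,2}(\Omega,\varphi;X)=W^{k,2}(\Omega,\varphi;D)$ (with equivalent norms). Furthermore, if $1\le k\le m-1$, then $W^{k,2}(\Omega,\varphi;X)$ embeds compactly in $W^{k-1,2}(\Omega,\varphi;X)$.
   Context: Setting. $\Omega\subset\mathbb R^n$ is open, $M=\partial\Omega$, $\nu$ is the outward unit normal, $\Omega'_\varepsilon=\{x\in\mathbb R^n:\operatorname{dist}(x,M)<\varepsilon\}$. For closed $A\subset\mathbb R^n$ let $U_A$ be the set of points having a unique nearest point in $A$; the reach of $A$ is $\inf_{y\in A}\sup\{r\ge0: B(y,r)\subset U_A\}$. Let $\varphi$ be a real-valued $C^\infty$ function. $(\Omega,\varphi)$ is admissible of order $m$ if: (1) $M$ is of class $C^m$ with positive reach and there are $\varepsilon>0$ and a defining function $\rho$ of $\Omega$ with $\|\rho\|_{C^m(\Omega'_\varepsilon)}<\infty$; (2) there is $\theta_0\in(0,1)$ with $\lim_{|x|\to\infty,\,x\in\Omega}(\theta_0|\nabla\varphi|^2+\Delta\varphi)=\infty$; (3) there is $\theta_0\in(0,1)$ with $\lim_{|x|\to\infty,\,x\in\Omega}(\theta_0|\nabla\varphi|^2-\Delta\varphi)=\infty$; (4) there is $C_m>0$ with $|\nabla^k\varphi|\le C_m(1+|\nabla\varphi|)$ on $\Omega$ for $1\le k\le m$; (5) $\varphi$ extends to $\mathbb R^n$ so that (2)-(4) hold with $\mathbb R^n$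 in place of $\Omega$ (the extension is still called $\varphi$); (6) $\inf_{r>0}\sup_{|x|>r,\,x\in M}|\nabla\varphi|^{-1}|\partial\varphi/\partial\nu|<1$. Spaces. $L^2(\Omega,\varphi)$ has norm$^2$ $\int_\Omega|f|^2e^{-\varphi}dx$; $D_j=\frac{\partial}{\partial x_j}$ and $X_j=\frac{\partial}{\partial x_j}-\frac{\partial\varphi}{\partial x_j}$. For $Y=X$ or $Y=D$, $W^{k,2}(\Omega,\varphi;Y)=\{f\in L^2(\Omega,\varphi):Y^\alpha f\in L^2(\Omega,\varphi),\ |\alpha|\le k\}$ with norm$^2$ $\sum_{|\alpha|\le k}\|Y^\alpha f\|^2_{L^2(\Omega,\varphi)}$. *)

theory Defs
  imports "HOL-Analysis.Analysis"
begin

section \<open>Classical derivatives\<close>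

definition partial :: "'n \<Rightarrow> (real^'n \<Rightarrow> real) \<Rightarrow> real^'n \<Rightarrow> real" where
  "partial i f x = frechet_derivative f (at x) (axis i 1)"

definition grad :: "(real^'n \<Rightarrow> real) \<Rightarrow> real^'n \<Rightarrow> real^'n" where
  "grad f x = (\<chi> i. partial i f x)"

definition laplacian :: "(real^'n \<Rightarrow> real) \<Rightarrow> real^'n \<Rightarrow> real" where
  "laplacian f x = (\<Sum>i\<in>UNIV. partial i (partial i f) x)"

text \<open>The length \<open>|\<nabla>\<^sup>k f|\<close> of the tensor of all \<open>k\<close>-th order partial derivatives; the
  components are indexed by \<open>k\<close>-tuples of directions.\<close>

definition nabla_norm :: "nat \<Rightarrow> (real^'n \<Rightarrow> real) \<Rightarrow> real^'n \<Rightarrow> real" where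
  "nabla_norm k f x = sqrt (\<Sum>js | length js = k. (foldr partial js f x)\<^sup>2)"

text \<open>The class \<open>C\<^sup>k(U)\<close>, used for open \<open>U\<close>.\<close>

primrec Ck_on :: "nat \<Rightarrow> (real^'n) set \<Rightarrow> (real^'n \<Rightarrow> real) \<Rightarrow> bool" where
  "Ck_on 0 U f \<longleftrightarrow> continuous_on U f"
| "Ck_on (Suc k) U f \<longleftrightarrow> (\<forall>x\<in>U. f differentiable (at x)) \<and> (\<forall>i. Ck_on k U (partial i f))"

definition smooth_on :: "(real^'n) set \<Rightarrow> (real^'n \<Rightarrow> real) \<Rightarrow> bool" where
  "smooth_on U f \<longleftrightarrow> (\<forall>k. Ck_on k U f)"

definition Ck_norm :: "nat \<Rightarrow> (real^'n) set \<Rightarrow> (real^'n \<Rightarrow> real) \<Rightarrow> ennreal" where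
  "Ck_norm m U f = (\<Sum>k\<le>m. SUP x\<in>U. ennreal (nabla_norm k f x))"

section \<open>Geometry of the boundary\<close>

definition unique_nearest :: "'a::metric_space set \<Rightarrow> 'a set" where
  "unique_nearest A = {x. \<exists>!a. a \<in> A \<and> dist x a = infdist x A}"

definition reach :: "'a::metric_space set \<Rightarrow> ereal" where
  "reach A = (INF y\<in>A. SUP r\<in>{r. 0 \<le> r \<and> ball y r \<subseteq> unique_nearest A}. ereal r)"

text \<open>The set \<open>\<Omega>'\<^sub>\<epsilon>\<close>. It is empty if \<open>\<Omega>\<close> has no boundary, since then the distance to the
  boundary is infinite, whereas \<open>infdist\<close> is 0 by convention.\<close>

definition bd_nbhd :: "(real^'n) set \<Rightarrow> real \<Rightarrow> (real^'n) set" where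
  "bd_nbhd \<Omega> \<epsilon> = {x. frontier \<Omega> \<noteq> {} \<and> infdist x (frontier \<Omega>) < \<epsilon>}"

text \<open>A \<open>C\<^sup>m\<close> defining function of \<open>\<Omega>\<close> on the open set \<open>U\<close>: a local one if \<open>U\<close> is a neighbourhood
  of a boundary point, a global one if \<open>U\<close> is a neighbourhood of the whole boundary.\<close>

definition defining_function ::
    "nat \<Rightarrow> (real^'n) set \<Rightarrow> (real^'n) set \<Rightarrow> (real^'n \<Rightarrow> real) \<Rightarrow> bool" where
  "defining_function m \<Omega> U \<rho> \<longleftrightarrow> Ck_on m U \<rho> \<and>
     \<Omega> \<inter> U = {x\<in>U. \<rho> x < 0} \<and> frontier \<Omega> \<inter> U = {x\<in>U. \<rho> x = 0} \<and>
     (\<forall>x\<in>frontier \<Omega> \<inter> U. grad \<rho> x \<noteq> 0)"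

definition Ck_boundary :: "nat \<Rightarrow> (real^'n) set \<Rightarrow> bool" where
  "Ck_boundary m \<Omega> \<longleftrightarrow>
     (\<forall>p\<in>frontier \<Omega>. \<exists>U r. open U \<and> p \<in> U \<and> defining_function m \<Omega> U r)"

text \<open>The vector does not depend on the choice of the local defining function.\<close>

definition outward_normal :: "(real^'n) set \<Rightarrow> real^'n \<Rightarrow> real^'n" where
  "outward_normal \<Omega> p = (THE v. \<exists>U r. open U \<and> p \<in> U \<and> defining_function 1 \<Omega> U r \<and>
     v = grad r p /\<^sub>R norm (grad r p))"

section \<open>Admissible pairs\<close>

text \<open>The growth conditions at infinity on \<open>\<theta>|\<nabla>\<phi>|\<^sup>2 \<plusminus> \<Delta>\<phi>\<close> are the cases \<open>s = 1\<close> and \<open>s = -1\<close>.\<close>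

definition growth_cond :: "real \<Rightarrow> (real^'n) set \<Rightarrow> (real^'n \<Rightarrow> real) \<Rightarrow> bool" where
  "growth_cond s \<Omega> \<phi> \<longleftrightarrow> (\<exists>\<theta>. 0 < \<theta> \<and> \<theta> < 1 \<and>
     filterlim (\<lambda>x. \<theta> * (norm (grad \<phi> x))\<^sup>2 + s * laplacian \<phi> x) at_top
       (inf at_infinity (principal \<Omega>)))"

definition deriv_bound_cond :: "nat \<Rightarrow> (real^'n) set \<Rightarrow> (real^'n \<Rightarrow> real) \<Rightarrow> bool" where
  "deriv_bound_cond m \<Omega> \<phi> \<longleftrightarrow> (\<exists>C>0. \<forall>k. 1 \<le> k \<and> k \<le> m \<longrightarrow>
     (\<forall>x\<in>\<Omega>. nabla_norm k \<phi> x \<le> C * (1 + norm (grad \<phi> x))))"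

definition normal_cond :: "(real^'n) set \<Rightarrow> (real^'n \<Rightarrow> real) \<Rightarrow> bool" where
  "normal_cond \<Omega> \<phi> \<longleftrightarrow>
     (INF r\<in>{0<..}. SUP x\<in>{x\<in>frontier \<Omega>. norm x > r}.
        ereal (inverse (norm (grad \<phi> x)) * \<bar>grad \<phi> x \<bullet> outward_normal \<Omega> x\<bar>)) < 1"

text \<open>Only the values of \<open>\<phi>\<close> on \<open>\<Omega>\<close> matter; \<open>\<psi>\<close> is its extension to the whole space. The condition
  on the normal derivative lives on the boundary and hence concerns the extension.\<close>

definition admissible :: "nat \<Rightarrow> (real^'n) set \<Rightarrow> (real^'n \<Rightarrow> real) \<Rightarrow> bool" where
  "admissible m \<Omega> \<phi> \<longleftrightarrow>
     open \<Omega> \<and> smooth_on \<Omega> \<phi> \<and>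
     Ck_boundary m \<Omega> \<and> reach (frontier \<Omega>) > 0 \<and>
     (\<exists>\<epsilon>>0. \<exists>\<rho>. defining_function m \<Omega> (bd_nbhd \<Omega> \<epsilon>) \<rho> \<and> Ck_norm m (bd_nbhd \<Omega> \<epsilon>) \<rho> < \<infinity>) \<and>
     growth_cond 1 \<Omega> \<phi> \<and> growth_cond (-1) \<Omega> \<phi> \<and> deriv_bound_cond m \<Omega> \<phi> \<and>
     (\<exists>\<psi>. smooth_on UNIV \<psi> \<and> (\<forall>x\<in>\<Omega>. \<psi> x = \<phi> x) \<and>
        growth_cond 1 UNIV \<psi> \<and> growth_cond (-1) UNIV \<psi> \<and> deriv_bound_cond m UNIV \<psi> \<and>
        normal_cond \<Omega> \<psi>)"

section \<open>Weighted Sobolev spaces\<close>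

text \<open>Scalars range over \<open>'b\<close> of class \<open>real_normed_field\<close> and \<open>euclidean_space\<close>, which covers both
  real- and complex-valued functions. Elements of the function spaces are functions rather than
  classes of functions modulo null sets, and their values outside \<open>\<Omega>\<close> are irrelevant.\<close>

definition L2w :: "(real^'n) set \<Rightarrow> (real^'n \<Rightarrow> real) \<Rightarrow>
    (real^'n \<Rightarrow> 'b::{real_normed_field, euclidean_space}) set" where
  "L2w \<Omega> \<phi> = {f. f \<in> borel_measurable (lebesgue_on \<Omega>) \<and>
     integrable (lebesgue_on \<Omega>) (\<lambda>x. (norm (f x))\<^sup>2 * exp (- \<phi> x))}"

definition L2w_norm :: "(real^'n) set \<Rightarrow> (real^'n \<Rightarrow> real) \<Rightarrow>
    (real^'n \<Rightarrow> 'b::{real_normed_field, euclidean_space}) \<Rightarrow> real" where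
  "L2w_norm \<Omega> \<phi> f = sqrt (integral\<^sup>L (lebesgue_on \<Omega>) (\<lambda>x. (norm (f x))\<^sup>2 * exp (- \<phi> x)))"

definition test_functions :: "(real^'n) set \<Rightarrow> (real^'n \<Rightarrow> real) set" where
  "test_functions \<Omega> =
     {\<eta>. smooth_on UNIV \<eta> \<and> compact (closure {x. \<eta> x \<noteq> 0}) \<and> closure {x. \<eta> x \<noteq> 0} \<subseteq> \<Omega>}"

text \<open>Distributions are functionals of which only the values on test functions matter.
  The operators \<open>D\<^sub>j\<close> and \<open>X\<^sub>j = D\<^sub>j - (\<partial>\<phi>/\<partial>x\<^sub>j)\<close> act on distributions by
  \<open>(D\<^sub>j T)(\<eta>) = -T(\<partial>\<eta>/\<partial>x\<^sub>j)\<close> and \<open>(a T)(\<eta>) = T(a \<eta>)\<close>.\<close>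

type_synonym ('n, 'b) distribution = "(real^'n \<Rightarrow> real) \<Rightarrow> 'b"

definition distr_of :: "(real^'n) set \<Rightarrow> (real^'n \<Rightarrow> 'b::{real_normed_field, euclidean_space}) \<Rightarrow>
    ('n, 'b) distribution" where
  "distr_of \<Omega> f \<eta> = integral\<^sup>L (lebesgue_on \<Omega>) (\<lambda>x. \<eta> x *\<^sub>R f x)"

definition D_op :: "'n::finite \<Rightarrow> ('n, 'b::real_normed_field) distribution \<Rightarrow> ('n, 'b) distribution" where
  "D_op j T \<eta> = - T (partial j \<eta>)"

definition X_op :: "(real^'n \<Rightarrow> real) \<Rightarrow> 'n \<Rightarrow>
    ('n, 'b::real_normed_field) distribution \<Rightarrow> ('n, 'b) distribution" where
  "X_op \<phi> j T \<eta> = D_op j T \<eta> - T (\<lambda>x. partial j \<phi> x * \<eta> x)"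

text \<open>\<open>Y\<^sup>\<alpha>\<close> for a multi-index \<open>\<alpha>\<close>. The operators \<open>D\<^sub>j\<close> commute with each other on distributions, and
  so do the \<open>X\<^sub>j\<close>, so it does not matter in which order the factors are arranged.\<close>

definition multi_op :: "('n::finite \<Rightarrow> ('n, 'b) distribution \<Rightarrow> ('n, 'b) distribution) \<Rightarrow>
    ('n \<Rightarrow> nat) \<Rightarrow> ('n, 'b) distribution \<Rightarrow> ('n, 'b) distribution" where
  "multi_op Y \<alpha> = foldr Y (SOME js. \<forall>j. count_list js j = \<alpha> j)"

definition represents :: "(real^'n) set \<Rightarrow> (real^'n \<Rightarrow> real) \<Rightarrow> ('n, 'b) distribution \<Rightarrow>
    (real^'n \<Rightarrow> 'b::{real_normed_field, euclidean_space}) \<Rightarrow> bool" where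
  "represents \<Omega> \<phi> T g \<longleftrightarrow> g \<in> L2w \<Omega> \<phi> \<and> (\<forall>\<eta>\<in>test_functions \<Omega>. T \<eta> = distr_of \<Omega> g \<eta>)"

definition multi_indices :: "nat \<Rightarrow> ('n::finite \<Rightarrow> nat) set" where
  "multi_indices k = {\<alpha>. (\<Sum>j\<in>UNIV. \<alpha> j) \<le> k}"

definition sobolev :: "nat \<Rightarrow> (real^'n) set \<Rightarrow> (real^'n \<Rightarrow> real) \<Rightarrow>
    ('n \<Rightarrow> ('n, 'b) distribution \<Rightarrow> ('n, 'b) distribution) \<Rightarrow>
    (real^'n \<Rightarrow> 'b::{real_normed_field, euclidean_space}) set" where
  "sobolev k \<Omega> \<phi> Y = {f \<in> L2w \<Omega> \<phi>.
     \<forall>\<alpha>\<in>multi_indices k. \<exists>g. represents \<Omega> \<phi> (multi_op Y \<alpha> (distr_of \<Omega> f)) g}"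

text \<open>The representing function is unique up to null sets, so its norm does not depend on the choice.\<close>

definition weak_op :: "(real^'n) set \<Rightarrow> (real^'n \<Rightarrow> real) \<Rightarrow>
    ('n \<Rightarrow> ('n, 'b) distribution \<Rightarrow> ('n, 'b) distribution) \<Rightarrow> ('n \<Rightarrow> nat) \<Rightarrow>
    (real^'n \<Rightarrow> 'b::{real_normed_field, euclidean_space}) \<Rightarrow> real^'n \<Rightarrow> 'b" where
  "weak_op \<Omega> \<phi> Y \<alpha> f = (SOME g. represents \<Omega> \<phi> (multi_op Y \<alpha> (distr_of \<Omega> f)) g)"

definition sobolev_norm :: "nat \<Rightarrow> (real^'n) set \<Rightarrow> (real^'n \<Rightarrow> real) \<Rightarrow>
    ('n \<Rightarrow> ('n, 'b) distribution \<Rightarrow> ('n, 'b) distribution) \<Rightarrow>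
    (real^'n \<Rightarrow> 'b::{real_normed_field, euclidean_space}) \<Rightarrow> real" where
  "sobolev_norm k \<Omega> \<phi> Y f =
     sqrt (\<Sum>\<alpha>\<in>multi_indices k. (L2w_norm \<Omega> \<phi> (weak_op \<Omega> \<phi> Y \<alpha> f))\<^sup>2)"

definition equivalent_norms_on :: "'f set \<Rightarrow> ('f \<Rightarrow> real) \<Rightarrow> ('f \<Rightarrow> real) \<Rightarrow> bool" where
  "equivalent_norms_on V N1 N2 \<longleftrightarrow> (\<exists>C>0. \<forall>f\<in>V. N1 f \<le> C * N2 f \<and> N2 f \<le> C * N1 f)"

text \<open>\<open>(V, N)\<close> embeds compactly in \<open>(W, N')\<close>: the inclusion maps bounded sequences to sequences
  with convergent subsequences.\<close>

definition compactly_embedded ::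
    "('x \<Rightarrow> 'b::ab_group_add) set \<Rightarrow> (('x \<Rightarrow> 'b) \<Rightarrow> real) \<Rightarrow>
     ('x \<Rightarrow> 'b) set \<Rightarrow> (('x \<Rightarrow> 'b) \<Rightarrow> real) \<Rightarrow> bool" where
  "compactly_embedded V N W N' \<longleftrightarrow> V \<subseteq> W \<and>
     (\<forall>F. (\<forall>i::nat. F i \<in> V) \<and> (\<exists>B. \<forall>i. N (F i) \<le> B) \<longrightarrow>
        (\<exists>g\<in>W. \<exists>s. strict_mono s \<and> (\<lambda>i. N' (\<lambda>x. F (s i) x - g x)) \<longlonglongrightarrow> 0))"

end

theory Submission
  imports Defs "HOL-Complex_Analysis.Great_Picard"
begin

text \<open>
  Let \<open>\<psi>\<close> be the extension of \<open>\<phi>\<close>. Since \<open>X\<^sub>j = D\<^sub>j - \<partial>\<^sub>j\<psi>\<close>, everything rests on the inequality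
  \<open>\<integral>\<^sub>\<Omega> (1 + |\<nabla>\<psi>|)\<^sup>2 |f|\<^sup>2 e\<^sup>-\<^sup>\<psi> \<le> C (\<parallel>f\<parallel>\<^sup>2 + \<parallel>Df\<parallel>\<^sup>2)\<close> and on its counterpart for \<open>X\<close>, which is the former for
  the weight \<open>-\<psi>\<close> and the function \<open>e\<^sup>-\<^sup>\<psi>f\<close>. They show that multiplication by \<open>\<partial>\<^sub>j\<psi>\<close> loses only one
  derivative, so the two kinds of spaces agree by induction on \<open>k\<close>.

  To prove the inequality, note that the two growth conditions force \<open>|\<nabla>\<psi>| \<rightarrow> \<infinity>\<close>, while the bound on
  the second derivatives makes \<open>\<nabla>\<psi>\<close> nearly constant, relative to its length, on balls of a fixed small
  radius. Positive reach gives two-sided tangent balls of a fixed radius at the boundary. Together with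
  the condition on the normal derivative they yield, near every far point, a direction \<open>t\<close> along which
  \<open>\<psi>\<close> increases at a rate comparable to \<open>|\<nabla>\<psi>|\<close> and for which moving by \<open>-t\<close> does not leave \<open>\<Omega>\<close>. Writing
  \<open>f x\<close> as \<open>f (x - st)\<close> plus the integral of \<open>Df\<close> over the segment, with \<open>s = L / |\<nabla>\<psi>|\<close>, bounds the local
  energy of \<open>f\<close> by \<open>e\<^sup>-\<^sup>c\<^sup>L\<close> times that on a larger ball plus \<open>L\<^sup>2 |\<nabla>\<psi>|\<^sup>-\<^sup>2\<close> times that of \<open>Df\<close>. Multiplying
  by \<open>|\<nabla>\<psi>|\<^sup>2\<close>, integrating over the centres and taking \<open>L\<close> large absorbs the first term.

  For compactness, the inequality makes the energy far out uniformly small. On a bounded part of \<open>\<Omega>\<close>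
  the same translations, now in an inward direction, compare \<open>f\<close> with its means over finitely many
  balls inside \<open>\<Omega>\<close>, so that a subsequence along which all these means converge is Cauchy.
\<close>

section \<open>Calculus of smooth functions\<close>

text \<open>Traces, extension operators and approximation up to the boundary are avoided: every
  estimate compares \<open>f\<close> with a translate along segments that stay in \<Omega>, and for
  this weak derivatives in the interior suffice. The geometry therefore only has to supply
  directions. If e is the direction of the gradient at a boundary point and |e . \<nu>| \<le> c < 1,
  then e + \<nu> has inner product at least 1 - c with both e and \<nu>; moving against it lowers
  the weight function and goes inward. This is where the condition on the normal derivative enters.
  Like the other conditions it is insensitive to the sign of the weight function, which makes the
  passage to -\<psi> possible.

  Absorption is only legitimate for a finite quantity, while finiteness of the weighted integral is
  part of the claim. Hence the gradient is truncated at height N; the truncated weights are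
  comparable on small balls with a constant independent of N, and N is sent to infinity at the end.

  Bounds of all orders are carried by one number b that dominates every iterated derivative, so the
  inductions on the order never handle sums over multi-indices.\<close>

lemma partial_eqI: "(f has_derivative f') (at x) \<Longrightarrow> partial i f x = f' (axis i 1)"
  by (metis partial_def frechet_derivative_at)

lemma partial_cong_open:
  assumes "open U" "x \<in> U" "\<And>y. y \<in> U \<Longrightarrow> f y = g y"
  shows "partial i f x = partial i g x"
proof -
  have *: "(f has_derivative D) (at x) \<longleftrightarrow> (g has_derivative D) (at x)" for D
    using assms has_derivative_transform_within_open by (metis (no_types, lifting))
  show ?thesis unfolding partial_def frechet_derivative_def * ..
qed

lemma differentiable_cong_open:
  assumes "open U" "x \<in> U" "\<And>y. y \<in> U \<Longrightarrow> f y = g y"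
  shows "f differentiable (at x) \<longleftrightarrow> g differentiable (at x)"
  using assms has_derivative_transform_within_open unfolding differentiable_def
  by (metis (no_types, lifting))

lemma Ck_on_cong:
  assumes "open U" "\<And>y. y \<in> U \<Longrightarrow> f y = g y"
  shows "Ck_on k U f \<longleftrightarrow> Ck_on k U g"
  using assms(2)
proof (induction k arbitrary: f g)
  case 0
  then show ?case by (simp cong: continuous_on_cong)
next
  case (Suc k)
  have "\<And>i. Ck_on k U (partial i f) \<longleftrightarrow> Ck_on k U (partial i g)"
    using Suc partial_cong_open[OF assms(1)] by blast
  then show ?case using differentiable_cong_open[OF assms(1), of _ f g] Suc.prems by auto
qed

lemma Ck_on_SucD: "Ck_on (Suc k) U f \<Longrightarrow> Ck_on k U f"
proof (induction k arbitrary: f)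
  case 0
  then show ?case
    by (auto simp: continuous_on_eq_continuous_within
        intro!: continuous_at_imp_continuous_within[OF differentiable_imp_continuous_within])
next
  case (Suc k)
  then show ?case by (metis Ck_on.simps(2))
qed

lemma Ck_on_mono: "Ck_on k U f \<Longrightarrow> l \<le> k \<Longrightarrow> Ck_on l U f"
  by (induction k) (auto simp: le_Suc_eq simp del: Ck_on.simps dest: Ck_on_SucD)

lemma partial_const [simp]: "partial i (\<lambda>x. c) = (\<lambda>x. 0)"
  by (rule ext) (auto intro!: partial_eqI derivative_eq_intros)

lemma Ck_on_const [simp]: "Ck_on k U (\<lambda>x. c)"
  by (induction k arbitrary: c) auto

lemma partial_add:
  assumes "f differentiable at x" "g differentiable at x"
  shows "partial i (\<lambda>x. f x + g x) x = partial i f x + partial i g x"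
  by (rule partial_eqI[THEN trans], rule has_derivative_add)
     (use assms in \<open>auto simp: frechet_derivative_works partial_def\<close>)

lemma partial_mult:
  assumes "f differentiable at x" "g differentiable at x"
  shows "partial i (\<lambda>x. f x * g x) x = f x * partial i g x + partial i f x * g x"
  by (rule partial_eqI[THEN trans], rule has_derivative_mult)
     (use assms in \<open>auto simp: frechet_derivative_works partial_def\<close>)

lemma partial_cmult:
  assumes "f differentiable at x"
  shows "partial i (\<lambda>x. c * f x) x = c * partial i f x"
  using partial_mult[of "\<lambda>x. c" x f i] assms by simp

lemma partial_minus:
  assumes "f differentiable at x"
  shows "partial i (\<lambda>x. - f x) x = - partial i f x"
  using partial_cmult[of f x i "-1"] assms by simp

lemma Ck_on_add:
  assumes "open U"
  shows "Ck_on k U f \<Longrightarrow> Ck_on k U g \<Longrightarrow> Ck_on k U (\<lambda>x. f x + g x)"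
proof (induction k arbitrary: f g)
  case 0
  then show ?case by (auto intro: continuous_on_add)
next
  case (Suc k)
  have "Ck_on k U (partial i (\<lambda>x. f x + g x))" for i
  proof -
    have "Ck_on k U (\<lambda>x. partial i f x + partial i g x)" using Suc by auto
    then show ?thesis
      by (rule Ck_on_cong[THEN iffD1, OF assms, rotated]) (use Suc in \<open>auto simp: partial_add\<close>)
  qed
  then show ?case using Suc by auto
qed

lemma Ck_on_mult:
  assumes "open U"
  shows "Ck_on k U f \<Longrightarrow> Ck_on k U g \<Longrightarrow> Ck_on k U (\<lambda>x. f x * g x)"
proof (induction k arbitrary: f g)
  case 0
  then show ?case by (auto intro: continuous_on_mult)
next
  case (Suc k)
  have "Ck_on k U (partial i (\<lambda>x. f x * g x))" for i
  proof -
    have "Ck_on k U (\<lambda>x. f x * partial i g x + partial i f x * g x)"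
      using Suc.prems by (intro Ck_on_add[OF assms] Suc.IH)
          (auto intro: Ck_on_SucD simp del: Ck_on.simps simp: Ck_on.simps(2))
    then show ?thesis
      by (rule Ck_on_cong[THEN iffD1, OF assms, rotated]) (use Suc in \<open>auto simp: partial_mult\<close>)
  qed
  then show ?case using Suc by auto
qed

lemma Ck_on_minus: "open U \<Longrightarrow> Ck_on k U f \<Longrightarrow> Ck_on k U (\<lambda>x. - f x)"
  using Ck_on_mult[of U k "\<lambda>_. -1" f] by simp

lemma Ck_on_prod:
  assumes "open U" "\<And>i. i \<in> I \<Longrightarrow> Ck_on k U (f i)"
  shows "Ck_on k U (\<lambda>x. \<Prod>i\<in>I. f i x)"
  using assms(2) by (induction I rule: infinite_finite_induct) (auto intro!: Ck_on_mult[OF assms(1)])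

lemma Ck_on_imp_differentiable: "Ck_on k U f \<Longrightarrow> k \<ge> 1 \<Longrightarrow> x \<in> U \<Longrightarrow> f differentiable at x"
  by (cases k) auto

lemma Ck_on_exp:
  assumes U: "open U" and "Ck_on k U f"
  shows "Ck_on k U (\<lambda>x. exp (f x))"
  using assms(2)
proof (induction k)
  case 0
  then show ?case by (auto intro: continuous_on_exp)
next
  case (Suc k)
  have d: "((\<lambda>x. exp (f x)) has_derivative (\<lambda>v. exp (f x) * frechet_derivative f (at x) v)) (at x)"
      if "x \<in> U" for x
    using Suc.prems that by (auto intro!: derivative_eq_intros simp: frechet_derivative_works)
  have "Ck_on k U (partial i (\<lambda>x. exp (f x)))" for i
  proof -
    have "Ck_on k U (\<lambda>x. exp (f x) * partial i f x)"
      using Suc.IH[OF Ck_on_SucD[OF Suc.prems]] Suc.prems by (intro Ck_on_mult[OF U]) auto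
    then show ?thesis
      by (rule Ck_on_cong[THEN iffD1, OF U, rotated]) (use partial_eqI[OF d] in \<open>auto simp: partial_def\<close>)
  qed
  then show ?case using d by (auto simp: differentiable_def)
qed

lemma smooth_onD: "smooth_on U f \<Longrightarrow> Ck_on k U f"
  by (simp add: smooth_on_def)

lemma smooth_on_differentiable: "smooth_on U f \<Longrightarrow> x \<in> U \<Longrightarrow> f differentiable at x"
  by (meson Ck_on_imp_differentiable order_refl smooth_onD)

lemma smooth_on_partial: "smooth_on U f \<Longrightarrow> smooth_on U (partial i f)"
  unfolding smooth_on_def by (metis Ck_on.simps(2))

lemma smooth_on_continuous_on: "smooth_on U f \<Longrightarrow> continuous_on U f"
  using smooth_onD[of U f 0] by simp

lemma smooth_on_add: "open U \<Longrightarrow> smooth_on U f \<Longrightarrow> smooth_on U g \<Longrightarrow> smooth_on U (\<lambda>x. f x + g x)"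
  by (simp add: smooth_on_def Ck_on_add)

lemma smooth_on_mult: "open U \<Longrightarrow> smooth_on U f \<Longrightarrow> smooth_on U g \<Longrightarrow> smooth_on U (\<lambda>x. f x * g x)"
  by (simp add: smooth_on_def Ck_on_mult)

lemma smooth_on_minus: "open U \<Longrightarrow> smooth_on U f \<Longrightarrow> smooth_on U (\<lambda>x. - f x)"
  by (simp add: smooth_on_def Ck_on_minus)

lemma smooth_on_exp: "open U \<Longrightarrow> smooth_on U f \<Longrightarrow> smooth_on U (\<lambda>x. exp (f x))"
  by (simp add: smooth_on_def Ck_on_exp)

lemma smooth_on_const [simp]: "smooth_on U (\<lambda>x. c)"
  by (simp add: smooth_on_def)

section \<open>Gradients, rays and the symmetry of mixed derivatives\<close>

lemma linear_axis_sum: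
  fixes l :: "real^'n \<Rightarrow> real"
  assumes "linear l"
  shows "l v = (\<Sum>i\<in>UNIV. v $ i * l (axis i 1))"
proof -
  have "v = (\<Sum>i\<in>UNIV. v $ i *\<^sub>R axis i 1)"
    by (metis basis_expansion scalar_mult_eq_scaleR)
  then have "l v = l (\<Sum>i\<in>UNIV. v $ i *\<^sub>R axis i 1)" by simp
  also have "\<dots> = (\<Sum>i\<in>UNIV. v $ i * l (axis i 1))"
    using assms by (simp add: linear_sum linear_cmul)
  finally show ?thesis .
qed

lemma has_derivative_grad:
  assumes "f differentiable at x"
  shows "(f has_derivative (\<lambda>v. v \<bullet> grad f x)) (at x)"
proof -
  have "frechet_derivative f (at x) v = v \<bullet> grad f x" for v
    using linear_axis_sum[OF linear_frechet_derivative[OF assms], of v]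
    by (simp add: inner_vec_def grad_def partial_def)
  then show ?thesis using assms by (metis (no_types, lifting) ext frechet_derivative_works)
qed

lemma has_vector_derivative_ray:
  assumes "f differentiable at (x + t *\<^sub>R v)"
  shows "((\<lambda>t. f (x + t *\<^sub>R v)) has_real_derivative (v \<bullet> grad f (x + t *\<^sub>R v))) (at t within S)"
proof -
  have 1: "((\<lambda>t. x + t *\<^sub>R v) has_derivative (\<lambda>h. h *\<^sub>R v)) (at t within S)"
    by (auto intro!: derivative_eq_intros)
  have "((\<lambda>t. f (x + t *\<^sub>R v)) has_derivative (\<lambda>h. (h *\<^sub>R v) \<bullet> grad f (x + t *\<^sub>R v))) (at t within S)"
    using has_derivative_compose[OF 1 has_derivative_grad[OF assms]] by simp
  then show ?thesis by (simp add: has_field_derivative_def mult_commute_abs)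
qed

lemma has_real_derivative_axis:
  assumes "f differentiable at (x + t *\<^sub>R axis i 1)"
  shows "((\<lambda>t. f (x + t *\<^sub>R axis i 1)) has_real_derivative (partial i f (x + t *\<^sub>R axis i 1)))
      (at t within S)"
  using has_vector_derivative_ray[OF assms, of S] by (simp add: inner_axis' grad_def)

text \<open>The mean value theorem is used twice, first in direction \<open>i\<close> for the
  increment across a step in direction \<open>j\<close>, then in direction \<open>j\<close> for
  \<open>partial i f\<close>. The left-hand side is symmetric in \<open>i\<close> and
  \<open>j\<close>, so letting the step shrink identifies the two mixed derivatives.\<close>

lemma second_difference:
  assumes f: "\<And>x. f differentiable at x" and g: "\<And>x. partial i f differentiable at x" and s: "s > 0"
  shows "\<exists>a b. 0 < a \<and> a < s \<and> 0 < b \<and> b < s \<and>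
     f (x + s *\<^sub>R axis i 1 + s *\<^sub>R axis j 1) - f (x + s *\<^sub>R axis i 1) - f (x + s *\<^sub>R axis j 1) + f x
     = s * s * partial j (partial i f) (x + a *\<^sub>R axis i 1 + b *\<^sub>R axis j 1)"
proof -
  let ?h = "\<lambda>t. f ((x + s *\<^sub>R axis j 1) + t *\<^sub>R axis i 1) - f (x + t *\<^sub>R axis i 1)"
  have "\<exists>a. a > 0 \<and> a < s \<and> ?h s - ?h 0 = (s - 0) *
     (partial i f ((x + s *\<^sub>R axis j 1) + a *\<^sub>R axis i 1) - partial i f (x + a *\<^sub>R axis i 1))"
    by (rule MVT2[OF s]) (intro DERIV_diff has_real_derivative_axis f)
  then obtain a where a: "a > 0" "a < s" "?h s - ?h 0 = s *
     (partial i f ((x + s *\<^sub>R axis j 1) + a *\<^sub>R axis i 1) - partial i f (x + a *\<^sub>R axis i 1))" by auto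
  have "\<exists>b. b > 0 \<and> b < s \<and> partial i f (x + a *\<^sub>R axis i 1 + s *\<^sub>R axis j 1) - partial i f (x
      + a *\<^sub>R axis i 1 + 0 *\<^sub>R axis j 1)
     = (s - 0) * partial j (partial i f) (x + a *\<^sub>R axis i 1 + b *\<^sub>R axis j 1)"
    by (rule MVT2[OF s]) (intro has_real_derivative_axis g)
  then obtain b where b: "b > 0" "b < s" "partial i f (x + a *\<^sub>R axis i 1
      + s *\<^sub>R axis j 1) - partial i f (x + a *\<^sub>R axis i 1)
     = s * partial j (partial i f) (x + a *\<^sub>R axis i 1 + b *\<^sub>R axis j 1)" by auto
  have e: "x + s *\<^sub>R axis j 1 + a *\<^sub>R axis i 1 = x + a *\<^sub>R axis i 1 + s *\<^sub>R axis j 1"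
    "x + s *\<^sub>R axis j 1 + s *\<^sub>R axis i 1 = x + s *\<^sub>R axis i 1 + s *\<^sub>R axis j 1" by simp_all
  have "f (x + s *\<^sub>R axis i 1 + s *\<^sub>R axis j 1) - f (x + s *\<^sub>R axis i 1) - f (x + s *\<^sub>R axis j 1) + f x
     = s * (s * partial j (partial i f) (x + a *\<^sub>R axis i 1 + b *\<^sub>R axis j 1))"
    unfolding b(3)[symmetric] using a(3) unfolding e by simp
  then show ?thesis using a(1,2) b(1,2) by (metis mult.assoc)
qed

lemma partial_commute:
  assumes "smooth_on UNIV f"
  shows "partial j (partial i f) x = partial i (partial j f) x"
proof (rule tendsto_unique[of sequentially])
  let ?s = "\<lambda>n. inverse (real (Suc n))"
  have d: "f differentiable at x" "partial i f differentiable at x" for x i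
    using assms smooth_on_differentiable smooth_on_partial by blast+
  have s0: "?s \<longlonglongrightarrow> 0" by (rule LIMSEQ_inverse_real_of_nat)
  define D where "D n = f (x + ?s n *\<^sub>R axis i 1 + ?s n *\<^sub>R axis j 1) - f (x + ?s n *\<^sub>R axis i 1) - f (x
      + ?s n *\<^sub>R axis j 1) + f x" for n
  have *: "(\<lambda>n. D n / (?s n * ?s n)) \<longlonglongrightarrow> partial j (partial i f) x"
    if D: "\<And>n. D n = f (x + ?s n *\<^sub>R axis i 1 + ?s n *\<^sub>R axis j 1) - f (x + ?s n *\<^sub>R axis i 1) - f (x
        + ?s n *\<^sub>R axis j 1) + f x" for i j D
  proof -
    have "\<forall>n. \<exists>ab. 0 < fst ab \<and> fst ab < ?s n \<and> 0 < snd ab \<and> snd ab < ?s n \<and>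
       D n = ?s n * ?s n * partial j (partial i f) (x + fst ab *\<^sub>R axis i 1 + snd ab *\<^sub>R axis j 1)"
      using second_difference[of f i "?s _" x j] d D by auto
    then obtain ab where ab: "\<And>n. 0 < fst (ab n) \<and> fst (ab n) < ?s n \<and> 0 < snd (ab n) \<and> snd (ab n) < ?s n
        \<and>
       D n = ?s n * ?s n * partial j (partial i f) (x + fst (ab n) *\<^sub>R axis i 1
           + snd (ab n) *\<^sub>R axis j 1)"
      by metis
    have "(\<lambda>n. fst (ab n)) \<longlonglongrightarrow> 0" "(\<lambda>n. snd (ab n)) \<longlonglongrightarrow> 0"
      using ab
      by (auto intro!: tendsto_sandwich[OF _ _ tendsto_const s0] always_eventually less_imp_le simp del:
          of_nat_Suc)
    then have "(\<lambda>n. x + fst (ab n) *\<^sub>R axis i 1 + snd (ab n) *\<^sub>R axis j 1) \<longlonglongrightarrow> x + 0 *\<^sub>R axis i 1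
        + 0 *\<^sub>R axis j 1"
      by (intro tendsto_intros)
    then have l: "(\<lambda>n. x + fst (ab n) *\<^sub>R axis i 1 + snd (ab n) *\<^sub>R axis j 1) \<longlonglongrightarrow> x" by simp
    have "isCont (partial j (partial i f)) x"
      using smooth_on_continuous_on[OF smooth_on_partial[OF smooth_on_partial[OF assms]]]
      by (simp add: continuous_on_eq_continuous_at)
    then have "(\<lambda>n. partial j (partial i f) (x + fst (ab n) *\<^sub>R axis i 1
        + snd (ab n) *\<^sub>R axis j 1)) \<longlonglongrightarrow> partial j (partial i f) x"
      using l isCont_tendsto_compose by blast
    moreover have "D n / (?s n * ?s n) = partial j (partial i f) (x + fst (ab n) *\<^sub>R axis i 1
        + snd (ab n) *\<^sub>R axis j 1)" for n
      using ab[of n] by (simp del: of_nat_Suc)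
    ultimately show ?thesis by simp
  qed
  show "(\<lambda>n. D n / (?s n * ?s n)) \<longlonglongrightarrow> partial j (partial i f) x" by (rule *) (simp add: D_def)
  show "(\<lambda>n. D n / (?s n * ?s n)) \<longlonglongrightarrow> partial i (partial j f) x"
      by (rule *) (simp add: D_def algebra_simps)
qed simp

section \<open>Smooth cutoff functions on the line\<close>

text \<open>The powers of 1/s make the family closed under differentiation up to linear
  combinations, so one induction, carried out for all \<open>n\<close> at once, shows that exp(-1/s)
  extended by 0 is smooth.\<close>

definition bumpn :: "nat \<Rightarrow> real \<Rightarrow> real" where
  "bumpn n s = (if s > 0 then exp (- inverse s) * inverse s ^ n else 0)"

lemma power_times_exp_uminus_bounded: "x \<ge> 0 \<Longrightarrow> x ^ n * exp (- x) \<le> fact n" for x :: real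
proof -
  assume x: "x \<ge> 0"
  have "x ^ n / fact n \<le> exp x"
  proof -
    have "x ^ n / fact n = (\<Sum>k\<in>{n}. x ^ k /\<^sub>R fact k)" by (simp add: field_simps)
    also have "\<dots> \<le> (\<Sum>k. x ^ k /\<^sub>R fact k)"
      using x by (intro sum_le_suminf summable_exp_generic) auto
    finally show ?thesis by (simp add: exp_def)
  qed
  then show ?thesis by (simp add: exp_minus field_simps)
qed

text \<open>The inequality x^N exp(-x) \<le> N! with x = 1/s and N = n + k: flatness at 0 of every
  order. The case \<open>k = 2\<close> gives the derivative at 0.\<close>

lemma bumpn_le: "bumpn n s \<le> fact (n + k) * \<bar>s\<bar> ^ k"
proof (cases "s > 0")
  case True
  have "bumpn n s = (inverse s ^ (n + k) * exp (- inverse s)) * s ^ k"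
    using True by (simp add: bumpn_def power_add field_simps)
  also have "\<dots> \<le> fact (n + k) * s ^ k"
    using True by (intro mult_right_mono power_times_exp_uminus_bounded) auto
  finally show ?thesis using True by simp
qed (simp add: bumpn_def)

lemma bumpn_nonneg: "bumpn n s \<ge> 0"
  by (simp add: bumpn_def)

lemma bumpn_deriv: "(bumpn n has_real_derivative (bumpn (n + 2) s - real n * bumpn (n + 1) s)) (at s)"
proof -
  consider "s > 0" | "s < 0" | "s = 0" by linarith
  then show ?thesis
  proof cases
    case 1
    have "((\<lambda>s. exp (- inverse s) * inverse s ^ n) has_real_derivative (bumpn (n
        + 2) s - real n * bumpn (n + 1) s)) (at s)"
      using 1 by (auto intro!: derivative_eq_intros simp: bumpn_def)
        (cases n; simp add: field_simps power2_eq_square)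
    then show ?thesis
      by (rule has_field_derivative_transform_within_open[of _ _ _ "{0<..}"])
          (use 1 in \<open>auto simp: bumpn_def\<close>)
  next
    case 2
    have "((\<lambda>s. 0) has_real_derivative (bumpn (n + 2) s - real n * bumpn (n + 1) s)) (at s)"
      using 2 by (simp add: bumpn_def)
    then show ?thesis
      by (rule has_field_derivative_transform_within_open[of _ _ _ "{..<0}"])
          (use 2 in \<open>auto simp: bumpn_def\<close>)
  next
    case 3
    have "((\<lambda>h. bumpn n h / h) \<longlongrightarrow> 0) (at 0)"
    proof (rule tendsto_0_le[of "\<lambda>h. h" _ _ "fact (n + 2)"])
      show "\<forall>\<^sub>F h in at 0. norm (bumpn n h / h) \<le> norm h * fact (n + 2)"
      proof (rule eventually_at_filter[THEN iffD2], rule always_eventually, intro allI impI)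
        fix h :: real assume "h \<noteq> 0"
        have "norm (bumpn n h / h) = bumpn n h / \<bar>h\<bar>" by (simp add: bumpn_nonneg)
        also have "\<dots> \<le> fact (n + 2) * \<bar>h\<bar> ^ 2 / \<bar>h\<bar>"
          by (intro divide_right_mono bumpn_le) auto
        also have "\<dots> = norm h * fact (n + 2)" using \<open>h \<noteq> 0\<close>
          by (simp add: power2_eq_square field_simps del: fact_Suc abs_mult_self_eq)
        finally show "norm (bumpn n h / h) \<le> norm h * fact (n + 2)" .
      qed
    qed (auto intro: tendsto_ident_at)
    then show ?thesis using 3 by (simp add: DERIV_def bumpn_def)
  qed
qed

lemma Ck_on_bumpn: "Ck_on k UNIV (\<lambda>x::real^'n. bumpn n (c * x $ i + d))"
proof (induction k arbitrary: n)
  case 0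
  have "continuous_on UNIV (bumpn n)" for n
    by (intro continuous_at_imp_continuous_on ballI DERIV_isCont[OF bumpn_deriv])
  moreover have "continuous_on UNIV (\<lambda>x::real^'n. c * x $ i + d)" by (intro continuous_intros)
  ultimately show ?case unfolding Ck_on.simps by (rule continuous_on_compose2) simp
next
  case (Suc k)
  have d: "((\<lambda>x::real^'n. bumpn n (c * x $ i + d)) has_derivative
      (\<lambda>v. (bumpn (n + 2) (c * x $ i + d) - real n * bumpn (n + 1) (c * x $ i + d)) * (c * v $ i)))
          (at x)" for n x
  proof -
    have "((\<lambda>x::real^'n. c * x $ i + d) has_derivative (\<lambda>v. c * v $ i + 0)) (at x)"
      by (intro has_derivative_add has_derivative_mult_right has_derivative_const
          bounded_linear_imp_has_derivative[OF bounded_linear_vec_nth])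
    from has_derivative_compose[OF this bumpn_deriv[unfolded has_field_derivative_def]]
    show ?thesis by simp
  qed
  have "Ck_on k UNIV (partial j (\<lambda>x::real^'n. bumpn n (c * x $ i + d)))" for j
  proof -
    have e: "partial j (\<lambda>x::real^'n. bumpn n (c * x $ i + d)) =
      (\<lambda>x::real^'n. (bumpn (n + 2) (c * x $ i + d) + - (real n * bumpn (n + 1) (c * x $ i + d))) *
          (c * axis j 1 $ i))"
      by (rule ext) (simp add: partial_eqI[OF d])
    have "Ck_on k UNIV (\<lambda>x::real^'n. (bumpn (n + 2) (c * x $ i + d)
        + - (real n * bumpn (n + 1) (c * x $ i + d))) * (c * axis j 1 $ i))"
      by (intro Ck_on_mult Ck_on_add Ck_on_minus open_UNIV Suc Ck_on_const)
    then show ?thesis unfolding e .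
  qed
  moreover have "(\<lambda>x::real^'n. bumpn n (c * x $ i + d)) differentiable at x" for x
    using d[of n x] by (rule differentiableI)
  ultimately show ?case by simp
qed

section \<open>Test functions\<close>

lemma continuous_on_closure_zero:
  assumes "x \<notin> closure {x. f x \<noteq> (0::real)}" shows "f x = 0"
  using assms closure_subset[of "{x. f x \<noteq> 0}"] by auto

text \<open>Any compact set outside which the function vanishes may replace the closure of its
  nonzero set; together with \<open>test_functionsE\<close> this keeps closures out of the later
  arguments.\<close>

lemma test_functionsI:
  assumes "smooth_on UNIV \<eta>" "compact K" "K \<subseteq> \<Omega>" "\<And>x. x \<notin> K \<Longrightarrow> \<eta> x = 0"
  shows "\<eta> \<in> test_functions \<Omega>"
proof -
  have "{x. \<eta> x \<noteq> 0} \<subseteq> K" using assms(4) by auto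
  then have 1: "closure {x. \<eta> x \<noteq> 0} \<subseteq> K"
    using assms(2) by (simp add: closure_minimal compact_imp_closed)
  then have "compact (closure {x. \<eta> x \<noteq> 0})"
    using assms(2) bounded_subset by (auto simp: compact_eq_bounded_closed)
  then show ?thesis using 1 assms by (auto simp: test_functions_def)
qed

lemma test_functionsE:
  assumes "\<eta> \<in> test_functions \<Omega>"
  obtains K where "smooth_on UNIV \<eta>" "compact K" "K \<subseteq> \<Omega>" "\<And>x. x \<notin> K \<Longrightarrow> \<eta> x = 0"
    "\<And>x i. x \<notin> K \<Longrightarrow> partial i \<eta> x = 0"
proof
  let ?K = "closure {x. \<eta> x \<noteq> 0}"
  show "smooth_on UNIV \<eta>" "compact ?K" "?K \<subseteq> \<Omega>" using assms by (auto simp: test_functions_def)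
  show z: "\<eta> x = 0" if "x \<notin> ?K" for x using that continuous_on_closure_zero by blast
  show "partial i \<eta> x = 0" if "x \<notin> ?K" for x i
  proof -
    have "partial i \<eta> x = partial i (\<lambda>_. 0) x"
    proof (rule partial_cong_open[of "- ?K"])
      show "open (- ?K)" by (simp add: open_Compl)
      show "x \<in> - ?K" using that by simp
      show "\<eta> y = 0" if "y \<in> - ?K" for y using that by (intro z) simp
    qed
    then show ?thesis by simp
  qed
qed

lemma test_functions_partial: "\<eta> \<in> test_functions \<Omega> \<Longrightarrow> partial i \<eta> \<in> test_functions \<Omega>"
  by (metis test_functionsE test_functionsI smooth_on_partial)

lemma test_functions_add:
  assumes "\<eta> \<in> test_functions \<Omega>" "\<zeta> \<in> test_functions \<Omega>"
  shows "(\<lambda>x. \<eta> x + \<zeta> x) \<in> test_functions \<Omega>"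
proof -
  obtain K where K: "smooth_on UNIV \<eta>" "compact K" "K \<subseteq> \<Omega>" "\<And>x. x \<notin> K \<Longrightarrow> \<eta> x = 0"
      using test_functionsE[OF assms(1)] by metis
  obtain L where L: "smooth_on UNIV \<zeta>" "compact L" "L \<subseteq> \<Omega>" "\<And>x. x \<notin> L \<Longrightarrow> \<zeta> x = 0"
      using test_functionsE[OF assms(2)] by metis
  show ?thesis by (rule test_functionsI[of _ "K \<union> L"]) (use K L in \<open>auto intro: smooth_on_add\<close>)
qed

lemma test_functions_smooth_mult:
  assumes "\<eta> \<in> test_functions \<Omega>" "smooth_on UNIV a"
  shows "(\<lambda>x. a x * \<eta> x) \<in> test_functions \<Omega>"
  using assms(1)
proof (rule test_functionsE)
  fix K assume "smooth_on UNIV \<eta>" "compact K" "K \<subseteq> \<Omega>" "\<And>x. x \<notin> K \<Longrightarrow> \<eta> x = 0"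
  then show ?thesis by (intro test_functionsI[of _ K]) (auto intro: smooth_on_mult assms(2))
qed

lemma test_functions_mono: "\<eta> \<in> test_functions U \<Longrightarrow> U \<subseteq> V \<Longrightarrow> \<eta> \<in> test_functions V"
  by (auto simp: test_functions_def)

lemma partial_translate: "f differentiable at (x + v) \<Longrightarrow>
    partial i (\<lambda>x. f (x + v)) x = partial i f (x + v)"
proof -
  assume d: "f differentiable at (x + v)"
  have 1: "((\<lambda>x. x + v) has_derivative (\<lambda>h. h)) (at x)" by (auto intro!: derivative_eq_intros)
  show ?thesis
    using partial_eqI[OF has_derivative_compose[OF 1 has_derivative_grad[OF d]], of i]
    by (simp add: inner_axis' grad_def)
qed

lemma Ck_on_translate: "Ck_on k UNIV f \<Longrightarrow> Ck_on k UNIV (\<lambda>x. f (x + v))"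
proof (induction k arbitrary: f)
  case 0
  moreover have "continuous_on UNIV (\<lambda>x. x + v)" by (intro continuous_intros)
  ultimately show ?case unfolding Ck_on.simps by (rule continuous_on_compose2) simp
next
  case (Suc k)
  have d: "f differentiable at x" for x using Suc.prems by simp
  have "(\<lambda>x. f (x + v)) differentiable at x" for x
    using d differentiable_chain_at[of "\<lambda>x. x + v" x f] by (simp add: o_def)
  moreover have "Ck_on k UNIV (partial i (\<lambda>x. f (x + v)))" for i
  proof -
    have "partial i (\<lambda>x. f (x + v)) = (\<lambda>x. partial i f (x + v))"
      by (rule ext) (rule partial_translate[OF d])
    then show ?thesis using Suc by simp
  qed
  ultimately show ?case by auto
qed

lemma test_functions_translate:
  assumes "\<eta> \<in> test_functions U" "\<And>x. x \<in> U \<Longrightarrow> x - v \<in> V"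
  shows "(\<lambda>x. \<eta> (x + v)) \<in> test_functions V"
  using assms(1)
proof (rule test_functionsE)
  fix K assume K: "smooth_on UNIV \<eta>" "compact K" "K \<subseteq> U" "\<And>x. x \<notin> K \<Longrightarrow> \<eta> x = 0"
  show ?thesis
  proof (rule test_functionsI[of _ "(\<lambda>x. x - v) ` K"])
    show "smooth_on UNIV (\<lambda>x. \<eta> (x + v))" using K(1) Ck_on_translate by (auto simp: smooth_on_def)
    show "compact ((\<lambda>x. x - v) ` K)" by (intro compact_continuous_image continuous_intros K)
    show "(\<lambda>x. x - v) ` K \<subseteq> V" using K(3) assms(2) by auto
    show "\<eta> (x + v) = 0" if "x \<notin> (\<lambda>x. x - v) ` K" for x
      using that K(4)[of "x + v"] by force
  qed
qed

lemma test_functions_continuous: "\<eta> \<in> test_functions \<Omega> \<Longrightarrow> continuous_on UNIV \<eta>"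
  by (erule test_functionsE) (rule smooth_on_continuous_on)

lemma test_functions_borel: "\<eta> \<in> test_functions \<Omega> \<Longrightarrow> \<eta> \<in> borel_measurable borel"
  using test_functions_continuous borel_measurable_continuous_onI by blast

lemma test_functions_bounded:
  assumes "\<eta> \<in> test_functions \<Omega>"
  obtains B where "B > 0" "\<And>x. \<bar>\<eta> x\<bar> \<le> B"
proof -
  from assms obtain K where K: "smooth_on UNIV \<eta>" "compact K" "\<And>x. x \<notin> K \<Longrightarrow> \<eta> x = 0"
    using test_functionsE by metis
  have "bounded (\<eta> ` K)"
    using K by (intro compact_imp_bounded compact_continuous_image)
      (auto intro: continuous_on_subset[OF smooth_on_continuous_on])
  then obtain B where "B > 0" "\<And>x. x \<in> K \<Longrightarrow> \<bar>\<eta> x\<bar> \<le> B" by (auto simp: bounded_pos)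
  then show ?thesis using that[of B] K(3) by (metis abs_zero less_imp_le)
qed

section \<open>Local integrability and the fundamental lemma\<close>

text \<open>Borel measurability on the whole space, rather than Lebesgue measurability on \<Omega>,
  makes f(x + r v) jointly measurable in (x, r), which the Fubini arguments below require.\<close>

definition loc_integrable :: "(real^'n) set \<Rightarrow> (real^'n \<Rightarrow> 'b::euclidean_space) \<Rightarrow> bool" where
  "loc_integrable \<Omega> f \<longleftrightarrow> f \<in> borel_measurable borel \<and>
     (\<forall>K. compact K \<longrightarrow> K \<subseteq> \<Omega> \<longrightarrow> integrable lborel (\<lambda>x. indicator K x *\<^sub>R f x))"

lemma integrable_bounded_scale:
  fixes f :: "'a \<Rightarrow> 'b::euclidean_space" and a :: "'a \<Rightarrow> real"
  assumes f: "integrable M f" and [measurable]: "a \<in> borel_measurable M" and a: "\<And>x. \<bar>a x\<bar> \<le> B"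
  shows "integrable M (\<lambda>x. a x *\<^sub>R f x)"
proof (rule Bochner_Integration.integrable_bound[of _ "\<lambda>x. B *\<^sub>R f x"])
  show "integrable M (\<lambda>x. B *\<^sub>R f x)" using f by simp
  show "(\<lambda>x. a x *\<^sub>R f x) \<in> borel_measurable M" using f by simp
  show "AE x in M. norm (a x *\<^sub>R f x) \<le> norm (B *\<^sub>R f x)"
    using a by (auto intro!: AE_I2 mult_right_mono) (metis abs_ge_self order_trans)
qed

lemma loc_integrable_mult:
  assumes f: "loc_integrable \<Omega> f" and a: "a \<in> borel_measurable borel" "\<And>x. \<bar>a x\<bar> \<le> B"
    and K: "compact K" "K \<subseteq> \<Omega>" "\<And>x. x \<notin> K \<Longrightarrow> a x = 0"
  shows "integrable lborel (\<lambda>x. a x *\<^sub>R f x)"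
proof -
  have "integrable lborel (\<lambda>x. indicator K x *\<^sub>R f x)"
    using f K by (simp add: loc_integrable_def)
  then have "integrable lborel (\<lambda>x. a x *\<^sub>R (indicator K x *\<^sub>R f x))"
    by (rule integrable_bounded_scale) (use a in auto)
  moreover have "(\<lambda>x. a x *\<^sub>R (indicator K x *\<^sub>R f x)) = (\<lambda>x. a x *\<^sub>R f x)"
    using K(3) by (auto simp: indicator_def fun_eq_iff)
  ultimately show ?thesis by simp
qed

lemma integrable_test:
  assumes "loc_integrable \<Omega> f" "\<eta> \<in> test_functions \<Omega>"
  shows "integrable lborel (\<lambda>x. \<eta> x *\<^sub>R f x)"
proof -
  obtain B where B: "\<And>x. \<bar>\<eta> x\<bar> \<le> B" using test_functions_bounded[OF assms(2)] by metis
  obtain K where "compact K" "K \<subseteq> \<Omega>" "\<And>x. x \<notin> K \<Longrightarrow> \<eta> x = 0" using test_functionsE[OF assms(2)] by metis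
  then show ?thesis
    using assms B by (intro loc_integrable_mult[of \<Omega> f \<eta> B K]) (auto dest: test_functions_borel)
qed

lemma bumpn_0_le_1: "bumpn 0 s \<le> 1"
  by (simp add: bumpn_def)

lemma bumpn_0_limit: "(\<lambda>k. bumpn 0 (real (Suc k) * s)) \<longlonglongrightarrow> (if s > 0 then 1 else 0)"
proof (cases "s > 0")
  case True
  have "(\<lambda>k. exp (- (inverse (real (Suc k)) * inverse s))) \<longlonglongrightarrow> exp (- (0 * inverse s))"
    by (intro tendsto_intros LIMSEQ_inverse_real_of_nat)
  moreover have "bumpn 0 (real (Suc k) * s) = exp (- (inverse (real (Suc k)) * inverse s))" for k
    unfolding bumpn_def using True by (simp del: of_nat_Suc add: inverse_mult_distrib)
  ultimately show ?thesis using True by (simp del: of_nat_Suc)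
next
  case False
  then have "bumpn 0 (real (Suc k) * s) = 0" for k
      by (simp add: bumpn_def mult_nonneg_nonpos not_less zero_less_mult_iff)
  then show ?thesis using False by simp
qed

text \<open>The steepness grows with \<open>k\<close>: exp(-1/((k+1)s)) tends to 1 for every s > 0.
  The functions stay supported in the closed box and converge to the indicator of the open
  one.\<close>

definition box_bump :: "real^'n \<Rightarrow> real^'n \<Rightarrow> nat \<Rightarrow> real^'n \<Rightarrow> real" where
  "box_bump a b k x = (\<Prod>i\<in>UNIV. bumpn 0 (real (Suc k) * (x $ i - a $ i))
      * bumpn 0 (real (Suc k) * (b $ i - x $ i)))"

lemma smooth_box_bump:
  fixes a b :: "real^'a"
  shows "smooth_on UNIV (box_bump a b k)"
proof -
  have "Ck_on l UNIV (\<lambda>x::real^'a. bumpn 0 (real (Suc k) * x $ i + (- real (Suc k) * a $ i)))"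
    "Ck_on l UNIV (\<lambda>x::real^'a. bumpn 0 (- real (Suc k) * x $ i + (real (Suc k) * b $ i)))" for i l
    by (rule Ck_on_bumpn)+
  then show ?thesis
    unfolding smooth_on_def box_bump_def
    by (intro allI Ck_on_prod Ck_on_mult) (auto simp: algebra_simps)
qed

lemma box_bump_bounds: "0 \<le> box_bump a b k x" "box_bump a b k x \<le> 1"
  unfolding box_bump_def
  by (auto intro!: prod_nonneg prod_le_1 mult_nonneg_nonneg mult_le_one bumpn_nonneg bumpn_0_le_1)

lemma box_bump_zero: "x \<notin> cbox a b \<Longrightarrow> box_bump a b k x = 0"
proof -
  assume "x \<notin> cbox a b"
  then obtain i where "x $ i < a $ i \<or> b $ i < x $ i" by (auto simp: mem_box_cart not_le)
  then have "bumpn 0 (real (Suc k) * (x $ i - a $ i)) * bumpn 0 (real (Suc k) * (b $ i - x $ i)) = 0"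
    by (auto simp: bumpn_def zero_less_mult_iff)
  then show ?thesis unfolding box_bump_def by (intro prod_zero) auto
qed

lemma box_bump_limit: "(\<lambda>k. box_bump a b k x) \<longlonglongrightarrow> indicator (box a b) x"
proof -
  have "(\<lambda>k. box_bump a b k x) \<longlonglongrightarrow> (\<Prod>i\<in>UNIV. (if x $ i - a $ i > 0 then 1 else 0)
      * (if b $ i - x $ i > 0 then 1 else 0))"
    unfolding box_bump_def by (intro tendsto_intros bumpn_0_limit)
  moreover have "(\<Prod>i\<in>UNIV. (if x $ i - a $ i > 0 then 1 else 0) * (if b $ i - x $ i > 0 then 1 else 0)) =
      (indicator (box a b) x :: real)"
  proof (cases "x \<in> box a b")
    case True then show ?thesis by (auto simp: mem_box_cart)
  next
    case False
    then obtain i where "\<not> (x $ i > a $ i \<and> b $ i > x $ i)" by (auto simp: mem_box_cart)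
    then have "(if x $ i - a $ i > 0 then 1 else 0) * (if b $ i - x $ i > 0 then 1 else 0) = (0::real)"
        by auto
    then show ?thesis using False by (subst prod_zero) (auto intro!: exI[of _ i])
  qed
  ultimately show ?thesis by simp
qed

lemma integral_box_eq_0:
  fixes h :: "real^'n \<Rightarrow> 'b::euclidean_space"
  assumes h: "loc_integrable \<Omega> h" and z: "\<And>\<eta>. \<eta> \<in> test_functions \<Omega> \<Longrightarrow> (\<integral>x. \<eta> x *\<^sub>R h x \<partial>lborel) = 0"
    and ab: "cbox a b \<subseteq> \<Omega>"
  shows "(\<integral>x. indicator (box a b) x *\<^sub>R h x \<partial>lborel) = 0"
proof -
  have m: "h \<in> borel_measurable borel" using h by (simp add: loc_integrable_def)
  have t: "box_bump a b k \<in> test_functions \<Omega>" for k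
    using ab by (intro test_functionsI[of _ "cbox a b"]) (auto simp: smooth_box_bump box_bump_zero)
  have "(\<lambda>k. \<integral>x. box_bump a b k x *\<^sub>R h x \<partial>lborel) \<longlonglongrightarrow> (\<integral>x. indicator (box a b) x *\<^sub>R h x \<partial>lborel)"
  proof (rule integral_dominated_convergence[where w="\<lambda>x. norm (indicator (cbox a b) x *\<^sub>R h x)"])
    show "integrable lborel (\<lambda>x. norm (indicator (cbox a b) x *\<^sub>R h x))"
      using h ab by (intro integrable_norm) (simp add: loc_integrable_def)
    show "(\<lambda>x. box_bump a b k x *\<^sub>R h x) \<in> borel_measurable lborel" for k
      using m test_functions_borel[OF t[of k]] by simp
    show "AE x in lborel. (\<lambda>k. box_bump a b k x *\<^sub>R h x) \<longlonglongrightarrow> indicator (box a b) x *\<^sub>R h x"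
      by (intro AE_I2 tendsto_intros box_bump_limit)
    show "AE x in lborel. norm (box_bump a b k x *\<^sub>R h x) \<le> norm (indicator (cbox a b) x *\<^sub>R h x)" for k
      using box_bump_bounds[of a b k] box_bump_zero[of _ a b k]
      by (auto intro!: AE_I2 mult_left_le_one_le simp: indicator_def)
  qed (use m in auto)
  then show ?thesis by (simp add: z[OF t] LIMSEQ_const_iff)
qed

text \<open>Dominated convergence along \<open>box_bump\<close> has turned test functions into
  indicators of boxes. Boxes are stable under intersection and generate the Borel sets, so the
  integral of \<open>h\<close> vanishes over every Borel subset of the box, and uniqueness of
  densities gives \<open>h = 0\<close> there.\<close>

lemma fundamental_lemma_real:
  fixes h :: "real^'n \<Rightarrow> real"
  assumes h: "loc_integrable \<Omega> h" and z: "\<And>\<eta>. \<eta> \<in> test_functions \<Omega> \<Longrightarrow> (\<integral>x. \<eta> x *\<^sub>R h x \<partial>lborel) = 0"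
    and cd: "cbox c d \<subseteq> \<Omega>"
  shows "AE x in lborel. x \<in> box c d \<longrightarrow> h x = 0"
proof -
  have m[measurable]: "h \<in> borel_measurable borel" using h by (simp add: loc_integrable_def)
  let ?h = "\<lambda>x. indicator (box c d) x * h x"
  have int: "integrable lborel (\<lambda>x. indicator (cbox c d) x *\<^sub>R h x)" using h cd
      by (auto simp: loc_integrable_def)
  have ih: "integrable lborel ?h"
    by (rule Bochner_Integration.integrable_bound[OF int])
        (auto simp: indicator_def box_subset_cbox[THEN subsetD])
  have sub: "integrable lborel (\<lambda>x. indicator A x * ?h x)" if [measurable]: "A \<in> sets borel" for A
    by (rule Bochner_Integration.integrable_bound[OF ih]) (auto simp: indicator_def)
  have boxes: "(\<integral>x. indicator (box a b) x * ?h x \<partial>lborel) = 0" for a b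
  proof -
    have "\<exists>p q. box a b \<inter> box c d = box p q" by (intro exI, rule box_Int_box)
    then obtain p q where pq: "box a b \<inter> box c d = box p q" by blast
    consider "box p q = {}" | "box p q \<noteq> {}" by blast
    then show ?thesis
    proof cases
      case 1
      then have "(\<lambda>x. indicator (box a b) x * ?h x) = (\<lambda>x. 0)" using pq
          by (auto simp: indicator_def fun_eq_iff)
      then show ?thesis by simp
    next
      case 2
      have "closure (box p q) \<subseteq> closure (box c d)" using pq by (intro closure_mono) auto
      moreover have "box c d \<noteq> {}" using 2 pq by auto
      ultimately have "cbox p q \<subseteq> \<Omega>" using 2 cd by (auto simp: closure_box)
      from integral_box_eq_0[OF h z this] have "(\<integral>x. indicator (box p q) x *\<^sub>R h x \<partial>lborel) = 0" .
      moreover have "(\<lambda>x. indicator (box a b) x * ?h x) = (\<lambda>x. indicator (box p q) x *\<^sub>R h x)"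
        unfolding pq[symmetric] by (auto simp: indicator_def fun_eq_iff)
      ultimately show ?thesis by simp
    qed
  qed
  have eq: "(\<integral>x. indicator A x * ?h x \<partial>lborel) = 0" if "A \<in> sigma_sets UNIV (range (\<lambda>(a,b). box a b))"
      for A
  proof -
    have sets: "sigma_sets UNIV (range (\<lambda>(a,b::real^'n). box a b)) = sets borel"
      by (subst borel_eq_box) simp
    have I: "Int_stable (range (\<lambda>(a,b::real^'n). box a b))"
      by (auto simp: Int_stable_def box_Int_box)
    have P: "range (\<lambda>(a,b::real^'n). box a b) \<subseteq> Pow UNIV" by simp
    show ?thesis
    proof (rule sigma_sets_induct_disjoint[OF I P that])
      show "(\<integral>x. indicator A x * ?h x \<partial>lborel) = 0" if "A \<in> range (\<lambda>(a,b). box a b)" for A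
          using that boxes by auto
    next
      show "(\<integral>x. indicator {} x * ?h x \<partial>lborel) = 0" by simp
    next
      fix A :: "(real^'n) set" assume compl: "A \<in> sigma_sets UNIV (range (\<lambda>(a,b). box a b))"
          "(\<integral>x. indicator A x * ?h x \<partial>lborel) = 0"
      then have A: "A \<in> sets borel" using sets by simp
      have "(\<integral>x. ?h x \<partial>lborel) = 0" using boxes[of c d]
          by (simp add: mult.assoc[symmetric] indicator_inter_arith[symmetric])
      moreover have "(\<integral>x. indicator A x * ?h x \<partial>lborel) + (\<integral>x. indicator (UNIV - A) x * ?h x \<partial>lborel) =
          (\<integral>x. ?h x \<partial>lborel)"
        using A by (subst Bochner_Integration.integral_add[symmetric, OF sub sub])
          (auto intro!: Bochner_Integration.integral_cong simp: indicator_def)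
      ultimately show "(\<integral>x. indicator (UNIV - A) x * ?h x \<partial>lborel) = 0" using compl by simp
    next
      fix A :: "nat \<Rightarrow> (real^'n) set" assume union: "disjoint_family A" "range A \<subseteq>
          sigma_sets UNIV (range (\<lambda>(a,b). box a b))"
        "\<And>i. (\<integral>x. indicator (A i) x * ?h x \<partial>lborel) = 0"
      then have A: "\<And>i. A i \<in> sets borel" using sets by auto
      have "(\<lambda>n. \<integral>x. indicator (\<Union>i<n. A i) x * ?h x \<partial>lborel) \<longlonglongrightarrow> (\<integral>x. indicator (\<Union>i. A i) x
          * ?h x \<partial>lborel)"
      proof (rule integral_dominated_convergence[where w="\<lambda>x. norm (?h x)"])
        show "AE x in lborel. (\<lambda>n. indicator (\<Union>i<n. A i) x * ?h x) \<longlonglongrightarrow> indicator (\<Union>i. A i) x * ?h x"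
          by (intro AE_I2 tendsto_intros LIMSEQ_indicator_UN)
      qed (use ih A in \<open>auto simp: indicator_def\<close>)
      moreover have "(\<integral>x. indicator (\<Union>i<n. A i) x * ?h x \<partial>lborel) = 0" for n
      proof (induction n)
        case (Suc n)
        have "(\<integral>x. indicator (\<Union>i<Suc n. A i) x * ?h x \<partial>lborel) =
            (\<integral>x. indicator (\<Union>i<n. A i) x * ?h x + indicator (A n) x * ?h x \<partial>lborel)"
          using union(1) by (intro Bochner_Integration.integral_cong)
            (auto simp: indicator_def lessThan_Suc disjoint_family_on_def less_le, blast)
        also have "\<dots> = 0" using A Suc union(3)
            by (subst Bochner_Integration.integral_add) (auto intro!: sub)
        finally show ?case .
      qed simp
      ultimately show "(\<integral>x. indicator (\<Union>i. A i) x * ?h x \<partial>lborel) = 0" by (simp add: LIMSEQ_const_iff)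
    qed
  qed
  have "AE x in lborel. ?h x = (\<lambda>x. 0) x"
  proof (rule density_unique_real[OF ih])
    fix A :: "(real^'n) set" assume "A \<in> sets lborel"
    then show "(\<integral>x\<in>A. ?h x \<partial>lborel) = (\<integral>x\<in>A. 0 \<partial>lborel)"
      using eq[of A] by (simp add: set_lebesgue_integral_def borel_eq_box)
  qed simp
  then show ?thesis by eventually_elim (auto simp: indicator_def)
qed

text \<open>Lindelof's theorem covers \<Omega> by countably many boxes whose closures lie in
  \<Omega>, so only countably many null sets have to be collected; coordinates reduce the values to
  real ones.\<close>

lemma fundamental_lemma:
  fixes h :: "real^'n \<Rightarrow> 'b::euclidean_space"
  assumes \<Omega>: "open \<Omega>" and h: "loc_integrable \<Omega> h"
    and z: "\<And>\<eta>. \<eta> \<in> test_functions \<Omega> \<Longrightarrow> (\<integral>x. \<eta> x *\<^sub>R h x \<partial>lborel) = 0"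
  shows "AE x in lborel. x \<in> \<Omega> \<longrightarrow> h x = 0"
proof -
  have m[measurable]: "h \<in> borel_measurable borel" using h by (simp add: loc_integrable_def)
  obtain D where D: "countable D" "\<And>X. X \<in> D \<Longrightarrow> \<exists>c d. X = box c d \<and> cbox c d \<subseteq> \<Omega>" "\<Omega> \<subseteq> \<Union>D"
  proof -
    let ?D = "{box c d | c d. cbox c d \<subseteq> \<Omega>}"
    have "\<Omega> \<subseteq> \<Union>?D"
    proof
      fix x assume "x \<in> \<Omega>"
      then obtain a b where "cbox a b \<subseteq> \<Omega>" "x \<in> box a b" using open_contains_cbox[of \<Omega> x] \<Omega> by metis
      then show "x \<in> \<Union>?D" by (intro UnionI[of "box a b"]) auto
    qed
    moreover have "open S" if "S \<in> ?D" for S using that by (auto simp: open_box)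
    then obtain D where "D \<subseteq> ?D" "countable D" "\<Union>D = \<Union>?D"
      by (rule Lindelof)
    ultimately show ?thesis by (intro that[of D]) auto
  qed
  have "AE x in lborel. \<forall>X\<in>D. \<forall>b\<in>Basis. x \<in> X \<longrightarrow> h x \<bullet> b = 0"
  proof (rule AE_ball_countable'[OF AE_ball_countable'[OF _ countable_finite[OF finite_Basis]] D(1)])
    fix X and b :: 'b assume X: "X \<in> D" and b: "b \<in> Basis"
    obtain c d where cd: "X = box c d" "cbox c d \<subseteq> \<Omega>" using D(2)[OF X] by auto
    have "loc_integrable \<Omega> (\<lambda>x. h x \<bullet> b)"
      unfolding loc_integrable_def
    proof (intro conjI allI impI)
      fix K assume "compact K" "K \<subseteq> \<Omega>"
      then have "integrable lborel (\<lambda>x. (indicator K x *\<^sub>R h x) \<bullet> b)"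
        using h by (intro integrable_inner_left) (auto simp: loc_integrable_def)
      then show "integrable lborel (\<lambda>x. indicator K x *\<^sub>R (h x \<bullet> b))" by simp
    qed simp
    moreover have "(\<integral>x. \<eta> x *\<^sub>R (h x \<bullet> b) \<partial>lborel) = 0" if "\<eta> \<in> test_functions \<Omega>" for \<eta>
      using z[OF that] integral_inner_left[OF integrable_test[OF h that], of b] by simp
    ultimately show "AE x in lborel. x \<in> X \<longrightarrow> h x \<bullet> b = 0"
      using fundamental_lemma_real[of \<Omega> "\<lambda>x. h x \<bullet> b" c d] cd by auto
  qed
  then show ?thesis
  proof eventually_elim
    case (elim x)
    show ?case
    proof
      assume "x \<in> \<Omega>"
      then obtain X where "X \<in> D" "x \<in> X" using D(3) by auto
      then have "h x \<bullet> b = 0 \<bullet> b" if "b \<in> Basis" for b using elim that by (metis inner_zero_left)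
      then show "h x = 0" by (rule euclidean_eqI)
    qed
  qed
qed

section \<open>Translates of weakly differentiable functions\<close>

lemma nn_integral_translate:
  fixes f :: "'a::euclidean_space \<Rightarrow> ennreal"
  assumes "f \<in> borel_measurable borel"
  shows "(\<integral>\<^sup>+x. f (x + v) \<partial>lborel) = (\<integral>\<^sup>+x. f x \<partial>lborel)"
proof -
  have "(\<integral>\<^sup>+x. f x \<partial>lborel) = (\<integral>\<^sup>+x. f x \<partial>(distr lborel borel ((+) v)))"
    by (simp add: lborel_distr_plus)
  also have "\<dots> = (\<integral>\<^sup>+x. f (x + v) \<partial>lborel)"
    by (subst nn_integral_distr) (use assms in \<open>auto simp: add.commute\<close>)
  finally show ?thesis by simp
qed

lemma integral_translate:
  fixes f :: "'a::euclidean_space \<Rightarrow> 'b::euclidean_space"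
  assumes "f \<in> borel_measurable borel"
  shows "(\<integral>x. f (x + v) \<partial>lborel) = (\<integral>x. f x \<partial>lborel)"
proof -
  have "(\<integral>x. f x \<partial>lborel) = (\<integral>x. f x \<partial>(distr lborel borel ((+) v)))"
    by (simp add: lborel_distr_plus)
  also have "\<dots> = (\<integral>x. f (x + v) \<partial>lborel)"
    by (subst integral_distr) (use assms in \<open>auto simp: add.commute\<close>)
  finally show ?thesis by simp
qed

lemma integrable_translate:
  fixes f :: "'a::euclidean_space \<Rightarrow> 'b::euclidean_space"
  assumes "integrable lborel f"
  shows "integrable lborel (\<lambda>x. f (x + v))"
proof -
  have [measurable]: "f \<in> borel_measurable borel" using assms by auto
  have "(\<integral>\<^sup>+x. ennreal (norm (f (x + v))) \<partial>lborel) = (\<integral>\<^sup>+x. ennreal (norm (f x)) \<partial>lborel)"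
    by (rule nn_integral_translate) simp
  then show ?thesis using assms unfolding integrable_iff_bounded by simp
qed

definition weak_deriv :: "(real^'n) set \<Rightarrow> 'n \<Rightarrow> (real^'n \<Rightarrow> 'b::euclidean_space) \<Rightarrow> (real^'n \<Rightarrow> 'b) \<Rightarrow> bool"
    where
  "weak_deriv \<Omega> j f g \<longleftrightarrow> (\<forall>\<eta>\<in>test_functions \<Omega>.
     (\<integral>x. partial j \<eta> x *\<^sub>R f x \<partial>lborel) = - (\<integral>x. \<eta> x *\<^sub>R g x \<partial>lborel))"

lemma loc_integrable_sum:
  assumes "\<And>j. j \<in> J \<Longrightarrow> loc_integrable \<Omega> (g j)"
  shows "loc_integrable \<Omega> (\<lambda>x. \<Sum>j\<in>J. c j *\<^sub>R g j x)"
  unfolding loc_integrable_def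
proof (intro conjI allI impI)
  show "(\<lambda>x. \<Sum>j\<in>J. c j *\<^sub>R g j x) \<in> borel_measurable borel"
    using assms by (intro borel_measurable_sum borel_measurable_scaleR) (auto simp: loc_integrable_def)
  fix K assume K: "compact K" "K \<subseteq> \<Omega>"
  have "integrable lborel (\<lambda>x. \<Sum>j\<in>J. c j *\<^sub>R (indicator K x *\<^sub>R g j x))"
    using assms K by (intro Bochner_Integration.integrable_sum integrable_scaleR_right)
        (auto simp: loc_integrable_def)
  then show "integrable lborel (\<lambda>x. indicator K x *\<^sub>R (\<Sum>j\<in>J. c j *\<^sub>R g j x))"
    by (simp add: scaleR_right.sum mult.commute)
qed

lemma swept_compact:
  fixes K :: "(real^'n) set"
  assumes "compact K"
  shows "compact ((\<lambda>(x, r). x + r *\<^sub>R v) ` (K \<times> {0..1::real}))"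
  by (intro compact_continuous_image compact_Times assms compact_Icc)
     (auto intro!: continuous_intros simp: split_def)

text \<open>These are the two absolute integrability statements that justify exchanging the
  integrals in \<open>translation_identity\<close>. For fixed \<open>r\<close> the inner integral is
  at most \<open>B\<close> times the integral of the norm of \<open>F\<close> over the compact set
  swept out by \<open>K\<close>, uniformly for \<open>r\<close> in the unit interval; the second
  integrand becomes the first under y = x + r v.\<close>

lemma swept_integrable:
  fixes F :: "real^'n \<Rightarrow> 'b::euclidean_space"
  assumes F: "loc_integrable \<Omega> F" and K: "compact K" "\<And>x r. x \<in> K \<Longrightarrow> 0 \<le> r \<Longrightarrow> r \<le> 1 \<Longrightarrow> x + r *\<^sub>R v \<in> \<Omega>"
    and [measurable]: "a \<in> borel_measurable borel"
    and a: "\<And>x. \<bar>a x\<bar> \<le> B" "\<And>x. x \<notin> K \<Longrightarrow> a x = 0"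
  shows "integrable (lborel \<Otimes>\<^sub>M lborel) (\<lambda>(r, y). (indicator {0..1::real} r * a (y - r *\<^sub>R v)) *\<^sub>R F y)"
      (is ?A)
    "integrable (lborel \<Otimes>\<^sub>M lborel) (\<lambda>(r, x). (indicator {0..1::real} r * a x) *\<^sub>R F (x + r *\<^sub>R v))"
        (is ?B)
proof -
  have [measurable]: "F \<in> borel_measurable borel" using F by (simp add: loc_integrable_def)
  define K' where "K' = (\<lambda>(x, r). x + r *\<^sub>R v) ` (K \<times> {0..1::real})"
  have K': "compact K'" "K' \<subseteq> \<Omega>"
    using swept_compact[OF K(1)] K(2) by (auto simp: K'_def)
  have [measurable]: "K' \<in> sets borel" using K'(1) by (simp add: borel_compact)
  have B0: "B \<ge> 0" using a(1)[of 0] by linarith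
  define I where "I = (\<integral>\<^sup>+y. ennreal (norm (indicator K' y *\<^sub>R F y)) \<partial>lborel)"
  have I: "I < \<infinity>"
    using F K' unfolding I_def loc_integrable_def integrable_iff_bounded by blast
  have bound: "(\<integral>\<^sup>+y. ennreal (norm ((indicator {0..1::real} r * a (y - r *\<^sub>R v)) *\<^sub>R F y)) \<partial>lborel)
      \<le> (ennreal B * I) * indicator {0..1} r" for r
  proof -
    have "(\<integral>\<^sup>+y. ennreal (norm ((indicator {0..1::real} r * a (y - r *\<^sub>R v)) *\<^sub>R F y)) \<partial>lborel)
      \<le> (\<integral>\<^sup>+y. (ennreal B * indicator {0..1} r) * ennreal (norm (indicator K' y *\<^sub>R F y)) \<partial>lborel)"
    proof (intro nn_integral_mono)
      fix y
      show "ennreal (norm ((indicator {0..1::real} r * a (y - r *\<^sub>R v)) *\<^sub>R F y))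
        \<le> (ennreal B * indicator {0..1} r) * ennreal (norm (indicator K' y *\<^sub>R F y))"
      proof (cases "r \<in> {0..1} \<and> y - r *\<^sub>R v \<in> K")
        case True
        then have "y \<in> K'" unfolding K'_def by (intro image_eqI[of _ _ "(y - r *\<^sub>R v, r)"]) auto
        then show ?thesis
          using True a(1)[of "y - r *\<^sub>R v"] B0
              by (auto simp: ennreal_mult[symmetric] intro!: ennreal_leI mult_right_mono)
      next
        case False
        then have e: "indicator {0..1::real} r * a (y - r *\<^sub>R v) = 0" using a(2)
            by (auto simp: indicator_def)
        show ?thesis unfolding e by simp
      qed
    qed
    also have "\<dots> = (ennreal B * indicator {0..1} r) * I"
      unfolding I_def by (intro nn_integral_cmult) simp
    finally show ?thesis by (simp add: mult.assoc mult.commute mult.left_commute)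
  qed
  have fin: "(\<integral>\<^sup>+r. (ennreal B * I) * indicator {0..1::real} r \<partial>lborel) < \<infinity>"
    using I by (simp add: nn_integral_cmult_indicator ennreal_mult_less_top)
  show ?A
  proof (rule integrableI_bounded)
    show "(\<lambda>(r, y). (indicator {0..1::real} r * a (y - r *\<^sub>R v))
        *\<^sub>R F y) \<in> borel_measurable (lborel \<Otimes>\<^sub>M lborel)"
      by measurable
    have "(\<integral>\<^sup>+p. ennreal (norm (case p of (r, y) \<Rightarrow> (indicator {0..1::real} r * a (y - r *\<^sub>R v)) *\<^sub>R F y))
        \<partial>(lborel \<Otimes>\<^sub>M lborel))
       = (\<integral>\<^sup>+r. \<integral>\<^sup>+y. ennreal (norm ((indicator {0..1::real} r * a (y - r *\<^sub>R v)) *\<^sub>R F y)) \<partial>lborel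
           \<partial>lborel)"
      by (subst lborel.nn_integral_fst[symmetric]) simp_all
    also have "\<dots> \<le> (\<integral>\<^sup>+r. (ennreal B * I) * indicator {0..1::real} r \<partial>lborel)"
      by (rule nn_integral_mono) (rule bound)
    finally show "(\<integral>\<^sup>+p. ennreal (norm (case p of (r, y) \<Rightarrow> (indicator {0..1::real} r * a (y - r *\<^sub>R v))
        *\<^sub>R F y)) \<partial>(lborel \<Otimes>\<^sub>M lborel)) < \<infinity>"
      using fin by (rule le_less_trans)
  qed
  show ?B
  proof (rule integrableI_bounded)
    show "(\<lambda>(r, x). (indicator {0..1::real} r * a x) *\<^sub>R F (x
        + r *\<^sub>R v)) \<in> borel_measurable (lborel \<Otimes>\<^sub>M lborel)"
      by measurable
    have "(\<integral>\<^sup>+p. ennreal (norm (case p of (r, x) \<Rightarrow> (indicator {0..1::real} r * a x) *\<^sub>R F (x + r *\<^sub>R v)))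
        \<partial>(lborel \<Otimes>\<^sub>M lborel))
       = (\<integral>\<^sup>+r. \<integral>\<^sup>+x. ennreal (norm ((indicator {0..1::real} r * a x) *\<^sub>R F (x + r *\<^sub>R v))) \<partial>lborel
           \<partial>lborel)"
      by (subst lborel.nn_integral_fst[symmetric]) simp_all
    also have "\<dots> = (\<integral>\<^sup>+r. \<integral>\<^sup>+y. ennreal (norm ((indicator {0..1::real} r * a (y - r *\<^sub>R v)) *\<^sub>R F y))
        \<partial>lborel \<partial>lborel)"
    proof (rule nn_integral_cong)
      fix r :: real
      show "(\<integral>\<^sup>+x. ennreal (norm ((indicator {0..1::real} r * a x) *\<^sub>R F (x + r *\<^sub>R v))) \<partial>lborel) =
        (\<integral>\<^sup>+y. ennreal (norm ((indicator {0..1::real} r * a (y - r *\<^sub>R v)) *\<^sub>R F y)) \<partial>lborel)"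
        using nn_integral_translate[of "\<lambda>y. ennreal (norm ((indicator {0..1::real} r * a (y - r *\<^sub>R v))
            *\<^sub>R F y))" "r *\<^sub>R v"]
        by simp
    qed
    also have "\<dots> \<le> (\<integral>\<^sup>+r. (ennreal B * I) * indicator {0..1::real} r \<partial>lborel)"
      by (rule nn_integral_mono) (rule bound)
    finally show "(\<integral>\<^sup>+p. ennreal (norm (case p of (r, x) \<Rightarrow> (indicator {0..1::real} r * a x) *\<^sub>R F (x
        + r *\<^sub>R v))) \<partial>(lborel \<Otimes>\<^sub>M lborel)) < \<infinity>"
      using fin by (rule le_less_trans)
  qed
qed

lemma test_directional:
  assumes f: "loc_integrable \<Omega> f" and wd: "\<And>j. weak_deriv \<Omega> j f (g j)"
      and g: "\<And>j. loc_integrable \<Omega> (g j)"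
    and \<eta>: "\<eta> \<in> test_functions \<Omega>"
  shows "(\<integral>x. (v \<bullet> grad \<eta> x) *\<^sub>R f x \<partial>lborel) = - (\<integral>x. \<eta> x *\<^sub>R (\<Sum>j\<in>UNIV. v $ j *\<^sub>R g j x) \<partial>lborel)"
proof -
  have "(\<integral>x. (v \<bullet> grad \<eta> x) *\<^sub>R f x \<partial>lborel) =
      (\<integral>x. (\<Sum>j\<in>UNIV. v $ j *\<^sub>R (partial j \<eta> x *\<^sub>R f x)) \<partial>lborel)"
    by (intro Bochner_Integration.integral_cong) (auto simp: inner_vec_def grad_def scaleR_left.sum)
  also have "\<dots> = (\<Sum>j\<in>UNIV. v $ j *\<^sub>R (\<integral>x. partial j \<eta> x *\<^sub>R f x \<partial>lborel))"
    using integrable_test[OF f test_functions_partial[OF \<eta>]]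
    by (subst Bochner_Integration.integral_sum) (simp_all del: scaleR_scaleR)
  also have "\<dots> = - (\<Sum>j\<in>UNIV. v $ j *\<^sub>R (\<integral>x. \<eta> x *\<^sub>R g j x \<partial>lborel))"
    using wd \<eta> by (simp add: weak_deriv_def sum_negf)
  also have "(\<Sum>j\<in>UNIV. v $ j *\<^sub>R (\<integral>x. \<eta> x *\<^sub>R g j x \<partial>lborel)) =
      (\<integral>x. (\<Sum>j\<in>UNIV. v $ j *\<^sub>R (\<eta> x *\<^sub>R g j x)) \<partial>lborel)"
    using integrable_test[OF g \<eta>] by (subst Bochner_Integration.integral_sum)
        (simp_all del: scaleR_scaleR)
  also have "\<dots> = (\<integral>x. \<eta> x *\<^sub>R (\<Sum>j\<in>UNIV. v $ j *\<^sub>R g j x) \<partial>lborel)"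
    by (intro Bochner_Integration.integral_cong) (auto simp: scaleR_right.sum mult.commute)
  finally show ?thesis .
qed

text \<open>No mollification is involved. When tested against a smooth function supported in
  \<open>U\<close>, the translation and the derivative can both be moved onto that function, by
  translation invariance and Fubini; what remains is the fundamental theorem of calculus for the
  test function along a segment. The fundamental lemma then gives the identity almost
  everywhere.\<close>

lemma translation_identity:
  fixes f :: "real^'n \<Rightarrow> 'b::euclidean_space"
  assumes f: "loc_integrable \<Omega> f" and g: "\<And>j. loc_integrable \<Omega> (g j)"
      and wd: "\<And>j. weak_deriv \<Omega> j f (g j)"
    and U: "open U" and seg: "\<And>x r. x \<in> U \<Longrightarrow> 0 \<le> r \<Longrightarrow> r \<le> 1 \<Longrightarrow> x + r *\<^sub>R v \<in> \<Omega>"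
  shows "AE x in lborel. x \<in> U \<longrightarrow> f (x + v) - f x =
    (\<integral>r. indicator {0..1::real} r *\<^sub>R (\<Sum>j\<in>UNIV. v $ j *\<^sub>R g j (x + r *\<^sub>R v)) \<partial>lborel)"
proof -
  define G where "G y = (\<Sum>j\<in>UNIV. v $ j *\<^sub>R g j y)" for y
  have G: "loc_integrable \<Omega> G" unfolding G_def by (intro loc_integrable_sum g)
  have [measurable]: "f \<in> borel_measurable borel" "G \<in> borel_measurable borel"
    using f G by (simp_all add: loc_integrable_def)
  define I where "I x = (\<integral>r. indicator {0..1::real} r *\<^sub>R G (x + r *\<^sub>R v) \<partial>lborel)" for x
  have [measurable]: "I \<in> borel_measurable borel" unfolding I_def by measurable
  let ?h = "\<lambda>x. f (x + v) - f x - I x"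
  have U\<Omega>: "U \<subseteq> \<Omega>" using seg[of _ 0] by auto
  have fv: "loc_integrable U (\<lambda>x. f (x + v))"
    unfolding loc_integrable_def
  proof (intro conjI allI impI)
    fix K assume K: "compact K" "K \<subseteq> U"
    have "compact ((\<lambda>x. x + v) ` K)" by (intro compact_continuous_image continuous_intros K)
    moreover have "(\<lambda>x. x + v) ` K \<subseteq> \<Omega>" using K seg[of _ 1] by auto
    ultimately have "integrable lborel (\<lambda>x. indicator ((\<lambda>x. x + v) ` K) x *\<^sub>R f x)"
      using f by (simp add: loc_integrable_def)
    moreover have "x + v \<in> (\<lambda>x. x + v) ` K \<longleftrightarrow> x \<in> K" for x by auto
    ultimately show "integrable lborel (\<lambda>x. indicator K x *\<^sub>R f (x + v))"
      using integrable_translate[of "\<lambda>x. indicator ((\<lambda>x. x + v) ` K) x *\<^sub>R f x" v]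
      by (simp add: indicator_def)
  qed simp
  have loc: "loc_integrable U ?h"
    unfolding loc_integrable_def
  proof (intro conjI allI impI)
    fix K assume K: "compact K" "K \<subseteq> U"
    have [measurable]: "K \<in> sets borel" using K(1) by (simp add: borel_compact)
    have "integrable (lborel \<Otimes>\<^sub>M lborel) (\<lambda>(r, x). (indicator {0..1::real} r * indicator K x) *\<^sub>R G (x
        + r *\<^sub>R v))"
      by (rule swept_integrable(2)[OF G K(1), of _ _ 1]) (use K seg in \<open>auto simp: indicator_def\<close>)
    from lborel_pair.integrable_snd[OF this]
    have "integrable lborel (\<lambda>x. \<integral>r. indicator K x
        *\<^sub>R (indicator {0..1::real} r *\<^sub>R G (x + r *\<^sub>R v)) \<partial>lborel)"
      by (simp add: mult.commute)
    then have "integrable lborel (\<lambda>x. indicator K x *\<^sub>R I x)" unfolding I_def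
        by (simp add: integral_scaleR_right del: scaleR_scaleR)
    moreover have "integrable lborel (\<lambda>x. indicator K x *\<^sub>R f x)" using f K U\<Omega>
        by (auto simp: loc_integrable_def)
    moreover have "integrable lborel (\<lambda>x. indicator K x *\<^sub>R f (x + v))" using fv K
        by (auto simp: loc_integrable_def)
    ultimately have "integrable lborel (\<lambda>x. indicator K x *\<^sub>R f (x + v) - indicator K x *\<^sub>R f x
        - indicator K x *\<^sub>R I x)"
      by (intro Bochner_Integration.integrable_diff)
    then show "integrable lborel (\<lambda>x. indicator K x *\<^sub>R ?h x)" by (simp add: scaleR_right_diff_distrib)
  qed simp
  have z: "(\<integral>x. \<psi> x *\<^sub>R ?h x \<partial>lborel) = 0" if \<psi>: "\<psi> \<in> test_functions U" for \<psi>
  proof -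
    obtain B where B: "\<And>x. \<bar>\<psi> x\<bar> \<le> B" using test_functions_bounded[OF \<psi>] by metis
    obtain K where K: "smooth_on UNIV \<psi>" "compact K" "K \<subseteq> U" "\<And>x. x \<notin> K \<Longrightarrow> \<psi> x = 0" "\<And>x i. x \<notin> K \<Longrightarrow>
        partial i \<psi> x = 0"
      using test_functionsE[OF \<psi>] by metis
    have segK: "\<And>x r. x \<in> K \<Longrightarrow> 0 \<le> r \<Longrightarrow> r \<le> 1 \<Longrightarrow> x + r *\<^sub>R v \<in> \<Omega>" using seg K by auto
    have [measurable]: "\<psi> \<in> borel_measurable borel" by (rule test_functions_borel[OF \<psi>])
    define a where "a x = v \<bullet> grad \<psi> x" for x
    have a_test: "a \<in> test_functions U"
    proof -
      have "(\<lambda>x. \<Sum>j\<in>J. v $ j * partial j \<psi> x) \<in> test_functions U" if "finite J" for J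
        using that
      proof (induction J)
        case empty
        show ?case by (rule test_functionsI[of _ "{}"]) auto
      next
        case (insert j J)
        then show ?case
          using test_functions_add[OF test_functions_smooth_mult[OF test_functions_partial[OF \<psi>], of
              "\<lambda>_. v $ j" j] insert(3)] by simp
      qed
      then show ?thesis unfolding a_def[abs_def] by (simp add: inner_vec_def grad_def)
    qed
    have [measurable]: "a \<in> borel_measurable borel" by (rule test_functions_borel[OF a_test])
    obtain B' where B': "\<And>x. \<bar>a x\<bar> \<le> B'" using test_functions_bounded[OF a_test] by metis
    have aK: "a x = 0" if "x \<notin> K" for x using K(5)[OF that] by (simp add: a_def inner_vec_def grad_def)
    have diff: "\<psi> differentiable at x" for x using K(1) smooth_on_differentiable by blast
    have acont: "isCont a x" for x
      using test_functions_continuous[OF a_test] by (simp add: continuous_on_eq_continuous_at)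
    have ftc: "(\<integral>r. indicator {0..1::real} r * a (y - r *\<^sub>R v) \<partial>lborel) = \<psi> y - \<psi> (y - v)" for y
    proof -
      have "(\<integral>r. (- a (y - r *\<^sub>R v)) * indicator {0..1::real} r \<partial>lborel) =
          \<psi> (y - 1 *\<^sub>R v) - \<psi> (y - 0 *\<^sub>R v)"
      proof (rule integral_FTC_Icc_real)
        fix r :: real
        have "((\<lambda>r. \<psi> (y + r *\<^sub>R (- v))) has_real_derivative ((- v) \<bullet> grad \<psi> (y + r *\<^sub>R (- v))))
            (at r within UNIV)"
          by (rule has_vector_derivative_ray[OF diff])
        then show "((\<lambda>r. \<psi> (y - r *\<^sub>R v)) has_real_derivative - a (y - r *\<^sub>R v)) (at r)"
            by (simp add: a_def)
        show "isCont (\<lambda>r. - a (y - r *\<^sub>R v)) r"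
          by (intro continuous_intros isCont_o2[OF _ acont])
      qed simp
      then show ?thesis by (simp add: mult.commute)
    qed
    have "(\<integral>x. \<psi> x *\<^sub>R I x \<partial>lborel) = (\<integral>x. \<integral>r. (indicator {0..1::real} r * \<psi> x) *\<^sub>R G (x
        + r *\<^sub>R v) \<partial>lborel \<partial>lborel)"
      unfolding I_def by (simp add: integral_scaleR_right[symmetric] mult.commute del:
          integral_scaleR_right)
    also have "\<dots> = (\<integral>r. \<integral>x. (indicator {0..1::real} r * \<psi> x) *\<^sub>R G (x + r *\<^sub>R v) \<partial>lborel \<partial>lborel)"
      by (rule lborel_pair.Fubini_integral[OF swept_integrable(2)[OF G K(2) segK _ B K(4)]]) auto
    also have "\<dots> = (\<integral>r. \<integral>y. - ((indicator {0..1::real} r * a (y - r *\<^sub>R v)) *\<^sub>R f y) \<partial>lborel \<partial>lborel)"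
    proof (rule Bochner_Integration.integral_cong[OF refl])
      fix r :: real
      show "(\<integral>x. (indicator {0..1::real} r * \<psi> x) *\<^sub>R G (x + r *\<^sub>R v) \<partial>lborel) =
        (\<integral>y. - ((indicator {0..1::real} r * a (y - r *\<^sub>R v)) *\<^sub>R f y) \<partial>lborel)"
      proof (cases "r \<in> {0..1}")
        case True
        \<comment> \<open>For fixed \<open>r\<close> the translated function is a test function of
          \<Omega>, because the segments starting in \<open>U\<close> stay in \<Omega>; so the weak
          derivative can be moved onto it.\<close>
        have t: "(\<lambda>y. \<psi> (y + (- (r *\<^sub>R v)))) \<in> test_functions \<Omega>"
          by (rule test_functions_translate[OF \<psi>]) (use seg True in auto)
        have gr: "grad (\<lambda>y. \<psi> (y + (- (r *\<^sub>R v)))) y = grad \<psi> (y - r *\<^sub>R v)" for y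
          unfolding grad_def using partial_translate[OF diff, where v="- (r *\<^sub>R v)"] by simp
        have "(\<integral>x. \<psi> x *\<^sub>R G (x + r *\<^sub>R v) \<partial>lborel) = (\<integral>y. \<psi> (y - r *\<^sub>R v) *\<^sub>R G y \<partial>lborel)"
          using integral_translate[of "\<lambda>y. \<psi> (y - r *\<^sub>R v) *\<^sub>R G y" "r *\<^sub>R v"] by simp
        also have "\<dots> = - (\<integral>y. a (y - r *\<^sub>R v) *\<^sub>R f y \<partial>lborel)"
          using test_directional[OF f wd g t, of v] unfolding gr by (simp add: G_def a_def)
        finally show ?thesis using True by simp
      qed simp
    qed
    also have "\<dots> = - (\<integral>r. \<integral>y. (indicator {0..1::real} r * a (y - r *\<^sub>R v)) *\<^sub>R f y \<partial>lborel \<partial>lborel)"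
      by simp
    also have "(\<integral>r. \<integral>y. (indicator {0..1::real} r * a (y - r *\<^sub>R v)) *\<^sub>R f y \<partial>lborel \<partial>lborel)
        = (\<integral>y. \<integral>r. (indicator {0..1::real} r * a (y - r *\<^sub>R v)) *\<^sub>R f y \<partial>lborel \<partial>lborel)"
      by (rule lborel_pair.Fubini_integral[symmetric, OF swept_integrable(1)[OF f K(2) segK _ B' aK]])
          auto
    also have "\<dots> = (\<integral>y. (\<psi> y - \<psi> (y - v)) *\<^sub>R f y \<partial>lborel)"
    proof (rule Bochner_Integration.integral_cong[OF refl])
      fix y
      have "integrable lborel (\<lambda>r. indicator {0..1::real} r * a (y - r *\<^sub>R v))"
      proof (rule Bochner_Integration.integrable_bound[of _ "\<lambda>r. B' * indicator {0..1::real} r"])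
        show "integrable lborel (\<lambda>r. B' * indicator {0..1::real} r)" by simp
        show "AE r in lborel. norm (indicator {0..1::real} r * a (y - r *\<^sub>R v)) \<le>
            norm (B' * indicator {0..1::real} r)"
          using B' by (auto intro!: AE_I2 simp: indicator_def abs_mult) (metis abs_ge_self order_trans)
      qed simp
      then show "(\<integral>r. (indicator {0..1::real} r * a (y - r *\<^sub>R v)) *\<^sub>R f y \<partial>lborel) =
          (\<psi> y - \<psi> (y - v)) *\<^sub>R f y"
        by (subst integral_scaleR_left) (simp_all add: ftc)
    qed
    finally have 1: "(\<integral>x. \<psi> x *\<^sub>R I x \<partial>lborel) = - (\<integral>y. (\<psi> y - \<psi> (y - v)) *\<^sub>R f y \<partial>lborel)" .
    have i1: "integrable lborel (\<lambda>y. \<psi> y *\<^sub>R f y)"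
        by (rule integrable_test[OF f test_functions_mono[OF \<psi> U\<Omega>]])
    have i2: "integrable lborel (\<lambda>y. \<psi> (y - v) *\<^sub>R f y)"
      using integrable_test[OF f test_functions_translate[OF \<psi>, of "- v" \<Omega>]] seg[of _ 1] by auto
    have i3: "integrable lborel (\<lambda>y. \<psi> y *\<^sub>R f (y + v))" by (rule integrable_test[OF fv \<psi>])
    have i4: "integrable lborel (\<lambda>y. \<psi> y *\<^sub>R I y)"
    proof -
      have "integrable lborel (\<lambda>y. \<psi> y *\<^sub>R f (y + v) - \<psi> y *\<^sub>R f y - \<psi> y *\<^sub>R ?h y)"
        by (intro Bochner_Integration.integrable_diff i1 i3 integrable_test[OF loc \<psi>])
      then show ?thesis by (simp add: algebra_simps)
    qed
    have 2: "(\<integral>y. \<psi> (y - v) *\<^sub>R f y \<partial>lborel) = (\<integral>y. \<psi> y *\<^sub>R f (y + v) \<partial>lborel)"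
      using integral_translate[of "\<lambda>y. \<psi> (y - v) *\<^sub>R f y" v] by simp
    have "(\<integral>x. \<psi> x *\<^sub>R ?h x \<partial>lborel) = (\<integral>x. \<psi> x *\<^sub>R f (x + v) - \<psi> x *\<^sub>R f x - \<psi> x *\<^sub>R I x \<partial>lborel)"
      by (simp add: scaleR_right_diff_distrib)
    also have "\<dots> = (\<integral>x. \<psi> x *\<^sub>R f (x + v) \<partial>lborel) - (\<integral>x. \<psi> x *\<^sub>R f x \<partial>lborel)
        - (\<integral>x. \<psi> x *\<^sub>R I x \<partial>lborel)"
      by (subst Bochner_Integration.integral_diff, intro Bochner_Integration.integrable_diff i1 i3, rule
          i4,
          subst Bochner_Integration.integral_diff[OF i3 i1]) simp
    also have "(\<integral>x. \<psi> x *\<^sub>R I x \<partial>lborel) = (\<integral>x. \<psi> x *\<^sub>R f (x + v) \<partial>lborel) - (\<integral>x. \<psi> x *\<^sub>R f x \<partial>lborel)"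
      unfolding 1 scaleR_left_diff_distrib Bochner_Integration.integral_diff[OF i1 i2] 2 by simp
    finally show ?thesis by simp
  qed
  have "AE x in lborel. x \<in> U \<longrightarrow> ?h x = 0" by (rule fundamental_lemma[OF U loc z])
  then show ?thesis
    unfolding I_def G_def by eventually_elim (auto simp: algebra_simps)
qed

text \<open>Cauchy-Schwarz twice, once in the sum over directions and once over the unit interval,
  which has measure 1. Extended nonnegative reals spare any integrability condition on the
  right-hand side.\<close>

lemma translation_estimate:
  fixes f :: "real^'n \<Rightarrow> 'b::euclidean_space"
  assumes f: "loc_integrable \<Omega> f" and g: "\<And>j. loc_integrable \<Omega> (g j)"
      and wd: "\<And>j. weak_deriv \<Omega> j f (g j)"
    and U: "open U" and seg: "\<And>x r. x \<in> U \<Longrightarrow> 0 \<le> r \<Longrightarrow> r \<le> 1 \<Longrightarrow> x + r *\<^sub>R v \<in> \<Omega>"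
  shows "AE x in lborel. x \<in> U \<longrightarrow> ennreal ((norm (f (x + v) - f x))\<^sup>2) \<le>
    ennreal ((norm v)\<^sup>2) * (\<integral>\<^sup>+r. indicator {0..1::real} r * ennreal
        (\<Sum>j\<in>UNIV. (norm (g j (x + r *\<^sub>R v)))\<^sup>2) \<partial>lborel)"
proof -
  have "AE x in lborel. x \<in> U \<longrightarrow> f (x + v) - f x =
    (\<integral>r. indicator {0..1::real} r *\<^sub>R (\<Sum>j\<in>UNIV. v $ j *\<^sub>R g j (x + r *\<^sub>R v)) \<partial>lborel)"
    by (rule translation_identity[OF f g wd U seg])
  then show ?thesis
proof eventually_elim
  case (elim x)
  have [measurable]: "g j \<in> borel_measurable borel" for j using g by (simp add: loc_integrable_def)
  define s where "s y = (\<Sum>j\<in>UNIV. (norm (g j y))\<^sup>2)" for y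
  have s0: "s y \<ge> 0" for y by (auto simp: s_def intro: sum_nonneg)
  have [measurable]: "s \<in> borel_measurable borel" unfolding s_def by measurable
  have sb: "norm (\<Sum>j\<in>UNIV. v $ j *\<^sub>R g j y) \<le> norm v * sqrt (s y)" for y
  proof -
    have "norm (\<Sum>j\<in>UNIV. v $ j *\<^sub>R g j y) \<le> (\<Sum>j\<in>UNIV. \<bar>v $ j\<bar> * norm (g j y))"
      by (rule order_trans[OF norm_sum]) simp
    also have "\<dots> \<le> sqrt ((\<Sum>j\<in>UNIV. \<bar>v $ j\<bar>\<^sup>2) * s y)"
      unfolding s_def by (intro real_le_rsqrt Cauchy_Schwarz_ineq_sum)
    also have "\<dots> = norm v * sqrt (s y)"
      by (simp add: real_sqrt_mult norm_vec_def L2_set_def)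
    finally show ?thesis .
  qed
  show ?case
  proof
    assume "x \<in> U"
    let ?u = "\<lambda>r. indicator {0..1::real} r *\<^sub>R (\<Sum>j\<in>UNIV. v $ j *\<^sub>R g j (x + r *\<^sub>R v))"
    have "ennreal (norm (f (x + v) - f x)) = ennreal (norm (\<integral>r. ?u r \<partial>lborel))"
      using elim \<open>x \<in> U\<close> by simp
    also have "\<dots> \<le> (\<integral>\<^sup>+r. ennreal (norm (?u r)) \<partial>lborel)"
    \<comment> \<open>The Bochner integral of a non-integrable function is 0 by convention, so the
      bound holds in that case as well.\<close>
    proof (cases "integrable lborel ?u")
      case True then show ?thesis by (rule integral_norm_bound_ennreal)
    next
      case False then show ?thesis by (simp add: not_integrable_integral_eq)
    qed
    also have "\<dots> \<le> (\<integral>\<^sup>+r. ennreal (norm v) * (indicator {0..1::real} r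
        * (indicator {0..1::real} r * ennreal (sqrt (s (x + r *\<^sub>R v))))) \<partial>lborel)"
      using sb s0 by (intro nn_integral_mono)
          (auto simp: indicator_def ennreal_mult[symmetric] intro!: ennreal_leI)
    also have "\<dots> = ennreal (norm v) * (\<integral>\<^sup>+r. indicator {0..1::real} r
        * (indicator {0..1::real} r * ennreal (sqrt (s (x + r *\<^sub>R v)))) \<partial>lborel)"
      by (intro nn_integral_cmult) simp
    finally have "(ennreal (norm (f (x + v) - f x)))\<^sup>2 \<le>
        (ennreal (norm v) * (\<integral>\<^sup>+r. indicator {0..1::real} r *
        (indicator {0..1::real} r * ennreal (sqrt (s (x + r *\<^sub>R v)))) \<partial>lborel))\<^sup>2"
      by (rule power_mono) simp
    also have "\<dots> = ennreal ((norm v)\<^sup>2) * (\<integral>\<^sup>+r. indicator {0..1::real} r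
        * (indicator {0..1::real} r * ennreal (sqrt (s (x + r *\<^sub>R v)))) \<partial>lborel)\<^sup>2"
      by (simp add: power_mult_distrib ennreal_power)
    also have "\<dots> \<le> ennreal ((norm v)\<^sup>2) * ((\<integral>\<^sup>+r. (indicator {0..1::real} r)\<^sup>2 \<partial>lborel)
        * (\<integral>\<^sup>+r. (indicator {0..1::real} r * ennreal (sqrt (s (x + r *\<^sub>R v))))\<^sup>2 \<partial>lborel))"
      by (intro mult_left_mono Cauchy_Schwarz_nn_integral) auto
    also have "(\<integral>\<^sup>+r. (indicator {0..1::real} r)\<^sup>2 \<partial>lborel) = (\<integral>\<^sup>+r. indicator {0..1::real} r \<partial>lborel)"
      by (intro nn_integral_cong) (auto simp: indicator_def)
    also have "\<dots> = 1" by simp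
    also have "(\<integral>\<^sup>+r. (indicator {0..1::real} r * ennreal (sqrt (s (x + r *\<^sub>R v))))\<^sup>2 \<partial>lborel) =
        (\<integral>\<^sup>+r. indicator {0..1::real} r * ennreal (s (x + r *\<^sub>R v)) \<partial>lborel)"
      using s0 by (intro nn_integral_cong) (auto simp: indicator_def ennreal_power)
    finally show "ennreal ((norm (f (x + v) - f x))\<^sup>2) \<le>
        ennreal ((norm v)\<^sup>2) * (\<integral>\<^sup>+r. indicator {0..1::real} r * ennreal
        (\<Sum>j\<in>UNIV. (norm (g j (x + r *\<^sub>R v)))\<^sup>2) \<partial>lborel)"
      by (simp add: ennreal_power s_def)
  qed
qed
qed

section \<open>Sets of positive reach\<close>

lemma reach_posE:
  fixes A :: "'a::metric_space set"
  assumes "reach A > 0"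
  obtains r where "r > 0" "\<And>y. y \<in> A \<Longrightarrow> ball y r \<subseteq> unique_nearest A"
proof -
  obtain r where r: "0 < ereal r" "ereal r < reach A"
    using ereal_dense2[OF assms] by auto
  have "ball y r \<subseteq> unique_nearest A" if "y \<in> A" for y
  proof -
    have "ereal r < (SUP r\<in>{r. 0 \<le> r \<and> ball y r \<subseteq> unique_nearest A}. ereal r)"
      using r(2) that unfolding reach_def by (meson INF_lower less_le_trans)
    then obtain r' where "ball y r' \<subseteq> unique_nearest A" "r < r'"
      by (auto simp: less_SUP_iff)
    then show ?thesis by (meson less_imp_le order_trans subset_ball)
  qed
  then show ?thesis using that r(1) by simp
qed

text \<open>Otherwise nearest points of a sequence tending to \<open>x\<close> stay away from
  \<open>p\<close>; they are bounded, and a limit point of them is a second nearest point of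
  \<open>x\<close>.\<close>

lemma nearest_point_continuous:
  fixes A :: "'a::euclidean_space set"
  assumes A: "closed A" and p: "p \<in> A" "dist x p = infdist x A"
    and uniq: "\<And>q. q \<in> A \<Longrightarrow> dist x q = infdist x A \<Longrightarrow> q = p" and e: "e > 0"
  shows "\<exists>\<eta>>0. \<forall>y q. dist y x < \<eta> \<longrightarrow> q \<in> A \<longrightarrow> dist y q = infdist y A \<longrightarrow> dist q p < e"
proof (rule ccontr)
  assume "\<not> ?thesis"
  then have "\<forall>k::nat. \<exists>y q. dist y x < inverse (real (Suc k)) \<and> q \<in> A \<and> dist y q = infdist y A
      \<and> dist q p \<ge> e"
    by (metis inverse_positive_iff_positive not_less of_nat_0_less_iff zero_less_Suc)
  then obtain y q where yq: "\<And>k::nat. dist (y k) x < inverse (real (Suc k))" "\<And>k. q k \<in> A"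
    "\<And>k. dist (y k) (q k) = infdist (y k) A" "\<And>k. dist (q k) p \<ge> e" by metis
  have "(\<lambda>k. dist (y k) x) \<longlonglongrightarrow> 0"
    by (rule tendsto_sandwich[OF _ _ tendsto_const LIMSEQ_inverse_real_of_nat])
       (auto intro!: always_eventually less_imp_le[OF yq(1)] simp del: of_nat_Suc)
  then have yl: "y \<longlonglongrightarrow> x" using tendsto_dist_iff by blast
  have "bounded (range y)" using yl convergent_imp_bounded by blast
  then obtain B where B: "\<And>k. norm (y k) \<le> B" by (auto simp: bounded_iff)
  have "norm (q k) \<le> 2 * B + norm p" for k
  proof -
    have "dist (y k) (q k) \<le> dist (y k) p" unfolding yq(3) by (rule infdist_le[OF p(1)])
    also have "\<dots> \<le> B + norm p" using B[of k] by
        (metis add_right_mono dist_norm norm_triangle_ineq4 order_trans)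
    finally have "norm (q k - y k) \<le> B + norm p" by (simp add: dist_norm norm_minus_commute)
    then show ?thesis using B[of k] norm_triangle_ineq[of "q k - y k" "y k"] by simp
  qed
  then have "bounded (range q)" by (auto simp: bounded_iff)
  then obtain l s where s: "strict_mono s" "(q \<circ> s) \<longlonglongrightarrow> l"
    using bounded_imp_convergent_subsequence by blast
  have "l \<in> A" using closed_sequentially[OF A, of "q \<circ> s" l] s yq(2) by auto
  have ys: "(y \<circ> s) \<longlonglongrightarrow> x" using yl s(1) LIMSEQ_subseq_LIMSEQ by blast
  have "(\<lambda>k. dist ((y \<circ> s) k) ((q \<circ> s) k)) \<longlonglongrightarrow> dist x l" by (intro tendsto_dist ys s)
  moreover have "(\<lambda>k. infdist ((y \<circ> s) k) A) \<longlonglongrightarrow> infdist x A" by (intro tendsto_infdist ys)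
  ultimately have "dist x l = infdist x A" using yq(3) LIMSEQ_unique by auto
  then have "l = p" using uniq \<open>l \<in> A\<close> by blast
  moreover have "(\<lambda>k. dist ((q \<circ> s) k) p) \<longlonglongrightarrow> dist l p" by (intro tendsto_dist s tendsto_const)
  ultimately have "e \<le> 0" using yq(4) by (intro tendsto_lowerbound[of _ 0 sequentially e]) auto
  then show False using e by simp
qed

text \<open>Nearest points of nearby points lie near \<open>p\<close>, so the direction from them to
  \<open>x\<close> makes only a small angle with the direction of motion, and the distance grows at
  a rate close to 1. The slack \<open>\<epsilon>\<close> pays for the angle.\<close>

lemma infdist_increase:
  fixes A :: "'a::euclidean_space set"
  assumes A: "closed A" and p: "p \<in> A" "dist x p = infdist x A"
    and uniq: "\<And>q. q \<in> A \<Longrightarrow> dist x q = infdist x A \<Longrightarrow> q = p" and pos: "infdist x A > 0"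
    and \<epsilon>: "0 < \<epsilon>" "\<epsilon> < 1"
  shows "\<exists>s0>0. \<forall>s. 0 < s \<and> s < s0 \<longrightarrow> infdist (x + s *\<^sub>R ((x - p) /\<^sub>R infdist x A)) A \<ge>
      infdist x A + (1 - \<epsilon>) * s"
proof -
  define n where "n = (x - p) /\<^sub>R infdist x A"
  have nn: "norm n = 1" using p(2) pos by (simp add: n_def dist_norm)
  have np: "n \<bullet> (x - p) = norm (x - p)"
    using p(2) pos by (simp add: n_def dist_norm dot_square_norm power2_eq_square)
  let ?F = "\<lambda>q. n \<bullet> (x - q) - (1 - \<epsilon>) * norm (x - q)"
  have "isCont ?F p" by (intro continuous_intros)
  moreover have "?F p > 0" using np p(2) pos \<epsilon> by (simp add: dist_norm algebra_simps)
  moreover have "(?F \<longlongrightarrow> ?F p) (nhds p)"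
    using calculation(1) unfolding isCont_def by (rule tendsto_at_iff_tendsto_nhds[THEN iffD1])
  ultimately have "eventually (\<lambda>q. ?F q > 0) (nhds p)"
    by (intro order_tendstoD(1))
  then obtain e where e: "e > 0" "\<And>q. dist q p < e \<Longrightarrow> ?F q > 0"
    by (auto simp: eventually_nhds_metric)
  obtain \<eta> where \<eta>: "\<eta> > 0" "\<And>y q. dist y x < \<eta> \<Longrightarrow> q \<in> A \<Longrightarrow> dist y q = infdist y A \<Longrightarrow> dist q p < e"
    using nearest_point_continuous[OF A p uniq e(1)] by metis
  have "infdist (x + s *\<^sub>R n) A \<ge> infdist x A + (1 - \<epsilon>) * s" if s: "0 < s" "s < \<eta>" for s
  proof -
    obtain q where q: "q \<in> A" "infdist (x + s *\<^sub>R n) A = dist (x + s *\<^sub>R n) q"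
      using infdist_attains_inf[OF A] p(1) by blast
    have "?F q > 0" using q s nn by (intro e(2) \<eta>(2)[of "x + s *\<^sub>R n"]) (auto simp: dist_norm)
    define D where "D = norm (x - q)"
    have F: "n \<bullet> (x - q) \<ge> (1 - \<epsilon>) * D" using \<open>?F q > 0\<close> by (simp add: D_def)
    have D: "D \<ge> infdist x A" using infdist_le[OF q(1), of x] by (simp add: D_def dist_norm)
    have "D \<ge> 0" by (simp add: D_def)
    have "(D + (1 - \<epsilon>) * s)\<^sup>2 = D\<^sup>2 + 2 * s * ((1 - \<epsilon>) * D) + (1 - \<epsilon>)\<^sup>2 * s\<^sup>2"
      by (simp add: power2_eq_square algebra_simps)
    also have "\<dots> \<le> D\<^sup>2 + 2 * s * (n \<bullet> (x - q)) + 1 * s\<^sup>2"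
      using s \<epsilon> F by (intro add_mono mult_left_mono mult_right_mono power_le_one) auto
    also have "\<dots> = (norm ((x - q) + s *\<^sub>R n))\<^sup>2"
      using nn unfolding D_def power2_norm_eq_inner
      by (simp add: inner_add_left inner_add_right inner_commute power2_eq_square norm_eq_1)
    finally have "D + (1 - \<epsilon>) * s \<le> norm ((x - q) + s *\<^sub>R n)"
      by (rule power2_le_imp_le) simp
    also have "\<dots> = infdist (x + s *\<^sub>R n) A" using q(2) by (simp add: dist_norm algebra_simps)
    finally show ?thesis using D by simp
  qed
  then show ?thesis using \<eta>(1) unfolding n_def by blast
qed

text \<open>The slack in \<open>infdist_increase\<close> is removed by compactness. A continuation
  argument, restarted with the nearest point of each point reached, yields for every
  \<open>\<epsilon>\<close> a point within distance \<open>h\<close> of \<open>x\<close> at which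
  the distance to \<open>A\<close> has grown by \<open>(1 - \<epsilon>) * h\<close>; it may stray
  from the ray. The maximum of the distance over the ball then shows the full growth
  \<open>h\<close>, and equality in the triangle inequality forces the maximiser onto the
  ray.\<close>

lemma infdist_ray:
  fixes A :: "'a::euclidean_space set"
  assumes A: "closed A" and r: "\<And>y. y \<in> A \<Longrightarrow> ball y r \<subseteq> unique_nearest A"
    and p: "p \<in> A" "dist x p = infdist x A" and pos: "infdist x A > 0"
        and h: "h \<ge> 0" "infdist x A + h < r"
  shows "infdist (x + h *\<^sub>R ((x - p) /\<^sub>R infdist x A)) A = infdist x A + h"
proof -
  let ?d = "\<lambda>y. infdist y A"
  have ne: "A \<noteq> {}" using p(1) by auto
  have uniq: "\<exists>!q. q \<in> A \<and> dist y q = ?d y" if "?d y < r" for y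
  proof -
    obtain q where "q \<in> A" "?d y = dist y q" using infdist_attains_inf[OF A ne] by blast
    then have "y \<in> unique_nearest A" using r[of q] that by (auto simp: dist_commute)
    then show ?thesis by (simp add: unique_nearest_def)
  qed
  have *: "\<exists>y\<in>cball x h. ?d y \<ge> ?d x + (1 - \<epsilon>) * h" if \<epsilon>: "0 < \<epsilon>" "\<epsilon> < 1" for \<epsilon>
  proof -
    \<comment> \<open>Only the distance from \<open>x\<close> and the gain are recorded, not the
      path; hence the supremum can be extended from whatever point attains it.\<close>
    define S where "S = {t\<in>{0..h}. \<exists>y\<in>cball x t. ?d y \<ge> ?d x + (1 - \<epsilon>) * t}"
    have S0: "0 \<in> S" using h by (auto simp: S_def intro!: bexI[of _ x])
    have bdd: "bdd_above S" by (rule bdd_aboveI[of _ h]) (auto simp: S_def)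
    define T where "T = Sup S"
    have T0: "0 \<le> T" unfolding T_def by (rule cSup_upper[OF S0 bdd])
    have Th: "T \<le> h" unfolding T_def
    proof (rule cSup_least)
      show "S \<noteq> {}" using S0 by blast
    qed (simp add: S_def)
    note T = T0 Th
    have "T \<in> S"
    proof -
      have "\<exists>t\<in>S. t > T - inverse (real (Suc k))" for k
        using less_cSupD[of S "T - inverse (real (Suc k))"] S0 by (auto simp: T_def)
      then obtain t where t: "\<And>k. t k \<in> S" "\<And>k. t k > T - inverse (real (Suc k))" by metis
      have tT: "t k \<le> T" for k using cSup_upper[OF t(1) bdd] by (simp add: T_def)
      have lim: "(\<lambda>k. T - inverse (real (Suc k))) \<longlonglongrightarrow> T"
        using tendsto_diff[OF tendsto_const LIMSEQ_inverse_real_of_nat, of T] by simp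
      have tl: "t \<longlonglongrightarrow> T"
        by (rule tendsto_sandwich[OF _ _ lim tendsto_const])
          (use less_imp_le[OF t(2)] tT in \<open>simp_all add: always_eventually del: of_nat_Suc\<close>)
      have "\<exists>y. dist x y \<le> t k \<and> ?d y \<ge> ?d x + (1 - \<epsilon>) * t k" for k using t(1)[of k]
          by (auto simp: S_def)
      then obtain y where y: "\<And>k. dist x (y k) \<le> t k" "\<And>k. ?d (y k) \<ge> ?d x + (1 - \<epsilon>) * t k" by metis
      have "y k \<in> cball x T" for k using y(1)[of k] tT[of k] by simp
      then have "bounded (range y)" using bounded_subset[OF bounded_cball] by blast
      then obtain l s where s: "strict_mono s" "(y \<circ> s) \<longlonglongrightarrow> l"
        using bounded_imp_convergent_subsequence by blast
      have ts: "(t \<circ> s) \<longlonglongrightarrow> T" using tl s(1) LIMSEQ_subseq_LIMSEQ by blast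
      have "dist x l \<le> T"
        by (rule tendsto_le[OF _ ts tendsto_dist[OF tendsto_const s(2)]]) (auto simp: y)
      moreover have "?d x + (1 - \<epsilon>) * T \<le> ?d l"
        by (rule tendsto_le[OF _ tendsto_infdist[OF s(2)]
            tendsto_add[OF tendsto_const tendsto_mult[OF tendsto_const ts]]]) (auto simp: y)
      ultimately show ?thesis using T by (auto simp: S_def)
    qed
    have "T = h"
    proof (rule ccontr)
      assume "T \<noteq> h"
      then have "T < h" using T by simp
      obtain y where y: "dist x y \<le> T" "?d y \<ge> ?d x + (1 - \<epsilon>) * T" using \<open>T \<in> S\<close> by (auto simp: S_def)
      have dy0: "?d y > 0" using y(2) pos T \<epsilon>
          by (metis add_pos_nonneg diff_ge_0_iff_ge less_eq_real_def less_le_trans mult_nonneg_nonneg)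
      have "?d y \<le> ?d x + dist x y" using infdist_triangle[of y A x] by (simp add: dist_commute)
      then have "?d y < r" using y(1) \<open>T < h\<close> h by simp
      from uniq[OF this] obtain q where q: "q \<in> A" "dist y q = ?d y" "\<And>q'. q' \<in> A \<Longrightarrow> dist y q' = ?d y \<Longrightarrow>
          q' = q" by metis
      obtain s0 where s0: "s0 > 0" "\<And>s. 0 < s \<Longrightarrow> s < s0 \<Longrightarrow> ?d (y + s *\<^sub>R ((y - q) /\<^sub>R ?d y)) \<ge>
          ?d y + (1 - \<epsilon>) * s"
        using infdist_increase[OF A q dy0 \<epsilon>] by metis
      define s where "s = min (s0 / 2) (h - T)"
      have s: "0 < s" "s < s0" "T + s \<le> h" using s0 \<open>T < h\<close> by (auto simp: s_def)
      let ?y = "y + s *\<^sub>R ((y - q) /\<^sub>R ?d y)"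
      have "norm (y - q) = ?d y" using q(2) by (simp add: dist_norm)
      then have "dist y ?y = s" using dy0 s by (simp add: dist_norm)
      then have "dist x ?y \<le> T + s" using y(1) dist_triangle[of x ?y y] by simp
      moreover have "?d ?y \<ge> ?d x + (1 - \<epsilon>) * (T + s)" using s0(2)[OF s(1,2)] y(2)
          by (simp add: algebra_simps)
      ultimately have "T + s \<in> S" using s T by (auto simp: S_def)
      then have "T + s \<le> T" unfolding T_def using bdd by (rule cSup_upper)
      then show False using s by simp
    qed
    then show ?thesis using \<open>T \<in> S\<close> by (auto simp: S_def)
  qed
  have "compact (cball x h)" "cball x h \<noteq> {}" using h by auto
  moreover have "continuous_on (cball x h) ?d" by (intro continuous_on_infdist continuous_on_id)
  ultimately obtain z where z: "z \<in> cball x h" "\<And>y. y \<in> cball x h \<Longrightarrow> ?d y \<le> ?d z"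
    using continuous_attains_sup[of "cball x h" ?d] by auto
  have zge: "?d z \<ge> ?d x + h"
  proof (rule ccontr)
    assume "\<not> ?thesis"
    then have lt: "?d z < ?d x + h" and h0: "h > 0 \<or> h = 0" using h by auto
    show False
    proof (cases "h = 0")
      case True then show False using z lt by simp
    next
      case False
      then have "h > 0" using h by simp
      define \<epsilon> where "\<epsilon> = min (1/2) ((?d x + h - ?d z) / (2 * h))"
      have "0 < \<epsilon>" "\<epsilon> < 1" using lt \<open>h > 0\<close> by (auto simp: \<epsilon>_def)
      from *[OF this] z(2) have "?d x + (1 - \<epsilon>) * h \<le> ?d z" by (meson order_trans)
      moreover have "\<epsilon> * h \<le> (?d x + h - ?d z) / 2"
      proof -
        have "\<epsilon> * h \<le> ((?d x + h - ?d z) / (2 * h)) * h" using \<open>h > 0\<close>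
            by (intro mult_right_mono) (auto simp: \<epsilon>_def)
        then show ?thesis using \<open>h > 0\<close> by simp
      qed
      ultimately show False using lt by (simp add: algebra_simps)
    qed
  qed
  have "?d z \<le> dist z p" by (rule infdist_le[OF p(1)])
  also have "dist z p \<le> norm (z - x) + norm (x - p)" by (metis dist_norm dist_triangle)
  finally have 1: "?d z \<le> norm (z - x) + ?d x" using p(2) by (simp add: dist_norm)
  have zx: "norm (z - x) = h" using 1 zge z(1) by (simp add: dist_norm norm_minus_commute)
  have "dist z p \<ge> norm (z - x) + norm (x - p)"
    using infdist_le[OF p(1), of z] zge zx p(2) by (simp add: dist_norm)
  then have "norm ((z - x) + (x - p)) = norm (z - x) + norm (x - p)"
    using norm_triangle_ineq[of "z - x" "x - p"] by (simp add: dist_norm)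
  then have "norm (z - x) *\<^sub>R (x - p) = norm (x - p) *\<^sub>R (z - x)" by (simp only: norm_triangle_eq)
  then have "h *\<^sub>R (x - p) = ?d x *\<^sub>R (z - x)" using zx p(2) by (simp add: dist_norm)
  then have "(inverse (?d x)) *\<^sub>R (h *\<^sub>R (x - p)) = (inverse (?d x)) *\<^sub>R (?d x *\<^sub>R (z - x))" by simp
  then have "z = x + h *\<^sub>R ((x - p) /\<^sub>R ?d x)" using pos by (simp add: algebra_simps)
  then show ?thesis using zge 1 zx by simp
qed

text \<open>Points of \<open>S\<close> near \<open>p\<close> have nearest points in
  \<open>A\<close>; by \<open>infdist_ray\<close> the ball of radius \<open>\<rho>\<close> touching
  \<open>A\<close> at such a nearest point, on the side of the given point, misses \<open>A\<close>.
  It is connected and meets \<open>S\<close> but not its frontier, so it lies in \<open>S\<close>. A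
  limit of the directions gives the ball at \<open>p\<close>. The set \<open>S\<close> will be
  \<Omega> or the complement of its closure.\<close>

lemma tangent_ball:
  fixes A :: "'a::euclidean_space set"
  assumes A: "closed A" and r: "\<And>y. y \<in> A \<Longrightarrow> ball y r \<subseteq> unique_nearest A" and \<rho>: "0 < \<rho>" "\<rho> < r"
    and S: "open S" "S \<inter> A = {}" "frontier S \<subseteq> A" and p: "p \<in> A" "p \<in> closure S"
  shows "\<exists>n. norm n = 1 \<and> ball (p + \<rho> *\<^sub>R n) \<rho> \<subseteq> S"
proof -
  let ?d = "\<lambda>y. infdist y A"
  have ne: "A \<noteq> {}" using p(1) by auto
  obtain x where x: "\<And>k. x k \<in> S" "x \<longlonglongrightarrow> p" using p(2) by (auto simp: closure_sequential)
  have dpos: "?d y > 0" if "y \<in> S" for y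
    using that S(2) in_closed_iff_infdist_zero[OF A ne] infdist_nonneg[of y A]
        by (metis IntI empty_iff order_le_less)
  have "\<forall>k. \<exists>q. q \<in> A \<and> dist (x k) q = ?d (x k)" using infdist_attains_inf[OF A ne] by metis
  then obtain q where q: "\<And>k. q k \<in> A" "\<And>k. dist (x k) (q k) = ?d (x k)" by metis
  define n where "n k = (x k - q k) /\<^sub>R ?d (x k)" for k
  have nn: "norm (n k) = 1" for k using q(2)[of k] dpos[OF x(1)[of k]] by (simp add: n_def dist_norm)
  have dl: "(\<lambda>k. ?d (x k)) \<longlonglongrightarrow> 0"
    using tendsto_infdist[OF x(2), of A] p(1) by simp
  have ql: "q \<longlonglongrightarrow> p"
  proof -
    have "(\<lambda>k. dist (q k) p) \<longlonglongrightarrow> 0"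
    proof (rule tendsto_sandwich[OF _ _ tendsto_const])
      show "(\<lambda>k. ?d (x k) + dist (x k) p) \<longlonglongrightarrow> 0"
        using tendsto_add[OF dl tendsto_dist[OF x(2) tendsto_const[of p]]] by simp
      show "\<forall>\<^sub>F k in sequentially. dist (q k) p \<le> ?d (x k) + dist (x k) p"
        using q(2) by (intro always_eventually allI) (metis dist_commute dist_triangle)
    qed simp
    then show ?thesis using tendsto_dist_iff by blast
  qed
  have balls: "ball (q k + \<rho> *\<^sub>R n k) \<rho> \<subseteq> S" if small: "?d (x k) < \<rho>" for k
  proof -
    let ?c = "q k + \<rho> *\<^sub>R n k"
    have c: "?c = x k + (\<rho> - ?d (x k)) *\<^sub>R ((x k - q k) /\<^sub>R ?d (x k))"
      using dpos[OF x(1)[of k]] by (simp add: n_def algebra_simps)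
    have "?d ?c = \<rho>"
      unfolding c using small \<rho> dpos[OF x(1)[of k]] by (subst infdist_ray[OF A r q]) auto
    then have disj: "ball ?c \<rho> \<inter> A = {}" by (auto dest: infdist_le[of _ A ?c])
    have "dist ?c (x k) = \<rho> - ?d (x k)"
      unfolding c n_def[symmetric] using small by (simp add: dist_norm nn)
    then have "x k \<in> ball ?c \<rho>" using dpos[OF x(1)[of k]] by simp
    then have "ball ?c \<rho> \<inter> S \<noteq> {}" using x(1) by blast
    moreover have "ball ?c \<rho> \<inter> frontier S = {}" using disj S(3) by blast
    ultimately have "ball ?c \<rho> - S = {}"
      using connected_Int_frontier[OF convex_connected[OF convex_ball]] by blast
    then show ?thesis by blast
  qed
  have "bounded (range n)" using nn by (auto simp: bounded_iff)
  then obtain l s where s: "strict_mono s" "(n \<circ> s) \<longlonglongrightarrow> l"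
    using bounded_imp_convergent_subsequence by blast
  have "norm l = 1" using tendsto_norm[OF s(2)] nn by (simp add: LIMSEQ_const_iff o_def)
  moreover have "ball (p + \<rho> *\<^sub>R l) \<rho> \<subseteq> S"
  proof
    fix y assume "y \<in> ball (p + \<rho> *\<^sub>R l) \<rho>"
    then have y: "dist (p + \<rho> *\<^sub>R l) y < \<rho>" by simp
    have "(\<lambda>k. dist ((q \<circ> s) k + \<rho> *\<^sub>R (n \<circ> s) k) y) \<longlonglongrightarrow> dist (p + \<rho> *\<^sub>R l) y"
      using LIMSEQ_subseq_LIMSEQ[OF ql s(1)] s(2) by (intro tendsto_intros)
    then have "\<forall>\<^sub>F k in sequentially. dist ((q \<circ> s) k + \<rho> *\<^sub>R (n \<circ> s) k) y < \<rho>"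
      using y by (rule order_tendstoD)
    moreover have "\<forall>\<^sub>F k in sequentially. ?d ((x \<circ> s) k) < \<rho>"
      using LIMSEQ_subseq_LIMSEQ[OF dl s(1)] \<rho>(1) by (intro order_tendstoD[of _ 0]) (auto simp: o_def)
    ultimately have "\<forall>\<^sub>F k in sequentially. y \<in> S"
      by eventually_elim (use balls in force)
    then show "y \<in> S" by simp
  qed
  ultimately show ?thesis by blast
qed

section \<open>The outward normal\<close>

lemma ball_touching:
  fixes u n :: "'a::euclidean_space"
  assumes "norm n = 1" "\<rho> > 0" "u \<bullet> n > 0"
  shows "\<exists>s0>0. \<forall>s. 0 < s \<and> s < s0 \<longrightarrow> p + s *\<^sub>R u \<in> ball (p + \<rho> *\<^sub>R n) \<rho>"
proof (intro exI conjI allI impI)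
  have u0: "norm u > 0" using assms by auto
  \<comment> \<open>The parameter at which the ray meets the sphere for the second time.\<close>
  show "2 * \<rho> * (u \<bullet> n) / (norm u)\<^sup>2 > 0" using assms u0 by simp
  fix s assume s: "0 < s \<and> s < 2 * \<rho> * (u \<bullet> n) / (norm u)\<^sup>2"
  then have "s * (norm u)\<^sup>2 < 2 * \<rho> * (u \<bullet> n)" using u0 by (simp add: field_simps)
  then have "s * (s * (norm u)\<^sup>2) < s * (2 * \<rho> * (u \<bullet> n))" using s by (intro mult_strict_left_mono) auto
  moreover have "(norm (s *\<^sub>R u - \<rho> *\<^sub>R n))\<^sup>2 = s * (s * (norm u)\<^sup>2) - s * (2 * \<rho> * (u \<bullet> n)) + \<rho>\<^sup>2"
    using assms(1) unfolding power2_norm_eq_inner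
    by (simp add: inner_diff_left inner_diff_right inner_commute power2_eq_square norm_eq_1)
  ultimately have "(norm (s *\<^sub>R u - \<rho> *\<^sub>R n))\<^sup>2 < \<rho>\<^sup>2" by simp
  then have "norm (s *\<^sub>R u - \<rho> *\<^sub>R n) < \<rho>" using assms(2) by (simp add: power2_less_imp_less)
  then show "p + s *\<^sub>R u \<in> ball (p + \<rho> *\<^sub>R n) \<rho>"
      by (simp add: dist_norm norm_minus_commute algebra_simps)
qed

text \<open>Tested on \<open>w + \<epsilon> *\<^sub>R n\<close>, where \<open>w\<close> is the part
  of \<open>g\<close> orthogonal to \<open>n\<close>: letting \<open>\<epsilon>\<close> tend to 0
  forces \<open>w = 0\<close>, and testing on \<open>n\<close> gives the sign.\<close>

lemma normal_unique:
  fixes g n :: "'a::euclidean_space"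
  assumes n: "norm n = 1" and *: "\<And>u. u \<bullet> n > 0 \<Longrightarrow> u \<bullet> g \<le> 0"
  shows "g = - (norm g *\<^sub>R n)"
proof -
  define \<alpha> where "\<alpha> = g \<bullet> n"
  define w where "w = g - \<alpha> *\<^sub>R n"
  have nn: "n \<bullet> n = 1" using n by (simp add: norm_eq_1)
  have wn: "w \<bullet> n = 0" using nn by (simp add: w_def inner_diff_left \<alpha>_def)
  have wg: "w \<bullet> g = w \<bullet> w" using wn by (simp add: w_def inner_diff_right inner_diff_left inner_commute)
  have a: "\<alpha> \<le> 0" using *[of n] nn by (simp add: \<alpha>_def inner_commute)
  have "w \<bullet> w + \<epsilon> * \<alpha> \<le> 0" if "\<epsilon> > 0" for \<epsilon>
  proof -
    have "(w + \<epsilon> *\<^sub>R n) \<bullet> n = \<epsilon>" using wn nn by (simp add: inner_add_left)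
    moreover have "(w + \<epsilon> *\<^sub>R n) \<bullet> g = w \<bullet> w + \<epsilon> * \<alpha>"
      unfolding \<alpha>_def using wg by (simp add: inner_add_left inner_commute[of n g])
    ultimately show ?thesis using *[of "w + \<epsilon> *\<^sub>R n"] that by simp
  qed
  then have "w \<bullet> w \<le> 0"
  proof -
    assume H: "\<And>\<epsilon>. \<epsilon> > 0 \<Longrightarrow> w \<bullet> w + \<epsilon> * \<alpha> \<le> 0"
    show ?thesis
    proof (rule field_le_epsilon)
      fix e :: real assume e: "e > 0"
      have "e / (1 - \<alpha>) * (- \<alpha>) \<le> e" using a e by (simp add: field_simps)
      then show "w \<bullet> w \<le> 0 + e" using H[of "e / (1 - \<alpha>)"] a e by simp
    qed
  qed
  then have "w = 0" by (metis inner_eq_zero_iff inner_ge_zero order_antisym)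
  then have g: "g = \<alpha> *\<^sub>R n" by (simp add: w_def)
  then have "norm g = - \<alpha>" using n a by simp
  then show ?thesis using g by simp
qed

lemma defining_function_1:
  assumes "defining_function m \<Omega> U r" "m \<ge> 1"
  shows "defining_function 1 \<Omega> U r"
  using assms Ck_on_mono[of m U r 1] by (auto simp: defining_function_def)

text \<open>This connects \<open>outward_normal\<close>, given by a definite description, with the
  tangent balls. Any local defining function is negative on the inner ball, so its gradient has
  nonpositive inner product with all directions entering that ball, and \<open>normal_unique\<close>
  determines its direction; hence the description is unambiguous. Along the gradient the defining
  function becomes positive, so \<open>p\<close> is also a limit of exterior points and an outer
  ball exists; being disjoint from the inner one, it must be its reflection.\<close>

lemma tangent_balls:
  fixes \<Omega> :: "(real^'n) set"
  assumes \<Omega>: "open \<Omega>" and bd: "Ck_boundary m \<Omega>" "m \<ge> 1"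
    and r: "\<And>y. y \<in> frontier \<Omega> \<Longrightarrow> ball y r \<subseteq> unique_nearest (frontier \<Omega>)" and \<rho>: "0 < \<rho>" "\<rho> < r"
    and p: "p \<in> frontier \<Omega>"
  shows "norm (outward_normal \<Omega> p) = 1 \<and> ball (p - \<rho> *\<^sub>R outward_normal \<Omega> p) \<rho> \<subseteq> \<Omega> \<and>
     ball (p + \<rho> *\<^sub>R outward_normal \<Omega> p) \<rho> \<inter> \<Omega> = {}"
proof -
  let ?A = "frontier \<Omega>"
  have A: "closed ?A" by simp
  have pc: "p \<in> closure \<Omega>" using p by (simp add: frontier_def)
  have d0: "\<Omega> \<inter> ?A = {}" using \<Omega> by (simp add: frontier_disjoint_eq[symmetric] Int_commute)
  obtain n1 where n1: "norm n1 = 1" "ball (p + \<rho> *\<^sub>R n1) \<rho> \<subseteq> \<Omega>"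
    using tangent_ball[OF A r \<rho> \<Omega> d0 order_refl p pc] by metis
  obtain U0 r0 where r0: "open U0" "p \<in> U0" "defining_function 1 \<Omega> U0 r0"
    using bd p defining_function_1 by (metis Ck_boundary_def)
  have deriv: "((\<lambda>s. f (p + s *\<^sub>R u)) has_real_derivative (u \<bullet> grad f p)) (at 0)"
    if "defining_function 1 \<Omega> U f" "p \<in> U" for U f u
    using has_vector_derivative_ray[of f p 0 u UNIV] that by (simp add: defining_function_def)
  have ray: "\<exists>e>0. \<forall>s. \<bar>s\<bar> < e \<longrightarrow> p + s *\<^sub>R u \<in> U" if "open U" "p \<in> U" for U u
  proof -
    have "((\<lambda>s. p + s *\<^sub>R u) \<longlongrightarrow> p + 0 *\<^sub>R u) (nhds 0)" by (intro tendsto_intros filterlim_ident)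
    then have "eventually (\<lambda>s. p + s *\<^sub>R u \<in> U) (nhds 0)" using that by (intro topological_tendstoD) auto
    then show ?thesis by (auto simp: eventually_nhds_metric)
  qed
  have g1: "grad f p /\<^sub>R norm (grad f p) = - n1" if f: "defining_function 1 \<Omega> U f" "open U" "p \<in> U"
      for U f
  proof -
    have "u \<bullet> grad f p \<le> 0" if u: "u \<bullet> n1 > 0" for u
    proof (rule ccontr)
      assume "\<not> ?thesis"
      then obtain d where d: "d > 0" "\<And>h. 0 < h \<Longrightarrow> h < d \<Longrightarrow> f (p + 0 *\<^sub>R u) < f (p + (0 + h) *\<^sub>R u)"
        using DERIV_pos_inc_right[OF deriv[OF f(1,3), of u]] by auto
      obtain s0 where s0: "s0 > 0" "\<And>s. 0 < s \<Longrightarrow> s < s0 \<Longrightarrow> p + s *\<^sub>R u \<in> ball (p + \<rho> *\<^sub>R n1) \<rho>"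
        using ball_touching[OF n1(1) \<rho>(1) u] by metis
      obtain e where e: "e > 0" "\<And>s. \<bar>s\<bar> < e \<Longrightarrow> p + s *\<^sub>R u \<in> U" using ray[OF f(2,3)] by metis
      define s where "s = min d (min s0 e) / 2"
      have s: "0 < s" "s < d" "s < s0" "s < e" using d s0 e by (auto simp: s_def)
      have "p + s *\<^sub>R u \<in> \<Omega> \<inter> U" using s s0 e n1 by auto
      then have "f (p + s *\<^sub>R u) < 0" using f(1) by (auto simp: defining_function_def)
      moreover have "f p = 0" using f p by (auto simp: defining_function_def)
      ultimately show False using d(2)[OF s(1,2)] by simp
    qed
    from normal_unique[OF n1(1) this] have "grad f p = - (norm (grad f p) *\<^sub>R n1)" .
    moreover have "grad f p \<noteq> 0" using f p by (auto simp: defining_function_def)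
    ultimately show ?thesis by (metis (no_types, lifting) divideR_right norm_eq_zero scaleR_minus_right
        scaleR_one right_inverse scaleR_scaleR)
  qed
  have on: "outward_normal \<Omega> p = - n1"
    unfolding outward_normal_def
  proof (rule the_equality)
    show "\<exists>U r. open U \<and> p \<in> U \<and> defining_function 1 \<Omega> U r \<and> - n1 = grad r p /\<^sub>R norm (grad r p)"
      using r0 g1 by metis
  qed (use g1 in metis)
  let ?E = "- closure \<Omega>"
  \<comment> \<open>Along its gradient the defining function increases from 0 at \<open>p\<close>,
    so points of this ray close to \<open>p\<close> are neither in \<Omega> nor on its
    frontier.\<close>
  have "p \<in> closure ?E"
  proof -
    let ?u = "grad r0 p"
    have "?u \<noteq> 0" using r0 p by (auto simp: defining_function_def)
    then have "?u \<bullet> ?u > 0" by simp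
    then obtain d where d: "d > 0" "\<And>h. 0 < h \<Longrightarrow> h < d \<Longrightarrow> r0 (p + 0 *\<^sub>R ?u) < r0 (p + (0 + h) *\<^sub>R ?u)"
      using DERIV_pos_inc_right[OF deriv[OF r0(3,2), of ?u]] by auto
    obtain e where e: "e > 0" "\<And>s. \<bar>s\<bar> < e \<Longrightarrow> p + s *\<^sub>R ?u \<in> U0" using ray[OF r0(1,2)] by metis
    have r0p: "r0 p = 0" using r0 p by (auto simp: defining_function_def)
    have in_E: "p + s *\<^sub>R ?u \<in> ?E" if s: "0 < s" "s < d" "s < e" for s
    proof -
      have "r0 (p + s *\<^sub>R ?u) > 0" using d(2)[OF s(1,2)] r0p by simp
      moreover have "p + s *\<^sub>R ?u \<in> U0" using e s by simp
      moreover have "\<Omega> \<inter> U0 = {x\<in>U0. r0 x < 0}" "?A \<inter> U0 = {x\<in>U0. r0 x = 0}"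
        using r0(3) unfolding defining_function_def by blast+
      ultimately have "p + s *\<^sub>R ?u \<notin> \<Omega>" "p + s *\<^sub>R ?u \<notin> ?A" by force+
      then show ?thesis using \<Omega> by (simp add: frontier_def interior_open)
    qed
    define s where "s k = min d e / 2 * inverse (real (Suc k))" for k :: nat
    have "s k > 0 \<and> s k < d \<and> s k < e" for k
    proof -
      have "s k \<le> min d e / 2 * 1"
        unfolding s_def using d e by (intro mult_left_mono) (auto simp: field_simps)
      moreover have "s k > 0" using d e by (simp add: s_def)
      ultimately show ?thesis using d e by auto
    qed
    then have "\<forall>k. p + s k *\<^sub>R ?u \<in> ?E" using in_E by blast
    moreover have "(\<lambda>k. p + s k *\<^sub>R ?u) \<longlonglongrightarrow> p + 0 *\<^sub>R ?u"
    proof -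
      have "s \<longlonglongrightarrow> min d e / 2 * 0" unfolding s_def
          by (intro tendsto_mult tendsto_const LIMSEQ_inverse_real_of_nat)
      then show ?thesis by (intro tendsto_intros) simp
    qed
    ultimately show ?thesis by (auto simp: closure_sequential intro!: exI[of _ "\<lambda>k. p + s k *\<^sub>R ?u"])
  qed
  moreover have "frontier ?E \<subseteq> ?A" 
    using interior_mono[OF closure_subset, of \<Omega>] unfolding frontier_complement
        by (auto simp: frontier_def)
  moreover have "?E \<inter> ?A = {}" by (auto simp: frontier_def)
  ultimately obtain n2 where n2: "norm n2 = 1" "ball (p + \<rho> *\<^sub>R n2) \<rho> \<subseteq> ?E"
    using tangent_ball[OF A r \<rho> open_Compl[OF closed_closure] _ _ p] by metis
  have "n2 = - n1"
  proof -
    have "u \<bullet> n2 \<le> 0" if u: "u \<bullet> n1 > 0" for u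
    proof (rule ccontr)
      assume "\<not> ?thesis"
      then have "u \<bullet> n2 > 0" by simp
      from ball_touching[OF n2(1) \<rho>(1) this, of p] ball_touching[OF n1(1) \<rho>(1) u, of p]
      obtain s1 s2 where "s1 > 0" "\<And>s. 0 < s \<Longrightarrow> s < s1 \<Longrightarrow> p + s *\<^sub>R u \<in> ball (p + \<rho> *\<^sub>R n2) \<rho>"
        "s2 > 0" "\<And>s. 0 < s \<Longrightarrow> s < s2 \<Longrightarrow> p + s *\<^sub>R u \<in> ball (p + \<rho> *\<^sub>R n1) \<rho>" by metis
      moreover from this have "0 < min s1 s2 / 2" "min s1 s2 / 2 < s1" "min s1 s2 / 2 < s2" by linarith+
      ultimately have "p + (min s1 s2 / 2) *\<^sub>R u \<in> ball (p + \<rho> *\<^sub>R n2) \<rho> \<inter> ball (p + \<rho> *\<^sub>R n1) \<rho>"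
          by blast
      then have "p + (min s1 s2 / 2) *\<^sub>R u \<in> ?E \<inter> \<Omega>" using n1 n2 by blast
      then show False using closure_subset by blast
    qed
    from normal_unique[OF n1(1) this] show ?thesis using n2(1) by simp
  qed
  then show ?thesis using on n1 n2 closure_subset[of \<Omega>] by auto
qed

text \<open>The inner ball at either point is disjoint from the outer ball at the other, so in both
  cases the centres are at least \<open>2 * \<rho>\<close> apart. In the sum of the two squared
  inequalities the mixed terms cancel, and |a + b|^2 = 4 - |a - b|^2 leaves the claim.\<close>

lemma normal_Lipschitz:
  fixes a b :: "'a::euclidean_space"
  assumes \<rho>: "\<rho> > 0" and n: "norm a = 1" "norm b = 1"
    and 1: "ball (p - \<rho> *\<^sub>R a) \<rho> \<inter> ball (q + \<rho> *\<^sub>R b) \<rho> = {}"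
    and 2: "ball (q - \<rho> *\<^sub>R b) \<rho> \<inter> ball (p + \<rho> *\<^sub>R a) \<rho> = {}"
  shows "\<rho> * norm (a - b) \<le> norm (p - q)"
proof -
  have far: "2 * \<rho> \<le> norm (x - y)" if "ball x \<rho> \<inter> ball y \<rho> = {}" for x y :: 'a
  proof (rule ccontr)
    assume "\<not> ?thesis"
    then have "midpoint x y \<in> ball x \<rho> \<inter> ball y \<rho>"
      by (simp add: dist_midpoint) (simp add: dist_norm)
    then show False using that by blast
  qed
  have nn: "a \<bullet> a = 1" "b \<bullet> b = 1" using n by (simp_all add: norm_eq_1)
  have e1: "(2 * \<rho>)\<^sup>2 \<le> (norm ((p - q) - \<rho> *\<^sub>R (a + b)))\<^sup>2"
    using far[OF 1] \<rho> by (intro power_mono) (auto simp: algebra_simps)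
  have e2: "(2 * \<rho>)\<^sup>2 \<le> (norm ((p - q) + \<rho> *\<^sub>R (a + b)))\<^sup>2"
    using far[OF 2] \<rho> by (intro power_mono) (auto simp: algebra_simps norm_minus_commute)
  have "2 * (norm (p - q))\<^sup>2 + 2 * \<rho>\<^sup>2 * (norm (a + b))\<^sup>2
      = (norm ((p - q) - \<rho> *\<^sub>R (a + b)))\<^sup>2 + (norm ((p - q) + \<rho> *\<^sub>R (a + b)))\<^sup>2"
    unfolding power2_norm_eq_inner
    by (simp add: inner_diff_left inner_diff_right inner_add_left inner_add_right inner_commute
        power2_eq_square algebra_simps)
  moreover have ab: "(norm (a + b))\<^sup>2 = 4 - (norm (a - b))\<^sup>2"
    unfolding power2_norm_eq_inner using nn by
        (simp add: inner_diff_left inner_diff_right inner_add_left inner_add_right inner_commute)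
  moreover have "(\<rho> * norm (a - b))\<^sup>2 = 4 * \<rho>\<^sup>2 - \<rho>\<^sup>2 * (norm (a + b))\<^sup>2"
    unfolding ab by (simp add: power_mult_distrib algebra_simps)
  moreover have "(2 * \<rho>)\<^sup>2 = 4 * \<rho>\<^sup>2" by simp
  ultimately have "(\<rho> * norm (a - b))\<^sup>2 \<le> (norm (p - q))\<^sup>2"
    using e1 e2 by linarith
  then show ?thesis by (rule power2_le_imp_le) simp
qed

text \<open>A tangent ball outside \<open>\<Omega>\<close> at the first exit point of the segment rules out an exit.\<close>

lemma uniform_cone:
  fixes \<Omega> :: "(real^'n) set"
  assumes \<Omega>: "open \<Omega>" and \<rho>: "\<rho> > 0" and nu: "\<And>p. p \<in> frontier \<Omega> \<Longrightarrow>
      norm (\<nu> p) = 1 \<and> ball (p - \<rho> *\<^sub>R \<nu> p) \<rho> \<subseteq> \<Omega> \<and>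
     ball (p + \<rho> *\<^sub>R \<nu> p) \<rho> \<inter> \<Omega> = {}"
    and \<kappa>: "\<kappa> > 0" and p: "p \<in> frontier \<Omega>" and x: "x \<in> \<Omega>" "norm (x - p) < \<kappa> * \<rho> / 4"
    and v: "norm v < \<kappa> * \<rho> / 4" "v \<bullet> \<nu> p \<le> - \<kappa> * norm v"
  shows "x + v \<in> \<Omega>"
proof (rule ccontr)
  assume "x + v \<notin> \<Omega>"
  then have v0: "v \<noteq> 0" using x by auto
  define T where "T = {t\<in>{0..1::real}. x + t *\<^sub>R v \<in> - \<Omega>}"
  have "closed T"
  proof -
    have "closed ((\<lambda>t. x + t *\<^sub>R v) -` (- \<Omega>))"
      using \<Omega> by (intro continuous_closed_vimage) (auto simp: closed_Compl intro!: continuous_intros)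
    moreover have "T = {0..1} \<inter> (\<lambda>t. x + t *\<^sub>R v) -` (- \<Omega>)" by (auto simp: T_def)
    ultimately show ?thesis by auto
  qed
  moreover have "1 \<in> T" using \<open>x + v \<notin> \<Omega>\<close> by (simp add: T_def)
  moreover have bdd: "bdd_below T" by (rule bdd_belowI[of _ 0]) (auto simp: T_def)
  ultimately have inT: "Inf T \<in> T" using closed_contains_Inf[of T] by blast
  define t where "t = Inf T"
  have t: "0 \<le> t" "t \<le> 1" "x + t *\<^sub>R v \<notin> \<Omega>" using inT by (auto simp: T_def t_def)
  have "t \<noteq> 0" using t x by auto
  then have "t > 0" using t by simp
  have before: "x + s *\<^sub>R v \<in> \<Omega>" if "0 \<le> s" "s < t" for s
  proof (rule ccontr)
    assume "x + s *\<^sub>R v \<notin> \<Omega>"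
    then have "s \<in> T" using that t by (simp add: T_def)
    then show False using cInf_lower[OF _ bdd, of s] that by (simp add: t_def)
  qed
  define q where "q = x + t *\<^sub>R v"
  have "q \<in> closure \<Omega>"
  proof -
    define s where "s k = t - t * inverse (real (Suc k))" for k :: nat
    have "0 \<le> s k \<and> s k < t" for k using \<open>t > 0\<close> by (auto simp: s_def field_simps)
    then have "\<forall>k. x + s k *\<^sub>R v \<in> \<Omega>" using before by blast
    moreover have "s \<longlonglongrightarrow> t - t * 0" unfolding s_def by (intro tendsto_intros LIMSEQ_inverse_real_of_nat)
    then have "s \<longlonglongrightarrow> t" by simp
    then have "(\<lambda>k. x + s k *\<^sub>R v) \<longlonglongrightarrow> q" unfolding q_def by (intro tendsto_intros)
    ultimately show ?thesis by (auto simp: closure_sequential intro!: exI[of _ "\<lambda>k. x + s k *\<^sub>R v"])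
  qed
  then have qf: "q \<in> frontier \<Omega>" using t \<Omega> by (simp add: frontier_def interior_open q_def)
  have "norm (p - q) \<le> norm (x - p) + norm (t *\<^sub>R v)"
    using norm_triangle_ineq[of "x - p" "t *\<^sub>R v"] by (simp add: q_def norm_minus_commute algebra_simps)
  also have "norm (t *\<^sub>R v) \<le> norm v" using t by (simp add: mult_left_le_one_le)
  \<comment> \<open>The two quarter bounds keep the exit point within
    \<open>\<kappa> * \<rho> / 2\<close> of \<open>p\<close>, so the normal turns by less than
    \<open>\<kappa> / 2\<close> and \<open>v\<close> still points inward at
    \<open>q\<close>.\<close>
  finally have pq: "norm (p - q) < \<kappa> * \<rho> / 2" using x v by simp
  have "\<rho> * norm (\<nu> p - \<nu> q) \<le> norm (p - q)"
    using nu[OF p] nu[OF qf] by (intro normal_Lipschitz[OF \<rho>]) auto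
  moreover have "\<rho> * (\<kappa> / 2) = \<kappa> * \<rho> / 2" by simp
  ultimately have "\<rho> * norm (\<nu> p - \<nu> q) < \<rho> * (\<kappa> / 2)" using pq by linarith
  then have nd: "norm (\<nu> p - \<nu> q) < \<kappa> / 2" using \<rho> by simp
  have "v \<bullet> \<nu> q = v \<bullet> \<nu> p - v \<bullet> (\<nu> p - \<nu> q)" by (simp add: inner_diff_right)
  also have "\<dots> \<le> - \<kappa> * norm v + norm v * norm (\<nu> p - \<nu> q)"
    using v(2) Cauchy_Schwarz_ineq2[of v "\<nu> p - \<nu> q"] by linarith
  also have "\<dots> < - \<kappa> * norm v + norm v * (\<kappa> / 2)"
    using v0 nd by (intro add_strict_left_mono mult_strict_left_mono) auto
  also have "\<dots> \<le> 0" using \<kappa> by simp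
  finally have "(- v) \<bullet> \<nu> q > 0" by simp
  then obtain s0 where s0: "s0 > 0" "\<And>s. 0 < s \<Longrightarrow> s < s0 \<Longrightarrow> q + s *\<^sub>R (- v) \<in> ball (q + \<rho> *\<^sub>R \<nu> q) \<rho>"
    using ball_touching[of "\<nu> q" \<rho> "- v" q] nu[OF qf] \<rho> by metis
  define s where "s = min s0 t / 2"
  have s: "0 < s" "s < s0" "s < t" using s0 \<open>t > 0\<close> by (auto simp: s_def)
  have "q + s *\<^sub>R (- v) = x + (t - s) *\<^sub>R v" by (simp add: q_def algebra_simps)
  then have "q + s *\<^sub>R (- v) \<in> \<Omega>" using before[of "t - s"] s by simp
  then show False using s0(2)[OF s(1,2)] nu[OF qf] by blast
qed

section \<open>The weight\<close>

lemma nabla_norm_2: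
  "nabla_norm 2 f x = sqrt (\<Sum>i\<in>UNIV. \<Sum>j\<in>UNIV. (partial j (partial i f) x)\<^sup>2)"
proof -
  have "(\<Sum>js | length js = 2. (foldr partial js f x)\<^sup>2) =
      (\<Sum>p\<in>UNIV \<times> UNIV. (foldr partial [snd p, fst p] f x)\<^sup>2)"
  proof (rule sum.reindex_bij_betw[symmetric])
    show "bij_betw (\<lambda>p. [snd p, fst p]) (UNIV \<times> UNIV) {js::'a list. length js = 2}"
      by (rule bij_betwI[where g="\<lambda>js. (js ! 1, js ! 0)"])
        (auto simp: numeral_2_eq_2 length_Suc_conv)
  qed
  then show ?thesis by (simp add: nabla_norm_def sum.cartesian_product split_def)
qed

text \<open>What the analysis takes from an admissible pair: \<open>\<Phi>\<close> is the extended
  weight function and \<open>\<nu>\<close> a field of normals with two-sided tangent balls of radius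
  \<open>\<rho>\<close>. All conditions are invariant under a change of sign of
  \<open>\<Phi>\<close>, so the locale can be interpreted a second time with
  \<open>- \<Phi>\<close>.\<close>

locale weighted_domain =
  fixes \<Omega> :: "(real^'n) set" and \<Phi> :: "real^'n \<Rightarrow> real" and \<nu> :: "real^'n \<Rightarrow> real^'n" and \<rho> H R c :: real
  assumes open_dom: "open \<Omega>" and smooth: "smooth_on UNIV \<Phi>"
    and hess: "H > 0" "\<And>x. nabla_norm 2 \<Phi> x \<le> H * (1 + norm (grad \<Phi> x))"
    and growth: "filterlim (\<lambda>x. norm (grad \<Phi> x)) at_top at_infinity"
    and rho: "\<rho> > 0"
    and nu: "\<And>p. p \<in> frontier \<Omega> \<Longrightarrow> norm (\<nu> p) = 1 \<and> ball (p - \<rho> *\<^sub>R \<nu> p) \<rho> \<subseteq> \<Omega> \<and>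
       ball (p + \<rho> *\<^sub>R \<nu> p) \<rho> \<inter> \<Omega> = {}"
    and c: "0 \<le> c" "c < 1"
    and normal: "\<And>p. p \<in> frontier \<Omega> \<Longrightarrow> norm p > R \<Longrightarrow> \<bar>grad \<Phi> p \<bullet> \<nu> p\<bar> \<le> c * norm (grad \<Phi> p)"
begin

lemma diff_Phi: "\<Phi> differentiable at x" "partial i \<Phi> differentiable at x"
  using smooth smooth_on_differentiable smooth_on_partial by blast+

lemma cont_Phi: "continuous_on S \<Phi>"
  using smooth_on_continuous_on[OF smooth] continuous_on_subset by blast

lemma cont_grad: "continuous_on S (grad \<Phi>)"
  unfolding grad_def[abs_def]
  by (intro continuous_on_vec_lambda continuous_on_subset[OF
      smooth_on_continuous_on[OF smooth_on_partial[OF smooth]]]) simp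

lemma borel_Phi [measurable]: "\<Phi> \<in> borel_measurable borel"
  by (rule borel_measurable_continuous_onI[OF cont_Phi])

lemma borel_grad [measurable]: "grad \<Phi> \<in> borel_measurable borel"
  by (rule borel_measurable_continuous_onI[OF cont_grad])

lemma hess_inner: "\<bar>\<Sum>i\<in>UNIV. w $ i * (v \<bullet> grad (partial i \<Phi>) y)\<bar> \<le> norm w * norm v * nabla_norm 2 \<Phi> y"
proof -
  have "\<bar>\<Sum>i\<in>UNIV. w $ i * (v \<bullet> grad (partial i \<Phi>) y)\<bar> \<le>
      (\<Sum>i\<in>UNIV. \<bar>w $ i\<bar> * (norm v * norm (grad (partial i \<Phi>) y)))"
    by (intro order_trans[OF sum_abs] sum_mono)
        (auto simp: abs_mult intro!: mult_left_mono Cauchy_Schwarz_ineq2)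
  also have "\<dots> = norm v * (\<Sum>i\<in>UNIV. \<bar>w $ i\<bar> * norm (grad (partial i \<Phi>) y))"
    by (simp add: sum_distrib_left mult_ac)
  also have "\<dots> \<le> norm v * sqrt ((\<Sum>i\<in>UNIV. \<bar>w $ i\<bar>\<^sup>2) * (\<Sum>i\<in>UNIV. (norm (grad (partial i \<Phi>) y))\<^sup>2))"
    by (intro mult_left_mono real_le_rsqrt Cauchy_Schwarz_ineq_sum) auto
  also have "(\<Sum>i\<in>UNIV. (norm (grad (partial i \<Phi>) y))\<^sup>2) =
      (\<Sum>i\<in>UNIV. \<Sum>j\<in>UNIV. (partial j (partial i \<Phi>) y)\<^sup>2)"
    by (intro sum.cong refl) (simp add: norm_vec_def L2_set_def grad_def sum_nonneg)
  also have "norm v * sqrt ((\<Sum>i\<in>UNIV. \<bar>w $ i\<bar>\<^sup>2) * (\<Sum>i\<in>UNIV. \<Sum>j\<in>UNIV. (partial j (partial i \<Phi>) y)\<^sup>2)) =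
      norm w * norm v * nabla_norm 2 \<Phi> y"
    by (simp add: nabla_norm_2 real_sqrt_mult norm_vec_def L2_set_def)
  finally show ?thesis .
qed

text \<open>A Gronwall estimate without differential inequalities: the Hessian along the segment is
  controlled by the largest gradient on it, attained at \<open>z\<close>, and the restriction on the
  length makes the increment up to \<open>z\<close> at most half of
  \<open>1 + norm (grad \<Phi> z)\<close>, which can be absorbed.\<close>

lemma grad_close:
  assumes xy: "norm (y - x) \<le> 1 / (2 * H)"
  shows "norm (grad \<Phi> y - grad \<Phi> x) \<le> 2 * H * norm (y - x) * (1 + norm (grad \<Phi> x))"
proof -
  obtain z where z: "z \<in> closed_segment x y" "\<And>u. u \<in> closed_segment x y \<Longrightarrow>
      norm (grad \<Phi> u) \<le> norm (grad \<Phi> z)"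
    using continuous_attains_sup[of "closed_segment x y" "\<lambda>u. norm (grad \<Phi> u)"] cont_grad
    by (auto intro: continuous_on_norm)
  let ?S = "1 + norm (grad \<Phi> z)"
  have *: "norm (grad \<Phi> u - grad \<Phi> x) \<le> H * ?S * norm (u - x)" if u: "u \<in> closed_segment x y" for u
  proof -
    define w where "w = grad \<Phi> u - grad \<Phi> x"
    define v where "v = u - x"
    \<comment> \<open>The mean value theorem is applied to the component along the increment
      \<open>w\<close> itself, so that the total change is the square of its norm.\<close>
    let ?F = "\<lambda>t. \<Sum>i\<in>UNIV. w $ i * partial i \<Phi> (x + t *\<^sub>R v)"
    have "\<exists>t. 0 < t \<and> t < 1 \<and> ?F 1 - ?F 0 = (1 - 0)
        * (\<Sum>i\<in>UNIV. w $ i * (v \<bullet> grad (partial i \<Phi>) (x + t *\<^sub>R v)))"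
      by (rule MVT2) (auto intro!: DERIV_sum DERIV_cmult has_vector_derivative_ray diff_Phi)
    then obtain t where t: "0 < t" "t < 1" "?F 1 - ?F 0 =
        (\<Sum>i\<in>UNIV. w $ i * (v \<bullet> grad (partial i \<Phi>) (x + t *\<^sub>R v)))" by auto
    have "?F 1 - ?F 0 = w \<bullet> w"
      by (simp add: w_def v_def inner_vec_def grad_def algebra_simps sum_subtractf[symmetric])
    then have "(norm w)\<^sup>2 \<le> norm w * norm v * nabla_norm 2 \<Phi> (x + t *\<^sub>R v)"
      using hess_inner[of w v "x + t *\<^sub>R v"] t(3) by (simp add: power2_norm_eq_inner)
    also have "\<dots> \<le> norm w * norm v * (H * ?S)"
    proof (intro mult_left_mono)
      have "x + t *\<^sub>R v \<in> closed_segment x u" using t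
          by (auto simp: closed_segment_def v_def algebra_simps intro!: exI[of _ t])
      then have "x + t *\<^sub>R v \<in> closed_segment x y" using u
          by (meson ends_in_segment(1) subset_closed_segment subsetD)
      then have "norm (grad \<Phi> (x + t *\<^sub>R v)) \<le> norm (grad \<Phi> z)" by (rule z)
      then show "nabla_norm 2 \<Phi> (x + t *\<^sub>R v) \<le> H * ?S"
        using hess(1) by (intro order_trans[OF hess(2)] mult_left_mono) auto
    qed auto
    finally have "norm w * norm w \<le> norm w * (H * ?S * norm v)" by (simp add: power2_eq_square mult_ac)
    then show ?thesis using hess(1) by (cases "norm w =
        0") (auto simp: w_def[symmetric] v_def[symmetric])
  qed
  have "norm (z - x) \<le> norm (y - x)" using z(1) segment_bound1 by blast
  then have "H * ?S * norm (z - x) \<le> H * ?S * (1 / (2 * H))" using xy hess(1)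
      by (intro mult_left_mono) (auto simp: add_nonneg_nonneg)
  also have "\<dots> = ?S / 2" using hess(1) by simp
  finally have "norm (grad \<Phi> z - grad \<Phi> x) \<le> ?S / 2" using *[OF z(1)] by linarith
  then have "norm (grad \<Phi> z) \<le> norm (grad \<Phi> x) + ?S / 2"
      using norm_triangle_sub[of "grad \<Phi> z" "grad \<Phi> x"] by linarith
  then have S: "?S \<le> 2 * (1 + norm (grad \<Phi> x))"
  proof -
    have "1 + p \<le> 2 * (1 + q)" if "p \<le> q + (1 + p) / 2" for p q :: real using that
        by (simp add: field_simps)
    then show ?thesis using \<open>norm (grad \<Phi> z) \<le> norm (grad \<Phi> x) + ?S / 2\<close> by blast
  qed
  have "norm (grad \<Phi> y - grad \<Phi> x) \<le> H * norm (y - x) * ?S" using *[of y] by (simp add: mult_ac)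
  also have "\<dots> \<le> H * norm (y - x) * (2 * (1 + norm (grad \<Phi> x)))" using S hess(1)
      by (intro mult_left_mono) auto
  also have "\<dots> = 2 * H * norm (y - x) * (1 + norm (grad \<Phi> x))" by (simp only: mult_ac)
  finally show ?thesis .
qed

text \<open>Away from the boundary the direction of the gradient will do, since
  \<open>ball x0 (2 * l)\<close> lies in \<Omega> as soon as it meets it. Near a boundary point
  \<open>p\<close> the unit normal is added to the direction of the gradient at \<open>p\<close>,
  which makes the inner product with each of the two unit vectors at least 1 - c. Half of this is
  given away to the variation of the gradient over the ball.\<close>

lemma local_direction:
  obtains l A where "l > 0" "A \<ge> 1" "4 * l * (2 * H) \<le> 1"
    "\<And>x0. norm (grad \<Phi> x0) \<ge> A \<Longrightarrow> \<exists>t. norm t \<le> 2 \<and>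
       (\<forall>x\<in>ball x0 (2 * l). t \<bullet> grad \<Phi> x \<ge> (1 - c) / 2 * norm (grad \<Phi> x0)) \<and>
       (\<forall>x\<in>\<Omega> \<inter> ball x0 l. \<forall>r. 0 \<le> r \<longrightarrow> 2 * r \<le> l \<longrightarrow> x - r *\<^sub>R t \<in> \<Omega>)"
proof -
  define b where "b = 1 - c"
  have b: "0 < b" "b \<le> 1" using c by (auto simp: b_def)
  \<comment> \<open>Half of the lower bound for \<open>t \<bullet> \<nu> p\<close>, because
    \<open>t\<close> may have length 2.\<close>
  define \<kappa> where "\<kappa> = b / 2"
  have \<kappa>: "\<kappa> > 0" using b by (simp add: \<kappa>_def)
  \<comment> \<open>The first bound keeps radius \<open>2 * l\<close> within the range of
    \<open>grad_close\<close>; the second makes the gradient vary there by at most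
    \<open>b / 16\<close> of its length; the third makes all points and steps involved small enough
    for \<open>uniform_cone\<close>.\<close>
  define l where "l = min (1 / (8 * H)) (min (b / (256 * H)) (\<kappa> * \<rho> / 17))"
  have l: "l > 0" using hess(1) b \<kappa> rho by (simp add: l_def)
  have "l \<le> 1 / (8 * H)" "l \<le> b / (256 * H)" "l \<le> \<kappa> * \<rho> / 17" by (auto simp: l_def)
  then have l1: "8 * H * l \<le> 1" "256 * H * l \<le> b" "4 * l < \<kappa> * \<rho> / 4"
    using hess(1) l by (auto simp: field_simps)
  have "bounded ((\<lambda>x. grad \<Phi> x) ` cball 0 (R + 2 * l))"
    by (intro compact_imp_bounded compact_continuous_image cont_grad compact_cball)
  then obtain B where "\<forall>y\<in>(\<lambda>x. grad \<Phi> x) ` cball 0 (R + 2 * l). norm y \<le> B" unfolding bounded_iff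
      by blast
  then have B: "\<And>x. norm x \<le> R + 2 * l \<Longrightarrow> norm (grad \<Phi> x) \<le> B" by simp
  \<comment> \<open>A gradient of this size at \<open>x0\<close> forces \<open>x0\<close> out of the
    ball of radius \<open>R + 2 * l\<close>, so that boundary points in
    \<open>ball x0 (2 * l)\<close> satisfy the normal condition.\<close>
  define A where "A = max 1 (B + 1)"
  show ?thesis
  proof (rule that[of l A])
    show "l > 0" by (rule l)
    show "A \<ge> 1" by (simp add: A_def)
    show "4 * l * (2 * H) \<le> 1" using l1 by (simp add: mult_ac)
    fix x0 assume A: "norm (grad \<Phi> x0) \<ge> A"
    define a where "a = grad \<Phi> x0"
    have a1: "norm a \<ge> 1" "norm a > B" using A by (auto simp: A_def a_def)
    have a0: "a \<noteq> 0" using a1 by auto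
    have close: "norm (grad \<Phi> x - a) \<le> b / 16 * norm a" if "x \<in> ball x0 (2 * l)" for x
    proof -
      have d: "norm (x - x0) \<le> 2 * l" using that by (simp add: dist_norm norm_minus_commute)
      have "2 * H * norm (x - x0) \<le> 2 * H * (2 * l)" using d hess(1) by (intro mult_left_mono) auto
      also have "\<dots> \<le> 1" using l1(1) hess(1) l mult_pos_pos[of H l] by linarith
      finally have "norm (x - x0) \<le> 1 / (2 * H)" using hess(1) by (simp add: field_simps)
      then have "norm (grad \<Phi> x - a) \<le> 2 * H * norm (x - x0) * (1 + norm a)" unfolding a_def
          by (rule grad_close)
      also have "\<dots> \<le> 2 * H * (2 * l) * (2 * norm a)" using d hess(1) a1 l by (intro mult_mono) auto
      also have "\<dots> = 8 * H * l * norm a" by simp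
      also have "\<dots> \<le> b / 16 * norm a" using l1(2) mult_pos_pos[OF hess(1) l]
          by (intro mult_right_mono) auto
      finally show ?thesis .
    qed
    show "\<exists>t. norm t \<le> 2 \<and> (\<forall>x\<in>ball x0 (2 * l). t \<bullet> grad \<Phi> x \<ge> (1 - c) / 2 * norm (grad \<Phi> x0)) \<and>
       (\<forall>x\<in>\<Omega> \<inter> ball x0 l. \<forall>r. 0 \<le> r \<longrightarrow> 2 * r \<le> l \<longrightarrow> x - r *\<^sub>R t \<in> \<Omega>)"
    proof (cases "ball x0 (2 * l) \<inter> frontier \<Omega> = {}")
      case True
      define t where "t = a /\<^sub>R norm a"
      have nt: "norm t = 1" using a0 by (simp add: t_def)
      have ta: "t \<bullet> a = norm a" using a0 by (simp add: t_def dot_square_norm power2_eq_square)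
      have "t \<bullet> grad \<Phi> x \<ge> b / 2 * norm a" if "x \<in> ball x0 (2 * l)" for x
      proof -
        have "t \<bullet> grad \<Phi> x = t \<bullet> a + t \<bullet> (grad \<Phi> x - a)" by (simp add: inner_diff_right)
        moreover have "\<bar>t \<bullet> (grad \<Phi> x - a)\<bar> \<le> b / 16 * norm a"
          using Cauchy_Schwarz_ineq2[of t "grad \<Phi> x - a"] close[OF that] nt by simp
        ultimately have "t \<bullet> grad \<Phi> x \<ge> norm a - b / 16 * norm a" using ta by linarith
        moreover have "b * norm a \<le> norm a" using b by (simp add: mult_left_le_one_le)
        moreover have "0 \<le> norm a" by simp
        ultimately show ?thesis by linarith
      qed
      moreover have "x - r *\<^sub>R t \<in> \<Omega>" if x: "x \<in> \<Omega> \<inter> ball x0 l" and r: "0 \<le> r" "2 * r \<le> l" for x r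
      proof -
        have "x \<in> ball x0 (2 * l) \<inter> \<Omega>" using x l by auto
        then have "ball x0 (2 * l) \<inter> \<Omega> \<noteq> {}" by blast
        then have "ball x0 (2 * l) \<subseteq> \<Omega>" using connected_Int_frontier[OF convex_connected[OF convex_ball]]
            True by blast
        moreover have "dist x0 (x - r *\<^sub>R t) < 2 * l"
        proof -
          have "dist x (x - r *\<^sub>R t) = r" using nt r by (simp add: dist_norm)
          moreover have "dist x0 x < l" using x by simp
          ultimately show ?thesis using dist_triangle[of x0 "x - r *\<^sub>R t" x] r l by linarith
        qed
        ultimately show ?thesis by auto
      qed
      ultimately show ?thesis using nt unfolding b_def a_def by (intro exI[of _ t]) auto
    next
      case False
      then obtain p where p: "p \<in> ball x0 (2 * l)" "p \<in> frontier \<Omega>" by auto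
      define ap where "ap = grad \<Phi> p"
      have "norm p > R"
      proof (rule ccontr)
        assume "\<not> norm p > R"
        then have "norm x0 \<le> R + 2 * l" using p(1) norm_triangle_sub[of x0 p] by (simp add: dist_norm)
        then show False using B a1 unfolding a_def by fastforce
      qed
      from normal[OF p(2) this] have nr: "\<bar>ap \<bullet> \<nu> p\<bar> \<le> c * norm ap" by (simp add: ap_def)
      have nup: "norm (\<nu> p) = 1" using nu[OF p(2)] by simp
      have apa: "norm (ap - a) \<le> b / 16 * norm a" using close[OF p(1)] by (simp add: ap_def)
      have apl: "norm ap \<ge> (1 - b / 16) * norm a"
        using norm_triangle_sub[of a ap] apa by (simp add: norm_minus_commute algebra_simps)
      have "(1 - b / 16) * norm a > 0" using b a0 by (intro mult_pos_pos) auto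
      then have ap0: "norm ap > 0" using apl by linarith
      define t where "t = ap /\<^sub>R norm ap + \<nu> p"
      have nt: "norm t \<le> 2" 
      proof -
        have "norm (ap /\<^sub>R norm ap) = 1" using ap0 by simp
        then show ?thesis using norm_triangle_ineq[of "ap /\<^sub>R norm ap" "\<nu> p"] nup by (simp add: t_def)
      qed
      have tap: "t \<bullet> ap \<ge> b * norm ap"
      proof -
        have "t \<bullet> ap = norm ap + ap \<bullet> \<nu> p"
        proof -
          have "(ap /\<^sub>R norm ap) \<bullet> ap = norm ap" using ap0
              by (simp add: dot_square_norm power2_eq_square)
          then show ?thesis unfolding t_def inner_add_left by (simp add: inner_commute)
        qed
        then show ?thesis using nr by (simp add: b_def algebra_simps)
      qed
      have tnu: "t \<bullet> \<nu> p \<ge> b"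
      proof -
        have "t \<bullet> \<nu> p = (ap \<bullet> \<nu> p) / norm ap + 1"
          using nup by (simp add: t_def inner_add_left norm_eq_1 divide_inverse mult.commute)
        moreover have "(ap \<bullet> \<nu> p) / norm ap \<ge> - c" using nr ap0 by (simp add: field_simps abs_le_iff)
        ultimately show ?thesis by (simp add: b_def)
      qed
      have "t \<bullet> grad \<Phi> x \<ge> b / 2 * norm a" if x: "x \<in> ball x0 (2 * l)" for x
      proof -
        have "norm (grad \<Phi> x - ap) \<le> b / 8 * norm a"
        proof -
          have "norm (grad \<Phi> x - ap) \<le> norm (grad \<Phi> x - a) + norm (ap - a)"
            using norm_triangle_ineq4[of "grad \<Phi> x - a" "ap - a"] by simp
          then show ?thesis using close[OF x] apa by simp
        qed
        then have "norm t * norm (grad \<Phi> x - ap) \<le> 2 * (b / 8 * norm a)" using nt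
            by (intro mult_mono) auto
        then have "\<bar>t \<bullet> (grad \<Phi> x - ap)\<bar> \<le> b / 4 * norm a"
          using Cauchy_Schwarz_ineq2[of t "grad \<Phi> x - ap"] by simp
        moreover have "t \<bullet> grad \<Phi> x = t \<bullet> ap + t \<bullet> (grad \<Phi> x - ap)" by (simp add: inner_diff_right)
        moreover have "b * norm ap \<ge> b * ((1 - b / 16) * norm a)" using apl b
            by (intro mult_left_mono) auto
        moreover have "b * ((1 - b / 16) * norm a) \<ge> b * ((1 - 1 / 16) * norm a)"
          using b by (intro mult_left_mono mult_right_mono) auto
        moreover have "b * norm a \<ge> 0" using b by simp
        ultimately show ?thesis using tap by simp
      qed
      moreover have "x - r *\<^sub>R t \<in> \<Omega>" if x: "x \<in> \<Omega> \<inter> ball x0 l" and r: "0 \<le> r" "2 * r \<le> l" for x r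
      proof -
        have "dist x x0 < l" "dist x0 p < 2 * l" using x p(1) by (auto simp: dist_commute)
        then have "dist x p < 3 * l" using dist_triangle[of x p x0] by linarith
        then have 1: "norm (x - p) < \<kappa> * \<rho> / 4" using l1(3) l by (simp add: dist_norm)
        have nv: "norm (- (r *\<^sub>R t)) \<le> 2 * r" using nt r mult_left_mono[of "norm t" 2 r] by simp
        then have 2: "norm (- (r *\<^sub>R t)) < \<kappa> * \<rho> / 4" using r l1(3) l by linarith
        have "\<kappa> * norm (- (r *\<^sub>R t)) \<le> \<kappa> * (2 * r)" using nv \<kappa> by (intro mult_left_mono) auto
        also have "\<dots> \<le> r * (t \<bullet> \<nu> p)" using tnu r mult_left_mono[of b "t \<bullet> \<nu> p" r]
            by (simp add: \<kappa>_def mult.commute)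
        finally have 3: "(- (r *\<^sub>R t)) \<bullet> \<nu> p \<le> - \<kappa> * norm (- (r *\<^sub>R t))" by simp
        show ?thesis using uniform_cone[OF open_dom rho nu \<kappa> p(2) _ 1 2 3] x by simp
      qed
      ultimately show ?thesis using nt unfolding b_def a_def by (intro exI[of _ t]) auto
    qed
  qed
qed

lemma Phi_along_ray:
  assumes r: "0 \<le> r" and d: "\<And>s. 0 \<le> s \<Longrightarrow> s \<le> r \<Longrightarrow> v \<bullet> grad \<Phi> (x + s *\<^sub>R v) \<le> - K"
  shows "\<Phi> (x + r *\<^sub>R v) \<le> \<Phi> x - K * r"
proof (cases "r = 0")
  case False
  then have "\<exists>s. 0 < s \<and> s < r \<and> \<Phi> (x + r *\<^sub>R v) - \<Phi> (x + 0 *\<^sub>R v) =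
      (r - 0) * (v \<bullet> grad \<Phi> (x + s *\<^sub>R v))"
    using r by (intro MVT2 has_vector_derivative_ray diff_Phi) auto
  then obtain s where "0 < s" "s < r" "\<Phi> (x + r *\<^sub>R v) - \<Phi> x = r * (v \<bullet> grad \<Phi> (x + s *\<^sub>R v))" by auto
  then show ?thesis using d[of s] r mult_left_mono[of "v \<bullet> grad \<Phi> (x + s *\<^sub>R v)" "- K" r]
      by (simp add: mult.commute)
qed simp

end

section \<open>The weighted Hardy inequality\<close>

context weighted_domain
begin

text \<open>The argument is already a square, so that sums of squares over all directions are
  covered as well.\<close>

definition wsq :: "(real^'n \<Rightarrow> real) \<Rightarrow> real^'n \<Rightarrow> ennreal" where
  "wsq u x = ennreal (u x * exp (- \<Phi> x))"

lemma borel_wsq [measurable]: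
  assumes [measurable]: "u \<in> borel_measurable borel"
  shows "wsq u \<in> borel_measurable borel"
proof -
  have [measurable]: "\<Phi> \<in> borel_measurable borel" by (rule borel_Phi)
  show ?thesis unfolding wsq_def[abs_def] by simp
qed

text \<open>With v = -s t the weight only helps: e^(-\<Phi>(x)) is at most e^(-K s) times
  e^(-\<Phi>(x + v)), and at most e^(-\<Phi>) at every point of the segment. So the weight can be
  moved to the translated point, and translation invariance removes the shift after integration. The
  constant \<open>8 * s\<^sup>2\<close> is 2, from splitting the square, times
  \<open>(2 * s)\<^sup>2\<close>, from the length of \<open>v\<close>.\<close>

lemma shift_ineq:
  fixes f :: "real^'n \<Rightarrow> 'b::euclidean_space"
  assumes f: "loc_integrable \<Omega> f" and g: "\<And>j. loc_integrable \<Omega> (g j)"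
      and wd: "\<And>j. weak_deriv \<Omega> j f (g j)"
    and l: "l > 0" and t: "norm t \<le> 2" and K: "\<And>x. x \<in> ball x0 (2 * l) \<Longrightarrow> t \<bullet> grad \<Phi> x \<ge> K" "K \<ge> 0"
    and dom: "\<And>x r. x \<in> \<Omega> \<inter> ball x0 l \<Longrightarrow> 0 \<le> r \<Longrightarrow> 2 * r \<le> l \<Longrightarrow> x - r *\<^sub>R t \<in> \<Omega>"
    and s: "0 \<le> s" "2 * s \<le> l"
  shows "(\<integral>\<^sup>+x. indicator (\<Omega> \<inter> ball x0 l) x * wsq (\<lambda>x. (norm (f x))\<^sup>2) x \<partial>lborel)
    \<le> ennreal (2 * exp (- (K * s))) * (\<integral>\<^sup>+x. indicator (\<Omega> \<inter> ball x0 (2 * l)) x * wsq (\<lambda>x. (norm (f x))\<^sup>2)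
        x \<partial>lborel)
      + ennreal (8 * s\<^sup>2) * (\<integral>\<^sup>+x. indicator (\<Omega> \<inter> ball x0 (2 * l)) x * wsq
          (\<lambda>x. \<Sum>j\<in>UNIV. (norm (g j x))\<^sup>2) x \<partial>lborel)"
    (is "?L \<le> ennreal ?c1 * ?F2 + ennreal (8 * s\<^sup>2) * ?G2")
proof -
  have [measurable]: "f \<in> borel_measurable borel" "\<And>j. g j \<in> borel_measurable borel"
    using f g by (simp_all add: loc_integrable_def)
  have [measurable]: "\<Omega> \<in> sets borel" using open_dom by simp
  define gg where "gg x = (\<Sum>j\<in>UNIV. (norm (g j x))\<^sup>2)" for x
  have gg0: "gg x \<ge> 0" for x by (auto simp: gg_def intro: sum_nonneg)
  have [measurable]: "gg \<in> borel_measurable borel" unfolding gg_def by measurable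
  let ?U = "\<Omega> \<inter> ball x0 l" and ?W = "\<Omega> \<inter> ball x0 (2 * l)"
  have [measurable]: "wsq gg \<in> borel_measurable borel"
      "wsq (\<lambda>x. (norm (f x))\<^sup>2) \<in> borel_measurable borel"
    by (rule borel_wsq, simp)+
  have [measurable]: "?U \<in> sets borel" "?W \<in> sets borel" by auto
  have [measurable]: "(indicator ?W :: _ \<Rightarrow> ennreal) \<in> borel_measurable borel" by simp
  define v where "v = - (s *\<^sub>R t)"
  have nv: "norm v \<le> 2 * s" using t s mult_left_mono[of "norm t" 2 s] by (simp add: v_def)
  have inW: "x + r *\<^sub>R v \<in> ?W" if x: "x \<in> ?U" and r: "0 \<le> r" "r \<le> 1" for x r
  proof -
    have rs: "0 \<le> r * s" "r * s \<le> s" using r s by (auto simp: mult_left_le_one_le)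
    have e: "x + r *\<^sub>R v = x - (r * s) *\<^sub>R t" by (simp add: v_def)
    have "x - (r * s) *\<^sub>R t \<in> \<Omega>" using rs s by (intro dom x) auto
    moreover have "norm (r *\<^sub>R v) \<le> norm v" using r by (simp add: mult_left_le_one_le)
    then have "dist x (x + r *\<^sub>R v) \<le> l" using nv s by (simp add: dist_norm)
    then have "dist x0 (x + r *\<^sub>R v) < 2 * l" using x dist_triangle[of x0 "x + r *\<^sub>R v" x] by simp
    ultimately show ?thesis by (simp add: e)
  qed
  have Phi: "\<Phi> (x + r *\<^sub>R v) \<le> \<Phi> x - (K * s) * r" if x: "x \<in> ?U" and r: "0 \<le> r" "r \<le> 1" for x r
  proof (rule Phi_along_ray[OF r(1)])
    fix q assume q: "0 \<le> q" "q \<le> r"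
    have "t \<bullet> grad \<Phi> (x + q *\<^sub>R v) \<ge> K" using inW[OF x, of q] q r by (intro K) auto
    then have "s * (t \<bullet> grad \<Phi> (x + q *\<^sub>R v)) \<ge> s * K" using s by (intro mult_left_mono) auto
    then show "v \<bullet> grad \<Phi> (x + q *\<^sub>R v) \<le> - (K * s)" by (simp add: v_def mult.commute)
  qed
  have ex: "exp (- \<Phi> x) \<le> exp (- (K * s * r)) * exp (- \<Phi> (x + r *\<^sub>R v))" if "x \<in> ?U" "0 \<le> r" "r \<le> 1"
      for x r
    using Phi[OF that] by (simp add: exp_add[symmetric] algebra_simps)
  have ex1: "exp (- \<Phi> x) \<le> exp (- \<Phi> (x + r *\<^sub>R v))" if "x \<in> ?U" "0 \<le> r" "r \<le> 1" for x r
  proof -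
    have "(K * s) * r \<ge> 0" using K(2) s that by simp
    then show ?thesis using Phi[OF that] by simp
  qed
  have U: "open ?U" using open_dom by auto
  have "AE x in lborel. x \<in> ?U \<longrightarrow> ennreal ((norm (f (x + v) - f x))\<^sup>2) \<le>
    ennreal ((norm v)\<^sup>2) * (\<integral>\<^sup>+r. indicator {0..1::real} r * ennreal
        (\<Sum>j\<in>UNIV. (norm (g j (x + r *\<^sub>R v)))\<^sup>2) \<partial>lborel)"
    by (rule translation_estimate[OF f g wd U]) (use inW in auto)
  then have AE: "AE x in lborel. indicator ?U x * wsq (\<lambda>x. (norm (f x))\<^sup>2) x \<le>
      ennreal ?c1 * (indicator ?W (x + v) * wsq (\<lambda>x. (norm (f x))\<^sup>2) (x + v))
      + ennreal (8 * s\<^sup>2) * (\<integral>\<^sup>+r. indicator {0..1::real} r * (indicator ?W (x + r *\<^sub>R v) * wsq gg (x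
          + r *\<^sub>R v)) \<partial>lborel)"
  proof eventually_elim
    case (elim x)
    show ?case
    proof (cases "x \<in> ?U")
      case True
      have "(norm (f x))\<^sup>2 \<le> (norm (f (x + v)) + norm (f (x + v) - f x))\<^sup>2"
        using norm_triangle_sub[of "f x" "f (x + v)"]
            by (intro power_mono) (auto simp: norm_minus_commute)
      also have "\<dots> \<le> 2 * (norm (f (x + v)))\<^sup>2 + 2 * (norm (f (x + v) - f x))\<^sup>2"
        using sum_squares_bound[of "norm (f (x + v))" "norm (f (x + v) - f x)"] by (simp add: power2_sum)
      finally have P: "(norm (f x))\<^sup>2 \<le> 2 * (norm (f (x + v)))\<^sup>2 + 2 * (norm (f (x + v) - f x))\<^sup>2" .
      have "(norm (f x))\<^sup>2 * exp (- \<Phi> x) \<le> 2 * (norm (f (x + v)))\<^sup>2 * exp (- \<Phi> x)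
          + 2 * exp (- \<Phi> x) * (norm (f (x + v) - f x))\<^sup>2"
      proof -
        have "(norm (f x))\<^sup>2 * exp (- \<Phi> x) \<le> (2 * (norm (f (x + v)))\<^sup>2 + 2 * (norm (f (x + v) - f x))\<^sup>2)
            * exp (- \<Phi> x)"
          by (rule mult_right_mono[OF P]) simp
        also have "\<dots> = 2 * (norm (f (x + v)))\<^sup>2 * exp (- \<Phi> x)
            + 2 * exp (- \<Phi> x) * (norm (f (x + v) - f x))\<^sup>2"
          by algebra
        finally show ?thesis .
      qed
      also have "\<dots> \<le> 2 * (norm (f (x + v)))\<^sup>2 * (exp (- (K * s)) * exp (- \<Phi> (x + v)))
          + 2 * exp (- \<Phi> x) * (norm (f (x + v) - f x))\<^sup>2"
        using ex[OF True, of 1] by (intro add_right_mono mult_left_mono) auto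
      finally have "wsq (\<lambda>x. (norm (f x))\<^sup>2) x \<le> ennreal ?c1 * wsq (\<lambda>x. (norm (f x))\<^sup>2) (x + v)
          + ennreal (2 * exp (- \<Phi> x)) * ennreal ((norm (f (x + v) - f x))\<^sup>2)"
        by (simp add: wsq_def ennreal_mult[symmetric] ennreal_plus[symmetric] mult_ac del: ennreal_plus)
      also have "ennreal (2 * exp (- \<Phi> x)) * ennreal ((norm (f (x + v) - f x))\<^sup>2) \<le>
          ennreal (2 * exp (- \<Phi> x)) * (ennreal ((norm v)\<^sup>2) * (\<integral>\<^sup>+r. indicator {0..1::real} r * ennreal
              (gg (x + r *\<^sub>R v)) \<partial>lborel))"
        using elim True by (intro mult_left_mono) (auto simp: gg_def)
      also have "\<dots> \<le> ennreal (2 * exp (- \<Phi> x))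
          * (ennreal (4 * s\<^sup>2) * (\<integral>\<^sup>+r. indicator {0..1::real} r * ennreal (gg (x + r *\<^sub>R v)) \<partial>lborel))"
        using power_mono[OF nv, of 2] by (intro mult_left_mono mult_right_mono ennreal_leI)
            (auto simp: power_mult_distrib)
      also have "\<dots> = ennreal (8 * s\<^sup>2) * (ennreal (exp (- \<Phi> x))
          * (\<integral>\<^sup>+r. indicator {0..1::real} r * ennreal (gg (x + r *\<^sub>R v)) \<partial>lborel))"
        by (simp add: mult.assoc[symmetric] ennreal_mult[symmetric]) (simp add: mult_ac)
      also have "ennreal (exp (- \<Phi> x)) * (\<integral>\<^sup>+r. indicator {0..1::real} r
          * ennreal (gg (x + r *\<^sub>R v)) \<partial>lborel)
          = (\<integral>\<^sup>+r. ennreal (exp (- \<Phi> x)) * (indicator {0..1::real} r * ennreal (gg (x + r *\<^sub>R v)))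
              \<partial>lborel)"
        by (rule nn_integral_cmult[symmetric]) simp
      also have "\<dots> \<le> (\<integral>\<^sup>+r. indicator {0..1::real} r
          * (indicator ?W (x + r *\<^sub>R v) * wsq gg (x + r *\<^sub>R v)) \<partial>lborel)"
      proof (rule nn_integral_mono)
        fix r :: real
        show "ennreal (exp (- \<Phi> x)) * (indicator {0..1::real} r * ennreal (gg (x + r *\<^sub>R v)))
            \<le> indicator {0..1::real} r * (indicator ?W (x + r *\<^sub>R v) * wsq gg (x + r *\<^sub>R v))"
        proof (cases "r \<in> {0..1}")
          case r: True
          have "exp (- \<Phi> x) * gg (x + r *\<^sub>R v) \<le> gg (x + r *\<^sub>R v) * exp (- \<Phi> (x + r *\<^sub>R v))"
            using mult_left_mono[OF ex1[OF True, of r] gg0[of "x + r *\<^sub>R v"]] r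
                by (simp add: mult.commute)
          then show ?thesis using r inW[OF True, of r] gg0
              by (simp add: wsq_def ennreal_mult[symmetric] ennreal_leI)
        qed simp
      qed
      finally show ?thesis using True inW[OF True, of 1] by (simp add: add_left_mono mult_left_mono)
    qed simp
  qed
  have "?L \<le> (\<integral>\<^sup>+x. ennreal ?c1 * (indicator ?W (x + v) * wsq (\<lambda>x. (norm (f x))\<^sup>2) (x + v))
      + ennreal (8 * s\<^sup>2) * (\<integral>\<^sup>+r. indicator {0..1::real} r * (indicator ?W (x + r *\<^sub>R v) * wsq gg (x
          + r *\<^sub>R v)) \<partial>lborel) \<partial>lborel)"
    by (rule nn_integral_mono_AE[OF AE])
  also have "\<dots> = ennreal ?c1 * (\<integral>\<^sup>+x. indicator ?W (x + v) * wsq (\<lambda>x. (norm (f x))\<^sup>2) (x + v) \<partial>lborel)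
      + ennreal (8 * s\<^sup>2) * (\<integral>\<^sup>+x. \<integral>\<^sup>+r. indicator {0..1::real} r * (indicator ?W (x
          + r *\<^sub>R v) * wsq gg (x + r *\<^sub>R v)) \<partial>lborel \<partial>lborel)"
    by (subst nn_integral_add, simp, simp, subst nn_integral_cmult, simp, subst nn_integral_cmult,
        simp_all)
  also have "(\<integral>\<^sup>+x. indicator ?W (x + v) * wsq (\<lambda>x. (norm (f x))\<^sup>2) (x + v) \<partial>lborel) = ?F2"
    by (rule nn_integral_translate[of "\<lambda>x. indicator ?W x * wsq (\<lambda>x. (norm (f x))\<^sup>2) x"]) simp
  also have "(\<integral>\<^sup>+x. \<integral>\<^sup>+r. indicator {0..1::real} r
      * (indicator ?W (x + r *\<^sub>R v) * wsq gg (x + r *\<^sub>R v)) \<partial>lborel \<partial>lborel)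
      = (\<integral>\<^sup>+r. \<integral>\<^sup>+x. indicator {0..1::real} r * (indicator ?W (x + r *\<^sub>R v) * wsq gg (x + r *\<^sub>R v))
          \<partial>lborel \<partial>lborel)"
    by (rule lborel_pair.Fubini') simp
  also have "\<dots> = (\<integral>\<^sup>+r. indicator {0..1::real} r * ?G2 \<partial>lborel)"
  proof (rule nn_integral_cong)
    fix r :: real
    have "(\<integral>\<^sup>+x. indicator ?W (x + r *\<^sub>R v) * wsq gg (x + r *\<^sub>R v) \<partial>lborel) = ?G2"
      unfolding gg_def[symmetric]
      by (rule nn_integral_translate[of "\<lambda>x. indicator ?W x * wsq gg x"]) simp
    then show "(\<integral>\<^sup>+x. indicator {0..1::real} r
        * (indicator ?W (x + r *\<^sub>R v) * wsq gg (x + r *\<^sub>R v)) \<partial>lborel) = indicator {0..1::real} r * ?G2"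
      by (subst nn_integral_cmult) simp_all
  qed
  also have "\<dots> = ?G2" by (subst nn_integral_multc) simp_all
  finally show ?thesis .
qed

text \<open>Bounded by \<open>N\<close>, so the integral to be absorbed is finite whenever the
  energy is.\<close>

definition trunc :: "real \<Rightarrow> real^'n \<Rightarrow> real" where
  "trunc N x = min N (1 + norm (grad \<Phi> x))"

lemma borel_trunc [measurable]: "trunc N \<in> borel_measurable borel"
  unfolding trunc_def[abs_def] by measurable

text \<open>The factor does not depend on \<open>N\<close>: by \<open>grad_close\<close> the
  quantity \<open>1 + norm (grad \<Phi> x)\<close> changes by at most a factor 2 over the distance
  \<open>2 * l\<close>, and the minimum with \<open>N\<close> preserves this.\<close>

lemma trunc_compare:
  assumes "4 * l * (2 * H) \<le> 1" "dist x y < 2 * l" "N \<ge> 1"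
  shows "(trunc N x)\<^sup>2 \<le> 4 * (trunc N y)\<^sup>2"
proof -
  have d: "norm (x - y) \<le> 2 * l" using assms(2) by (simp add: dist_norm)
  have "2 * H * norm (x - y) \<le> 2 * H * (2 * l)" using d hess(1) by (intro mult_left_mono) auto
  also have "\<dots> = (4 * l * (2 * H)) / 2" by simp
  also have "\<dots> \<le> 1" using assms(1) by linarith
  finally have "norm (x - y) \<le> 1 / (2 * H)" using hess(1) by (simp add: field_simps)
  from grad_close[OF this] have "norm (grad \<Phi> x - grad \<Phi> y) \<le>
      2 * H * norm (x - y) * (1 + norm (grad \<Phi> y))" .
  also have "\<dots> \<le> 2 * H * (2 * l) * (1 + norm (grad \<Phi> y))"
    using d hess(1) by (intro mult_right_mono mult_left_mono) auto
  also have "\<dots> = (4 * l * (2 * H)) * ((1 + norm (grad \<Phi> y)) / 2)" by simp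
  also have "\<dots> \<le> 1 * ((1 + norm (grad \<Phi> y)) / 2)" using assms(1) by (intro mult_right_mono) auto
  finally have "1 + norm (grad \<Phi> x) \<le> 2 * (1 + norm (grad \<Phi> y))"
    using norm_triangle_sub[of "grad \<Phi> x" "grad \<Phi> y"] norm_ge_zero[of "grad \<Phi> y"] by argo
  then have "trunc N x \<le> 2 * trunc N y" using assms(3) by (auto simp: trunc_def min_def)
  moreover have "trunc N x \<ge> 0" using assms(3) by (auto simp: trunc_def min_def add_nonneg_nonneg)
  ultimately have "(trunc N x)\<^sup>2 \<le> (2 * trunc N y)\<^sup>2" by (intro power_mono)
  then show ?thesis by (simp add: power_mult_distrib)
qed

text \<open>Fubini; a point lies in the ball about \<open>x0\<close> exactly when \<open>x0\<close>
  lies in the ball of the same radius about that point.\<close>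

lemma averaged_integral:
  assumes [measurable]: "M \<in> borel_measurable borel" "u \<in> borel_measurable borel"
  shows "(\<integral>\<^sup>+x0. M x0 * (\<integral>\<^sup>+x. indicator (\<Omega> \<inter> ball x0 l) x * u x \<partial>lborel) \<partial>lborel)
    = (\<integral>\<^sup>+x. (indicator \<Omega> x * u x) * (\<integral>\<^sup>+x0. M x0 * indicator (ball x l) x0 \<partial>lborel) \<partial>lborel)"
proof -
  have [measurable]: "\<Omega> \<in> sets borel" using open_dom by simp
  have i: "indicator (\<Omega> \<inter> ball x0 l) x = (indicator \<Omega> x * (if dist x0 x < l then 1 else 0) :: ennreal)"
      for x0 x
    by (auto simp: indicator_def)
  have i2: "indicator (ball x l) x0 = (if dist x0 x < l then 1 else 0 :: ennreal)" for x0 x :: "real^'n"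
    by (auto simp: indicator_def dist_commute)
  have "(\<integral>\<^sup>+x0. M x0 * (\<integral>\<^sup>+x. indicator (\<Omega> \<inter> ball x0 l) x * u x \<partial>lborel) \<partial>lborel)
      = (\<integral>\<^sup>+x0. \<integral>\<^sup>+x. M x0 * ((indicator \<Omega> x * (if dist x0 x < l then 1 else 0)) * u x) \<partial>lborel \<partial>lborel)"
    unfolding i by (intro nn_integral_cong nn_integral_cmult[symmetric]) simp
  also have "\<dots> = (\<integral>\<^sup>+x. \<integral>\<^sup>+x0. M x0 * ((indicator \<Omega> x * (if dist x0 x < l then 1 else 0))
      * u x) \<partial>lborel \<partial>lborel)"
    by (rule lborel_pair.Fubini') simp
  also have "\<dots> = (\<integral>\<^sup>+x. (indicator \<Omega> x * u x) * (\<integral>\<^sup>+x0. M x0 * indicator (ball x l) x0 \<partial>lborel) \<partial>lborel)"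
    unfolding i2 by (intro nn_integral_cong, subst nn_integral_cmult[symmetric])
        (auto intro!: nn_integral_cong simp: mult_ac)
  finally show ?thesis .
qed

text \<open>The local inequality at \<open>x0\<close> is multiplied by the square of the truncated
  weight at \<open>x0\<close> and integrated over all \<open>x0\<close>. Comparability of the
  weights turns each side into a volume times the global integral \<open>X\<close>: at least
  \<open>V l / 4\<close> on the left, and on the right at most \<open>4 * V (2 * l)\<close> with the
  small factor \<open>2 * exp (- (b * L))\<close>.\<close>

theorem weighted_hardy:
  "\<exists>C>0. \<forall>(f :: real^'n \<Rightarrow> 'b::euclidean_space) g. loc_integrable \<Omega> f \<longrightarrow> (\<forall>j. loc_integrable \<Omega> (g j)) \<longrightarrow>
    (\<forall>j. weak_deriv \<Omega> j f (g j)) \<longrightarrow>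
    (\<integral>\<^sup>+x. indicator \<Omega> x * (ennreal ((1 + norm (grad \<Phi> x))\<^sup>2) * wsq (\<lambda>x. (norm (f x))\<^sup>2) x) \<partial>lborel)
    \<le> ennreal C * ((\<integral>\<^sup>+x. indicator \<Omega> x * wsq (\<lambda>x. (norm (f x))\<^sup>2) x \<partial>lborel)
       + (\<integral>\<^sup>+x. indicator \<Omega> x * wsq (\<lambda>x. \<Sum>j\<in>UNIV. (norm (g j x))\<^sup>2) x \<partial>lborel))"
proof -
  obtain l A where l: "l > 0" and A: "A \<ge> 1" and lH: "4 * l * (2 * H) \<le> 1" and
    dir: "\<And>x0. norm (grad \<Phi> x0) \<ge> A \<Longrightarrow> \<exists>t. norm t \<le> 2 \<and>
       (\<forall>x\<in>ball x0 (2 * l). t \<bullet> grad \<Phi> x \<ge> (1 - c) / 2 * norm (grad \<Phi> x0)) \<and>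
       (\<forall>x\<in>\<Omega> \<inter> ball x0 l. \<forall>r. 0 \<le> r \<longrightarrow> 2 * r \<le> l \<longrightarrow> x - r *\<^sub>R t \<in> \<Omega>)"
    using local_direction by metis
  define b where "b = (1 - c) / 2"
  have b: "b > 0" using c by (simp add: b_def)
  define V where "V r = unit_ball_vol (real (DIM(real^'n))) * r ^ DIM(real^'n)" for r
  have V: "emeasure lborel (ball x r) = ennreal (V r)" if "r \<ge> 0" for x :: "real^'n" and r
    unfolding V_def by (rule emeasure_ball[OF that])
  have V1: "V l > 0" and V2: "V (2 * l) > 0" using l
      by (auto simp: V_def intro!: mult_pos_pos unit_ball_vol_pos)
  \<comment> \<open>Chosen for the estimate \<open>eL\<close>, which makes the absorbed term at most
    half of the \<open>V l / 4\<close> gained on the left.\<close>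
  define L where "L = ln (64 * V (2 * l) / V l + 1) / b"
  have L: "L > 0" using V1 V2 b by (auto simp: L_def intro!: divide_pos_pos ln_gt_zero)
  have eL: "8 * exp (- (b * L)) * V (2 * l) \<le> V l / 8"
  proof -
    have "exp (- (b * L)) = inverse (64 * V (2 * l) / V l + 1)"
      using b V1 V2 by (simp add: L_def exp_minus add_pos_pos)
    also have "\<dots> \<le> inverse (64 * V (2 * l) / V l)" using V1 V2 by (intro le_imp_inverse_le) auto
    finally show ?thesis using V1 V2 by (simp add: field_simps)
  qed
  \<comment> \<open>The second entry makes the step \<open>s = L / w\<close> at most
    \<open>l / 2\<close>.\<close>
  define A' where "A' = max A (2 * L / l)"
  \<comment> \<open>The two entries serve the two cases below: where the gradient is large, the
    squared weight times \<open>8 * s\<^sup>2\<close> is at most \<open>32 * L\<^sup>2\<close>;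
    elsewhere the weight itself is at most \<open>1 + A'\<close>.\<close>
  define K where "K = max (32 * L\<^sup>2) ((1 + A')\<^sup>2)"
  have K: "32 * L\<^sup>2 \<le> K" "(1 + A')\<^sup>2 \<le> K" by (auto simp: K_def)
  have K0: "K > 0" using K(1) L by (smt (verit) zero_less_power mult_pos_pos)
  have [measurable]: "\<Omega> \<in> sets borel" using open_dom by simp
  define C where "C = 8 * K * V (2 * l) / V l"
  have C0: "C > 0" using K0 V1 V2 by (simp add: C_def)
  have main: "(\<integral>\<^sup>+x. indicator \<Omega> x * (ennreal ((1 + norm (grad \<Phi> x))\<^sup>2)
      * wsq (\<lambda>x. (norm (f x))\<^sup>2) x) \<partial>lborel)
    \<le> ennreal C * ((\<integral>\<^sup>+x. indicator \<Omega> x * wsq (\<lambda>x. (norm (f x))\<^sup>2) x \<partial>lborel)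
       + (\<integral>\<^sup>+x. indicator \<Omega> x * wsq (\<lambda>x. \<Sum>j\<in>UNIV. (norm (g j x))\<^sup>2) x \<partial>lborel))"
    if f: "loc_integrable \<Omega> f" and g: "\<And>j. loc_integrable \<Omega> (g j)" and wd: "\<And>j. weak_deriv \<Omega> j f (g j)"
    for f :: "real^'n \<Rightarrow> 'b" and g
  proof -
    have [measurable]: "f \<in> borel_measurable borel" "\<And>j. g j \<in> borel_measurable borel"
      using f g by (simp_all add: loc_integrable_def)
    define F where "F = wsq (\<lambda>x. (norm (f x))\<^sup>2)"
    define G where "G = wsq (\<lambda>x. \<Sum>j\<in>UNIV. (norm (g j x))\<^sup>2)"
    have [measurable]: "F \<in> borel_measurable borel" "G \<in> borel_measurable borel"
      unfolding F_def G_def by measurable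
    define FO where "FO = (\<integral>\<^sup>+x. indicator \<Omega> x * F x \<partial>lborel)"
    define GO where "GO = (\<integral>\<^sup>+x. indicator \<Omega> x * G x \<partial>lborel)"
    define J where "J r u x0 = (\<integral>\<^sup>+x. indicator (\<Omega> \<inter> ball x0 r) x * u x \<partial>lborel)" for r
        and u :: "real^'n \<Rightarrow> ennreal" and x0
    have Jm: "J r u \<in> borel_measurable borel" if [measurable]: "u \<in> borel_measurable borel" for r u
    proof -
      have "J r u x0 = (\<integral>\<^sup>+x. (indicator \<Omega> x * (if dist x0 x < r then 1 else 0)) * u x \<partial>lborel)" for x0
        unfolding J_def by (intro nn_integral_cong) (auto simp: indicator_def)
      then show ?thesis by (subst measurable_cong) auto
    qed
    note [measurable] = Jm[of F] Jm[of G]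
    show ?thesis
    proof (cases "FO + GO = \<infinity>")
      case True
      then show ?thesis using C0 unfolding F_def[symmetric] G_def[symmetric] FO_def[symmetric]
          GO_def[symmetric] True
        by (simp add: ennreal_mult_top)
    next
      case False
      have bound: "(\<integral>\<^sup>+x. indicator \<Omega> x * (ennreal ((trunc N x)\<^sup>2) * F x) \<partial>lborel) \<le>
          ennreal C * (FO + GO)" if N: "N \<ge> 1" for N
      proof -
        define X where "X = (\<integral>\<^sup>+x. indicator \<Omega> x * (ennreal ((trunc N x)\<^sup>2) * F x) \<partial>lborel)"
        have tr0: "trunc N x \<ge> 0" for x using N by (auto simp: trunc_def min_def add_nonneg_nonneg)
        have local: "ennreal ((trunc N x0)\<^sup>2) * J l F x0 \<le>
           ennreal (2 * exp (- (b * L))) * (ennreal ((trunc N x0)\<^sup>2) * J (2 * l) F x0)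
               + ennreal K * (J (2 * l) F x0 + J (2 * l) G x0)" for x0
        proof (cases "norm (grad \<Phi> x0) \<ge> A'")
          case True
          define w where "w = norm (grad \<Phi> x0)"
          have w: "w \<ge> A" "w \<ge> 2 * L / l" "w \<ge> 1" using True A by (auto simp: A'_def w_def)
          obtain t where t: "norm t \<le> 2" "\<And>x. x \<in> ball x0 (2 * l) \<Longrightarrow> t \<bullet> grad \<Phi> x \<ge> b * w"
            "\<And>x r. x \<in> \<Omega> \<inter> ball x0 l \<Longrightarrow> 0 \<le> r \<Longrightarrow> 2 * r \<le> l \<Longrightarrow> x - r *\<^sub>R t \<in> \<Omega>"
            using dir[of x0] w(1) by (auto simp: w_def b_def)
          define s where "s = L / w"
          have s: "0 \<le> s" "2 * s \<le> l" using L w l by (auto simp: s_def field_simps)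
          have ws: "b * w * s = b * L" using w by (simp add: s_def)
          have "J l F x0 \<le> ennreal (2 * exp (- (b * L))) * J (2 * l) F x0
              + ennreal (8 * s\<^sup>2) * J (2 * l) G x0"
            using shift_ineq[OF f g wd l t(1) t(2) _ t(3) s] b w unfolding J_def F_def G_def ws by simp
          then have "ennreal ((trunc N x0)\<^sup>2) * J l F x0 \<le>
              ennreal ((trunc N x0)\<^sup>2) * (ennreal (2 * exp (- (b * L))) * J (2 * l) F x0
              + ennreal (8 * s\<^sup>2) * J (2 * l) G x0)"
            by (intro mult_left_mono) auto
          also have "\<dots> = ennreal (2 * exp (- (b * L))) * (ennreal ((trunc N x0)\<^sup>2) * J (2 * l) F x0)
              + ennreal ((trunc N x0)\<^sup>2 * (8 * s\<^sup>2)) * J (2 * l) G x0"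
            by (simp add: distrib_left ennreal_mult mult_ac)
          also have "(trunc N x0)\<^sup>2 * (8 * s\<^sup>2) \<le> K"
          proof -
            have "trunc N x0 \<le> 2 * w" using w by (auto simp: trunc_def w_def)
            then have "(trunc N x0)\<^sup>2 \<le> (2 * w)\<^sup>2" using tr0 by (intro power_mono)
            then have "(trunc N x0)\<^sup>2 * (8 * s\<^sup>2) \<le> (2 * w)\<^sup>2 * (8 * s\<^sup>2)"
                by (intro mult_right_mono) auto
            also have "\<dots> = 32 * L\<^sup>2" using w by (simp add: s_def power_mult_distrib power_divide)
            finally show ?thesis using K(1) by linarith
          qed
          then have "ennreal ((trunc N x0)\<^sup>2 * (8 * s\<^sup>2)) * J (2 * l) G x0 \<le>
              ennreal K * (J (2 * l) F x0 + J (2 * l) G x0)"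
            by (intro mult_mono ennreal_leI) auto
          finally show ?thesis by (simp add: add_left_mono)
        next
          case False
          have "trunc N x0 \<le> 1 + A'" using False by (auto simp: trunc_def)
          then have "(trunc N x0)\<^sup>2 \<le> (1 + A')\<^sup>2" using tr0 by (intro power_mono)
          then have "(trunc N x0)\<^sup>2 \<le> K" using K(2) by simp
          moreover have "J l F x0 \<le> J (2 * l) F x0"
            unfolding J_def using l by (intro nn_integral_mono mult_right_mono)
                (auto simp: indicator_def)
          ultimately have "ennreal ((trunc N x0)\<^sup>2) * J l F x0 \<le>
              ennreal K * (J (2 * l) F x0 + J (2 * l) G x0)"
            by (intro mult_mono ennreal_leI) (auto intro: order_trans)
          then show ?thesis by (simp add: add_increasing)
        qed
        have "(\<integral>\<^sup>+x0. ennreal ((trunc N x0)\<^sup>2) * J l F x0 \<partial>lborel) \<le>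
          (\<integral>\<^sup>+x0. ennreal (2 * exp (- (b * L))) * (ennreal ((trunc N x0)\<^sup>2) * J (2 * l) F x0)
              + ennreal K * (1 * J (2 * l) F x0 + 1 * J (2 * l) G x0) \<partial>lborel)"
          using local by (intro nn_integral_mono) simp
        also have "\<dots> = ennreal (2 * exp (- (b * L)))
            * (\<integral>\<^sup>+x0. ennreal ((trunc N x0)\<^sup>2) * J (2 * l) F x0 \<partial>lborel)
           + ennreal K * ((\<integral>\<^sup>+x0. 1 * J (2 * l) F x0 \<partial>lborel) + (\<integral>\<^sup>+x0. 1 * J (2 * l) G x0 \<partial>lborel))"
          by (subst nn_integral_add, simp, simp, subst nn_integral_cmult, simp, subst nn_integral_cmult,
              simp, subst nn_integral_add, simp_all)
        finally have I: "(\<integral>\<^sup>+x0. ennreal ((trunc N x0)\<^sup>2) * J l F x0 \<partial>lborel) \<le> \<dots>" .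
        have lower: "ennreal (V l / 4) * X \<le> (\<integral>\<^sup>+x0. ennreal ((trunc N x0)\<^sup>2) * J l F x0 \<partial>lborel)"
        proof -
          have "ennreal (V l / 4) * X = (\<integral>\<^sup>+x. ennreal (V l / 4)
              * (indicator \<Omega> x * (ennreal ((trunc N x)\<^sup>2) * F x)) \<partial>lborel)"
            unfolding X_def by (rule nn_integral_cmult[symmetric]) simp
          also have "\<dots> \<le> (\<integral>\<^sup>+x. (indicator \<Omega> x * F x)
              * (\<integral>\<^sup>+x0. ennreal ((trunc N x0)\<^sup>2) * indicator (ball x l) x0 \<partial>lborel) \<partial>lborel)"
          proof (rule nn_integral_mono)
            fix x
            have "ennreal ((trunc N x)\<^sup>2 / 4) * emeasure lborel (ball x l) =
                (\<integral>\<^sup>+x0. ennreal ((trunc N x)\<^sup>2 / 4) * indicator (ball x l) x0 \<partial>lborel)"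
              by (rule nn_integral_cmult_indicator[symmetric]) simp
            also have "\<dots> \<le> (\<integral>\<^sup>+x0. ennreal ((trunc N x0)\<^sup>2) * indicator (ball x l) x0 \<partial>lborel)"
            proof (rule nn_integral_mono)
              fix x0
              show "ennreal ((trunc N x)\<^sup>2 / 4) * indicator (ball x l) x0 \<le>
                  ennreal ((trunc N x0)\<^sup>2) * indicator (ball x l) x0"
                using trunc_compare[OF lH _ N, of x x0] l
                    by (auto simp: indicator_def intro!: ennreal_leI)
            qed
            finally have "(indicator \<Omega> x * F x)
                * (ennreal ((trunc N x)\<^sup>2 / 4) * emeasure lborel (ball x l)) \<le>
              (indicator \<Omega> x * F x) * (\<integral>\<^sup>+x0. ennreal ((trunc N x0)\<^sup>2) * indicator
                  (ball x l) x0 \<partial>lborel)" by (intro mult_left_mono) auto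
            moreover have "ennreal ((trunc N x)\<^sup>2 / 4) * emeasure lborel (ball x l) =
                ennreal (V l / 4) * ennreal ((trunc N x)\<^sup>2)"
              using V[of l x] l V1 by (simp add: ennreal_mult[symmetric] mult_ac)
            ultimately show "ennreal (V l / 4) * (indicator \<Omega> x * (ennreal ((trunc N x)\<^sup>2) * F x)) \<le>
              (indicator \<Omega> x * F x) * (\<integral>\<^sup>+x0. ennreal ((trunc N x0)\<^sup>2) * indicator
                  (ball x l) x0 \<partial>lborel)"
              by (simp add: mult_ac)
          qed
          also have "\<dots> = (\<integral>\<^sup>+x0. ennreal ((trunc N x0)\<^sup>2) * J l F x0 \<partial>lborel)"
            unfolding J_def by (rule averaged_integral[symmetric]) simp_all
          finally show ?thesis .
        qed
        have upper: "(\<integral>\<^sup>+x0. ennreal ((trunc N x0)\<^sup>2) * J (2 * l) F x0 \<partial>lborel) \<le>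
            ennreal (4 * V (2 * l)) * X"
        proof -
          have "(\<integral>\<^sup>+x0. ennreal ((trunc N x0)\<^sup>2) * J (2 * l) F x0 \<partial>lborel) =
              (\<integral>\<^sup>+x. (indicator \<Omega> x * F x) * (\<integral>\<^sup>+x0. ennreal ((trunc N x0)\<^sup>2) * indicator
              (ball x (2 * l)) x0 \<partial>lborel) \<partial>lborel)"
            unfolding J_def by (rule averaged_integral) simp_all
          also have "\<dots> \<le> (\<integral>\<^sup>+x. ennreal (4 * V (2 * l))
              * (indicator \<Omega> x * (ennreal ((trunc N x)\<^sup>2) * F x)) \<partial>lborel)"
          proof (rule nn_integral_mono)
            fix x
            have "(\<integral>\<^sup>+x0. ennreal ((trunc N x0)\<^sup>2) * indicator (ball x (2 * l)) x0 \<partial>lborel) \<le>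
                (\<integral>\<^sup>+x0. ennreal (4 * (trunc N x)\<^sup>2) * indicator (ball x (2 * l)) x0 \<partial>lborel)"
            proof (rule nn_integral_mono)
              fix x0
              show "ennreal ((trunc N x0)\<^sup>2) * indicator (ball x (2 * l)) x0 \<le>
                  ennreal (4 * (trunc N x)\<^sup>2) * indicator (ball x (2 * l)) x0"
                using trunc_compare[OF lH _ N, of x0 x]
                    by (auto simp: indicator_def dist_commute intro!: ennreal_leI)
            qed
            also have "\<dots> = ennreal (4 * (trunc N x)\<^sup>2) * emeasure lborel (ball x (2 * l))"
              by (rule nn_integral_cmult_indicator) simp
            finally have "(indicator \<Omega> x * F x)
                * (\<integral>\<^sup>+x0. ennreal ((trunc N x0)\<^sup>2) * indicator (ball x (2 * l)) x0 \<partial>lborel) \<le>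
              (indicator \<Omega> x * F x) * (ennreal (4 * (trunc N x)\<^sup>2) * emeasure lborel
                  (ball x (2 * l)))" by (intro mult_left_mono) auto
            moreover have "ennreal (4 * (trunc N x)\<^sup>2) * emeasure lborel (ball x (2 * l)) =
                ennreal (4 * V (2 * l)) * ennreal ((trunc N x)\<^sup>2)"
              using V[of "2 * l" x] l V2 by (simp add: ennreal_mult[symmetric] mult_ac)
            ultimately show "(indicator \<Omega> x * F x)
                * (\<integral>\<^sup>+x0. ennreal ((trunc N x0)\<^sup>2) * indicator (ball x (2 * l)) x0 \<partial>lborel) \<le>
              ennreal (4 * V (2 * l)) * (indicator \<Omega> x * (ennreal ((trunc N x)\<^sup>2) * F x))"
              by (simp add: mult_ac)
          qed
          also have "\<dots> = ennreal (4 * V (2 * l)) * X"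
            unfolding X_def by (rule nn_integral_cmult) simp
          finally show ?thesis .
        qed
        have const: "(\<integral>\<^sup>+x0. 1 * J (2 * l) u x0 \<partial>lborel) =
            ennreal (V (2 * l)) * (\<integral>\<^sup>+x. indicator \<Omega> x * u x \<partial>lborel)"
          if [measurable]: "u \<in> borel_measurable borel" for u
        proof -
          have "(\<integral>\<^sup>+x0. 1 * J (2 * l) u x0 \<partial>lborel) =
              (\<integral>\<^sup>+x. (indicator \<Omega> x * u x) * (\<integral>\<^sup>+x0. 1 * indicator (ball x (2 * l)) x0 \<partial>lborel) \<partial>lborel)"
            unfolding J_def by (rule averaged_integral) simp_all
          also have "\<dots> = (\<integral>\<^sup>+x. ennreal (V (2 * l)) * (indicator \<Omega> x * u x) \<partial>lborel)"
            using V[of "2 * l"] l by (intro nn_integral_cong) (simp add: mult_ac)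
          finally show ?thesis by (simp add: nn_integral_cmult)
        qed
        \<comment> \<open>Finiteness of \<open>X\<close> is what permits the passage to real numbers
          and the subtraction of the absorbed term.\<close>
        have Xfin: "X < \<infinity>"
        proof -
          have "X \<le> (\<integral>\<^sup>+x. ennreal (N\<^sup>2) * (indicator \<Omega> x * F x) \<partial>lborel)"
            unfolding X_def
          proof (rule nn_integral_mono)
            fix x
            have "(trunc N x)\<^sup>2 \<le> N\<^sup>2" using tr0[of x] by (intro power_mono) (auto simp: trunc_def)
            then have "ennreal ((trunc N x)\<^sup>2) * (indicator \<Omega> x * F x) \<le>
                ennreal (N\<^sup>2) * (indicator \<Omega> x * F x)"
              by (intro mult_right_mono ennreal_leI) auto
            then show "indicator \<Omega> x * (ennreal ((trunc N x)\<^sup>2) * F x) \<le>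
                ennreal (N\<^sup>2) * (indicator \<Omega> x * F x)" by (simp add: mult_ac)
          qed
          also have "\<dots> = ennreal (N\<^sup>2) * FO" unfolding FO_def by (rule nn_integral_cmult) simp
          also have "\<dots> < \<infinity>" using False by (auto simp: ennreal_mult_less_top top.not_eq_extremum)
          finally show ?thesis .
        qed
        obtain x' where x': "X = ennreal x'" "x' \<ge> 0" using Xfin by (cases X) auto
        obtain S where S: "FO + GO = ennreal S" "S \<ge> 0" using False by (cases "FO + GO") auto
        have "ennreal (V l / 4) * X \<le> ennreal (2 * exp (- (b * L))) * (ennreal (4 * V (2 * l)) * X)
            + ennreal K * (ennreal (V (2 * l)) * (FO + GO))"
          using lower I upper const[of F] const[of G] unfolding FO_def GO_def
          by (simp add: distrib_left) (meson add_right_mono mult_left_mono order_trans zero_le)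
        then have "V l / 4 * x' \<le> 2 * exp (- (b * L)) * (4 * V (2 * l) * x') + K * (V (2 * l) * S)"
          unfolding x' S using x'(2) S(2) V1 V2 K0
              by (simp add: ennreal_mult[symmetric] ennreal_plus[symmetric] del: ennreal_plus)
        moreover have "8 * exp (- (b * L)) * V (2 * l) * x' \<le> V l / 8 * x'" using eL x'(2)
            by (rule mult_right_mono)
        ultimately have "V l / 8 * x' \<le> K * (V (2 * l) * S)" by (simp add: mult_ac)
        then have "x' \<le> C * S" using V1 by (simp add: C_def field_simps)
        then show ?thesis using x' S C0 unfolding X_def[symmetric]
            by (simp add: ennreal_mult[symmetric] ennreal_leI)
      qed
      \<comment> \<open>The bound does not depend on \<open>N\<close>, so Fatou's lemma removes the
        truncation.\<close>
      have "(\<integral>\<^sup>+x. indicator \<Omega> x * (ennreal ((1 + norm (grad \<Phi> x))\<^sup>2) * F x) \<partial>lborel)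
         = (\<integral>\<^sup>+x. liminf (\<lambda>n. indicator \<Omega> x * (ennreal ((trunc (real (Suc n)) x)\<^sup>2) * F x)) \<partial>lborel)"
      proof (rule nn_integral_cong)
        fix x
        have "eventually (\<lambda>n. trunc (real (Suc n)) x = 1 + norm (grad \<Phi> x)) sequentially"
          using eventually_ge_at_top[of "nat \<lceil>1 + norm (grad \<Phi> x)\<rceil>"]
          by eventually_elim (auto simp: trunc_def min_def)
        then have "(\<lambda>n. indicator \<Omega> x * (ennreal ((trunc (real (Suc n)) x)\<^sup>2) * F x)) \<longlonglongrightarrow> indicator \<Omega> x
            * (ennreal ((1 + norm (grad \<Phi> x))\<^sup>2) * F x)"
          by (intro tendsto_eventually) (auto elim: eventually_mono)
        then show "indicator \<Omega> x * (ennreal ((1 + norm (grad \<Phi> x))\<^sup>2) * F x) =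
            liminf (\<lambda>n. indicator \<Omega> x * (ennreal ((trunc (real (Suc n)) x)\<^sup>2) * F x))"
          by (simp add: lim_imp_Liminf)
      qed
      also have "\<dots> \<le> liminf (\<lambda>n. \<integral>\<^sup>+x. indicator \<Omega> x
          * (ennreal ((trunc (real (Suc n)) x)\<^sup>2) * F x) \<partial>lborel)"
        by (rule nn_integral_liminf) simp
      also have "\<dots> \<le> ennreal C * (FO + GO)"
        by (intro Liminf_le) (auto intro!: always_eventually bound)
      finally show ?thesis unfolding F_def G_def FO_def GO_def .
    qed
  qed
  show ?thesis using C0 main by blast
qed

end

section \<open>Sobolev spaces of Borel functions\<close>

text \<open>The distributional identity g = D_j f - (D_j \<theta>) f. With \<theta> = 0 it is the
  weak derivative, with the weight function as \<theta> it is X_j; the parameter \<theta> lets both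
  families of spaces be treated at once.\<close>

definition twisted_deriv ::
    "(real^'n) set \<Rightarrow> (real^'n \<Rightarrow> real) \<Rightarrow> 'n \<Rightarrow> (real^'n \<Rightarrow> 'b::euclidean_space) \<Rightarrow> (real^'n \<Rightarrow> 'b) \<Rightarrow> bool"
        where
  "twisted_deriv \<Omega> \<theta> j f g \<longleftrightarrow> (\<forall>\<eta>\<in>test_functions \<Omega>.
     (\<integral>x. (partial j \<eta> x + partial j \<theta> x * \<eta> x) *\<^sub>R f x \<partial>lborel) = - (\<integral>x. \<eta> x *\<^sub>R g x \<partial>lborel))"

lemma twisted_test:
  assumes "\<eta> \<in> test_functions \<Omega>" "smooth_on UNIV \<theta>"
  shows "(\<lambda>x. partial j \<eta> x + partial j \<theta> x * \<eta> x) \<in> test_functions \<Omega>"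
  by (intro test_functions_add test_functions_partial test_functions_smooth_mult smooth_on_partial assms)

lemma test_differentiable: "\<eta> \<in> test_functions \<Omega> \<Longrightarrow> \<eta> differentiable at x"
  by (erule test_functionsE) (rule smooth_on_differentiable, auto)

lemma twisted_deriv_add:
  assumes "loc_integrable \<Omega> f" "loc_integrable \<Omega> f'" "loc_integrable \<Omega> g" "loc_integrable \<Omega> g'"
      "smooth_on UNIV \<theta>"
    and "twisted_deriv \<Omega> \<theta> j f g" "twisted_deriv \<Omega> \<theta> j f' g'"
  shows "twisted_deriv \<Omega> \<theta> j (\<lambda>x. f x + f' x) (\<lambda>x. g x + g' x)"
  using assms(6,7) integrable_test[OF assms(1) twisted_test[OF _ assms(5)]]
      integrable_test[OF assms(2) twisted_test[OF _ assms(5)]]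
    integrable_test[OF assms(3)] integrable_test[OF assms(4)]
  unfolding twisted_deriv_def scaleR_add_right by simp

lemma twisted_deriv_mult:
  assumes f: "loc_integrable \<Omega> f" and g: "loc_integrable \<Omega> g" and \<theta>: "smooth_on UNIV \<theta>"
      and a: "smooth_on UNIV a"
    and wd: "twisted_deriv \<Omega> \<theta> j f g"
  shows "twisted_deriv \<Omega> \<theta> j (\<lambda>x. a x *\<^sub>R f x) (\<lambda>x. partial j a x *\<^sub>R f x + a x *\<^sub>R g x)"
  unfolding twisted_deriv_def
proof
  fix \<eta> :: "real^'a \<Rightarrow> real" assume \<eta>: "\<eta> \<in> test_functions \<Omega>"
  have a\<eta>: "(\<lambda>x. a x * \<eta> x) \<in> test_functions \<Omega>" by (rule test_functions_smooth_mult[OF \<eta> a])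
  have da\<eta>: "(\<lambda>x. partial j a x * \<eta> x) \<in> test_functions \<Omega>"
      by (rule test_functions_smooth_mult[OF \<eta> smooth_on_partial[OF a]])
  have p: "partial j (\<lambda>x. a x * \<eta> x) x = a x * partial j \<eta> x + partial j a x * \<eta> x" for x
    using smooth_on_differentiable[OF a] test_differentiable[OF \<eta>] by (intro partial_mult) auto
  have "(\<integral>x. (partial j \<eta> x + partial j \<theta> x * \<eta> x) *\<^sub>R (a x *\<^sub>R f x) \<partial>lborel)
     = (\<integral>x. (partial j (\<lambda>x. a x * \<eta> x) x + partial j \<theta> x * (a x * \<eta> x)) *\<^sub>R f x -
         (partial j a x * \<eta> x) *\<^sub>R f x \<partial>lborel)"
    unfolding p by (intro Bochner_Integration.integral_cong refl) (simp add: algebra_simps)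
  also have "\<dots> = (\<integral>x. (partial j (\<lambda>x. a x * \<eta> x) x + partial j \<theta> x * (a x * \<eta> x)) *\<^sub>R f x \<partial>lborel)
      - (\<integral>x. (partial j a x * \<eta> x) *\<^sub>R f x \<partial>lborel)"
    by (rule Bochner_Integration.integral_diff)
        (rule integrable_test[OF f twisted_test[OF a\<eta> \<theta>]], rule integrable_test[OF f da\<eta>])
  also have "\<dots> = - (\<integral>x. (a x * \<eta> x) *\<^sub>R g x \<partial>lborel) - (\<integral>x. (partial j a x * \<eta> x) *\<^sub>R f x \<partial>lborel)"
    using wd a\<eta> unfolding twisted_deriv_def by simp
  also have "\<dots> = - ((\<integral>x. (partial j a x * \<eta> x) *\<^sub>R f x \<partial>lborel) + (\<integral>x. (a x * \<eta> x) *\<^sub>R g x \<partial>lborel))"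
      by simp
  also have "(\<integral>x. (partial j a x * \<eta> x) *\<^sub>R f x \<partial>lborel) + (\<integral>x. (a x * \<eta> x) *\<^sub>R g x \<partial>lborel)
     = (\<integral>x. (partial j a x * \<eta> x) *\<^sub>R f x + (a x * \<eta> x) *\<^sub>R g x \<partial>lborel)"
    by (rule Bochner_Integration.integral_add[symmetric])
        (rule integrable_test[OF f da\<eta>], rule integrable_test[OF g a\<eta>])
  also have "\<dots> = (\<integral>x. \<eta> x *\<^sub>R (partial j a x *\<^sub>R f x + a x *\<^sub>R g x) \<partial>lborel)"
    by (intro Bochner_Integration.integral_cong refl) (simp add: algebra_simps)
  finally show "(\<integral>x. (partial j \<eta> x + partial j \<theta> x * \<eta> x) *\<^sub>R (a x *\<^sub>R f x) \<partial>lborel)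
     = - (\<integral>x. \<eta> x *\<^sub>R (partial j a x *\<^sub>R f x + a x *\<^sub>R g x) \<partial>lborel)" .
qed

lemma twisted_deriv_switch:
  assumes f: "loc_integrable \<Omega> f" and g: "loc_integrable \<Omega> g"
    and \<theta>1: "smooth_on UNIV \<theta>1" and a: "smooth_on UNIV a" "\<And>x. a x = partial j \<theta>1 x - partial j \<theta>2 x"
    and wd: "twisted_deriv \<Omega> \<theta>1 j f g"
  shows "twisted_deriv \<Omega> \<theta>2 j f (\<lambda>x. g x + a x *\<^sub>R f x)"
  unfolding twisted_deriv_def
proof
  fix \<eta> :: "real^'a \<Rightarrow> real" assume \<eta>: "\<eta> \<in> test_functions \<Omega>"
  have a\<eta>: "(\<lambda>x. a x * \<eta> x) \<in> test_functions \<Omega>" by (rule test_functions_smooth_mult[OF \<eta> a(1)])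
  have "(\<integral>x. (partial j \<eta> x + partial j \<theta>2 x * \<eta> x) *\<^sub>R f x \<partial>lborel)
      = (\<integral>x. (partial j \<eta> x + partial j \<theta>1 x * \<eta> x) *\<^sub>R f x - (a x * \<eta> x) *\<^sub>R f x \<partial>lborel)"
    by (intro Bochner_Integration.integral_cong refl) (simp add: a(2) algebra_simps)
  also have "\<dots> = (\<integral>x. (partial j \<eta> x + partial j \<theta>1 x * \<eta> x) *\<^sub>R f x \<partial>lborel)
      - (\<integral>x. (a x * \<eta> x) *\<^sub>R f x \<partial>lborel)"
    by (rule Bochner_Integration.integral_diff)
        (rule integrable_test[OF f twisted_test[OF \<eta> \<theta>1]], rule integrable_test[OF f a\<eta>])
  also have "\<dots> = - ((\<integral>x. \<eta> x *\<^sub>R g x \<partial>lborel) + (\<integral>x. (a x * \<eta> x) *\<^sub>R f x \<partial>lborel))"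
    using wd \<eta> unfolding twisted_deriv_def by simp
  also have "(\<integral>x. \<eta> x *\<^sub>R g x \<partial>lborel) + (\<integral>x. (a x * \<eta> x) *\<^sub>R f x \<partial>lborel) =
      (\<integral>x. \<eta> x *\<^sub>R g x + (a x * \<eta> x) *\<^sub>R f x \<partial>lborel)"
    by (rule Bochner_Integration.integral_add[symmetric])
        (rule integrable_test[OF g \<eta>], rule integrable_test[OF f a\<eta>])
  also have "\<dots> = (\<integral>x. \<eta> x *\<^sub>R (g x + a x *\<^sub>R f x) \<partial>lborel)"
    by (intro Bochner_Integration.integral_cong refl) (simp add: algebra_simps)
  finally show "(\<integral>x. (partial j \<eta> x + partial j \<theta>2 x * \<eta> x) *\<^sub>R f x \<partial>lborel) =
      - (\<integral>x. \<eta> x *\<^sub>R (g x + a x *\<^sub>R f x) \<partial>lborel)" .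
qed

text \<open>Conjugation by e^(-\<theta>) turns D_j - D_j \<theta> into D_j, as seen by testing with
  e^(-\<theta>) \<zeta>. This carries the inequality for D over to X.\<close>

lemma twisted_deriv_conjugate:
  assumes \<theta>: "smooth_on UNIV \<theta>" and wd: "twisted_deriv \<Omega> \<theta> j f g"
  shows "weak_deriv \<Omega> j (\<lambda>x. exp (- \<theta> x) *\<^sub>R f x) (\<lambda>x. exp (- \<theta> x) *\<^sub>R g x)"
  unfolding weak_deriv_def
proof
  fix \<zeta> :: "real^'a \<Rightarrow> real" assume \<zeta>: "\<zeta> \<in> test_functions \<Omega>"
  have e: "smooth_on UNIV (\<lambda>x. exp (- \<theta> x))" by (intro smooth_on_exp smooth_on_minus \<theta> open_UNIV)
  define \<eta> where "\<eta> x = exp (- \<theta> x) * \<zeta> x" for x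
  have \<eta>: "\<eta> \<in> test_functions \<Omega>" unfolding \<eta>_def[abs_def] by (rule test_functions_smooth_mult[OF \<zeta> e])
  have d\<theta>: "\<theta> differentiable at x" for x using smooth_on_differentiable[OF \<theta>] by simp
  have "((\<lambda>x. exp (- \<theta> x)) has_derivative (\<lambda>v. exp (- \<theta> x) * (- (v \<bullet> grad \<theta> x)))) (at x)" for x
    by (auto intro!: derivative_eq_intros has_derivative_grad[OF d\<theta>])
  from partial_eqI[OF this] have pe: "partial j (\<lambda>x. exp (- \<theta> x)) x = - exp (- \<theta> x) * partial j \<theta> x"
      for x
    by (simp add: inner_axis' grad_def)
  have p: "partial j \<eta> x = exp (- \<theta> x) * partial j \<zeta> x - exp (- \<theta> x) * partial j \<theta> x * \<zeta> x" for x
    unfolding \<eta>_def[abs_def] using smooth_on_differentiable[OF e, of x] test_differentiable[OF \<zeta>, of x]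
    by (subst partial_mult) (auto simp: pe)
  have "(\<integral>x. partial j \<zeta> x *\<^sub>R (exp (- \<theta> x) *\<^sub>R f x) \<partial>lborel) =
      (\<integral>x. (partial j \<eta> x + partial j \<theta> x * \<eta> x) *\<^sub>R f x \<partial>lborel)"
    by (intro Bochner_Integration.integral_cong refl) (simp add: p, simp add: \<eta>_def algebra_simps)
  also have "\<dots> = - (\<integral>x. \<eta> x *\<^sub>R g x \<partial>lborel)" using wd \<eta> unfolding twisted_deriv_def by simp
  also have "(\<integral>x. \<eta> x *\<^sub>R g x \<partial>lborel) = (\<integral>x. \<zeta> x *\<^sub>R (exp (- \<theta> x) *\<^sub>R g x) \<partial>lborel)"
    by (intro Bochner_Integration.integral_cong refl) (simp add: \<eta>_def mult.commute)
  finally show "(\<integral>x. partial j \<zeta> x *\<^sub>R (exp (- \<theta> x) *\<^sub>R f x) \<partial>lborel) =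
      - (\<integral>x. \<zeta> x *\<^sub>R (exp (- \<theta> x) *\<^sub>R g x) \<partial>lborel)" .
qed

lemma twisted_deriv_0: "twisted_deriv \<Omega> (\<lambda>x. 0) j f g \<longleftrightarrow> weak_deriv \<Omega> j f g"
  by (simp add: twisted_deriv_def weak_deriv_def)

lemma loc_integrable_smooth_mult:
  assumes f: "loc_integrable \<Omega> f" and a: "smooth_on UNIV a"
  shows "loc_integrable \<Omega> (\<lambda>x. a x *\<^sub>R f x)"
  unfolding loc_integrable_def
proof (intro conjI allI impI)
  have c: "continuous_on UNIV a" by (rule smooth_on_continuous_on[OF a])
  have [measurable]: "a \<in> borel_measurable borel" by (rule borel_measurable_continuous_onI[OF c])
  have [measurable]: "f \<in> borel_measurable borel" using f by (simp add: loc_integrable_def)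
  show "(\<lambda>x. a x *\<^sub>R f x) \<in> borel_measurable borel" by simp
  fix K assume K: "compact K" "K \<subseteq> \<Omega>"
  have [measurable]: "K \<in> sets borel" using K by (simp add: borel_compact)
  have "bounded (a ` K)" using K c by (intro compact_imp_bounded compact_continuous_image)
      (auto intro: continuous_on_subset)
  then obtain B where "\<forall>y\<in>a ` K. norm y \<le> B" unfolding bounded_iff by blast
  then have B: "\<And>x. x \<in> K \<Longrightarrow> \<bar>a x\<bar> \<le> B" by simp
  have "integrable lborel (\<lambda>x. (indicator K x * a x) *\<^sub>R f x)"
    by (rule loc_integrable_mult[OF f, of _ "max 0 B" K]) (use K B in \<open>force simp: indicator_def\<close>)+
  then show "integrable lborel (\<lambda>x. indicator K x *\<^sub>R (a x *\<^sub>R f x))" by simp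
qed

section \<open>Sobolev bounds, and multipliers that cost one derivative\<close>

context weighted_domain
begin

definition energy :: "(real^'n \<Rightarrow> 'b::euclidean_space) \<Rightarrow> ennreal" where
  "energy f = (\<integral>\<^sup>+x. indicator \<Omega> x * wsq (\<lambda>x. (norm (f x))\<^sup>2) x \<partial>lborel)"

lemma dom_borel [measurable]: "\<Omega> \<in> sets borel"
  using open_dom by simp

lemma energy_add:
  assumes [measurable]: "f \<in> borel_measurable borel" "g \<in> borel_measurable borel"
  shows "energy (\<lambda>x. f x + g x) \<le> 2 * energy f + 2 * energy g"
proof -
  have "energy (\<lambda>x. f x + g x) \<le> (\<integral>\<^sup>+x. 2 * (indicator \<Omega> x * wsq (\<lambda>x. (norm (f x))\<^sup>2) x)
      + 2 * (indicator \<Omega> x * wsq (\<lambda>x. (norm (g x))\<^sup>2) x) \<partial>lborel)"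
    unfolding energy_def
  proof (rule nn_integral_mono)
    fix x
    have "(norm (f x + g x))\<^sup>2 \<le> (norm (f x) + norm (g x))\<^sup>2"
        by (intro power_mono norm_triangle_ineq) auto
    also have "\<dots> \<le> 2 * (norm (f x))\<^sup>2 + 2 * (norm (g x))\<^sup>2"
      using sum_squares_bound[of "norm (f x)" "norm (g x)"] by (simp add: power2_sum)
    finally have P: "(norm (f x + g x))\<^sup>2 \<le> 2 * (norm (f x))\<^sup>2 + 2 * (norm (g x))\<^sup>2" .
    have "wsq (\<lambda>x. (norm (f x + g x))\<^sup>2) x \<le> ennreal (2 * ((norm (f x))\<^sup>2 * exp (- \<Phi> x))
        + 2 * ((norm (g x))\<^sup>2 * exp (- \<Phi> x)))"
      unfolding wsq_def using mult_right_mono[OF P, of "exp (- \<Phi> x)"]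
          by (intro ennreal_leI) (simp add: algebra_simps)
    also have "\<dots> = 2 * wsq (\<lambda>x. (norm (f x))\<^sup>2) x + 2 * wsq (\<lambda>x. (norm (g x))\<^sup>2) x"
      unfolding wsq_def by (subst ennreal_plus) (auto simp: ennreal_mult)
    finally show "indicator \<Omega> x * wsq (\<lambda>x. (norm (f x + g x))\<^sup>2) x \<le>
        2 * (indicator \<Omega> x * wsq (\<lambda>x. (norm (f x))\<^sup>2) x)
        + 2 * (indicator \<Omega> x * wsq (\<lambda>x. (norm (g x))\<^sup>2) x)"
      by (auto simp: indicator_def)
  qed
  also have "\<dots> = 2 * energy f + 2 * energy g"
    unfolding energy_def by (subst nn_integral_add, simp, simp, subst nn_integral_cmult, simp, subst
        nn_integral_cmult, simp_all)
  finally show ?thesis .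
qed

text \<open>Cauchy-Schwarz after inserting e^(\<Phi>/2) e^(-\<Phi>/2). Since \<Phi> is defined on
  the whole space, it is bounded on the compact closure of \<open>Z\<close>. Test functions and
  indicators of bounded open sets are both covered.\<close>

lemma functional_bound:
  assumes [measurable]: "a \<in> borel_measurable borel" and a: "\<And>x. \<bar>a x\<bar> \<le> B" "\<And>x. x \<notin> Z \<Longrightarrow> a x = 0"
    and Z: "bounded Z" "Z \<subseteq> \<Omega>"
  shows "\<exists>M\<ge>0. \<forall>f :: real^'n \<Rightarrow> 'b::euclidean_space. f \<in> borel_measurable borel \<longrightarrow>
    (\<integral>\<^sup>+x. ennreal (norm (a x *\<^sub>R f x)) \<partial>lborel)\<^sup>2 \<le> ennreal M * energy f"
proof -
  have [measurable]: "\<Phi> \<in> borel_measurable borel" by (rule borel_Phi)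
  let ?K = "closure Z"
  have K: "compact ?K" using Z(1) by (simp add: compact_closure)
  have "bounded (\<Phi> ` ?K)" using K by (intro compact_imp_bounded compact_continuous_image cont_Phi)
  then obtain T where "\<forall>y\<in>\<Phi> ` ?K. norm y \<le> T" unfolding bounded_iff by blast
  then have T: "\<And>x. x \<in> Z \<Longrightarrow> \<Phi> x \<le> T" using closure_subset by force
  define M where "M = B\<^sup>2 * exp T * measure lborel ?K"
  have M0: "M \<ge> 0" by (simp add: M_def)
  have fin: "(\<integral>\<^sup>+x. (ennreal (\<bar>a x\<bar> * exp (\<Phi> x / 2)))\<^sup>2 \<partial>lborel) \<le> ennreal M"
  proof -
    have "(\<integral>\<^sup>+x. (ennreal (\<bar>a x\<bar> * exp (\<Phi> x / 2)))\<^sup>2 \<partial>lborel) \<le>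
        (\<integral>\<^sup>+x. ennreal (B\<^sup>2 * exp T) * indicator ?K x \<partial>lborel)"
    proof (rule nn_integral_mono)
      fix x
      show "(ennreal (\<bar>a x\<bar> * exp (\<Phi> x / 2)))\<^sup>2 \<le> ennreal (B\<^sup>2 * exp T) * indicator ?K x"
      proof (cases "x \<in> Z")
        case True
        then have "x \<in> ?K" using closure_subset by blast
        have "(\<bar>a x\<bar> * exp (\<Phi> x / 2))\<^sup>2 = \<bar>a x\<bar>\<^sup>2 * exp (\<Phi> x)"
          by (simp add: power_mult_distrib exp_double[symmetric])
        also have "\<dots> \<le> B\<^sup>2 * exp T" using a(1)[of x] T[OF True] by (intro mult_mono power_mono) auto
        finally show ?thesis using \<open>x \<in> ?K\<close> by (simp add: ennreal_power ennreal_leI)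
      qed (simp add: a(2))
    qed
    also have "\<dots> = ennreal (B\<^sup>2 * exp T) * emeasure lborel ?K" by (rule nn_integral_cmult_indicator) simp
    also have "emeasure lborel ?K = ennreal (measure lborel ?K)"
      using emeasure_compact_finite[OF K] by (simp add: emeasure_eq_ennreal_measure)
    finally show ?thesis by (simp add: M_def ennreal_mult)
  qed
  have "(\<integral>\<^sup>+x. ennreal (norm (a x *\<^sub>R f x)) \<partial>lborel)\<^sup>2 \<le> ennreal M * energy f"
    if [measurable]: "f \<in> borel_measurable borel" for f :: "real^'n \<Rightarrow> 'b"
  proof -
    have h: "exp (\<Phi> x / 2) * exp (- (\<Phi> x / 2)) = 1" for x by (simp add: exp_minus)
    have "(\<integral>\<^sup>+x. ennreal (norm (a x *\<^sub>R f x)) \<partial>lborel)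
       = (\<integral>\<^sup>+x. ennreal (\<bar>a x\<bar> * exp (\<Phi> x / 2)) *
           (indicator \<Omega> x * ennreal (norm (f x) * exp (- \<Phi> x / 2))) \<partial>lborel)"
    proof (rule nn_integral_cong)
      fix x
      show "ennreal (norm (a x *\<^sub>R f x)) = ennreal (\<bar>a x\<bar> * exp (\<Phi> x / 2))
          * (indicator \<Omega> x * ennreal (norm (f x) * exp (- \<Phi> x / 2)))"
      proof (cases "x \<in> Z")
        case True
        have "(\<bar>a x\<bar> * exp (\<Phi> x / 2)) * (norm (f x) * exp (- \<Phi> x / 2)) =
            \<bar>a x\<bar> * norm (f x) * (exp (\<Phi> x / 2) * exp (- \<Phi> x / 2))"
          by (simp only: mult_ac)
        then have "ennreal (norm (a x *\<^sub>R f x)) =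
            ennreal ((\<bar>a x\<bar> * exp (\<Phi> x / 2)) * (norm (f x) * exp (- \<Phi> x / 2)))"
          by (simp add: h)
        also have "\<dots> = ennreal (\<bar>a x\<bar> * exp (\<Phi> x / 2)) * ennreal (norm (f x) * exp (- \<Phi> x / 2))"
          by (rule ennreal_mult) auto
        finally show ?thesis using True Z(2) by (simp add: subsetD)
      qed (simp add: a(2))
    qed
    then have "(\<integral>\<^sup>+x. ennreal (norm (a x *\<^sub>R f x)) \<partial>lborel)\<^sup>2 \<le>
        (\<integral>\<^sup>+x. (ennreal (\<bar>a x\<bar> * exp (\<Phi> x / 2)))\<^sup>2 \<partial>lborel)
       * (\<integral>\<^sup>+x. (indicator \<Omega> x * ennreal (norm (f x) * exp (- \<Phi> x / 2)))\<^sup>2 \<partial>lborel)"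
      by (simp only:) (rule Cauchy_Schwarz_nn_integral, simp_all)
    also have "(\<integral>\<^sup>+x. (indicator \<Omega> x * ennreal (norm (f x) * exp (- \<Phi> x / 2)))\<^sup>2 \<partial>lborel) = energy f"
      unfolding energy_def wsq_def
      by (intro nn_integral_cong) (auto simp: indicator_def ennreal_power power_mult_distrib
          exp_double[symmetric])
    finally show ?thesis using fin by (meson mult_right_mono order_trans zero_le)
  qed
  then show ?thesis using M0 by blast
qed

lemma energy_loc_integrable:
  fixes f :: "real^'n \<Rightarrow> 'b::euclidean_space"
  assumes [measurable]: "f \<in> borel_measurable borel" and fin: "energy f < \<infinity>"
  shows "loc_integrable \<Omega> f"
  unfolding loc_integrable_def
proof (intro conjI allI impI)
  show "f \<in> borel_measurable borel" by simp
  fix K assume K: "compact K" "K \<subseteq> \<Omega>"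
  have [measurable]: "K \<in> sets borel" using K by (simp add: borel_compact)
  have "\<exists>M\<ge>0. \<forall>f :: real^'n \<Rightarrow> 'b. f \<in> borel_measurable borel \<longrightarrow>
    (\<integral>\<^sup>+x. ennreal (norm (indicator K x *\<^sub>R f x)) \<partial>lborel)\<^sup>2 \<le> ennreal M * energy f"
    by (rule functional_bound[where B=1 and Z=K])
        (use compact_imp_bounded[OF K(1)] K(2) in \<open>auto simp: indicator_def\<close>)
  then obtain M where "(\<integral>\<^sup>+x. ennreal (norm (indicator K x *\<^sub>R f x)) \<partial>lborel)\<^sup>2 \<le> ennreal M * energy f"
    using assms(1) by blast
  also have "\<dots> < \<infinity>" using fin by (simp add: ennreal_mult_less_top)
  finally have "(\<integral>\<^sup>+x. ennreal (norm (indicator K x *\<^sub>R f x)) \<partial>lborel) < \<infinity>"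
    by (auto simp: power_less_top_ennreal)
  then show "integrable lborel (\<lambda>x. indicator K x *\<^sub>R f x)" by (intro integrableI_bounded) auto
qed

text \<open>One number bounds the norm of every iterated derivative of order at most
  \<open>k\<close>, in every ordering of the directions. The existential quantifier avoids choosing
  derivatives, and a single bound survives the inductions on \<open>k\<close> with explicit
  constants. Up to a factor this is the Sobolev norm, by \<open>sobolev_imp_sob_bd\<close> and
  \<open>sob_bd_imp_sobolev\<close>.\<close>

primrec sob_bd :: "(real^'n \<Rightarrow> real) \<Rightarrow> nat \<Rightarrow> (real^'n \<Rightarrow> 'b::euclidean_space) \<Rightarrow> real \<Rightarrow> bool" where
  "sob_bd \<theta> 0 f b \<longleftrightarrow> f \<in> borel_measurable borel \<and> energy f \<le> ennreal (b\<^sup>2)"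
| "sob_bd \<theta> (Suc k) f b \<longleftrightarrow> f \<in> borel_measurable borel \<and> energy f \<le> ennreal (b\<^sup>2) \<and>
     (\<forall>j. \<exists>g. twisted_deriv \<Omega> \<theta> j f g \<and> sob_bd \<theta> k g b)"

lemma sob_bdD: "sob_bd \<theta> k f b \<Longrightarrow> f \<in> borel_measurable borel \<and> energy f \<le> ennreal (b\<^sup>2)"
  by (cases k) auto

lemma sob_bd_loc_integrable: "sob_bd \<theta> k f b \<Longrightarrow> loc_integrable \<Omega> f"
  using sob_bdD[of \<theta> k f b] by (intro energy_loc_integrable) (auto intro: le_less_trans)

lemma sob_bd_SucD: "sob_bd \<theta> (Suc k) f b \<Longrightarrow> sob_bd \<theta> k f b"
proof (induction k arbitrary: f)
  case (Suc k)
  then show ?case by (metis sob_bd.simps(2))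
qed simp

lemma sob_bd_le: "sob_bd \<theta> k f b \<Longrightarrow> l \<le> k \<Longrightarrow> sob_bd \<theta> l f b"
proof (induction k)
  case (Suc k)
  then show ?case using sob_bd_SucD[of \<theta> k f b] by (cases "l = Suc k") auto
qed simp

lemma energy_bd_mono: "energy f \<le> ennreal (b\<^sup>2) \<Longrightarrow> 0 \<le> b \<Longrightarrow> b \<le> b' \<Longrightarrow> energy f \<le> ennreal (b'\<^sup>2)"
  by (meson ennreal_leI order_trans power_mono)

lemma sob_bd_mono: "sob_bd \<theta> k f b \<Longrightarrow> 0 \<le> b \<Longrightarrow> b \<le> b' \<Longrightarrow> sob_bd \<theta> k f b'"
proof (induction k arbitrary: f)
  case 0
  then show ?case using energy_bd_mono by auto
next
  case (Suc k)
  then have "energy f \<le> ennreal (b'\<^sup>2)" using energy_bd_mono[of f b b'] by simp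
  then show ?case using Suc by (metis sob_bd.simps(2))
qed

lemma energy_add_bd:
  assumes "f \<in> borel_measurable borel" "g \<in> borel_measurable borel"
    and "energy f \<le> ennreal (b1\<^sup>2)" "energy g \<le> ennreal (b2\<^sup>2)" "0 \<le> b1" "0 \<le> b2"
  shows "energy (\<lambda>x. f x + g x) \<le> ennreal ((2 * (b1 + b2))\<^sup>2)"
proof -
  have "energy (\<lambda>x. f x + g x) \<le> 2 * energy f + 2 * energy g" by (rule energy_add) (use assms in auto)
  also have "\<dots> \<le> 2 * ennreal (b1\<^sup>2) + 2 * ennreal (b2\<^sup>2)" using assms
      by (intro add_mono mult_left_mono) auto
  also have "\<dots> = ennreal (2 * b1\<^sup>2 + 2 * b2\<^sup>2)" by (subst ennreal_plus) (auto simp: ennreal_mult)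
  also have "\<dots> \<le> ennreal ((2 * (b1 + b2))\<^sup>2)"
    using assms mult_nonneg_nonneg[of b1 b2] by (intro ennreal_leI)
        (simp add: power2_eq_square algebra_simps)
  finally show ?thesis .
qed

lemma sob_bd_add:
  assumes \<theta>: "smooth_on UNIV \<theta>" and b: "0 \<le> b1" "0 \<le> b2"
  shows "sob_bd \<theta> k f b1 \<Longrightarrow> sob_bd \<theta> k g b2 \<Longrightarrow> sob_bd \<theta> k (\<lambda>x. f x + g x) (2 * (b1 + b2))"
proof (induction k arbitrary: f g)
  case 0
  then show ?case using energy_add_bd[of f g b1 b2] b by auto
next
  case (Suc k)
  have "\<exists>h. twisted_deriv \<Omega> \<theta> j (\<lambda>x. f x + g x) h \<and> sob_bd \<theta> k h (2 * (b1 + b2))" for j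
  proof -
    obtain f' g' where fg: "twisted_deriv \<Omega> \<theta> j f f'" "sob_bd \<theta> k f' b1" "twisted_deriv \<Omega> \<theta> j g g'"
        "sob_bd \<theta> k g' b2"
      using Suc.prems by (metis sob_bd.simps(2))
    then show ?thesis using Suc.prems
      by (intro exI[of _ "\<lambda>x. f' x + g' x"] conjI twisted_deriv_add Suc.IH \<theta>)
          (auto intro: sob_bd_loc_integrable simp del: sob_bd.simps)
  qed
  moreover have "energy (\<lambda>x. f x + g x) \<le> ennreal ((2 * (b1 + b2))\<^sup>2)"
    using Suc.prems b by (intro energy_add_bd) auto
  moreover have "(\<lambda>x. f x + g x) \<in> borel_measurable borel"
    using Suc.prems by (intro borel_measurable_add) auto
  ultimately show ?case unfolding sob_bd.simps(2) by blast
qed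

text \<open>The multipliers in view are plus or minus the first derivatives of \<Phi>, with
  \<open>p = m - 1\<close>.\<close>

definition mult_bd :: "nat \<Rightarrow> real \<Rightarrow> (real^'n \<Rightarrow> real) \<Rightarrow> bool" where
  "mult_bd p A a \<longleftrightarrow> smooth_on UNIV a \<and>
     (\<forall>js. length js \<le> p \<longrightarrow> (\<forall>x\<in>\<Omega>. \<bar>foldr partial js a x\<bar> \<le> A * (1 + norm (grad \<Phi> x))))"

lemma mult_bd_partial: "mult_bd (Suc p) A a \<Longrightarrow> mult_bd p A (partial j a)"
  unfolding mult_bd_def
proof (intro conjI allI impI ballI)
  fix js :: "'n list" and x
  assume a: "smooth_on UNIV a \<and> (\<forall>js. length js \<le> Suc p \<longrightarrow>
      (\<forall>x\<in>\<Omega>. \<bar>foldr partial js a x\<bar> \<le> A * (1 + norm (grad \<Phi> x))))"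
    and js: "length js \<le> p" "x \<in> \<Omega>"
  then have "\<bar>foldr partial (js @ [j]) a x\<bar> \<le> A * (1 + norm (grad \<Phi> x))"
      by (metis Suc_le_mono length_append_singleton)
  then show "\<bar>foldr partial js (partial j a) x\<bar> \<le> A * (1 + norm (grad \<Phi> x))" by simp
qed (simp add: smooth_on_partial)

lemma mult_bd_le: "mult_bd p A a \<Longrightarrow> q \<le> p \<Longrightarrow> mult_bd q A a"
  by (auto simp: mult_bd_def)

definition grad_energy :: "(real^'n \<Rightarrow> 'b::euclidean_space) \<Rightarrow> ennreal" where
  "grad_energy f = (\<integral>\<^sup>+x. indicator \<Omega> x * (ennreal ((1 + norm (grad \<Phi> x))\<^sup>2)
      * wsq (\<lambda>x. (norm (f x))\<^sup>2) x) \<partial>lborel)"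

lemma energy_mult:
  fixes f :: "real^'n \<Rightarrow> 'b::euclidean_space"
  assumes a: "mult_bd p A a" and A: "A \<ge> 0" and [measurable]: "f \<in> borel_measurable borel"
    and H: "grad_energy f \<le> ennreal ((C * b)\<^sup>2)"
  shows "energy (\<lambda>x. a x *\<^sub>R f x) \<le> ennreal ((C * A * b)\<^sup>2)"
proof -
  have bd: "\<bar>a x\<bar> \<le> A * (1 + norm (grad \<Phi> x))" if "x \<in> \<Omega>" for x
    using a that unfolding mult_bd_def by (metis foldr.simps(1) id_apply le0 list.size(3))
  have "energy (\<lambda>x. a x *\<^sub>R f x) \<le> (\<integral>\<^sup>+x. ennreal (A\<^sup>2)
      * (indicator \<Omega> x * (ennreal ((1 + norm (grad \<Phi> x))\<^sup>2) * wsq (\<lambda>x. (norm (f x))\<^sup>2) x)) \<partial>lborel)"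
    unfolding energy_def
  proof (rule nn_integral_mono)
    fix x
    show "indicator \<Omega> x * wsq (\<lambda>x. (norm (a x *\<^sub>R f x))\<^sup>2) x \<le>
        ennreal (A\<^sup>2) * (indicator \<Omega> x * (ennreal ((1 + norm (grad \<Phi> x))\<^sup>2) * wsq (\<lambda>x. (norm (f x))\<^sup>2)
        x))"
    proof (cases "x \<in> \<Omega>")
      case True
      have "\<bar>a x\<bar>\<^sup>2 \<le> (A * (1 + norm (grad \<Phi> x)))\<^sup>2" using bd[OF True] by (intro power_mono) auto
      then have "\<bar>a x\<bar>\<^sup>2 * ((norm (f x))\<^sup>2 * exp (- \<Phi> x)) \<le>
          (A * (1 + norm (grad \<Phi> x)))\<^sup>2 * ((norm (f x))\<^sup>2 * exp (- \<Phi> x))"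
        by (intro mult_right_mono) auto
      then show ?thesis using True
        by (simp add: wsq_def ennreal_mult[symmetric] power_mult_distrib mult.assoc ennreal_leI)
    qed simp
  qed
  also have "\<dots> = ennreal (A\<^sup>2) * grad_energy f"
  proof -
    have [measurable]: "grad \<Phi> \<in> borel_measurable borel"
        "wsq (\<lambda>x. (norm (f x))\<^sup>2) \<in> borel_measurable borel"
      by (rule borel_grad, rule borel_wsq, simp)
    show ?thesis unfolding grad_energy_def by (rule nn_integral_cmult) simp
  qed
  also have "\<dots> \<le> ennreal (A\<^sup>2) * ennreal ((C * b)\<^sup>2)" by (rule mult_left_mono[OF H]) simp
  also have "\<dots> = ennreal ((C * A * b)\<^sup>2)" by (simp add: ennreal_mult[symmetric] power_mult_distrib
      mult_ac)
  finally show ?thesis .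
qed

lemma smooth_borel: "smooth_on UNIV a \<Longrightarrow> a \<in> borel_measurable borel"
  by (rule borel_measurable_continuous_onI) (rule smooth_on_continuous_on)

text \<open>At order 0 this is the Hardy inequality, passed as the hypothesis \<open>H\<close> so
  that D and X are served alike. Higher orders follow from the product rule, since derivatives of
  \<open>a\<close> are multipliers of the same kind.\<close>

lemma sob_bd_mult:
  assumes \<theta>: "smooth_on UNIV \<theta>" and C: "C \<ge> 0"
    and H: "\<And>(f :: real^'n \<Rightarrow> 'b::euclidean_space) b. sob_bd \<theta> (Suc 0) f b \<Longrightarrow>
        grad_energy f \<le> ennreal ((C * b)\<^sup>2)"
  shows "\<exists>D\<ge>0. \<forall>(f :: real^'n \<Rightarrow> 'b) a b A. 0 \<le> b \<longrightarrow> 0 \<le> A \<longrightarrow> sob_bd \<theta> (Suc k) f b \<longrightarrow> mult_bd k A a \<longrightarrow>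
    sob_bd \<theta> k (\<lambda>x. a x *\<^sub>R f x) (D * A * b)"
proof (induction k)
  case 0
  have "sob_bd \<theta> 0 (\<lambda>x. a x *\<^sub>R f x) (C * A * b)"
    if "0 \<le> b" "0 \<le> A" "sob_bd \<theta> (Suc 0) f b" "mult_bd 0 A a" for f :: "real^'n \<Rightarrow> 'b" and a b A
  proof -
    have [measurable]: "f \<in> borel_measurable borel" using that by simp
    have [measurable]: "a \<in> borel_measurable borel" using that
        by (intro smooth_borel) (simp add: mult_bd_def)
    show ?thesis using energy_mult[OF that(4,2) _ H[OF that(3)]] by simp
  qed
  then show ?case using C by blast
next
  case (Suc k)
  then obtain D where D: "D \<ge> 0" "\<And>(f :: real^'n \<Rightarrow> 'b) a b A. 0 \<le> b \<Longrightarrow> 0 \<le> A \<Longrightarrow> sob_bd \<theta> (Suc k) f b \<Longrightarrow>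
      mult_bd k A a \<Longrightarrow>
    sob_bd \<theta> k (\<lambda>x. a x *\<^sub>R f x) (D * A * b)" by metis
  \<comment> \<open>The product rule gives two terms with bound \<open>D * A * b\<close> each, and
    \<open>sob_bd_add\<close> doubles their sum.\<close>
  define E where "E = max C (4 * D)"
  have E0: "E \<ge> 0" using C by (simp add: E_def)
  have "sob_bd \<theta> (Suc k) (\<lambda>x. a x *\<^sub>R f x) (E * A * b)"
    if b: "0 \<le> b" and A: "0 \<le> A" and f: "sob_bd \<theta> (Suc (Suc k)) f b" and a: "mult_bd (Suc k) A a"
        for f :: "real^'n \<Rightarrow> 'b" and a b A
  proof -
    have [measurable]: "f \<in> borel_measurable borel" using f by simp
    have sa: "smooth_on UNIV a" using a by (simp add: mult_bd_def)
    have [measurable]: "a \<in> borel_measurable borel" using sa by (rule smooth_borel)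
    have f1: "sob_bd \<theta> (Suc 0) f b" using f by (rule sob_bd_le) simp
    have "energy (\<lambda>x. a x *\<^sub>R f x) \<le> ennreal ((C * A * b)\<^sup>2)" using energy_mult[OF a A _ H[OF f1]]
        by simp
    also have "\<dots> \<le> ennreal ((E * A * b)\<^sup>2)" using C A b
        by (intro ennreal_leI power_mono mult_right_mono) (auto simp: E_def)
    finally have e: "energy (\<lambda>x. a x *\<^sub>R f x) \<le> ennreal ((E * A * b)\<^sup>2)" .
    have "\<exists>h. twisted_deriv \<Omega> \<theta> j (\<lambda>x. a x *\<^sub>R f x) h \<and> sob_bd \<theta> k h (E * A * b)" for j
    proof -
      obtain g where g: "twisted_deriv \<Omega> \<theta> j f g" "sob_bd \<theta> (Suc k) g b" using f
          by (metis sob_bd.simps(2))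
      have 1: "sob_bd \<theta> k (\<lambda>x. partial j a x *\<^sub>R f x) (D * A * b)"
        by (rule D(2)[OF b A sob_bd_SucD[OF f] mult_bd_partial[OF a]])
      have 2: "sob_bd \<theta> k (\<lambda>x. a x *\<^sub>R g x) (D * A * b)"
        by (rule D(2)[OF b A g(2) mult_bd_le[OF a]]) simp
      have nn: "0 \<le> D * A * b" using D A b by simp
      have S: "sob_bd \<theta> k (\<lambda>x. partial j a x *\<^sub>R f x + a x *\<^sub>R g x) (2 * (D * A * b + D * A * b))"
        by (rule sob_bd_add[OF \<theta> nn nn 1 2])
      have L: "2 * (D * A * b + D * A * b) \<le> E * A * b"
      proof -
        have "(4 * D) * (A * b) \<le> E * (A * b)" using A b by (intro mult_right_mono) (auto simp: E_def)
        then show ?thesis by (simp add: mult_ac)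
      qed
      have "sob_bd \<theta> k (\<lambda>x. partial j a x *\<^sub>R f x + a x *\<^sub>R g x) (E * A * b)"
        by (rule sob_bd_mono[OF S _ L]) (intro mult_nonneg_nonneg add_nonneg_nonneg nn, simp)
      then show ?thesis
        using twisted_deriv_mult[OF sob_bd_loc_integrable[OF f] sob_bd_loc_integrable[OF g(2)] \<theta> sa g(1)]
            by blast
    qed
    then show ?thesis using e by simp
  qed
  then show ?case using E0 by blast
qed

text \<open>If \<open>g\<close> is the derivative of \<open>f\<close> with respect to \<theta>1,
  then g + a f is the one with respect to \<theta>2. Multiplication by \<open>a\<close> costs one
  derivative, so this sum is still bounded to one order less than \<open>f\<close> with respect to
  \<theta>1, and the induction hypothesis converts it. Bounds on \<open>p\<close> derivatives of
  \<open>a\<close> thus reach order \<open>Suc p\<close>.\<close>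

lemma sob_bd_switch:
  assumes \<theta>1: "smooth_on UNIV \<theta>1" and C: "C \<ge> 0"
    and H: "\<And>(f :: real^'n \<Rightarrow> 'b::euclidean_space) b. sob_bd \<theta>1 (Suc 0) f b \<Longrightarrow>
        grad_energy f \<le> ennreal ((C * b)\<^sup>2)"
    and A: "A \<ge> 0" and a: "\<And>j. mult_bd p A (a j)" "\<And>j x. a j x = partial j \<theta>1 x - partial j \<theta>2 x"
  shows "k \<le> Suc p \<Longrightarrow> \<exists>D\<ge>0. \<forall>(f :: real^'n \<Rightarrow> 'b) b. 0 \<le> b \<longrightarrow> sob_bd \<theta>1 k f b \<longrightarrow> sob_bd \<theta>2 k f (D * b)"
proof (induction k)
  case 0
  then show ?case by (intro exI[of _ 1]) auto
next
  case (Suc k)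
  then obtain D where D: "D \<ge> 0" "\<And>(f :: real^'n \<Rightarrow> 'b) b. 0 \<le> b \<Longrightarrow> sob_bd \<theta>1 k f b \<Longrightarrow>
      sob_bd \<theta>2 k f (D * b)"
    by auto
  obtain M where M: "M \<ge> 0" "\<And>(f :: real^'n \<Rightarrow> 'b) a b A. 0 \<le> b \<Longrightarrow> 0 \<le> A \<Longrightarrow> sob_bd \<theta>1 (Suc k) f b \<Longrightarrow>
      mult_bd k A a \<Longrightarrow>
    sob_bd \<theta>1 k (\<lambda>x. a x *\<^sub>R f x) (M * A * b)"
    using sob_bd_mult[OF \<theta>1 C H, of k] by metis
  define E where "E = max 1 (D * (2 * (1 + M * A)))"
  have E: "E \<ge> 1" by (simp add: E_def)
  have "sob_bd \<theta>2 (Suc k) f (E * b)" if b: "0 \<le> b" and f: "sob_bd \<theta>1 (Suc k) f b" for f :: "real^'n \<Rightarrow> 'b"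
      and b
  proof -
    have bE: "b \<le> E * b" using E b mult_right_mono[of 1 E b] by simp
    have "energy f \<le> ennreal ((E * b)\<^sup>2)"
      using sob_bdD[OF f] bE b energy_bd_mono by blast
    moreover have "\<exists>h. twisted_deriv \<Omega> \<theta>2 j f h \<and> sob_bd \<theta>2 k h (E * b)" for j
    proof -
      obtain g where g: "twisted_deriv \<Omega> \<theta>1 j f g" "sob_bd \<theta>1 k g b" using f by (metis sob_bd.simps(2))
      have sa: "smooth_on UNIV (a j)" using a(1)[of j] by (simp add: mult_bd_def)
      have aj: "mult_bd k A (a j)" using a(1) by (rule mult_bd_le) (use Suc.prems in simp)
      have nn: "0 \<le> M * A * b" using M A b by simp
      have "sob_bd \<theta>1 k (\<lambda>x. g x + a j x *\<^sub>R f x) (2 * (b + M * A * b))"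
        by (rule sob_bd_add[OF \<theta>1 b nn g(2) M(2)[OF b A f aj]])
      then have "sob_bd \<theta>2 k (\<lambda>x. g x + a j x *\<^sub>R f x) (D * (2 * (b + M * A * b)))"
        using b nn by (intro D(2)) auto
      moreover have "D * (2 * (b + M * A * b)) \<le> E * b"
      proof -
        have "D * (2 * (1 + M * A)) * b \<le> E * b" using b by (intro mult_right_mono) (auto simp: E_def)
        then show ?thesis by (simp add: algebra_simps)
      qed
      moreover have "0 \<le> D * (2 * (b + M * A * b))" using D b nn by simp
      ultimately have "sob_bd \<theta>2 k (\<lambda>x. g x + a j x *\<^sub>R f x) (E * b)" by (metis sob_bd_mono)
      then show ?thesis
        using twisted_deriv_switch[OF sob_bd_loc_integrable[OF f] sob_bd_loc_integrable[OF g(2)] \<theta>1 sa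
            a(2) g(1)] by blast
    qed
    ultimately show ?thesis using f by simp
  qed
  then show ?case using E by (intro exI[of _ E]) auto
qed

lemma hardy_D:
  "\<exists>C\<ge>0. \<forall>(f :: real^'n \<Rightarrow> 'b::euclidean_space) b. sob_bd (\<lambda>x. 0) (Suc 0) f b \<longrightarrow>
      grad_energy f \<le> ennreal ((C * b)\<^sup>2)"
proof -
  obtain C where C: "C > 0" and H: "\<And>(f :: real^'n \<Rightarrow> 'b) g. loc_integrable \<Omega> f \<Longrightarrow>
      (\<And>j. loc_integrable \<Omega> (g j)) \<Longrightarrow>
    (\<And>j. weak_deriv \<Omega> j f (g j)) \<Longrightarrow>
    (\<integral>\<^sup>+x. indicator \<Omega> x * (ennreal ((1 + norm (grad \<Phi> x))\<^sup>2) * wsq (\<lambda>x. (norm (f x))\<^sup>2) x) \<partial>lborel)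
    \<le> ennreal C * ((\<integral>\<^sup>+x. indicator \<Omega> x * wsq (\<lambda>x. (norm (f x))\<^sup>2) x \<partial>lborel)
       + (\<integral>\<^sup>+x. indicator \<Omega> x * wsq (\<lambda>x. \<Sum>j\<in>UNIV. (norm (g j x))\<^sup>2) x \<partial>lborel))"
    using weighted_hardy[where 'b='b] by blast
  let ?n = "real CARD('n)"
  have "grad_energy f \<le> ennreal ((sqrt (C * (1 + ?n)) * b)\<^sup>2)" if f: "sob_bd (\<lambda>x. 0) (Suc 0) f b"
      for f :: "real^'n \<Rightarrow> 'b" and b
  proof -
    obtain g where g: "\<And>j. weak_deriv \<Omega> j f (g j)" "\<And>j. sob_bd (\<lambda>x. 0) 0 (g j) b"
      using f unfolding sob_bd.simps(2) twisted_deriv_0 by metis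
    have lf: "loc_integrable \<Omega> f" by (rule sob_bd_loc_integrable[OF f])
    have lg: "\<And>j. loc_integrable \<Omega> (g j)" by (rule sob_bd_loc_integrable[OF g(2)])
    have [measurable]: "\<And>j. g j \<in> borel_measurable borel" using g(2) by simp
    have "(\<integral>\<^sup>+x. indicator \<Omega> x * wsq (\<lambda>x. \<Sum>j\<in>UNIV. (norm (g j x))\<^sup>2) x \<partial>lborel)
       = (\<integral>\<^sup>+x. (\<Sum>j\<in>UNIV. indicator \<Omega> x * wsq (\<lambda>x. (norm (g j x))\<^sup>2) x) \<partial>lborel)"
      unfolding wsq_def
      by (intro nn_integral_cong) (auto simp: indicator_def sum_distrib_right sum_ennreal)
    also have "\<dots> = (\<Sum>j\<in>UNIV. energy (g j))" unfolding energy_def by (rule nn_integral_sum) simp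
    also have "\<dots> \<le> (\<Sum>j\<in>(UNIV::'n set). ennreal (b\<^sup>2))" using g(2) by (intro sum_mono) simp
    also have "\<dots> = ennreal (?n * b\<^sup>2)" by (simp add: ennreal_mult ennreal_of_nat_eq_real_of_nat)
    finally have 1: "(\<integral>\<^sup>+x. indicator \<Omega> x * wsq (\<lambda>x. \<Sum>j\<in>UNIV. (norm (g j x))\<^sup>2) x \<partial>lborel) \<le>
        ennreal (?n * b\<^sup>2)" .
    have "grad_energy f \<le> ennreal C * (energy f
        + (\<integral>\<^sup>+x. indicator \<Omega> x * wsq (\<lambda>x. \<Sum>j\<in>UNIV. (norm (g j x))\<^sup>2) x \<partial>lborel))"
      unfolding grad_energy_def energy_def by (rule H[OF lf lg g(1)])
    also have "\<dots> \<le> ennreal C * (ennreal (b\<^sup>2) + ennreal (?n * b\<^sup>2))"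
      using 1 sob_bdD[OF f] by (intro mult_left_mono add_mono) auto
    also have "\<dots> = ennreal (C * (b\<^sup>2 + ?n * b\<^sup>2))"
      using C by (simp add: ennreal_plus[symmetric] ennreal_mult[symmetric] del: ennreal_plus)
    also have "C * (b\<^sup>2 + ?n * b\<^sup>2) = (sqrt (C * (1 + ?n)) * b)\<^sup>2"
      using C by (simp add: power_mult_distrib algebra_simps)
    finally show ?thesis .
  qed
  moreover have "sqrt (C * (1 + ?n)) \<ge> 0" using C by simp
  ultimately show ?thesis by blast
qed

lemma grad_minus: "grad (\<lambda>x. - \<Phi> x) x = - grad \<Phi> x"
  by (simp add: grad_def vec_eq_iff partial_minus[OF diff_Phi(1)])

lemma negated: "weighted_domain \<Omega> (\<lambda>x. - \<Phi> x) \<nu> \<rho> H R c"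
proof
  show "smooth_on UNIV (\<lambda>x. - \<Phi> x)" by (intro smooth_on_minus smooth open_UNIV)
  fix x
  have "partial i (\<lambda>x. - \<Phi> x) = (\<lambda>x. - partial i \<Phi> x)" for i
      by (rule ext) (rule partial_minus[OF diff_Phi(1)])
  then have "nabla_norm 2 (\<lambda>x. - \<Phi> x) x = nabla_norm 2 \<Phi> x"
    by (simp add: nabla_norm_2 partial_minus[OF diff_Phi(2)])
  then show "nabla_norm 2 (\<lambda>x. - \<Phi> x) x \<le> H * (1 + norm (grad (\<lambda>x. - \<Phi> x) x))"
    using hess(2)[of x] by (simp add: grad_minus)
qed (use open_dom hess(1) growth rho nu c normal in \<open>simp_all add: grad_minus\<close>)

lemma hardy_X:
  "\<exists>C\<ge>0. \<forall>(f :: real^'n \<Rightarrow> 'b::euclidean_space) b. sob_bd \<Phi> (Suc 0) f b \<longrightarrow>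
      grad_energy f \<le> ennreal ((C * b)\<^sup>2)"
proof -
  interpret neg: weighted_domain \<Omega> "\<lambda>x. - \<Phi> x" \<nu> \<rho> H R c by (rule negated)
  obtain C where C: "C \<ge> 0" and H: "\<And>(f :: real^'n \<Rightarrow> 'b) b. neg.sob_bd (\<lambda>x. 0) (Suc 0) f b \<Longrightarrow>
      neg.grad_energy f \<le> ennreal ((C * b)\<^sup>2)"
    using neg.hardy_D[where 'b='b] by blast
  have [measurable]: "\<Phi> \<in> borel_measurable borel" by (rule borel_Phi)
  let ?E = "\<lambda>f x. exp (- \<Phi> x) *\<^sub>R (f x :: 'b)"
  have m: "?E h \<in> borel_measurable borel" if [measurable]: "h \<in> borel_measurable borel" for h by simp
  have w: "neg.wsq (\<lambda>x. (norm (?E f x))\<^sup>2) x = wsq (\<lambda>x. (norm (f x))\<^sup>2) x" for f x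
  proof -
    have "(norm (?E f x))\<^sup>2 * exp (\<Phi> x) = (norm (f x))\<^sup>2 * (exp (- \<Phi> x) * (exp (- \<Phi> x) * exp (\<Phi> x)))"
      by (simp add: power_mult_distrib power2_eq_square)
    also have "exp (- \<Phi> x) * exp (\<Phi> x) = 1" by (simp add: exp_minus)
    finally show ?thesis by (simp add: neg.wsq_def wsq_def)
  qed
  have e: "neg.energy (?E f) = energy f" for f unfolding neg.energy_def energy_def w ..
  have ge: "neg.grad_energy (?E f) = grad_energy f" for f
    unfolding neg.grad_energy_def grad_energy_def w by (simp add: grad_minus)
  have "grad_energy f \<le> ennreal ((C * b)\<^sup>2)" if f: "sob_bd \<Phi> (Suc 0) f b" for f :: "real^'n \<Rightarrow> 'b" and b
  proof -
    have "\<exists>h. twisted_deriv \<Omega> (\<lambda>x. 0) j (?E f) h \<and> neg.sob_bd (\<lambda>x. 0) 0 h b" for j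
    proof -
      obtain g where g: "twisted_deriv \<Omega> \<Phi> j f g" "sob_bd \<Phi> 0 g b" using f by (metis sob_bd.simps(2))
      have "neg.sob_bd (\<lambda>x. 0) 0 (?E g) b" using g(2) m[of g] unfolding neg.sob_bd.simps sob_bd.simps e
          by blast
      then show ?thesis using twisted_deriv_conjugate[OF smooth g(1)] unfolding twisted_deriv_0 by blast
    qed
    then have "neg.sob_bd (\<lambda>x. 0) (Suc 0) (?E f) b" using f m[of f]
        unfolding neg.sob_bd.simps(2) sob_bd.simps(2) e by blast
    from H[OF this] show ?thesis by (simp add: ge)
  qed
  then show ?thesis using C by blast
qed

end

section \<open>Compactness\<close>

lemma norm_integral_le_nn:
  fixes u :: "'a \<Rightarrow> 'b::euclidean_space"
  shows "ennreal (norm (\<integral>x. u x \<partial>M)) \<le> (\<integral>\<^sup>+x. ennreal (norm (u x)) \<partial>M)"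
  by (cases "integrable M u") (auto intro: integral_norm_bound_ennreal simp: not_integrable_integral_eq)

lemma norm_square_add_le: "(norm (a + b))\<^sup>2 \<le> 2 * (norm a)\<^sup>2 + 2 * (norm b)\<^sup>2"
    for a b :: "'b::real_normed_vector"
proof -
  have "(norm (a + b))\<^sup>2 \<le> (norm a + norm b)\<^sup>2" by (intro power_mono norm_triangle_ineq) auto
  also have "\<dots> \<le> 2 * (norm a)\<^sup>2 + 2 * (norm b)\<^sup>2"
    using sum_squares_bound[of "norm a" "norm b"] by (simp add: power2_sum)
  finally show ?thesis .
qed

text \<open>The difference of \<open>y\<close> and the mean is the mean of the differences;
  Cauchy-Schwarz does the rest.\<close>

lemma average_deviation:
  fixes f :: "'a::euclidean_space \<Rightarrow> 'b::euclidean_space"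
  assumes [measurable]: "Z \<in> sets borel" and V: "emeasure lborel Z = ennreal V" "V > 0"
    and f: "integrable lborel (\<lambda>z. indicator Z z *\<^sub>R f z)" and [measurable]: "f \<in> borel_measurable borel"
  shows "ennreal ((norm (y - (\<integral>z. indicator Z z *\<^sub>R f z \<partial>lborel) /\<^sub>R V))\<^sup>2)
    \<le> ennreal (1 / V) * (\<integral>\<^sup>+z. indicator Z z * ennreal ((norm (f z - y))\<^sup>2) \<partial>lborel)"
proof -
  have mZ: "measure lborel Z = V" using V by (simp add: measure_def)
  have iZ: "integrable lborel (\<lambda>z. indicator Z z *\<^sub>R y)"
    using V by (intro integrable_scaleR_left) simp
  have "(\<integral>z. indicator Z z *\<^sub>R y \<partial>lborel) = V *\<^sub>R y"
    using V mZ by (subst integral_scaleR_left) auto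
  then have "V *\<^sub>R (y - (\<integral>z. indicator Z z *\<^sub>R f z \<partial>lborel) /\<^sub>R V) =
      (\<integral>z. indicator Z z *\<^sub>R y - indicator Z z *\<^sub>R f z \<partial>lborel)"
    using V by (subst Bochner_Integration.integral_diff[OF iZ f])
        (simp add: scaleR_right_diff_distrib del: integral_scaleR_left)
  also have "\<dots> = (\<integral>z. indicator Z z *\<^sub>R (y - f z) \<partial>lborel)" by (simp add: scaleR_right_diff_distrib)
  finally have e: "V * norm (y - (\<integral>z. indicator Z z *\<^sub>R f z \<partial>lborel) /\<^sub>R V) =
      norm (\<integral>z. indicator Z z *\<^sub>R (y - f z) \<partial>lborel)"
    using V(2) by (metis abs_of_pos norm_scaleR)
  let ?n = "norm (y - (\<integral>z. indicator Z z *\<^sub>R f z \<partial>lborel) /\<^sub>R V)"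
  let ?I = "\<integral>\<^sup>+z. indicator Z z * ennreal ((norm (f z - y))\<^sup>2) \<partial>lborel"
  have "ennreal (V * ?n) \<le> (\<integral>\<^sup>+z. ennreal (norm (indicator Z z *\<^sub>R (y - f z))) \<partial>lborel)"
    unfolding e by (rule norm_integral_le_nn)
  also have "\<dots> = (\<integral>\<^sup>+z. indicator Z z * (indicator Z z * ennreal (norm (f z - y))) \<partial>lborel)"
    by (intro nn_integral_cong) (auto simp: indicator_def norm_minus_commute)
  finally have "(ennreal (V * ?n))\<^sup>2 \<le> (\<integral>\<^sup>+z. indicator Z z
      * (indicator Z z * ennreal (norm (f z - y))) \<partial>lborel)\<^sup>2"
    by (rule power_mono) simp
  also have "\<dots> \<le> (\<integral>\<^sup>+z. (indicator Z z)\<^sup>2 \<partial>lborel)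
      * (\<integral>\<^sup>+z. (indicator Z z * ennreal (norm (f z - y)))\<^sup>2 \<partial>lborel)"
    by (rule Cauchy_Schwarz_nn_integral) simp_all
  also have "(\<integral>\<^sup>+z. (indicator Z z)\<^sup>2 \<partial>lborel) = (\<integral>\<^sup>+z. indicator Z z \<partial>lborel)"
    by (intro nn_integral_cong) (auto simp: indicator_def)
  also have "\<dots> = ennreal V" using V by simp
  also have "(\<integral>\<^sup>+z. (indicator Z z * ennreal (norm (f z - y)))\<^sup>2 \<partial>lborel) = ?I"
    by (intro nn_integral_cong) (auto simp: indicator_def ennreal_power)
  finally have "ennreal (V\<^sup>2 * ?n\<^sup>2) \<le> ennreal V * ?I"
    using V(2) by (simp add: ennreal_power power_mult_distrib)
  then have "ennreal (1 / V\<^sup>2) * ennreal (V\<^sup>2 * ?n\<^sup>2) \<le> ennreal (1 / V\<^sup>2) * (ennreal V * ?I)"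
    by (intro mult_left_mono) auto
  also have "\<dots> = ennreal (1 / V) * ?I"
    using V(2) by (simp add: mult.assoc[symmetric] ennreal_mult[symmetric] power2_eq_square)
  also have "ennreal (1 / V\<^sup>2) * ennreal (V\<^sup>2 * ?n\<^sup>2) = ennreal (?n\<^sup>2)"
    using V(2) by (simp add: ennreal_mult[symmetric])
  finally show ?thesis .
qed

text \<open>Each \<open>x\<close> in \<open>P\<close> is compared with the mean of \<open>f\<close>
  over the ball about \<open>xs k + v\<close>, where \<open>xs k\<close> is a net point near
  \<open>x\<close>. The shift by \<open>v\<close> moves these balls away from the boundary even if
  the net point is close to it. Differences z - x with z in such a ball lie in
  \<open>ball v (2 * \<tau>)\<close>, so the deviation is controlled by an average of squared
  translation differences. The volume ratio of the two balls gives the power of 2, the splitting of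
  the square the remaining factor 2.\<close>

lemma net_inequality:
  fixes f :: "real^'n \<Rightarrow> 'b::euclidean_space" and xs :: "nat \<Rightarrow> real^'n"
  assumes f: "loc_integrable \<Omega> f" and g: "\<And>j. loc_integrable \<Omega> (g j)"
      and wd: "\<And>j. weak_deriv \<Omega> j f (g j)"
    and P: "open P" "P \<subseteq> (\<Union>k<N. ball (xs k) \<tau>)" and \<tau>: "\<tau> > 0"
    and W [measurable]: "W \<in> sets borel" "W \<subseteq> \<Omega>"
    and seg: "\<And>x y r. x \<in> P \<Longrightarrow> y \<in> ball v (2 * \<tau>) \<Longrightarrow> 0 \<le> r \<Longrightarrow> r \<le> 1 \<Longrightarrow> x + r *\<^sub>R y \<in> W"
    and D: "\<And>y. y \<in> ball v (2 * \<tau>) \<Longrightarrow> norm y \<le> D"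
    and Z: "\<And>k. k < N \<Longrightarrow> integrable lborel (\<lambda>z. indicator (ball (xs k + v) \<tau>) z *\<^sub>R f z)"
    and V: "V = unit_ball_vol (real (DIM(real^'n))) * \<tau> ^ DIM(real^'n)"
  shows "(\<integral>\<^sup>+x. indicator P x * ennreal ((norm (f x))\<^sup>2) \<partial>lborel) \<le>
     ennreal (2 * 2 ^ DIM(real^'n) * D\<^sup>2) * (\<integral>\<^sup>+x. indicator W x * ennreal (\<Sum>j\<in>UNIV. (norm (g j x))\<^sup>2)
         \<partial>lborel)
     + (\<Sum>k<N. ennreal (2 / V * (norm (\<integral>z. indicator (ball (xs k + v) \<tau>) z *\<^sub>R f z \<partial>lborel))\<^sup>2))"
proof -
  have [measurable]: "f \<in> borel_measurable borel" "\<And>j. g j \<in> borel_measurable borel"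
    using f g by (simp_all add: loc_integrable_def)
  have [measurable]: "P \<in> sets borel" using P by simp
  define gg where "gg x = (\<Sum>j\<in>UNIV. (norm (g j x))\<^sup>2)" for x
  have [measurable]: "gg \<in> borel_measurable borel" unfolding gg_def by measurable
  define B where "B = ball v (2 * \<tau>)"
  have [measurable]: "B \<in> sets borel" by (simp add: B_def)
  let ?G = "\<integral>\<^sup>+x. indicator W x * ennreal (gg x) \<partial>lborel"
  define Zk where "Zk k = ball (xs k + v) \<tau>" for k
  have [measurable]: "Zk k \<in> sets borel" for k by (simp add: Zk_def)
  define c where "c k = (\<integral>z. indicator (Zk k) z *\<^sub>R f z \<partial>lborel)" for k
  have V0: "V > 0" using \<tau> by (auto simp: V intro!: mult_pos_pos unit_ball_vol_pos)
  have eb: "emeasure lborel (ball x \<tau>) = ennreal V" for x :: "real^'n"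
    unfolding V using \<tau> by (intro emeasure_ball) simp
  have eB: "emeasure lborel B = ennreal (2 ^ DIM(real^'n) * V)"
    unfolding B_def V using \<tau> by (subst emeasure_ball) (auto simp: power_mult_distrib mult_ac)
  \<comment> \<open>Disjoint pieces of \<open>P\<close>, each within \<tau> of its net point, so
    that their indicators add up to that of \<open>P\<close>.\<close>
  define Q where "Q k = P \<inter> ball (xs k) \<tau> - (\<Union>i<k. ball (xs i) \<tau>)" for k
  have [measurable]: "Q k \<in> sets borel" for k unfolding Q_def
      by (intro sets.Diff sets.Int sets.finite_UN) auto
  have part: "(\<Sum>k<N. indicator (Q k) x) = (indicator P x :: ennreal)" for x
  proof (cases "x \<in> P")
    case True
    define k0 where "k0 = (LEAST k. x \<in> ball (xs k) \<tau>)"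
    obtain k1 where k1: "k1 < N" "x \<in> ball (xs k1) \<tau>" using True P by auto
    have k0: "x \<in> ball (xs k0) \<tau>" unfolding k0_def by (rule LeastI[of _ k1]) (rule k1)
    have "k0 \<le> k1" unfolding k0_def by (rule Least_le) (rule k1)
    then have "k0 < N" using k1 by simp
    have less: "x \<notin> ball (xs i) \<tau>" if "i < k0" for i
        using not_less_Least[of i "\<lambda>k. x \<in> ball (xs k) \<tau>"] that by (auto simp: k0_def)
    have "indicator (Q k) x = (if k = k0 then 1 else 0 :: ennreal)" for k
    proof (cases k k0 rule: linorder_cases)
      case equal
      have "x \<in> Q k0" using True k0 less unfolding Q_def by blast
      then show ?thesis using equal by simp
    next
      case less': less
      then show ?thesis using less[OF less'] by (auto simp: Q_def)
    next
      case greater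
      have "x \<notin> Q k" using k0 greater unfolding Q_def by blast
      then show ?thesis using greater by simp
    qed
    then show ?thesis using \<open>k0 < N\<close> True by simp
  next
    case False
    then show ?thesis by (simp add: Q_def)
  qed
  have pt: "indicator (Q k) x * ennreal ((norm (f x))\<^sup>2) \<le>
      indicator (Q k) x * (ennreal (2 / V) * (\<integral>\<^sup>+y. indicator B y * ennreal ((norm (f (x + y) - f x))\<^sup>2)
      \<partial>lborel))
      + indicator (Q k) x * ennreal (2 * (norm (c k /\<^sub>R V))\<^sup>2)" if k: "k < N" for k x
  proof (cases "x \<in> Q k")
    case True
    have "(norm (f x))\<^sup>2 \<le> 2 * (norm (f x - c k /\<^sub>R V))\<^sup>2 + 2 * (norm (c k /\<^sub>R V))\<^sup>2"
      using norm_square_add_le[of "f x - c k /\<^sub>R V" "c k /\<^sub>R V"] by simp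
    then have "ennreal ((norm (f x))\<^sup>2) \<le> ennreal (2 * (norm (f x - c k /\<^sub>R V))\<^sup>2
        + 2 * (norm (c k /\<^sub>R V))\<^sup>2)" by (rule ennreal_leI)
    also have "\<dots> = 2 * ennreal ((norm (f x - c k /\<^sub>R V))\<^sup>2) + ennreal (2 * (norm (c k /\<^sub>R V))\<^sup>2)"
      by (subst ennreal_plus) (auto simp: ennreal_mult)
    also have "ennreal ((norm (f x - c k /\<^sub>R V))\<^sup>2) \<le>
        ennreal (1 / V) * (\<integral>\<^sup>+z. indicator (Zk k) z * ennreal ((norm (f z - f x))\<^sup>2) \<partial>lborel)"
      unfolding c_def by (rule average_deviation) (use eb V0 Z[OF k] in \<open>auto simp: Zk_def\<close>)
    also have "(\<integral>\<^sup>+z. indicator (Zk k) z * ennreal ((norm (f z - f x))\<^sup>2) \<partial>lborel) =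
        (\<integral>\<^sup>+y. indicator (Zk k) (y + x) * ennreal ((norm (f (y + x) - f x))\<^sup>2) \<partial>lborel)"
      by (rule nn_integral_translate[symmetric, of
          "\<lambda>z. indicator (Zk k) z * ennreal ((norm (f z - f x))\<^sup>2)" x]) simp
    also have "\<dots> \<le> (\<integral>\<^sup>+y. indicator B y * ennreal ((norm (f (x + y) - f x))\<^sup>2) \<partial>lborel)"
    proof (rule nn_integral_mono)
      fix y
      have "y \<in> B" if "y + x \<in> Zk k"
      proof -
        have "norm (xs k + v - (y + x)) < \<tau>" "norm (xs k - x) < \<tau>"
          using that True by (auto simp: Zk_def Q_def dist_norm)
        then have "norm (v - y) < 2 * \<tau>"
          using norm_triangle_ineq4[of "xs k + v - (y + x)" "xs k - x"] by (simp add: algebra_simps)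
        then show ?thesis by (simp add: B_def dist_norm)
      qed
      then show "indicator (Zk k) (y + x) * ennreal ((norm (f (y + x) - f x))\<^sup>2) \<le>
          indicator B y * ennreal ((norm (f (x + y) - f x))\<^sup>2)"
        by (auto simp: indicator_def add.commute)
    qed
    finally have "ennreal ((norm (f x))\<^sup>2) \<le> 2
        * (ennreal (1 / V) * (\<integral>\<^sup>+y. indicator B y * ennreal ((norm (f (x + y) - f x))\<^sup>2) \<partial>lborel))
        + ennreal (2 * (norm (c k /\<^sub>R V))\<^sup>2)"
      by (simp add: mult_left_mono add_right_mono)
    moreover have "2 * ennreal (1 / V) = ennreal (2 / V)" using V0
        by (simp add: ennreal_mult[symmetric] flip: ennreal_numeral)
    ultimately show ?thesis using True by (simp add: mult.assoc[symmetric])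
  qed simp
  define h where "h x = (\<integral>\<^sup>+y. indicator B y * ennreal ((norm (f (x + y) - f x))\<^sup>2) \<partial>lborel)" for x
  have [measurable]: "h \<in> borel_measurable borel" unfolding h_def by measurable
  have "(\<integral>\<^sup>+x. indicator P x * ennreal ((norm (f x))\<^sup>2) \<partial>lborel) =
      (\<integral>\<^sup>+x. (\<Sum>k<N. indicator (Q k) x * ennreal ((norm (f x))\<^sup>2)) \<partial>lborel)"
    unfolding part[symmetric] sum_distrib_right ..
  also have "\<dots> \<le> (\<integral>\<^sup>+x. (\<Sum>k<N. indicator (Q k) x * (ennreal (2 / V) * h x)
      + indicator (Q k) x * ennreal (2 * (norm (c k /\<^sub>R V))\<^sup>2)) \<partial>lborel)"
    using pt unfolding h_def by (intro nn_integral_mono sum_mono) auto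
  also have "\<dots> = (\<integral>\<^sup>+x. indicator P x * (ennreal (2 / V) * h x)
      + (\<Sum>k<N. indicator (Q k) x * ennreal (2 * (norm (c k /\<^sub>R V))\<^sup>2)) \<partial>lborel)"
    unfolding part[symmetric] sum.distrib sum_distrib_right ..
  also have "\<dots> = (\<integral>\<^sup>+x. indicator P x * (ennreal (2 / V) * h x) \<partial>lborel)
      + (\<Sum>k<N. \<integral>\<^sup>+x. indicator (Q k) x * ennreal (2 * (norm (c k /\<^sub>R V))\<^sup>2) \<partial>lborel)"
  proof -
    have m: "(\<lambda>x. indicator (Q k) x * ennreal (2 * (norm (c k /\<^sub>R V))\<^sup>2)) \<in> borel_measurable lborel"
        for k
      by measurable
    have "(\<lambda>x. \<Sum>k<N. indicator (Q k) x * ennreal (2 * (norm (c k /\<^sub>R V))\<^sup>2)) \<in> borel_measurable lborel"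
      by (rule borel_measurable_sum) (rule m)
    then show ?thesis unfolding nn_integral_sum[OF m, symmetric] by (intro nn_integral_add) simp_all
  qed
  also have "(\<Sum>k<N. \<integral>\<^sup>+x. indicator (Q k) x * ennreal (2 * (norm (c k /\<^sub>R V))\<^sup>2) \<partial>lborel) \<le>
      (\<Sum>k<N. ennreal (2 / V * (norm (c k))\<^sup>2))"
  proof (rule sum_mono)
    fix k
    have "(\<integral>\<^sup>+x. indicator (Q k) x * ennreal (2 * (norm (c k /\<^sub>R V))\<^sup>2) \<partial>lborel) =
        ennreal (2 * (norm (c k /\<^sub>R V))\<^sup>2) * emeasure lborel (Q k)"
      by (subst mult.commute, rule nn_integral_cmult_indicator) simp
    also have "\<dots> \<le> ennreal (2 * (norm (c k /\<^sub>R V))\<^sup>2) * emeasure lborel (ball (xs k) \<tau>)"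
      by (intro mult_left_mono emeasure_mono) (auto simp: Q_def)
    also have "\<dots> = ennreal (2 / V * (norm (c k))\<^sup>2)"
      using V0 by (simp add: eb ennreal_mult[symmetric] power_divide power2_eq_square field_simps)
    finally show "(\<integral>\<^sup>+x. indicator (Q k) x * ennreal (2 * (norm (c k /\<^sub>R V))\<^sup>2) \<partial>lborel) \<le>
        ennreal (2 / V * (norm (c k))\<^sup>2)" .
  qed
  also have "(\<integral>\<^sup>+x. indicator P x * (ennreal (2 / V) * h x) \<partial>lborel) =
      ennreal (2 / V) * (\<integral>\<^sup>+x. indicator P x * h x \<partial>lborel)"
    by (subst nn_integral_cmult[symmetric]) (auto intro!: nn_integral_cong simp: mult_ac)
  also have "(\<integral>\<^sup>+x. indicator P x * h x \<partial>lborel) =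
      (\<integral>\<^sup>+x. \<integral>\<^sup>+y. indicator B y * (indicator P x * ennreal ((norm (f (x + y) - f x))\<^sup>2)) \<partial>lborel
      \<partial>lborel)"
    unfolding h_def by (intro nn_integral_cong, subst nn_integral_cmult[symmetric])
        (auto intro!: nn_integral_cong simp: mult_ac)
  also have "\<dots> = (\<integral>\<^sup>+y. \<integral>\<^sup>+x. indicator B y * (indicator P x
      * ennreal ((norm (f (x + y) - f x))\<^sup>2)) \<partial>lborel \<partial>lborel)"
    by (rule lborel_pair.Fubini') simp
  also have "\<dots> \<le> (\<integral>\<^sup>+y. (ennreal (D\<^sup>2) * ?G) * indicator B y \<partial>lborel)"
  proof (rule nn_integral_mono)
    fix y
    show "(\<integral>\<^sup>+x. indicator B y * (indicator P x * ennreal ((norm (f (x + y) - f x))\<^sup>2)) \<partial>lborel) \<le>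
        (ennreal (D\<^sup>2) * ?G) * indicator B y"
    proof (cases "y \<in> B")
      case True
      have sg: "x + r *\<^sub>R y \<in> W" if "x \<in> P" "0 \<le> r" "r \<le> 1" for x r using seg that True
          by (simp add: B_def)
      have "AE x in lborel. x \<in> P \<longrightarrow> ennreal ((norm (f (x + y) - f x))\<^sup>2) \<le>
        ennreal ((norm y)\<^sup>2) * (\<integral>\<^sup>+r. indicator {0..1::real} r * ennreal
            (\<Sum>j\<in>UNIV. (norm (g j (x + r *\<^sub>R y)))\<^sup>2) \<partial>lborel)"
        by (rule translation_estimate[OF f g wd P(1)]) (use sg W in auto)
      then have "AE x in lborel. indicator P x * ennreal ((norm (f (x + y) - f x))\<^sup>2) \<le>
        ennreal (D\<^sup>2) * (\<integral>\<^sup>+r. indicator {0..1::real} r * (indicator W (x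
            + r *\<^sub>R y) * ennreal (gg (x + r *\<^sub>R y))) \<partial>lborel)"
      proof eventually_elim
        case (elim x)
        show ?case
        proof (cases "x \<in> P")
          case xP: True
          have "ennreal ((norm (f (x + y) - f x))\<^sup>2) \<le>
            ennreal ((norm y)\<^sup>2) * (\<integral>\<^sup>+r. indicator {0..1::real} r * ennreal
                (\<Sum>j\<in>UNIV. (norm (g j (x + r *\<^sub>R y)))\<^sup>2) \<partial>lborel)"
            using elim xP by simp
          also have "\<dots> \<le> ennreal (D\<^sup>2) * (\<integral>\<^sup>+r. indicator {0..1::real} r
              * (indicator W (x + r *\<^sub>R y) * ennreal (gg (x + r *\<^sub>R y))) \<partial>lborel)"
          proof (rule mult_mono)
            show "ennreal ((norm y)\<^sup>2) \<le> ennreal (D\<^sup>2)"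
              using True D by (intro ennreal_leI power_mono) (auto simp: B_def)
            show "(\<integral>\<^sup>+r. indicator {0..1::real} r
                * ennreal (\<Sum>j\<in>UNIV. (norm (g j (x + r *\<^sub>R y)))\<^sup>2) \<partial>lborel)
               \<le> (\<integral>\<^sup>+r. indicator {0..1::real} r * (indicator W (x
                   + r *\<^sub>R y) * ennreal (gg (x + r *\<^sub>R y))) \<partial>lborel)"
            proof (rule nn_integral_mono)
              fix r :: real
              show "indicator {0..1::real} r * ennreal (\<Sum>j\<in>UNIV. (norm (g j (x + r *\<^sub>R y)))\<^sup>2) \<le>
                  indicator {0..1::real} r * (indicator W (x + r *\<^sub>R y) * ennreal (gg (x + r *\<^sub>R y)))"
                using sg[OF xP, of r] by (auto simp: indicator_def gg_def)
            qed
          qed auto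
          finally show ?thesis using xP by simp
        qed simp
      qed
      then have "(\<integral>\<^sup>+x. indicator P x * ennreal ((norm (f (x + y) - f x))\<^sup>2) \<partial>lborel) \<le>
         (\<integral>\<^sup>+x. ennreal (D\<^sup>2) * (\<integral>\<^sup>+r. indicator {0..1::real} r * (indicator W (x
             + r *\<^sub>R y) * ennreal (gg (x + r *\<^sub>R y))) \<partial>lborel) \<partial>lborel)"
        by (rule nn_integral_mono_AE)
      also have "\<dots> = ennreal (D\<^sup>2) * (\<integral>\<^sup>+x. \<integral>\<^sup>+r. indicator {0..1::real} r
          * (indicator W (x + r *\<^sub>R y) * ennreal (gg (x + r *\<^sub>R y))) \<partial>lborel \<partial>lborel)"
        by (rule nn_integral_cmult) simp
      also have "(\<integral>\<^sup>+x. \<integral>\<^sup>+r. indicator {0..1::real} r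
          * (indicator W (x + r *\<^sub>R y) * ennreal (gg (x + r *\<^sub>R y))) \<partial>lborel \<partial>lborel)
        = (\<integral>\<^sup>+r. \<integral>\<^sup>+x. indicator {0..1::real} r * (indicator W (x
            + r *\<^sub>R y) * ennreal (gg (x + r *\<^sub>R y))) \<partial>lborel \<partial>lborel)"
        by (rule lborel_pair.Fubini') simp
      also have "\<dots> = (\<integral>\<^sup>+r. indicator {0..1::real} r * ?G \<partial>lborel)"
      proof (rule nn_integral_cong)
        fix r :: real
        have "(\<integral>\<^sup>+x. indicator W (x + r *\<^sub>R y) * ennreal (gg (x + r *\<^sub>R y)) \<partial>lborel) = ?G"
          by (rule nn_integral_translate[of "\<lambda>x. indicator W x * ennreal (gg x)"]) simp
        then show "(\<integral>\<^sup>+x. indicator {0..1::real} r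
            * (indicator W (x + r *\<^sub>R y) * ennreal (gg (x + r *\<^sub>R y))) \<partial>lborel) =
            indicator {0..1::real} r * ?G"
          by (subst nn_integral_cmult) simp_all
      qed
      also have "\<dots> = ?G" by (subst nn_integral_multc) simp_all
      finally show ?thesis using True by simp
    qed simp
  qed
  also have "\<dots> = (ennreal (D\<^sup>2) * ?G) * ennreal (2 ^ DIM(real^'n) * V)"
    by (subst nn_integral_cmult_indicator) (simp_all add: eB)
  finally have "(\<integral>\<^sup>+x. indicator P x * ennreal ((norm (f x))\<^sup>2) \<partial>lborel) \<le>
     ennreal (2 / V) * ((ennreal (D\<^sup>2) * ?G) * ennreal (2 ^ DIM(real^'n) * V))
         + (\<Sum>k<N. ennreal (2 / V * (norm (c k))\<^sup>2))"
    by (simp add: mult_left_mono add_mono)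
  moreover have "ennreal (2 / V) * ((ennreal (D\<^sup>2) * ?G) * ennreal (2 ^ DIM(real^'n) * V)) =
      ennreal (2 * 2 ^ DIM(real^'n) * D\<^sup>2) * ?G"
  proof -
    have "ennreal (2 / V) * ((ennreal (D\<^sup>2) * ?G) * ennreal (2 ^ DIM(real^'n) * V)) =
        (ennreal (2 / V) * ennreal (D\<^sup>2) * ennreal (2 ^ DIM(real^'n) * V)) * ?G"
      by (simp only: mult_ac)
    also have "ennreal (2 / V) * ennreal (D\<^sup>2) * ennreal (2 ^ DIM(real^'n) * V) =
        ennreal (2 * 2 ^ DIM(real^'n) * D\<^sup>2)"
      using V0 by (simp add: ennreal_mult[symmetric])
    finally show ?thesis .
  qed
  ultimately show ?thesis by (simp add: gg_def c_def Zk_def)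
qed

section \<open>Control of the energy by finitely many means\<close>

context weighted_domain
begin

text \<open>At interior points \<open>u = 0\<close> and \<kappa> = 1 allow all small shifts, outside
  the closure there is nothing to shift, and at the boundary the inner normal is the axis of a cone
  of admissible shifts by \<open>uniform_cone\<close>.\<close>

lemma inward_direction:
  "\<exists>\<delta>>0. \<exists>u \<kappa>. 0 < \<kappa> \<and> \<kappa> \<le> 1 \<and> norm u \<le> 1 \<and>
     (\<forall>x\<in>\<Omega> \<inter> ball p \<delta>. \<forall>r y. 0 < r \<longrightarrow> r < \<delta> \<longrightarrow> norm (y - r *\<^sub>R u) \<le> \<kappa> * r \<longrightarrow> x + y \<in> \<Omega>)"
proof -
  consider "p \<in> \<Omega>" | "p \<in> frontier \<Omega>" | "p \<in> - closure \<Omega>"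
    using open_dom by (auto simp: frontier_def interior_open)
  then show ?thesis
  proof cases
    case 1
    then obtain e where e: "e > 0" "ball p e \<subseteq> \<Omega>" using open_dom open_contains_ball by blast
    have "x + y \<in> \<Omega>" if "x \<in> \<Omega> \<inter> ball p (e / 2)" "0 < r" "r < e / 2" "norm (y - r *\<^sub>R 0) \<le> 1 * r"
        for x r y
    proof -
      have "dist p x < e / 2" "norm y < e / 2" using that by auto
      then have "dist p (x + y) < e" using dist_triangle[of p "x + y" x] by (simp add: dist_norm)
      then show ?thesis using e by auto
    qed
    then show ?thesis using e(1) by (intro exI[of _ "e / 2"] conjI exI[of _ 0] exI[of _ 1]) auto
  next
    case 2
    let ?u = "- \<nu> p"
    have nu1: "norm (\<nu> p) = 1" using nu[OF 2] by simp
    \<comment> \<open>The opening 1/4 gives \<open>norm y \<le> 5 / 4 * r\<close> and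
      \<open>y \<bullet> \<nu> p \<le> - 3 / 4 * r\<close>, enough for \<open>uniform_cone\<close>
      with its \<kappa> equal to 1/2.\<close>
    have "x + y \<in> \<Omega>" if x: "x \<in> \<Omega> \<inter> ball p (\<rho> / 16)" and r: "0 < r" "r < \<rho> / 16"
        and y: "norm (y - r *\<^sub>R ?u) \<le> 1 / 4 * r" for x r y
    proof -
      have "norm y \<le> norm (y - r *\<^sub>R ?u) + norm (r *\<^sub>R ?u)" using norm_triangle_sub[of y "r *\<^sub>R ?u"]
          by simp
      then have ny: "norm y \<le> 5 / 4 * r" using y r nu1 by simp
      have "y \<bullet> \<nu> p = (y - r *\<^sub>R ?u) \<bullet> \<nu> p - r"
        using nu1 by (simp add: inner_diff_left inner_add_left norm_eq_1)
      also have "\<dots> \<le> norm (y - r *\<^sub>R ?u) * norm (\<nu> p) - r"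
          using Cauchy_Schwarz_ineq2[of "y - r *\<^sub>R ?u" "\<nu> p"] by simp
      also have "\<dots> \<le> 1 / 4 * r - r" using y nu1 by simp
      also have "\<dots> \<le> - (1 / 2) * norm y" using ny r by simp
      finally have 3: "y \<bullet> \<nu> p \<le> - (1 / 2) * norm y" .
      have ny2: "norm y < (1 / 2) * \<rho> / 4" using ny r by simp
      have 1: "norm (x - p) < (1 / 2) * \<rho> / 4" using x rho by (auto simp: dist_norm norm_minus_commute)
      show ?thesis using uniform_cone[OF open_dom rho nu _ 2 _ 1 ny2 3] x by simp
    qed
    then show ?thesis using rho nu1 by (intro exI[of _ "\<rho> / 16"] conjI exI[of _ ?u] exI[of _ "1 / 4"])
        auto
  next
    case 3
    then obtain e where e: "e > 0" "ball p e \<subseteq> - closure \<Omega>" using open_contains_ball[of "- closure \<Omega>"]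
        by auto
    then have "\<Omega> \<inter> ball p e = {}" using closure_subset by blast
    then show ?thesis using e(1) by (intro exI[of _ e] conjI exI[of _ 0] exI[of _ 1]) auto
  qed
qed

text \<open>Integrals stand for means, the volumes being part of \<open>C\<close>. Lists make the
  union of two families an append.\<close>

definition mean_energy :: "(real^'n) set list \<Rightarrow> real \<Rightarrow> (real^'n \<Rightarrow> 'b::euclidean_space) \<Rightarrow> ennreal" where
  "mean_energy zs C f = (\<Sum>Z\<leftarrow>zs. ennreal (C * (norm (\<integral>x. indicator Z x *\<^sub>R f x \<partial>lborel))\<^sup>2))"

definition good_sets :: "(real^'n) set list \<Rightarrow> bool" where
  "good_sets zs \<longleftrightarrow> (\<forall>Z\<in>set zs. open Z \<and> bounded Z \<and> Z \<subseteq> \<Omega>)"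

text \<open>On \<open>S\<close> the energy is controlled, up to a small multiple of the Sobolev bound, by finitely
  many mean values; the type argument fixes the range of the functions.\<close>

definition compact_part :: "'b::euclidean_space itself \<Rightarrow> (real^'n) set \<Rightarrow> bool" where
  "compact_part _ S \<longleftrightarrow> (\<forall>\<epsilon>>0. \<exists>zs C. 0 \<le> C \<and> good_sets zs \<and>
     (\<forall>(f :: real^'n \<Rightarrow> 'b) b. sob_bd (\<lambda>x. 0) (Suc 0) f b \<longrightarrow>
       (\<integral>\<^sup>+x. indicator (\<Omega> \<inter> S) x * wsq (\<lambda>x. (norm (f x))\<^sup>2) x \<partial>lborel) \<le>
           ennreal (\<epsilon> * b\<^sup>2) + mean_energy zs C f))"

lemma compact_partE:
  assumes "compact_part TYPE('b::euclidean_space) S" "\<epsilon> > 0"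
  obtains zs C where "0 \<le> C" "good_sets zs" "\<And>(f :: real^'n \<Rightarrow> 'b) b. sob_bd (\<lambda>x. 0) (Suc 0) f b \<Longrightarrow>
       (\<integral>\<^sup>+x. indicator (\<Omega> \<inter> S) x * wsq (\<lambda>x. (norm (f x))\<^sup>2) x \<partial>lborel) \<le>
           ennreal (\<epsilon> * b\<^sup>2) + mean_energy zs C f"
  using assms unfolding compact_part_def by blast

lemma mean_energy_mono:
  assumes "0 \<le> C" "C \<le> C'"
  shows "mean_energy zs C f \<le> mean_energy zs C' f"
  unfolding mean_energy_def by (induction zs) (auto intro!: add_mono ennreal_leI mult_right_mono assms)

lemma mean_energy_append: "mean_energy (zs @ zs') C f = mean_energy zs C f + mean_energy zs' C f"
  by (simp add: mean_energy_def)

lemma compact_part_Un: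
  assumes S: "compact_part TYPE('b::euclidean_space) S" "S \<in> sets borel"
      and S': "compact_part TYPE('b) S'" "S' \<in> sets borel"
  shows "compact_part TYPE('b) (S \<union> S')"
  unfolding compact_part_def
proof (intro allI impI)
  fix \<epsilon> :: real assume e: "\<epsilon> > 0"
  have [measurable]: "S \<in> sets borel" "S' \<in> sets borel" by fact+
  obtain zs C where 1: "0 \<le> C" "good_sets zs" "\<And>(f :: real^'n \<Rightarrow> 'b) b. sob_bd (\<lambda>x. 0) (Suc 0) f b \<Longrightarrow>
       (\<integral>\<^sup>+x. indicator (\<Omega> \<inter> S) x * wsq (\<lambda>x. (norm (f x))\<^sup>2) x \<partial>lborel) \<le>
           ennreal (\<epsilon> / 2 * b\<^sup>2) + mean_energy zs C f"
    by (rule compact_partE[OF S(1) half_gt_zero[OF e]]) (rule that)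
  obtain zs' C' where 2: "0 \<le> C'" "good_sets zs'" "\<And>(f :: real^'n \<Rightarrow> 'b) b. sob_bd (\<lambda>x. 0) (Suc 0) f b \<Longrightarrow>
       (\<integral>\<^sup>+x. indicator (\<Omega> \<inter> S') x * wsq (\<lambda>x. (norm (f x))\<^sup>2) x \<partial>lborel) \<le>
           ennreal (\<epsilon> / 2 * b\<^sup>2) + mean_energy zs' C' f"
    by (rule compact_partE[OF S'(1) half_gt_zero[OF e]]) (rule that)
  let ?zs = "zs @ zs'" and ?C = "max C C'"
  have "(\<integral>\<^sup>+x. indicator (\<Omega> \<inter> (S \<union> S')) x * wsq (\<lambda>x. (norm (f x))\<^sup>2) x \<partial>lborel) \<le>
      ennreal (\<epsilon> * b\<^sup>2) + mean_energy ?zs ?C f"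
    if f: "sob_bd (\<lambda>x. 0) (Suc 0) f b" for f :: "real^'n \<Rightarrow> 'b" and b
  proof -
    have [measurable]: "f \<in> borel_measurable borel" using f by simp
    have [measurable]: "wsq (\<lambda>x. (norm (f x))\<^sup>2) \<in> borel_measurable borel" by (rule borel_wsq) simp
    have "(\<integral>\<^sup>+x. indicator (\<Omega> \<inter> (S \<union> S')) x * wsq (\<lambda>x. (norm (f x))\<^sup>2) x \<partial>lborel)
      \<le> (\<integral>\<^sup>+x. indicator (\<Omega> \<inter> S) x * wsq (\<lambda>x. (norm (f x))\<^sup>2) x
          + indicator (\<Omega> \<inter> S') x * wsq (\<lambda>x. (norm (f x))\<^sup>2) x \<partial>lborel)"
      by (intro nn_integral_mono) (auto simp: indicator_def)
    also have "\<dots> = (\<integral>\<^sup>+x. indicator (\<Omega> \<inter> S) x * wsq (\<lambda>x. (norm (f x))\<^sup>2) x \<partial>lborel)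
        + (\<integral>\<^sup>+x. indicator (\<Omega> \<inter> S') x * wsq (\<lambda>x. (norm (f x))\<^sup>2) x \<partial>lborel)"
      by (rule nn_integral_add) simp_all
    also have "\<dots> \<le> (ennreal (\<epsilon> / 2 * b\<^sup>2) + mean_energy zs ?C f)
        + (ennreal (\<epsilon> / 2 * b\<^sup>2) + mean_energy zs' ?C f)"
      by (intro add_mono order_trans[OF 1(3)[OF f]] order_trans[OF 2(3)[OF f]] mean_energy_mono
          order_refl) (use 1 2 in auto)
    also have "\<dots> = (ennreal (\<epsilon> / 2 * b\<^sup>2) + ennreal (\<epsilon> / 2 * b\<^sup>2)) + mean_energy ?zs ?C f"
      by (simp add: mean_energy_append ac_simps)
    also have "ennreal (\<epsilon> / 2 * b\<^sup>2) + ennreal (\<epsilon> / 2 * b\<^sup>2) = ennreal (\<epsilon> * b\<^sup>2)"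
      using e by (subst ennreal_plus[symmetric]) auto
    finally show ?thesis .
  qed
  moreover have "good_sets ?zs" using 1(2) 2(2) by (auto simp: good_sets_def)
  moreover have "0 \<le> ?C" using 1(1) by simp
  ultimately show "\<exists>zs C. 0 \<le> C \<and> good_sets zs \<and>
     (\<forall>(f :: real^'n \<Rightarrow> 'b) b. sob_bd (\<lambda>x. 0) (Suc 0) f b \<longrightarrow>
       (\<integral>\<^sup>+x. indicator (\<Omega> \<inter> (S \<union> S')) x * wsq (\<lambda>x. (norm (f x))\<^sup>2) x \<partial>lborel) \<le>
           ennreal (\<epsilon> * b\<^sup>2) + mean_energy zs C f)" by blast
qed

lemma compact_part_UN:
  "finite X \<Longrightarrow> (\<And>x. x \<in> X \<Longrightarrow> compact_part TYPE('b::euclidean_space) (S x) \<and> S x \<in> sets borel) \<Longrightarrow>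
      compact_part TYPE('b) (\<Union>x\<in>X. S x)"
proof (induction X rule: finite_induct)
  case empty
  show ?case
    unfolding compact_part_def
    by (intro allI impI exI[of _ "[]"] exI[of _ 0]) (auto simp: good_sets_def mean_energy_def)
next
  case (insert x X)
  have "(\<Union>x\<in>X. S x) \<in> sets borel" using insert by (intro sets.finite_UN) auto
  then show ?case using insert compact_part_Un[of "S x" "\<Union>x\<in>X. S x"] by auto
qed

lemma compact_part_mono: "compact_part TYPE('b::euclidean_space) S \<Longrightarrow> S' \<subseteq> S \<Longrightarrow> compact_part TYPE('b) S'"
  unfolding compact_part_def
  by (elim all_forward imp_forward ex_forward conj_forward asm_rl)
     (auto intro!: nn_integral_mono mult_right_mono elim!: order_trans[rotated] simp: indicator_def)

lemma finite_net:
  fixes P :: "'a::euclidean_space set"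
  assumes "bounded P" "\<tau> > 0"
  obtains N and xs :: "nat \<Rightarrow> 'a" where "\<And>k. k < N \<Longrightarrow> xs k \<in> P" "P \<subseteq> (\<Union>k<N. ball (xs k) \<tau>)"
proof -
  have "closure P \<subseteq> (\<Union>x\<in>P. ball x \<tau>)"
  proof
    fix y assume "y \<in> closure P"
    then obtain x where "x \<in> P" "dist x y < \<tau>" using assms(2) by (auto simp: closure_approachable)
    then show "y \<in> (\<Union>x\<in>P. ball x \<tau>)" by auto
  qed
  moreover have "compact (closure P)" using assms(1) by (simp add: compact_closure)
  ultimately obtain X where X: "X \<subseteq> P" "finite X" "closure P \<subseteq> (\<Union>x\<in>X. ball x \<tau>)"
    using compactE_image[of "closure P" P "\<lambda>x. ball x \<tau>"] by (metis open_ball)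
  obtain ls where ls: "set ls = X" using finite_list[OF X(2)] by blast
  show ?thesis
  proof (rule that[of "length ls" "\<lambda>k. ls ! k"])
    show "ls ! k \<in> P" if "k < length ls" for k using that ls X(1) nth_mem by blast
    show "P \<subseteq> (\<Union>k<length ls. ball (ls ! k) \<tau>)"
    proof
      fix y assume "y \<in> P"
      then obtain x where "x \<in> X" "y \<in> ball x \<tau>" using X(3) closure_subset by blast
      moreover from this(1) obtain k where "k < length ls" "ls ! k = x" using ls
          by (metis in_set_conv_nth)
      ultimately show "y \<in> (\<Union>k<length ls. ball (ls ! k) \<tau>)" by auto
    qed
  qed
qed

lemma grad_sum_bound:
  fixes g :: "'n \<Rightarrow> real^'n \<Rightarrow> 'b::euclidean_space"
  assumes "\<And>j. sob_bd \<theta> k (g j) b"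
  shows "(\<integral>\<^sup>+x. indicator \<Omega> x * wsq (\<lambda>x. \<Sum>j\<in>UNIV. (norm (g j x))\<^sup>2) x \<partial>lborel) \<le>
      ennreal (real CARD('n) * b\<^sup>2)"
proof -
  have [measurable]: "\<And>j. g j \<in> borel_measurable borel" using sob_bdD assms by blast
  have "(\<integral>\<^sup>+x. indicator \<Omega> x * wsq (\<lambda>x. \<Sum>j\<in>UNIV. (norm (g j x))\<^sup>2) x \<partial>lborel)
     = (\<integral>\<^sup>+x. (\<Sum>j\<in>UNIV. indicator \<Omega> x * wsq (\<lambda>x. (norm (g j x))\<^sup>2) x) \<partial>lborel)"
    unfolding wsq_def
    by (intro nn_integral_cong) (auto simp: indicator_def sum_distrib_right sum_ennreal)
  also have "\<dots> = (\<Sum>j\<in>UNIV. energy (g j))" unfolding energy_def by (rule nn_integral_sum) simp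
  also have "\<dots> \<le> (\<Sum>j\<in>(UNIV::'n set). ennreal (b\<^sup>2))" using sob_bdD assms by (intro sum_mono) blast
  also have "\<dots> = ennreal (real CARD('n) * b\<^sup>2)" by (simp add: ennreal_mult ennreal_of_nat_eq_real_of_nat)
  finally show ?thesis .
qed

text \<open>This is \<open>net_inequality\<close> on the part of \<Omega> near \<open>p\<close> with
  the shift v = s u. All translations have length at most 2 s, so the gradient term is of order s^2;
  on a bounded region the weight is bounded above and below.\<close>

lemma compact_part_local: "\<exists>\<delta>>0. compact_part TYPE('b::euclidean_space) (ball p \<delta>)"
proof -
  obtain \<delta> u \<kappa> where \<delta>: "\<delta> > 0" and \<kappa>: "0 < \<kappa>" "\<kappa> \<le> 1" and u: "norm u \<le> 1" and
    inw: "\<And>x r y. x \<in> \<Omega> \<inter> ball p \<delta> \<Longrightarrow> 0 < r \<Longrightarrow> r < \<delta> \<Longrightarrow> norm (y - r *\<^sub>R u) \<le> \<kappa> * r \<Longrightarrow> x + y \<in> \<Omega>"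
    using inward_direction[of p] by metis
  let ?n = "real CARD('n)" and ?d = "DIM(real^'n)"
  define P where "P = \<Omega> \<inter> ball p \<delta>"
  \<comment> \<open>Room for the translations, which have length at most
    \<open>2 * s \<le> 2\<close>.\<close>
  define W where "W = \<Omega> \<inter> ball p (\<delta> + 2)"
  have [measurable]: "W \<in> sets borel" "P \<in> sets borel" by (auto simp: W_def P_def)
  have "bounded (\<Phi> ` cball p (\<delta> + 2))" by (intro compact_imp_bounded compact_continuous_image cont_Phi
      compact_cball)
  then obtain B where "\<forall>y\<in>\<Phi> ` cball p (\<delta> + 2). norm y \<le> B" unfolding bounded_iff by blast
  then have B: "\<bar>\<Phi> x\<bar> \<le> B" if "dist p x \<le> \<delta> + 2" for x using that by auto
  have "compact_part TYPE('b) (ball p \<delta>)"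
    unfolding compact_part_def
  proof (intro allI impI)
    fix \<epsilon> :: real assume e: "\<epsilon> > 0"
    \<comment> \<open>Collects the constant of \<open>net_inequality\<close> with
      \<open>D = 2 * s\<close>, one factor \<open>exp B\<close> for removing and one for restoring
      the weight, and the number of directions.\<close>
    define K where "K = 2 * 2 ^ ?d * 4 * exp B * exp B * ?n"
    have K: "K > 0" by (simp add: K_def)
    define s where "s = min (\<delta> / 2) (min 1 (sqrt (\<epsilon> / K)))"
    have s: "0 < s" "s < \<delta>" "s \<le> 1" using \<delta> e K by (auto simp: s_def)
    have "s \<le> sqrt (\<epsilon> / K)" by (simp add: s_def)
    then have "s\<^sup>2 \<le> \<epsilon> / K" using s(1) e K by
        (metis less_imp_le power_mono real_sqrt_pow2 divide_nonneg_pos)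
    then have sK: "K * s\<^sup>2 \<le> \<epsilon>" using K by (simp add: field_simps)
    \<comment> \<open>Then \<open>ball v (2 * \<tau>)\<close> has radius \<open>\<kappa> * s\<close>
      about \<open>s *\<^sub>R u\<close> and lies in the cone of
      \<open>inward_direction\<close>.\<close>
    define \<tau> where "\<tau> = \<kappa> * s / 2"
    have \<tau>: "\<tau> > 0" using s \<kappa> by (simp add: \<tau>_def)
    define v where "v = s *\<^sub>R u"
    have ks: "\<kappa> * s \<le> s" using \<kappa> s by simp
    have nv: "norm v \<le> s" using u s by (simp add: v_def mult_left_le)
    have D: "norm y \<le> 2 * s" if "y \<in> ball v (2 * \<tau>)" for y
      using that nv ks norm_triangle_sub[of y v] by (simp add: \<tau>_def dist_norm norm_minus_commute)
    have seg: "x + r *\<^sub>R y \<in> W" if x: "x \<in> P" and y: "y \<in> ball v (2 * \<tau>)" and r: "0 \<le> r" "r \<le> 1"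
        for x y r
    proof -
      have "norm (r *\<^sub>R y) \<le> norm y" using r by (simp add: mult_left_le_one_le)
      then have "norm (r *\<^sub>R y) \<le> 2" using D[OF y] s by simp
      then have "dist p (x + r *\<^sub>R y) < \<delta> + 2" using x dist_triangle[of p "x + r *\<^sub>R y" x]
          by (simp add: P_def dist_norm)
      moreover have "x + r *\<^sub>R y \<in> \<Omega>"
      proof (cases "r = 0")
        case True then show ?thesis using x by (simp add: P_def)
      next
        case False
        then have r0: "r > 0" using r by simp
        have "norm (r *\<^sub>R y - (r * s) *\<^sub>R u) = r * norm (y - v)"
          using r0 by (simp add: v_def flip: scaleR_scaleR scaleR_right_diff_distrib)
        also have "\<dots> \<le> r * (\<kappa> * s)" using y r0
            by (intro mult_left_mono) (auto simp: \<tau>_def dist_norm norm_minus_commute)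
        finally have "norm (r *\<^sub>R y - (r * s) *\<^sub>R u) \<le> \<kappa> * (r * s)" by (simp add: mult_ac)
        moreover have "r * s \<le> 1 * s" using r s by (intro mult_right_mono) auto
        then have "r * s < \<delta>" by (rule le_less_trans) (use s in simp)
        ultimately show ?thesis using x r0 s by (intro inw[of x "r * s"]) (auto simp: P_def)
      qed
      ultimately show ?thesis by (simp add: W_def)
    qed
    have "bounded P" unfolding P_def by (simp add: bounded_Int)
    then obtain N and xs :: "nat \<Rightarrow> real^'n" where xs: "\<And>k. k < N \<Longrightarrow> xs k \<in> P" "P \<subseteq> (\<Union>k<N. ball (xs k) \<tau>)"
      using finite_net[OF _ \<tau>] by metis
    define V where "V = unit_ball_vol (real ?d) * \<tau> ^ ?d"
    have V0: "V > 0" using \<tau> by (auto simp: V_def intro!: mult_pos_pos unit_ball_vol_pos)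
    define Z where "Z k = ball (xs k + v) \<tau>" for k
    \<comment> \<open>Closed balls, because \<open>loc_integrable\<close> speaks of compact subsets
      of \<Omega>.\<close>
    have cZ: "cball (xs k + v) \<tau> \<subseteq> \<Omega>" if "k < N" for k
    proof
      fix z assume z: "z \<in> cball (xs k + v) \<tau>"
      have "norm ((z - xs k) - s *\<^sub>R u) \<le> \<tau>" using z
          by (simp add: v_def dist_norm norm_minus_commute algebra_simps)
      also have "\<tau> \<le> \<kappa> * s" using \<kappa> s by (simp add: \<tau>_def)
      finally show "z \<in> \<Omega>" using inw[of "xs k" s "z - xs k"] xs(1)[OF that] s by (simp add: P_def)
    qed
    define zs where "zs = map Z [0..<N]"
    define C where "C = exp B * (2 / V)"
    have C0: "C \<ge> 0" using V0 by (simp add: C_def)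
    have good: "good_sets zs"
      using cZ ball_subset_cball by (fastforce simp: good_sets_def zs_def Z_def)
    have "(\<integral>\<^sup>+x. indicator (\<Omega> \<inter> ball p \<delta>) x * wsq (\<lambda>x. (norm (f x))\<^sup>2) x \<partial>lborel) \<le>
        ennreal (\<epsilon> * b\<^sup>2) + mean_energy zs C f"
      if f: "sob_bd (\<lambda>x. 0) (Suc 0) f b" for f :: "real^'n \<Rightarrow> 'b" and b
    proof -
      obtain g where g: "\<And>j. weak_deriv \<Omega> j f (g j)" "\<And>j. sob_bd (\<lambda>x. 0) 0 (g j) b"
        using f unfolding sob_bd.simps(2) twisted_deriv_0 by metis
      have lf: "loc_integrable \<Omega> f" by (rule sob_bd_loc_integrable[OF f])
      have lg: "\<And>j. loc_integrable \<Omega> (g j)" by (rule sob_bd_loc_integrable[OF g(2)])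
      have [measurable]: "f \<in> borel_measurable borel" "\<And>j. g j \<in> borel_measurable borel"
        using lf lg by (simp_all add: loc_integrable_def)
      define gg where "gg x = (\<Sum>j\<in>UNIV. (norm (g j x))\<^sup>2)" for x
      have gg0: "gg x \<ge> 0" for x by (auto simp: gg_def intro: sum_nonneg)
      have [measurable]: "gg \<in> borel_measurable borel" unfolding gg_def by measurable
      have [measurable]: "wsq gg \<in> borel_measurable borel" by (rule borel_wsq) simp
      have iZ: "integrable lborel (\<lambda>z. indicator (ball (xs k + v) \<tau>) z *\<^sub>R f z)" if "k < N" for k
      proof (rule Bochner_Integration.integrable_bound)
        show "integrable lborel (\<lambda>z. indicator (cball (xs k + v) \<tau>) z *\<^sub>R f z)"
          using lf cZ[OF that] by (simp add: loc_integrable_def)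
      qed (auto intro!: AE_I2 simp: indicator_def)
      have eB: "exp (- \<Phi> x) \<le> exp B" "1 \<le> exp B * exp (- \<Phi> x)" if "dist p x \<le> \<delta> + 2" for x
        using B[OF that] by (auto simp: exp_add[symmetric] abs_le_iff)
      have "(\<integral>\<^sup>+x. indicator (\<Omega> \<inter> ball p \<delta>) x * wsq (\<lambda>x. (norm (f x))\<^sup>2) x \<partial>lborel) \<le>
          (\<integral>\<^sup>+x. ennreal (exp B) * (indicator P x * ennreal ((norm (f x))\<^sup>2)) \<partial>lborel)"
      proof (rule nn_integral_mono)
        fix x
        show "indicator (\<Omega> \<inter> ball p \<delta>) x * wsq (\<lambda>x. (norm (f x))\<^sup>2) x \<le>
            ennreal (exp B) * (indicator P x * ennreal ((norm (f x))\<^sup>2))"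
        proof (cases "x \<in> P")
          case True
          then have "dist p x \<le> \<delta> + 2" by (simp add: P_def)
          from mult_left_mono[OF eB(1)[OF this], of "(norm (f x))\<^sup>2"] show ?thesis
            using True by (simp add: P_def wsq_def ennreal_mult[symmetric] ennreal_leI mult.commute)
        qed (auto simp: P_def)
      qed
      also have "\<dots> = ennreal (exp B) * (\<integral>\<^sup>+x. indicator P x * ennreal ((norm (f x))\<^sup>2) \<partial>lborel)"
        by (rule nn_integral_cmult) simp
      also have "\<dots> \<le> ennreal (exp B) * (ennreal (2 * 2 ^ ?d * (2 * s)\<^sup>2)
          * (\<integral>\<^sup>+x. indicator W x * ennreal (gg x) \<partial>lborel)
          + (\<Sum>k<N. ennreal (2 / V * (norm (\<integral>z. indicator (ball (xs k + v) \<tau>) z *\<^sub>R f z \<partial>lborel))\<^sup>2)))"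
      proof (rule mult_left_mono)
        have "open P" "W \<subseteq> \<Omega>" using open_dom by (auto simp: P_def W_def)
        then show "(\<integral>\<^sup>+x. indicator P x * ennreal ((norm (f x))\<^sup>2) \<partial>lborel) \<le>
            ennreal (2 * 2 ^ ?d * (2 * s)\<^sup>2) * (\<integral>\<^sup>+x. indicator W x * ennreal (gg x) \<partial>lborel)
          + (\<Sum>k<N. ennreal (2 / V * (norm (\<integral>z. indicator (ball (xs k + v) \<tau>) z *\<^sub>R f z \<partial>lborel))\<^sup>2))"
          unfolding gg_def using lf lg g(1) xs(2) \<tau> seg D iZ V_def
          by (intro net_inequality) auto
      qed simp
      also have "\<dots> = ennreal (exp B) * (ennreal (2 * 2 ^ ?d * (2 * s)\<^sup>2)
          * (\<integral>\<^sup>+x. indicator W x * ennreal (gg x) \<partial>lborel)) + mean_energy zs C f"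
      proof -
        have "ennreal (exp B) * (\<Sum>k<N. ennreal (2 / V
            * (norm (\<integral>z. indicator (ball (xs k + v) \<tau>) z *\<^sub>R f z \<partial>lborel))\<^sup>2)) = mean_energy zs C f"
          unfolding mean_energy_def zs_def C_def sum_distrib_left
          using V0 by (simp add: o_def interv_sum_list_conv_sum_set_nat atLeast0LessThan Z_def
              ennreal_mult[symmetric] mult_ac)
        then show ?thesis by (simp add: distrib_left)
      qed
      also have "(\<integral>\<^sup>+x. indicator W x * ennreal (gg x) \<partial>lborel) \<le>
          (\<integral>\<^sup>+x. ennreal (exp B) * (indicator \<Omega> x * wsq gg x) \<partial>lborel)"
      proof (rule nn_integral_mono)
        fix x
        show "indicator W x * ennreal (gg x) \<le> ennreal (exp B) * (indicator \<Omega> x * wsq gg x)"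
        proof (cases "x \<in> W")
          case True
          then have "dist p x \<le> \<delta> + 2" by (simp add: W_def)
          from mult_left_mono[OF eB(2)[OF this] gg0[of x]] have "gg x \<le> exp B * (gg x * exp (- \<Phi> x))"
              by (simp add: mult_ac)
          then show ?thesis
            using True gg0[of x] by (simp add: W_def wsq_def ennreal_mult[symmetric] ennreal_leI)
        qed simp
      qed
      also have "\<dots> = ennreal (exp B) * (\<integral>\<^sup>+x. indicator \<Omega> x * wsq gg x \<partial>lborel)"
        by (rule nn_integral_cmult) simp
      also have "(\<integral>\<^sup>+x. indicator \<Omega> x * wsq gg x \<partial>lborel) \<le> ennreal (?n * b\<^sup>2)"
        using grad_sum_bound[of "\<lambda>x. 0" 0 g b] g(2) unfolding gg_def[abs_def] by blast
      finally have "(\<integral>\<^sup>+x. indicator (\<Omega> \<inter> ball p \<delta>) x * wsq (\<lambda>x. (norm (f x))\<^sup>2) x \<partial>lborel) \<le>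
         ennreal (exp B) * (ennreal (2 * 2 ^ ?d * (2 * s)\<^sup>2) * (ennreal (exp B) * ennreal (?n * b\<^sup>2)))
             + mean_energy zs C f"
        by (simp add: mult_left_mono add_right_mono)
      also have "ennreal (exp B) * (ennreal (2 * 2 ^ ?d * (2 * s)\<^sup>2)
          * (ennreal (exp B) * ennreal (?n * b\<^sup>2))) = ennreal ((K * s\<^sup>2) * b\<^sup>2)"
        by (simp add: ennreal_mult[symmetric] K_def power_mult_distrib mult_ac)
      also have "\<dots> \<le> ennreal (\<epsilon> * b\<^sup>2)" using sK by (intro ennreal_leI mult_right_mono) auto
      finally show ?thesis by (simp add: add_right_mono)
    qed
    then show "\<exists>zs C. 0 \<le> C \<and> good_sets zs \<and>
     (\<forall>(f :: real^'n \<Rightarrow> 'b) b. sob_bd (\<lambda>x. 0) (Suc 0) f b \<longrightarrow>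
       (\<integral>\<^sup>+x. indicator (\<Omega> \<inter> ball p \<delta>) x * wsq (\<lambda>x. (norm (f x))\<^sup>2) x \<partial>lborel) \<le>
           ennreal (\<epsilon> * b\<^sup>2) + mean_energy zs C f)"
      using C0 good by blast
  qed
  then show ?thesis using \<delta> by blast
qed

lemma compact_part_cball: "compact_part TYPE('b::euclidean_space) (cball 0 R0)"
proof -
  have "\<forall>p. \<exists>\<delta>>0. compact_part TYPE('b) (ball p \<delta>)" using compact_part_local by blast
  then obtain d where d: "\<And>p. d p > 0" "\<And>p. compact_part TYPE('b) (ball p (d p))" by metis
  have cov: "cball 0 R0 \<subseteq> (\<Union>p\<in>UNIV. ball p (d p))" using d(1)
      by (auto intro!: centre_in_ball[THEN iffD2])
  obtain X where X: "finite X" "cball 0 R0 \<subseteq> (\<Union>p\<in>X. ball p (d p))"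
    by (rule compactE_image[OF compact_cball _ cov]) auto
  have "compact_part TYPE('b) (\<Union>p\<in>X. ball p (d p))" using X(1) d(2) by (intro compact_part_UN) auto
  then show ?thesis using X(2) by (rule compact_part_mono)
qed

lemma compactness_ineq:
  assumes e: "\<epsilon> > 0"
  shows "\<exists>zs C. 0 \<le> C \<and> good_sets zs \<and>
     (\<forall>(f :: real^'n \<Rightarrow> 'b::euclidean_space) b. sob_bd (\<lambda>x. 0) (Suc 0) f b \<longrightarrow>
         energy f \<le> ennreal (\<epsilon> * b\<^sup>2) + mean_energy zs C f)"
proof -
  obtain C0 where C0: "C0 \<ge> 0" and H: "\<And>(f :: real^'n \<Rightarrow> 'b) b. sob_bd (\<lambda>x. 0) (Suc 0) f b \<Longrightarrow>
      grad_energy f \<le> ennreal ((C0 * b)\<^sup>2)"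
    using hardy_D[where 'b='b] by blast
  \<comment> \<open>Where the gradient is at least \<open>T\<close>, the energy is at most
    \<open>1 / T\<close> times \<open>grad_energy f\<close>, hence at most
    \<open>\<epsilon> / 2 * b\<^sup>2\<close> by the Hardy inequality.\<close>
  define T where "T = 2 * C0\<^sup>2 / \<epsilon> + 1"
  have T: "T \<ge> 1" using e by (simp add: T_def)
  have TC: "C0\<^sup>2 / T \<le> \<epsilon> / 2"
  proof -
    have "2 * C0\<^sup>2 \<le> \<epsilon> * T" using e by (simp add: T_def distrib_left)
    then show ?thesis using T by (simp add: field_simps)
  qed
  have "\<forall>\<^sub>F x in at_infinity. T \<le> norm (grad \<Phi> x)" using growth by (simp add: filterlim_at_top)
  then obtain R0 where R0: "\<And>x. norm x \<ge> R0 \<Longrightarrow> T \<le> norm (grad \<Phi> x)" by (auto simp: eventually_at_infinity)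
  obtain zs C where 1: "0 \<le> C" "good_sets zs" "\<And>(f :: real^'n \<Rightarrow> 'b) b. sob_bd (\<lambda>x. 0) (Suc 0) f b \<Longrightarrow>
       (\<integral>\<^sup>+x. indicator (\<Omega> \<inter> cball 0 R0) x * wsq (\<lambda>x. (norm (f x))\<^sup>2) x \<partial>lborel) \<le>
           ennreal (\<epsilon> / 2 * b\<^sup>2) + mean_energy zs C f"
    by (rule compact_partE[OF compact_part_cball[of R0] half_gt_zero[OF e]]) (rule that)
  have "energy f \<le> ennreal (\<epsilon> * b\<^sup>2) + mean_energy zs C f" if f: "sob_bd (\<lambda>x. 0) (Suc 0) f b"
      for f :: "real^'n \<Rightarrow> 'b" and b
  proof -
    have [measurable]: "f \<in> borel_measurable borel" using f by simp
    have [measurable]: "wsq (\<lambda>x. (norm (f x))\<^sup>2) \<in> borel_measurable borel" by (rule borel_wsq) simp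
    have [measurable]: "grad \<Phi> \<in> borel_measurable borel" by (rule borel_grad)
    have [measurable]: "\<Omega> \<inter> cball 0 R0 \<in> sets borel" by auto
    let ?far = "\<lambda>x. ennreal (1 / T) * (indicator \<Omega> x
        * (ennreal ((1 + norm (grad \<Phi> x))\<^sup>2) * wsq (\<lambda>x. (norm (f x))\<^sup>2) x))"
    have "energy f \<le> (\<integral>\<^sup>+x. indicator (\<Omega> \<inter> cball 0 R0) x * wsq (\<lambda>x. (norm (f x))\<^sup>2) x + ?far x \<partial>lborel)"
      unfolding energy_def
    proof (rule nn_integral_mono)
      fix x
      show "indicator \<Omega> x * wsq (\<lambda>x. (norm (f x))\<^sup>2) x \<le>
          indicator (\<Omega> \<inter> cball 0 R0) x * wsq (\<lambda>x. (norm (f x))\<^sup>2) x + ?far x"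
      proof (cases "x \<in> cball 0 R0")
        case True then show ?thesis by (auto simp: indicator_def)
      next
        case False
        then have "T \<le> norm (grad \<Phi> x)" by (intro R0) simp
        then have "T \<le> (1 + norm (grad \<Phi> x))\<^sup>2" using T
          by (smt (verit) power2_eq_square mult_le_cancel_left1 one_le_power power_one_right
              self_le_power zero_less_numeral)
        then have "1 \<le> 1 / T * (1 + norm (grad \<Phi> x))\<^sup>2" using T by (simp add: field_simps)
        then have "ennreal 1 * wsq (\<lambda>x. (norm (f x))\<^sup>2) x \<le>
            ennreal (1 / T * (1 + norm (grad \<Phi> x))\<^sup>2) * wsq (\<lambda>x. (norm (f x))\<^sup>2) x"
          by (intro mult_right_mono ennreal_leI) auto
        also have "ennreal (1 / T * (1 + norm (grad \<Phi> x))\<^sup>2) =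
            ennreal (1 / T) * ennreal ((1 + norm (grad \<Phi> x))\<^sup>2)"
          by (rule ennreal_mult) (use T in auto)
        finally have "wsq (\<lambda>x. (norm (f x))\<^sup>2) x \<le>
            ennreal (1 / T) * (ennreal ((1 + norm (grad \<Phi> x))\<^sup>2) * wsq (\<lambda>x. (norm (f x))\<^sup>2) x)"
          by (simp only: mult.assoc ennreal_1 mult_1)
        then show ?thesis by (auto simp: indicator_def)
      qed
    qed
    also have "\<dots> = (\<integral>\<^sup>+x. indicator (\<Omega> \<inter> cball 0 R0) x * wsq (\<lambda>x. (norm (f x))\<^sup>2) x \<partial>lborel)
        + ennreal (1 / T) * grad_energy f"
      unfolding grad_energy_def by (subst nn_integral_add, simp, simp, subst nn_integral_cmult, simp_all)
    also have "\<dots> \<le> (ennreal (\<epsilon> / 2 * b\<^sup>2) + mean_energy zs C f) + ennreal (1 / T) * ennreal ((C0 * b)\<^sup>2)"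
      by (intro add_mono mult_left_mono 1(3) H f) simp
    also have "ennreal (1 / T) * ennreal ((C0 * b)\<^sup>2) = ennreal (C0\<^sup>2 / T * b\<^sup>2)"
      using T by (simp add: ennreal_mult[symmetric] power_mult_distrib)
    also have "\<dots> \<le> ennreal (\<epsilon> / 2 * b\<^sup>2)" using TC by (intro ennreal_leI mult_right_mono) auto
    finally have "energy f \<le> (ennreal (\<epsilon> / 2 * b\<^sup>2) + mean_energy zs C f) + ennreal (\<epsilon> / 2 * b\<^sup>2)"
      by (simp add: add_left_mono)
    also have "\<dots> = (ennreal (\<epsilon> / 2 * b\<^sup>2) + ennreal (\<epsilon> / 2 * b\<^sup>2)) + mean_energy zs C f"
        by (simp add: ac_simps)
    also have "ennreal (\<epsilon> / 2 * b\<^sup>2) + ennreal (\<epsilon> / 2 * b\<^sup>2) = ennreal (\<epsilon> * b\<^sup>2)"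
      using e by (subst ennreal_plus[symmetric]) auto
    finally show ?thesis .
  qed
  then show ?thesis using 1 by blast
qed

end

section \<open>Extraction of convergent subsequences\<close>

context weighted_domain
begin

lemma energy_uminus: "energy (\<lambda>x. - f x) = energy f"
  by (simp add: energy_def)

lemma twisted_deriv_uminus: "twisted_deriv \<Omega> \<theta> j f g \<Longrightarrow> twisted_deriv \<Omega> \<theta> j (\<lambda>x. - f x) (\<lambda>x. - g x)"
  by (simp add: twisted_deriv_def)

lemma sob_bd_uminus: "sob_bd \<theta> k f b \<Longrightarrow> sob_bd \<theta> k (\<lambda>x. - f x) b"
proof (induction k arbitrary: f)
  case (Suc k)
  have "\<exists>h. twisted_deriv \<Omega> \<theta> j (\<lambda>x. - f x) h \<and> sob_bd \<theta> k h b" for j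
    using Suc.prems Suc.IH twisted_deriv_uminus by (metis sob_bd.simps(2))
  then show ?case using Suc.prems by (simp add: energy_uminus)
qed (simp add: energy_uminus)

lemma sob_bd_diff:
  assumes "smooth_on UNIV \<theta>" "0 \<le> b1" "0 \<le> b2" "sob_bd \<theta> k f b1" "sob_bd \<theta> k g b2"
  shows "sob_bd \<theta> k (\<lambda>x. f x - g x) (2 * (b1 + b2))"
  using sob_bd_add[OF assms(1-4) sob_bd_uminus[OF assms(5)]] by simp

lemma functional_continuous:
  assumes [measurable]: "a \<in> borel_measurable borel" and a: "\<And>x. \<bar>a x\<bar> \<le> B" "\<And>x. x \<notin> Z \<Longrightarrow> a x = 0"
    and Z: "bounded Z" "Z \<subseteq> \<Omega>"
  shows "\<exists>M\<ge>0. \<forall>(f :: real^'n \<Rightarrow> 'b::euclidean_space) b. f \<in> borel_measurable borel \<longrightarrow>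
      energy f \<le> ennreal (b\<^sup>2) \<longrightarrow>
    integrable lborel (\<lambda>x. a x *\<^sub>R f x) \<and> norm (\<integral>x. a x *\<^sub>R f x \<partial>lborel) \<le> M * \<bar>b\<bar>"
proof -
  have "\<exists>M\<ge>0. \<forall>f :: real^'n \<Rightarrow> 'b. f \<in> borel_measurable borel \<longrightarrow>
    (\<integral>\<^sup>+x. ennreal (norm (a x *\<^sub>R f x)) \<partial>lborel)\<^sup>2 \<le> ennreal M * energy f"
    by (rule functional_bound[OF assms])
  then obtain M where M: "M \<ge> 0" "\<And>f :: real^'n \<Rightarrow> 'b. f \<in> borel_measurable borel \<Longrightarrow>
    (\<integral>\<^sup>+x. ennreal (norm (a x *\<^sub>R f x)) \<partial>lborel)\<^sup>2 \<le> ennreal M * energy f" by blast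
  have "integrable lborel (\<lambda>x. a x *\<^sub>R f x) \<and> norm (\<integral>x. a x *\<^sub>R f x \<partial>lborel) \<le> sqrt M * \<bar>b\<bar>"
    if [measurable]: "f \<in> borel_measurable borel" and e: "energy f \<le> ennreal (b\<^sup>2)"
        for f :: "real^'n \<Rightarrow> 'b" and b
  proof
    let ?I = "\<integral>\<^sup>+x. ennreal (norm (a x *\<^sub>R f x)) \<partial>lborel"
    have "?I\<^sup>2 \<le> ennreal M * energy f" by (rule M(2)) simp
    also have "\<dots> \<le> ennreal M * ennreal (b\<^sup>2)" by (rule mult_left_mono[OF e]) simp
    finally have I2: "?I\<^sup>2 \<le> ennreal (M * b\<^sup>2)" using M(1) by (simp add: ennreal_mult)
    also have "\<dots> < \<infinity>" by simp
    finally have "?I < \<infinity>" by (auto simp: power_less_top_ennreal)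
    then show "integrable lborel (\<lambda>x. a x *\<^sub>R f x)" by (intro integrableI_bounded) auto
    have "(ennreal (norm (\<integral>x. a x *\<^sub>R f x \<partial>lborel)))\<^sup>2 \<le> ?I\<^sup>2"
        by (intro power_mono norm_integral_le_nn) simp
    also note I2
    finally have "(norm (\<integral>x. a x *\<^sub>R f x \<partial>lborel))\<^sup>2 \<le> M * b\<^sup>2" using M(1) by (simp add: ennreal_power)
    also have "\<dots> = (sqrt M * \<bar>b\<bar>)\<^sup>2" using M(1) by (simp add: power_mult_distrib)
    finally show "norm (\<integral>x. a x *\<^sub>R f x \<partial>lborel) \<le> sqrt M * \<bar>b\<bar>"
        by (rule power2_le_imp_le) (use M in simp)
  qed
  moreover have "sqrt M \<ge> 0" using M by simp
  ultimately show ?thesis by blast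
qed

lemma set_functional:
  assumes "open Z" "bounded Z" "Z \<subseteq> \<Omega>"
  shows "\<exists>M\<ge>0. \<forall>(f :: real^'n \<Rightarrow> 'b::euclidean_space) b. f \<in> borel_measurable borel \<longrightarrow>
      energy f \<le> ennreal (b\<^sup>2) \<longrightarrow>
    integrable lborel (\<lambda>x. indicator Z x *\<^sub>R f x) \<and> norm (\<integral>x. indicator Z x *\<^sub>R f x \<partial>lborel) \<le> M * \<bar>b\<bar>"
proof (rule functional_continuous[where a="indicator Z" and B=1 and Z=Z])
  show "indicator Z \<in> borel_measurable borel" using assms(1) by simp
qed (use assms in \<open>auto simp: indicator_def\<close>)

lemma test_functional:
  assumes "\<eta> \<in> test_functions \<Omega>"
  shows "\<exists>M\<ge>0. \<forall>(f :: real^'n \<Rightarrow> 'b::euclidean_space) b. f \<in> borel_measurable borel \<longrightarrow>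
      energy f \<le> ennreal (b\<^sup>2) \<longrightarrow>
    integrable lborel (\<lambda>x. \<eta> x *\<^sub>R f x) \<and> norm (\<integral>x. \<eta> x *\<^sub>R f x \<partial>lborel) \<le> M * \<bar>b\<bar>"
proof -
  obtain B where B: "\<And>x. \<bar>\<eta> x\<bar> \<le> B" using test_functions_bounded[OF assms] by metis
  obtain K where K: "compact K" "K \<subseteq> \<Omega>" "\<And>x. x \<notin> K \<Longrightarrow> \<eta> x = 0" using test_functionsE[OF assms] by metis
  show ?thesis
    by (rule functional_continuous[OF test_functions_borel[OF assms] B K(3) compact_imp_bounded[OF K(1)]
        K(2)])
qed

lemma mean_energy_Cauchy:
  fixes F :: "nat \<Rightarrow> real^'n \<Rightarrow> 'b::euclidean_space"
  assumes C: "C \<ge> 0"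
  shows "(\<And>Z i. Z \<in> set zs \<Longrightarrow> integrable lborel (\<lambda>x. indicator Z x *\<^sub>R F i x)) \<Longrightarrow>
    (\<And>Z. Z \<in> set zs \<Longrightarrow> Cauchy (\<lambda>i. \<integral>x. indicator Z x *\<^sub>R F i x \<partial>lborel)) \<Longrightarrow> e > 0 \<Longrightarrow>
    \<exists>I. \<forall>i\<ge>I. \<forall>j\<ge>I. mean_energy zs C (\<lambda>x. F i x - F j x) \<le> ennreal e"
proof (induction zs arbitrary: e)
  case Nil
  show ?case by (simp add: mean_energy_def)
next
  case (Cons Z zs)
  have "\<exists>I. \<forall>i\<ge>I. \<forall>j\<ge>I. mean_energy zs C (\<lambda>x. F i x - F j x) \<le> ennreal (e / 2)"
    by (rule Cons.IH) (use Cons.prems in auto)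
  then obtain I where I: "\<forall>i\<ge>I. \<forall>j\<ge>I. mean_energy zs C (\<lambda>x. F i x - F j x) \<le> ennreal (e / 2)" by blast
  define d where "d = sqrt (e / (2 * (C + 1)))"
  have d: "d > 0" using Cons.prems(3) C by (simp add: d_def)
  have Cd: "C * d\<^sup>2 \<le> e / 2"
  proof -
    have "d\<^sup>2 = e / (2 * (C + 1))" using Cons.prems(3) C by (simp add: d_def)
    then have "C * d\<^sup>2 = (C / (C + 1)) * (e / 2)" by simp
    also have "\<dots> \<le> 1 * (e / 2)" using C Cons.prems(3) by (intro mult_right_mono) auto
    finally show ?thesis by simp
  qed
  have "Cauchy (\<lambda>i. \<integral>x. indicator Z x *\<^sub>R F i x \<partial>lborel)" by (rule Cons.prems(2)) simp
  then obtain I' where I': "\<And>i j. i \<ge> I' \<Longrightarrow> j \<ge> I' \<Longrightarrow>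
      norm ((\<integral>x. indicator Z x *\<^sub>R F i x \<partial>lborel) - (\<integral>x. indicator Z x *\<^sub>R F j x \<partial>lborel)) < d"
    using d unfolding Cauchy_iff by blast
  have "mean_energy (Z # zs) C (\<lambda>x. F i x - F j x) \<le> ennreal e" if "i \<ge> max I I'" "j \<ge> max I I'" for i j
  proof -
    have i: "integrable lborel (\<lambda>x. indicator Z x *\<^sub>R F i x)" for i by (rule Cons.prems(1)) simp
    have "(\<integral>x. indicator Z x *\<^sub>R (F i x - F j x) \<partial>lborel) =
        (\<integral>x. indicator Z x *\<^sub>R F i x \<partial>lborel) - (\<integral>x. indicator Z x *\<^sub>R F j x \<partial>lborel)"
      unfolding scaleR_right_diff_distrib by (rule Bochner_Integration.integral_diff[OF i i])
    then have "norm (\<integral>x. indicator Z x *\<^sub>R (F i x - F j x) \<partial>lborel) \<le> d" using I'[of i j] that by simp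
    then have "C * (norm (\<integral>x. indicator Z x *\<^sub>R (F i x - F j x) \<partial>lborel))\<^sup>2 \<le> C * d\<^sup>2"
      using C by (intro mult_left_mono power_mono) auto
    then have "ennreal (C * (norm (\<integral>x. indicator Z x *\<^sub>R (F i x - F j x) \<partial>lborel))\<^sup>2) \<le> ennreal (e / 2)"
      using Cd by (intro ennreal_leI) simp
    then have "mean_energy (Z # zs) C (\<lambda>x. F i x - F j x) \<le> ennreal (e / 2) + ennreal (e / 2)"
      
      using I that unfolding mean_energy_def by (auto intro!: add_mono)
    also have "\<dots> = ennreal e" using Cons.prems(3) by (subst ennreal_plus[symmetric]) auto
    finally show ?thesis .
  qed
  then show ?case by blast
qed

text \<open>The sets belonging to the tolerances 1/(n+1) form one countable family, so a diagonal
  subsequence makes all their integrals converge. The compactness inequality is then applied to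
  differences of two members, whose integrals over finitely many of these sets become small.\<close>

lemma Cauchy_subsequence:
  fixes F :: "nat \<Rightarrow> real^'n \<Rightarrow> 'b::euclidean_space"
  assumes b: "b \<ge> 0" and F: "\<And>i. sob_bd (\<lambda>x. 0) (Suc 0) (F i) b"
  shows "\<exists>s :: nat \<Rightarrow> nat. strict_mono s \<and> (\<forall>e>0. \<exists>I. \<forall>i\<ge>I. \<forall>j\<ge>I. energy (\<lambda>x. F (s i) x - F (s j) x) \<le>
      ennreal e)"
proof -
  have "\<exists>zs C. 0 \<le> C \<and> good_sets zs \<and> (\<forall>(f :: real^'n \<Rightarrow> 'b) b. sob_bd (\<lambda>x. 0) (Suc 0) f b \<longrightarrow>
      energy f \<le> ennreal (1 / real (Suc n) * b\<^sup>2) + mean_energy zs C f)" for n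
    by (rule compactness_ineq) simp
  then obtain zs C where zs: "\<And>n. 0 \<le> C n" "\<And>n. good_sets (zs n)"
      "\<And>n (f :: real^'n \<Rightarrow> 'b) b. sob_bd (\<lambda>x. 0) (Suc 0) f b \<Longrightarrow>
      energy f \<le> ennreal (1 / real (Suc n) * b\<^sup>2) + mean_energy (zs n) (C n) f" by metis
  define S where "S = (\<Union>n. set (zs n))"
  have cS: "countable S" unfolding S_def by (intro countable_UN) (auto intro: countable_finite)
  have FD: "F i \<in> borel_measurable borel" "energy (F i) \<le> ennreal (b\<^sup>2)" for i using sob_bdD[OF F]
      by auto
  have "\<forall>Z\<in>S. \<exists>M\<ge>0. \<forall>i. integrable lborel (\<lambda>x. indicator Z x *\<^sub>R F i x)
      \<and> norm (\<integral>x. indicator Z x *\<^sub>R F i x \<partial>lborel) \<le> M"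
  proof
    fix Z assume "Z \<in> S"
    then have Z: "open Z" "bounded Z" "Z \<subseteq> \<Omega>" using zs(2) by (auto simp: S_def good_sets_def)
    obtain M where "M \<ge> 0" "\<And>(f :: real^'n \<Rightarrow> 'b) b. f \<in> borel_measurable borel \<Longrightarrow>
        energy f \<le> ennreal (b\<^sup>2) \<Longrightarrow>
       integrable lborel (\<lambda>x. indicator Z x *\<^sub>R f x) \<and> norm (\<integral>x. indicator Z x *\<^sub>R f x \<partial>lborel) \<le>
           M * \<bar>b\<bar>"
      using set_functional[OF Z, where 'b='b] by blast
    then show "\<exists>M\<ge>0. \<forall>i. integrable lborel (\<lambda>x. indicator Z x *\<^sub>R F i x)
        \<and> norm (\<integral>x. indicator Z x *\<^sub>R F i x \<partial>lborel) \<le> M"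
      using FD by (intro exI[of _ "M * \<bar>b\<bar>"]) auto
  qed
  then obtain M where M: "\<And>Z. Z \<in> S \<Longrightarrow> M Z \<ge> 0" "\<And>Z i. Z \<in> S \<Longrightarrow>
      integrable lborel (\<lambda>x. indicator Z x *\<^sub>R F i x)"
    "\<And>Z i. Z \<in> S \<Longrightarrow> norm (\<integral>x. indicator Z x *\<^sub>R F i x \<partial>lborel) \<le> M Z"
    by metis
  define L where "L i Z = (\<integral>x. indicator Z x *\<^sub>R F i x \<partial>lborel)" for i Z
  \<comment> \<open>The scaling provides the uniform bound that the diagonal argument requires;
    \<open>Cau\<close> undoes it.\<close>
  have "norm (L i Z /\<^sub>R (M Z + 1)) \<le> 1" if "Z \<in> S" for i Z
  proof -
    have "norm (L i Z) \<le> M Z + 1" using M(3)[OF that, of i] by (simp add: L_def)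
    then show ?thesis using M(1)[OF that] by (simp add: field_simps)
  qed
  then obtain s where s: "strict_mono (s :: nat \<Rightarrow> nat)" "\<And>Z. Z \<in> S \<Longrightarrow>
      \<exists>l. (\<lambda>n. L (s n) Z /\<^sub>R (M Z + 1)) \<longlonglongrightarrow> l"
    using function_convergent_subsequence[OF cS, of "\<lambda>i Z. L i Z /\<^sub>R (M Z + 1)" 1] by blast
  have Cau: "Cauchy (\<lambda>n. L (s n) Z)" if Z: "Z \<in> S" for Z
  proof -
    obtain l where "(\<lambda>n. L (s n) Z /\<^sub>R (M Z + 1)) \<longlonglongrightarrow> l" using s(2)[OF Z] by blast
    then have "(\<lambda>n. (M Z + 1) *\<^sub>R (L (s n) Z /\<^sub>R (M Z + 1))) \<longlonglongrightarrow> (M Z + 1) *\<^sub>R l" by (intro tendsto_intros)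
    moreover have "M Z + 1 \<noteq> 0" using M(1)[OF Z] by linarith
    ultimately have "(\<lambda>n. L (s n) Z) \<longlonglongrightarrow> (M Z + 1) *\<^sub>R l" by simp
    then show ?thesis by (rule LIMSEQ_imp_Cauchy)
  qed
  have "\<exists>I. \<forall>i\<ge>I. \<forall>j\<ge>I. energy (\<lambda>x. F (s i) x - F (s j) x) \<le> ennreal e" if e: "e > 0" for e
  proof -
    \<comment> \<open>\<open>4 * b\<close> is the bound that \<open>sob_bd_diff\<close> gives for
      differences of two members.\<close>
    obtain n where n: "1 / real (Suc n) * (4 * b)\<^sup>2 \<le> e / 2"
    proof -
      obtain n :: nat where "real n \<ge> (4 * b)\<^sup>2 / (e / 2)" using real_arch_simple by blast
      then have "(4 * b)\<^sup>2 \<le> real n * (e / 2)" using e by (simp add: field_simps)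
      also have "\<dots> \<le> real (Suc n) * (e / 2)" using e by (intro mult_right_mono) auto
      finally have "1 / real (Suc n) * (4 * b)\<^sup>2 \<le> e / 2" by (simp add: field_simps)
      then show ?thesis by (rule that)
    qed
    have sub: "Z \<in> S" if "Z \<in> set (zs n)" for Z using that by (auto simp: S_def)
    have "\<exists>I. \<forall>i\<ge>I. \<forall>j\<ge>I. mean_energy (zs n) (C n) (\<lambda>x. F (s i) x - F (s j) x) \<le> ennreal (e / 2)"
      by (rule mean_energy_Cauchy[OF zs(1)[of n]]) (use M(2)[OF sub] Cau[OF sub] e in \<open>auto simp: L_def\<close>)
    then obtain I where I: "\<forall>i\<ge>I. \<forall>j\<ge>I. mean_energy (zs n) (C n) (\<lambda>x. F (s i) x - F (s j) x) \<le>
        ennreal (e / 2)" by blast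
    have "energy (\<lambda>x. F (s i) x - F (s j) x) \<le> ennreal e" if "i \<ge> I" "j \<ge> I" for i j
    proof -
      have "sob_bd (\<lambda>x. 0) (Suc 0) (\<lambda>x. F (s i) x - F (s j) x) (2 * (b + b))"
        by (rule sob_bd_diff[OF _ b b F F]) simp
      then have "sob_bd (\<lambda>x. 0) (Suc 0) (\<lambda>x. F (s i) x - F (s j) x) (4 * b)" by (simp del: sob_bd.simps)
      from zs(3)[OF this, of n] have "energy (\<lambda>x. F (s i) x - F (s j) x) \<le>
          ennreal (1 / real (Suc n) * (4 * b)\<^sup>2)
          + mean_energy (zs n) (C n) (\<lambda>x. F (s i) x - F (s j) x)" .
      also have "\<dots> \<le> ennreal (e / 2) + ennreal (e / 2)" using n I that
          by (intro add_mono ennreal_leI) auto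
      also have "\<dots> = ennreal e" using e by (subst ennreal_plus[symmetric]) auto
      finally show ?thesis .
    qed
    then show ?thesis by blast
  qed
  then show ?thesis using s(1) by blast
qed

text \<open>Riesz-Fischer. Along a subsequence whose consecutive differences have energy at most
  8^(-n), the sum of 4^n times these energies is finite, so almost everywhere the differences are
  O(2^(-n)) and the subsequence converges pointwise. Fatou's lemma transfers the Cauchy condition to
  the limit.\<close>

lemma energy_complete:
  fixes G :: "nat \<Rightarrow> real^'n \<Rightarrow> 'b::euclidean_space"
  assumes G[measurable]: "\<And>i. G i \<in> borel_measurable borel"
    and Cau: "\<And>e. e > 0 \<Longrightarrow> \<exists>I. \<forall>i\<ge>I. \<forall>j\<ge>I. energy (\<lambda>x. G i x - G j x) \<le> ennreal e"
  shows "\<exists>g\<in>borel_measurable borel. \<forall>e>0. \<exists>I. \<forall>i\<ge>I. energy (\<lambda>x. G i x - g x) \<le> ennreal e"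
proof -
  have "\<forall>n. \<exists>I. \<forall>i\<ge>I. \<forall>j\<ge>I. energy (\<lambda>x. G i x - G j x) \<le> ennreal ((1/8) ^ n)" using Cau by auto
  then obtain N where N: "\<And>n i j. i \<ge> N n \<Longrightarrow> j \<ge> N n \<Longrightarrow> energy (\<lambda>x. G i x - G j x) \<le> ennreal ((1/8) ^ n)"
      by metis
  \<comment> \<open>The sum makes \<open>s n\<close> and \<open>s (Suc n)\<close> both at least
    \<open>N n\<close>; the summand \<open>n\<close> makes the indices tend to infinity.\<close>
  define s where "s n = n + (\<Sum>k\<le>n. N k)" for n
  have sN: "s n \<ge> N n" "s (Suc n) \<ge> N n" "s n \<ge> n" for n
  proof -
    have "N n \<le> (\<Sum>k\<le>n. N k)" by (rule member_le_sum) auto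
    then show "s n \<ge> N n" "s (Suc n) \<ge> N n" "s n \<ge> n" by (auto simp: s_def)
  qed
  define d where "d n x = G (s (Suc n)) x - G (s n) x" for n x
  have [measurable]: "d n \<in> borel_measurable borel" for n unfolding d_def by measurable
  have wd[measurable]: "wsq (\<lambda>x. (norm (d n x))\<^sup>2) \<in> borel_measurable borel" for n
      by (rule borel_wsq) simp
  have ed: "energy (d n) \<le> ennreal ((1/8) ^ n)" for n
    unfolding d_def[abs_def] by (rule N) (rule sN)+
  let ?H = "\<lambda>x. \<Sum>n. ennreal (4 ^ n) * (indicator \<Omega> x * wsq (\<lambda>x. (norm (d n x))\<^sup>2) x)"
  have "(\<integral>\<^sup>+x. ?H x \<partial>lborel) = (\<Sum>n. \<integral>\<^sup>+x. ennreal (4 ^ n)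
      * (indicator \<Omega> x * wsq (\<lambda>x. (norm (d n x))\<^sup>2) x) \<partial>lborel)"
    by (rule nn_integral_suminf) simp
  also have "\<dots> = (\<Sum>n. ennreal (4 ^ n) * energy (d n))"
    unfolding energy_def by (intro suminf_cong nn_integral_cmult) simp
  also have "\<dots> \<le> (\<Sum>n. ennreal ((1/2) ^ n))"
  proof (rule suminf_le)
    fix n
    have "ennreal (4 ^ n) * energy (d n) \<le> ennreal (4 ^ n) * ennreal ((1/8) ^ n)"
        by (intro mult_left_mono ed) simp
    also have "\<dots> = ennreal ((1/2) ^ n)" by (simp add: ennreal_mult[symmetric]
        power_mult_distrib[symmetric])
    finally show "ennreal (4 ^ n) * energy (d n) \<le> ennreal ((1/2) ^ n)" .
  qed auto
  also have "\<dots> = ennreal (\<Sum>n. (1/2) ^ n)" by (rule suminf_ennreal2) auto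
  also have "\<dots> < \<infinity>" by simp
  finally have fin: "(\<integral>\<^sup>+x. ?H x \<partial>lborel) \<noteq> \<infinity>" by simp
  have AE: "AE x in lborel. ?H x \<noteq> \<infinity>"
    by (rule nn_integral_noteq_infinite[OF _ fin]) simp
  have conv: "convergent (\<lambda>n. G (s n) x)" if H: "?H x \<noteq> \<infinity>" and x: "x \<in> \<Omega>" for x
  proof -
    obtain m where m: "?H x = ennreal m" "m \<ge> 0" using H by (cases "?H x") auto
    have "norm (d n x) \<le> sqrt (m * exp (\<Phi> x)) * (1/2) ^ n" for n
    proof -
      have "ennreal (4 ^ n) * (indicator \<Omega> x * wsq (\<lambda>x. (norm (d n x))\<^sup>2) x) =
          (\<Sum>k\<in>{n}. ennreal (4 ^ k) * (indicator \<Omega> x * wsq (\<lambda>x. (norm (d k x))\<^sup>2) x))" by simp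
      also have "\<dots> \<le> ?H x" by (rule sum_le_suminf) auto
      finally have "ennreal (4 ^ n * ((norm (d n x))\<^sup>2 * exp (- \<Phi> x))) \<le> ennreal m"
        using x m(1) by (simp add: wsq_def ennreal_mult)
      then have "4 ^ n * ((norm (d n x))\<^sup>2 * exp (- \<Phi> x)) \<le> m" using m(2) by simp
      then have "(4 ^ n * ((norm (d n x))\<^sup>2 * exp (- \<Phi> x))) * (exp (\<Phi> x) * (1/4) ^ n) \<le>
          m * (exp (\<Phi> x) * (1/4) ^ n)"
        by (intro mult_right_mono) auto
      also have "(4 ^ n * ((norm (d n x))\<^sup>2 * exp (- \<Phi> x))) * (exp (\<Phi> x) * (1/4) ^ n) =
          (norm (d n x))\<^sup>2 * (exp (- \<Phi> x) * exp (\<Phi> x)) * (4 ^ n * (1/4) ^ n)"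
        by (simp only: mult_ac)
      also have "\<dots> = (norm (d n x))\<^sup>2" by (simp add: exp_minus power_mult_distrib[symmetric])
      also have "m * (exp (\<Phi> x) * (1/4) ^ n) = (sqrt (m * exp (\<Phi> x)) * (1/2) ^ n)\<^sup>2"
        using m(2) by (simp add: power_mult_distrib power2_eq_square[of "(1/2) ^ n"]
            power_mult_distrib[symmetric] mult.assoc)
      finally show ?thesis by (rule power2_le_imp_le) (use m in auto)
    qed
    then have "summable (\<lambda>n. d n x)"
      by (intro summable_comparison_test[of "\<lambda>n. d n x" "\<lambda>n. sqrt (m * exp (\<Phi> x)) * (1/2) ^ n"])
         (auto intro!: summable_mult summable_geometric)
    then have "convergent (\<lambda>n. \<Sum>k<n. d k x)" by (simp add: summable_iff_convergent)
    moreover have "(\<Sum>k<n. d k x) = G (s n) x - G (s 0) x" for n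
      unfolding d_def by (rule sum_lessThan_telescope)
    ultimately have "convergent (\<lambda>n. (G (s n) x - G (s 0) x) + G (s 0) x)"
        by (intro convergent_add convergent_const) simp
    then show ?thesis by simp
  qed
  \<comment> \<open>Only the values in \<Omega> off a null set matter; where the sequence diverges
    \<open>lim\<close> is arbitrary.\<close>
  define g where "g x = lim (\<lambda>n. G (s n) x)" for x
  have g[measurable]: "g \<in> borel_measurable borel" unfolding g_def[abs_def]
      by (rule borel_measurable_lim_metric) simp
  have "\<exists>I. \<forall>i\<ge>I. energy (\<lambda>x. G i x - g x) \<le> ennreal e" if e: "e > 0" for e
  proof -
    obtain I where I: "\<And>i j. i \<ge> I \<Longrightarrow> j \<ge> I \<Longrightarrow> energy (\<lambda>x. G i x - G j x) \<le> ennreal e" using Cau[OF e]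
        by blast
    have "energy (\<lambda>x. G i x - g x) \<le> ennreal e" if i: "i \<ge> I" for i
    proof -
      let ?u = "\<lambda>n x. indicator \<Omega> x * wsq (\<lambda>x. (norm (G i x - G (s n) x))\<^sup>2) x"
      have [measurable]: "wsq (\<lambda>x. (norm (G i x - G (s n) x))\<^sup>2) \<in> borel_measurable borel" for n
          by (rule borel_wsq) simp
      have "energy (\<lambda>x. G i x - g x) = (\<integral>\<^sup>+x. liminf (\<lambda>n. ?u n x) \<partial>lborel)"
        unfolding energy_def
      proof (rule nn_integral_cong_AE)
        show "AE x in lborel. indicator \<Omega> x * wsq (\<lambda>x. (norm (G i x - g x))\<^sup>2) x = liminf (\<lambda>n. ?u n x)"
          using AE
        proof eventually_elim
          case (elim x)
          have "(\<lambda>n. ?u n x) \<longlonglongrightarrow> indicator \<Omega> x * wsq (\<lambda>x. (norm (G i x - g x))\<^sup>2) x"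
          proof (cases "x \<in> \<Omega>")
            case True
            then have "(\<lambda>n. G (s n) x) \<longlonglongrightarrow> g x" using conv[OF elim True] unfolding g_def
                by (simp add: convergent_LIMSEQ_iff)
            then have "(\<lambda>n. (norm (G i x - G (s n) x))\<^sup>2 * exp (- \<Phi> x)) \<longlonglongrightarrow> (norm (G i x - g x))\<^sup>2
                * exp (- \<Phi> x)"
              by (intro tendsto_intros)
            then have "(\<lambda>n. ennreal ((norm (G i x - G (s n) x))\<^sup>2 * exp (- \<Phi> x))) \<longlonglongrightarrow> ennreal
                ((norm (G i x - g x))\<^sup>2 * exp (- \<Phi> x))"
              by (rule tendsto_ennrealI)
            then show ?thesis using True by (simp add: wsq_def)
          qed simp
          then show ?case by (simp add: lim_imp_Liminf)
        qed
      qed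
      also have "\<dots> \<le> liminf (\<lambda>n. \<integral>\<^sup>+x. ?u n x \<partial>lborel)"
        by (rule nn_integral_liminf) simp
      also have "\<dots> \<le> ennreal e"
      proof (rule Liminf_le)
        show "\<forall>\<^sub>F n in sequentially. (\<integral>\<^sup>+x. ?u n x \<partial>lborel) \<le> ennreal e"
          using eventually_ge_at_top[of I]
        proof eventually_elim
          case (elim n)
          then have "s n \<ge> I" using sN(3)[of n] by simp
          then show ?case using I[OF i, of "s n"] by (simp add: energy_def)
        qed
      qed simp
      finally show ?thesis .
    qed
    then show ?thesis by blast
  qed
  then show ?thesis using g by blast
qed

text \<open>Pairing with a fixed test function is continuous in the energy, so the defining identity
  passes to the limit.\<close>

lemma twisted_deriv_limit:
  fixes F G :: "nat \<Rightarrow> real^'n \<Rightarrow> 'b::euclidean_space"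
  assumes [measurable]: "\<And>i. F i \<in> borel_measurable borel" "\<And>i. G i \<in> borel_measurable borel"
      "g \<in> borel_measurable borel" "h \<in> borel_measurable borel"
    and fin: "\<And>i. energy (F i) \<le> ennreal (b\<^sup>2)" "\<And>i. energy (G i) \<le> ennreal (b\<^sup>2)"
    and wd: "\<And>i. twisted_deriv \<Omega> (\<lambda>x. 0) j (F i) (G i)"
    and lim: "\<And>e. e > 0 \<Longrightarrow> \<exists>I. \<forall>i\<ge>I. energy (\<lambda>x. F i x - g x) \<le> ennreal (e\<^sup>2)"
       "\<And>e. e > 0 \<Longrightarrow> \<exists>I. \<forall>i\<ge>I. energy (\<lambda>x. G i x - h x) \<le> ennreal (e\<^sup>2)"
  shows "twisted_deriv \<Omega> (\<lambda>x. 0) j g h"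
  unfolding twisted_deriv_0 weak_deriv_def
proof
  fix \<eta> :: "real^'n \<Rightarrow> real" assume \<eta>: "\<eta> \<in> test_functions \<Omega>"
  obtain M1 where M1: "M1 \<ge> 0" "\<And>(f :: real^'n \<Rightarrow> 'b) b. f \<in> borel_measurable borel \<Longrightarrow>
      energy f \<le> ennreal (b\<^sup>2) \<Longrightarrow>
    integrable lborel (\<lambda>x. \<eta> x *\<^sub>R f x) \<and> norm (\<integral>x. \<eta> x *\<^sub>R f x \<partial>lborel) \<le> M1 * \<bar>b\<bar>"
    using test_functional[OF \<eta>, where 'b='b] by blast
  obtain M2 where M2: "M2 \<ge> 0" "\<And>(f :: real^'n \<Rightarrow> 'b) b. f \<in> borel_measurable borel \<Longrightarrow>
      energy f \<le> ennreal (b\<^sup>2) \<Longrightarrow>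
    integrable lborel (\<lambda>x. partial j \<eta> x *\<^sub>R f x) \<and> norm (\<integral>x. partial j \<eta> x *\<^sub>R f x \<partial>lborel) \<le> M2 * \<bar>b\<bar>"
    using test_functional[OF test_functions_partial[OF \<eta>], where 'b='b] by blast
  let ?A = "\<integral>x. partial j \<eta> x *\<^sub>R g x \<partial>lborel" and ?B = "\<integral>x. \<eta> x *\<^sub>R h x \<partial>lborel"
  have "norm (?A + ?B) \<le> (M1 + M2) * e" if e: "e > 0" for e
  proof -
    obtain I1 I2 where "\<forall>i\<ge>I1. energy (\<lambda>x. F i x - g x) \<le>
        ennreal (e\<^sup>2)" "\<forall>i\<ge>I2. energy (\<lambda>x. G i x - h x) \<le> ennreal (e\<^sup>2)"
      using lim e by metis
    then obtain i where i: "energy (\<lambda>x. F i x - g x) \<le> ennreal (e\<^sup>2)" "energy (\<lambda>x. G i x - h x) \<le>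
        ennreal (e\<^sup>2)"
      by (meson max.cobounded1 max.cobounded2)
    have iF: "integrable lborel (\<lambda>x. partial j \<eta> x *\<^sub>R F i x)" using M2(2)[OF _ fin(1)] by simp
    have iG: "integrable lborel (\<lambda>x. \<eta> x *\<^sub>R G i x)" using M1(2)[OF _ fin(2)] by simp
    have dF: "integrable lborel (\<lambda>x. partial j \<eta> x *\<^sub>R (F i x - g x))"
        "norm (\<integral>x. partial j \<eta> x *\<^sub>R (F i x - g x) \<partial>lborel) \<le> M2 * e"
      using M2(2)[OF _ i(1)] e by auto
    have dG: "integrable lborel (\<lambda>x. \<eta> x *\<^sub>R (G i x - h x))" "norm (\<integral>x. \<eta> x *\<^sub>R (G i x - h x) \<partial>lborel) \<le>
        M1 * e"
      using M1(2)[OF _ i(2)] e by auto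
    have "?A = (\<integral>x. partial j \<eta> x *\<^sub>R F i x - partial j \<eta> x *\<^sub>R (F i x - g x) \<partial>lborel)"
      by (simp add: scaleR_right_diff_distrib)
    also have "\<dots> = (\<integral>x. partial j \<eta> x *\<^sub>R F i x \<partial>lborel) - (\<integral>x. partial j \<eta> x *\<^sub>R (F i x - g x) \<partial>lborel)"
      by (rule Bochner_Integration.integral_diff[OF iF dF(1)])
    finally have A: "?A = (\<integral>x. partial j \<eta> x *\<^sub>R F i x \<partial>lborel)
        - (\<integral>x. partial j \<eta> x *\<^sub>R (F i x - g x) \<partial>lborel)" .
    have "?B = (\<integral>x. \<eta> x *\<^sub>R G i x - \<eta> x *\<^sub>R (G i x - h x) \<partial>lborel)"
      by (simp add: scaleR_right_diff_distrib)
    also have "\<dots> = (\<integral>x. \<eta> x *\<^sub>R G i x \<partial>lborel) - (\<integral>x. \<eta> x *\<^sub>R (G i x - h x) \<partial>lborel)"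
      by (rule Bochner_Integration.integral_diff[OF iG dG(1)])
    finally have B: "?B = (\<integral>x. \<eta> x *\<^sub>R G i x \<partial>lborel) - (\<integral>x. \<eta> x *\<^sub>R (G i x - h x) \<partial>lborel)" .
    have "(\<integral>x. partial j \<eta> x *\<^sub>R F i x \<partial>lborel) = - (\<integral>x. \<eta> x *\<^sub>R G i x \<partial>lborel)"
      using wd[of i] \<eta> unfolding twisted_deriv_0 weak_deriv_def by blast
    then have E: "?A + ?B = - (\<integral>x. partial j \<eta> x *\<^sub>R (F i x - g x) \<partial>lborel)
        - (\<integral>x. \<eta> x *\<^sub>R (G i x - h x) \<partial>lborel)"
      unfolding A B by simp
    have "norm (?A + ?B) \<le> norm (- (\<integral>x. partial j \<eta> x *\<^sub>R (F i x - g x) \<partial>lborel))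
        + norm (\<integral>x. \<eta> x *\<^sub>R (G i x - h x) \<partial>lborel)"
      unfolding E by (rule norm_triangle_ineq4)
    then show ?thesis using dF(2) dG(2) by (simp add: distrib_right)
  qed
  have "norm (?A + ?B) \<le> 0"
  proof (rule field_le_epsilon)
    fix e :: real assume e: "e > 0"
    have "norm (?A + ?B) \<le> (M1 + M2) * (e / (M1 + M2 + 1))" using e M1(1) M2(1)
        by (intro \<open>\<And>e. e > 0 \<Longrightarrow> norm (?A + ?B) \<le> (M1 + M2) * e\<close>) simp
    also have "\<dots> \<le> e" using e M1(1) M2(1) by (simp add: field_simps)
    finally show "norm (?A + ?B) \<le> 0 + e" by simp
  qed
  then show "?A = - ?B" by (simp add: eq_neg_iff_add_eq_0)
qed

lemma compact_base:
  fixes F :: "nat \<Rightarrow> real^'n \<Rightarrow> 'b::euclidean_space"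
  assumes b: "b \<ge> 0" and F: "\<And>i. sob_bd (\<lambda>x. 0) (Suc 0) (F i) b"
  shows "\<exists>g (s :: nat \<Rightarrow> nat). strict_mono s \<and> g \<in> borel_measurable borel \<and>
    (\<forall>e>0. \<exists>I. \<forall>i\<ge>I. energy (\<lambda>x. F (s i) x - g x) \<le> ennreal (e\<^sup>2))"
proof -
  obtain s :: "nat \<Rightarrow> nat" where s0: "strict_mono s
      \<and> (\<forall>e>0. \<exists>I. \<forall>i\<ge>I. \<forall>j\<ge>I. energy (\<lambda>x. F (s i) x - F (s j) x) \<le> ennreal e)"
    by (rule exE[OF Cauchy_subsequence[of b F, OF b F]]) (rule that)
  have s: "strict_mono s" "\<And>e. e > 0 \<Longrightarrow> \<exists>I. \<forall>i\<ge>I. \<forall>j\<ge>I. energy (\<lambda>x. F (s i) x - F (s j) x) \<le> ennreal e"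
    using s0 by simp_all
  have "F (s i) \<in> borel_measurable borel" for i using sob_bdD[OF F] by blast
  from energy_complete[of "\<lambda>i. F (s i)", OF this s(2)] obtain g where "g \<in> borel_measurable borel"
    "\<And>e. e > 0 \<Longrightarrow> \<exists>I. \<forall>i\<ge>I. energy (\<lambda>x. F (s i) x - g x) \<le> ennreal e" by blast
  then have "\<forall>e>0. \<exists>I. \<forall>i\<ge>I. energy (\<lambda>x. F (s i) x - g x) \<le> ennreal (e\<^sup>2)" by simp
  then show ?thesis using s(1) \<open>g \<in> borel_measurable borel\<close> by blast
qed

text \<open>Plain derivatives are enough here, since X is reached by switching. In the induction
  step the limits \<open>h j\<close> of the derivatives are recognised as the derivatives of the
  limit \<open>g\<close> by \<open>twisted_deriv_limit\<close>.\<close>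

theorem sob_compact:
  fixes F :: "nat \<Rightarrow> real^'n \<Rightarrow> 'b::euclidean_space"
  assumes b: "b \<ge> 0"
  shows "(\<And>i. sob_bd (\<lambda>x. 0) (Suc k) (F i) b) \<Longrightarrow>
    \<exists>g (s :: nat \<Rightarrow> nat). strict_mono s \<and> g \<in> borel_measurable borel
        \<and> (\<forall>e>0. \<exists>I. \<forall>i\<ge>I. sob_bd (\<lambda>x. 0) k (\<lambda>x. F (s i) x - g x) e)"
proof (induction k arbitrary: F)
  case 0
  obtain g and s :: "nat \<Rightarrow> nat" where gs0: "strict_mono s \<and> g \<in> borel_measurable borel \<and>
    (\<forall>e>0. \<exists>I. \<forall>i\<ge>I. energy (\<lambda>x. F (s i) x - g x) \<le> ennreal (e\<^sup>2))"
    using compact_base[of b F, OF b 0] by (elim exE) (rule that)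
  then have gs: "strict_mono s" "g \<in> borel_measurable borel"
    "\<And>e. e > 0 \<Longrightarrow> \<exists>I. \<forall>i\<ge>I. energy (\<lambda>x. F (s i) x - g x) \<le> ennreal (e\<^sup>2)"
    by simp_all
  have "F i \<in> borel_measurable borel" for i using sob_bdD[OF 0] by blast
  then have "(\<lambda>x. F (s i) x - g x) \<in> borel_measurable borel" for i using gs(2)
      by (intro borel_measurable_diff) auto
  then show ?case using gs unfolding sob_bd.simps by blast
next
  case (Suc k)
  have F1: "\<And>i. sob_bd (\<lambda>x. 0) (Suc 0) (F i) b" by (rule sob_bd_le[OF Suc.prems]) simp
  obtain g and s1 :: "nat \<Rightarrow> nat" where gs0: "strict_mono s1 \<and> g \<in> borel_measurable borel \<and>
    (\<forall>e>0. \<exists>I. \<forall>i\<ge>I. energy (\<lambda>x. F (s1 i) x - g x) \<le> ennreal (e\<^sup>2))"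
    using compact_base[of b F, OF b F1] by (elim exE) (rule that)
  then have gs: "strict_mono s1" "g \<in> borel_measurable borel"
    "\<And>e. e > 0 \<Longrightarrow> \<exists>I. \<forall>i\<ge>I. energy (\<lambda>x. F (s1 i) x - g x) \<le> ennreal (e\<^sup>2)"
    by simp_all
  have "\<forall>i j. \<exists>G. twisted_deriv \<Omega> (\<lambda>x. 0) j (F i) G \<and> sob_bd (\<lambda>x. 0) (Suc k) G b"
    using Suc.prems by (metis sob_bd.simps(2))
  then obtain G where G: "\<And>i j. twisted_deriv \<Omega> (\<lambda>x. 0) j (F i) (G i j)"
      "\<And>i j. sob_bd (\<lambda>x. 0) (Suc k) (G i j) b" by metis
  \<comment> \<open>Directions are added one at a time; convergence in the earlier ones survives the
    passage to a further subsequence.\<close>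
  have "\<exists>s :: nat \<Rightarrow> nat. strict_mono s \<and> (\<forall>j\<in>J. \<exists>h. h \<in> borel_measurable borel
      \<and> (\<forall>e>0. \<exists>I. \<forall>i\<ge>I. sob_bd (\<lambda>x. 0) k (\<lambda>x. G (s1 (s i)) j x - h x) e))" if "finite J" for J
    using that
  proof (induction J rule: finite_induct)
    case empty
    show ?case by (intro exI[of _ id]) (auto simp: strict_mono_def)
  next
    case (insert j J)
    obtain s :: "nat \<Rightarrow> nat" where s: "strict_mono s" "\<And>j. j \<in> J \<Longrightarrow> \<exists>h. h \<in> borel_measurable borel
        \<and> (\<forall>e>0. \<exists>I. \<forall>i\<ge>I. sob_bd (\<lambda>x. 0) k (\<lambda>x. G (s1 (s i)) j x - h x) e)"
      using insert.IH by blast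
    obtain h and t :: "nat \<Rightarrow> nat" where t: "strict_mono t" "h \<in> borel_measurable borel"
        "\<forall>e>0. \<exists>I. \<forall>i\<ge>I. sob_bd (\<lambda>x. 0) k (\<lambda>x. G (s1 (s (t i))) j x - h x) e"
      using Suc.IH[of "\<lambda>i. G (s1 (s i)) j"] G(2) by blast
    have "\<exists>h. h \<in> borel_measurable borel \<and> (\<forall>e>0. \<exists>I. \<forall>i\<ge>I. sob_bd (\<lambda>x. 0) k (\<lambda>x. G (s1 (s (t i))) j' x
        - h x) e)" if j': "j' \<in> J" for j'
    proof -
      obtain h where h: "h \<in> borel_measurable borel" "\<And>e. e > 0 \<Longrightarrow>
          \<exists>I. \<forall>i\<ge>I. sob_bd (\<lambda>x. 0) k (\<lambda>x. G (s1 (s i)) j' x - h x) e"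
        using s(2)[OF j'] by blast
      have "\<exists>I. \<forall>i\<ge>I. sob_bd (\<lambda>x. 0) k (\<lambda>x. G (s1 (s (t i))) j' x - h x) e" if "e > 0" for e
        using h(2)[OF that] seq_suble[OF t(1)] by (meson order_trans)
      then show ?thesis using h(1) by blast
    qed
    moreover have "strict_mono (\<lambda>i. s (t i))" using s(1) t(1) by (simp add: strict_mono_def)
    ultimately show ?case using t by (intro exI[of _ "\<lambda>i. s (t i)"]) auto
  qed
  from this[OF finite[of UNIV]] obtain s2 :: "nat \<Rightarrow> nat" where s20: "strict_mono s2
      \<and> (\<forall>j\<in>UNIV. \<exists>h. h \<in> borel_measurable borel \<and>
      (\<forall>e>0. \<exists>I. \<forall>i\<ge>I. sob_bd (\<lambda>x. 0) k (\<lambda>x. G (s1 (s2 i)) j x - h x) e))"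
    by (elim exE) (rule that)
  then have "\<forall>j. \<exists>h. h \<in> borel_measurable borel
      \<and> (\<forall>e>0. \<exists>I. \<forall>i\<ge>I. sob_bd (\<lambda>x. 0) k (\<lambda>x. G (s1 (s2 i)) j x - h x) e)" by simp
  from choice[OF this] obtain h where h: "\<forall>j. h j \<in> borel_measurable borel
      \<and> (\<forall>e>0. \<exists>I. \<forall>i\<ge>I. sob_bd (\<lambda>x. 0) k (\<lambda>x. G (s1 (s2 i)) j x - h j x) e)"
    by (elim exE) (rule that)
  have s2: "strict_mono s2" "\<And>j. h j \<in> borel_measurable borel"
    "\<And>j e. e > 0 \<Longrightarrow> \<exists>I. \<forall>i\<ge>I. sob_bd (\<lambda>x. 0) k (\<lambda>x. G (s1 (s2 i)) j x - h j x) e"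
    using s20 h by simp_all
  define s where "s i = s1 (s2 i)" for i
  have sm: "strict_mono s" using gs(1) s2(1) by (auto simp: s_def strict_mono_def)
  have gl: "\<exists>I. \<forall>i\<ge>I. energy (\<lambda>x. F (s i) x - g x) \<le> ennreal (e\<^sup>2)" if "e > 0" for e
    using gs(3)[OF that] seq_suble[OF s2(1)] unfolding s_def by (meson order_trans)
  have hl: "\<exists>I. \<forall>i\<ge>I. energy (\<lambda>x. G (s i) j x - h j x) \<le> ennreal (e\<^sup>2)" if "e > 0" for e j
    using s2(3)[OF that, of j] sob_bdD unfolding s_def by blast
  have FD: "F i \<in> borel_measurable borel" "energy (F i) \<le> ennreal (b\<^sup>2)" for i using sob_bdD[OF F1]
      by auto
  have GD: "G i j \<in> borel_measurable borel" "energy (G i j) \<le> ennreal (b\<^sup>2)" for i j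
      using sob_bdD[OF G(2)] by auto
  have tw: "twisted_deriv \<Omega> (\<lambda>x. 0) j g (h j)" for j
    by (rule twisted_deriv_limit[of "\<lambda>i. F (s i)" "\<lambda>i. G (s i) j" g "h j" b])
        (auto simp: FD GD gs(2) s2(2) G(1) gl hl)
  \<comment> \<open>A limit inherits finite energy from a member of the sequence whose difference
    from it has energy at most 1.\<close>
  have fin: "energy u < \<infinity>" if e: "energy (\<lambda>x. v x - u x) \<le> ennreal (1\<^sup>2)" "energy v \<le> ennreal (b\<^sup>2)"
      and m: "u \<in> borel_measurable borel" "v \<in> borel_measurable borel" for u v :: "real^'n \<Rightarrow> 'b"
  proof -
    have "energy (\<lambda>x. v x + - (v x - u x)) \<le> ennreal ((2 * (b + 1))\<^sup>2)"
      by (rule energy_add_bd) (use e m b energy_uminus[of "\<lambda>x. v x - u x"] in auto)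
    then show ?thesis by (auto intro: le_less_trans)
  qed
  have lg: "loc_integrable \<Omega> g"
    using gl[of 1] fin[of "F (s _)" g] FD gs(2) by (intro energy_loc_integrable) (auto)
  have lh: "loc_integrable \<Omega> (h j)" for j
    using hl[of 1 j] fin[of "G (s _) j" "h j"] GD s2(2) by (intro energy_loc_integrable) (auto)
  have lF: "loc_integrable \<Omega> (F i)" "loc_integrable \<Omega> (G i j)" for i j
    using sob_bd_loc_integrable[OF F1] sob_bd_loc_integrable[OF G(2)] by auto
  have lm: "loc_integrable \<Omega> (\<lambda>x. - u x)" if "loc_integrable \<Omega> u" for u :: "real^'n \<Rightarrow> 'b"
    using loc_integrable_smooth_mult[OF that, of "\<lambda>_. -1"] by simp
  have twd: "twisted_deriv \<Omega> (\<lambda>x. 0) j (\<lambda>x. F i x - g x) (\<lambda>x. G i j x - h j x)" for i j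
    using twisted_deriv_add[OF lF(1) lm[OF lg] lF(2) lm[OF lh] _ G(1) twisted_deriv_uminus[OF tw], of j
        i] by simp
  have "\<exists>I. \<forall>i\<ge>I. sob_bd (\<lambda>x. 0) (Suc k) (\<lambda>x. F (s i) x - g x) e" if e: "e > 0" for e
  proof -
    obtain I where I: "\<And>i. i \<ge> I \<Longrightarrow> energy (\<lambda>x. F (s i) x - g x) \<le> ennreal (e\<^sup>2)" using gl[OF e] by blast
    have "\<forall>j. \<exists>I. \<forall>i\<ge>I. sob_bd (\<lambda>x. 0) k (\<lambda>x. G (s i) j x - h j x) e" using s2(3)[OF e]
        by (simp add: s_def)
    then obtain K where K: "\<And>j i. i \<ge> K j \<Longrightarrow> sob_bd (\<lambda>x. 0) k (\<lambda>x. G (s i) j x - h j x) e" by metis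
    have "sob_bd (\<lambda>x. 0) (Suc k) (\<lambda>x. F (s i) x - g x) e" if i: "i \<ge> max I (Max (range K))" for i
    proof -
      have "i \<ge> K j" for j using i Max_ge[of "range K" "K j"] by simp
      then have "\<exists>h'. twisted_deriv \<Omega> (\<lambda>x. 0) j (\<lambda>x. F (s i) x - g x) h' \<and> sob_bd (\<lambda>x. 0) k h' e" for j
        using twd K by blast
      moreover have "(\<lambda>x. F (s i) x - g x) \<in> borel_measurable borel" using FD gs(2)
          by (intro borel_measurable_diff) auto
      ultimately show ?thesis using I[of i] i by simp
    qed
    then show ?thesis by blast
  qed
  then show ?case using sm gs(2) by blast
qed

end

section \<open>Distributions and Borel representatives\<close>

lemma lebesgue_on_borel_representative:
  fixes f :: "real^'n \<Rightarrow> 'b::euclidean_space"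
  assumes f: "f \<in> borel_measurable (lebesgue_on \<Omega>)" and \<Omega>: "\<Omega> \<in> sets lebesgue"
  shows "\<exists>f'\<in>borel_measurable borel. AE x in lborel. x \<in> \<Omega> \<longrightarrow> f x = f' x"
proof -
  define F where "F x = (if x \<in> \<Omega> then f x else 0)" for x
  have F: "F \<in> borel_measurable lebesgue"
    unfolding F_def[abs_def] using borel_measurable_if[OF \<Omega>, of f] f by simp
  have "\<forall>b\<in>Basis. \<exists>g\<in>borel_measurable lborel. AE x in lborel. F x \<bullet> b = g x"
    by (intro ballI completion_ex_borel_measurable_real borel_measurable_inner F) simp
  then obtain g where g: "\<And>b. b \<in> Basis \<Longrightarrow> g b \<in> borel_measurable lborel" "\<And>b. b \<in> Basis \<Longrightarrow>
      AE x in lborel. F x \<bullet> b = g b x" by metis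
  define f' where "f' x = (\<Sum>b\<in>Basis. g b x *\<^sub>R b)" for x
  have "f' \<in> borel_measurable borel"
    unfolding f'_def[abs_def] using g(1) by (intro borel_measurable_sum borel_measurable_scaleR) auto
  moreover have "AE x in lborel. \<forall>b\<in>Basis. F x \<bullet> b = g b x"
    by (rule AE_finite_allI) (use g(2) in auto)
  then have "AE x in lborel. x \<in> \<Omega> \<longrightarrow> f x = f' x"
  proof eventually_elim
    case (elim x)
    have "f' x = (\<Sum>b\<in>Basis. (F x \<bullet> b) *\<^sub>R b)" unfolding f'_def using elim by (intro sum.cong) auto
    then show ?case by (simp add: euclidean_representation F_def)
  qed
  ultimately show ?thesis by blast
qed

text \<open>Distributions are arbitrary functionals here; additivity is the part of linearity that
  combines the two terms of \<open>X_op\<close> into one.\<close>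

definition additive_on_tests :: "(real^'n) set \<Rightarrow> ('n, 'b::real_normed_field) distribution \<Rightarrow> bool" where
  "additive_on_tests \<Omega> T \<longleftrightarrow> (\<forall>\<eta>\<in>test_functions \<Omega>. \<forall>\<zeta>\<in>test_functions \<Omega>. T (\<lambda>x. \<eta> x + \<zeta> x) = T \<eta> + T \<zeta>)"

definition agree_on_tests :: "(real^'n) set \<Rightarrow> ('n, 'b) distribution \<Rightarrow> ('n, 'b) distribution \<Rightarrow> bool" where
  "agree_on_tests \<Omega> T T' \<longleftrightarrow> (\<forall>\<eta>\<in>test_functions \<Omega>. T \<eta> = T' \<eta>)"

text \<open>The negative of the transpose of D_j - D_j \<theta>.\<close>

definition twist :: "(real^'n \<Rightarrow> real) \<Rightarrow> 'n \<Rightarrow> (real^'n \<Rightarrow> real) \<Rightarrow> real^'n \<Rightarrow> real" where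
  "twist \<theta> j \<eta> = (\<lambda>x. partial j \<eta> x + partial j \<theta> x * \<eta> x)"

text \<open>Common description of \<open>D\<^sub>j\<close> (with \<open>\<theta> = 0\<close>) and \<open>X\<^sub>j\<close> (with \<open>\<theta> = \<phi>\<close> on \<open>\<Omega>\<close>).\<close>

definition twisted_op :: "(real^'n) set \<Rightarrow> (real^'n \<Rightarrow> real) \<Rightarrow>
    ('n \<Rightarrow> ('n, 'b::real_normed_field) distribution \<Rightarrow> ('n, 'b) distribution) \<Rightarrow> bool" where
  "twisted_op \<Omega> \<theta> Y \<longleftrightarrow> smooth_on UNIV \<theta> \<and>
     (\<forall>T j \<eta>. additive_on_tests \<Omega> T \<longrightarrow> \<eta> \<in> test_functions \<Omega> \<longrightarrow> Y j T \<eta> = - T (twist \<theta> j \<eta>))"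

lemma twist_test: "smooth_on UNIV \<theta> \<Longrightarrow> \<eta> \<in> test_functions \<Omega> \<Longrightarrow> twist \<theta> j \<eta> \<in> test_functions \<Omega>"
  unfolding twist_def by (rule twisted_test)

lemma twist_add:
  assumes "\<eta> \<in> test_functions \<Omega>" "\<zeta> \<in> test_functions \<Omega>"
  shows "twist \<theta> j (\<lambda>x. \<eta> x + \<zeta> x) = (\<lambda>x. twist \<theta> j \<eta> x + twist \<theta> j \<zeta> x)"
  unfolding twist_def using test_differentiable[OF assms(1)] test_differentiable[OF assms(2)]
  by (intro ext) (simp add: partial_add algebra_simps)

lemma twisted_op_D: "twisted_op \<Omega> (\<lambda>x. 0) D_op"
  by (simp add: twisted_op_def D_op_def twist_def)

text \<open>Outside \<Omega> nothing is known about \<phi>, but there the test function vanishes; in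
  the open set \<Omega> the derivatives of \<phi> and \<psi> agree.\<close>

lemma twisted_op_X:
  assumes \<Omega>: "open \<Omega>" and \<psi>: "smooth_on UNIV \<psi>" "\<And>x. x \<in> \<Omega> \<Longrightarrow> \<psi> x = \<phi> x"
  shows "twisted_op \<Omega> \<psi> (X_op \<phi>)"
  unfolding twisted_op_def
proof (intro conjI allI impI)
  fix T :: "('a, 'b) distribution" and j \<eta>
  assume T: "additive_on_tests \<Omega> T" and \<eta>: "\<eta> \<in> test_functions \<Omega>"
  obtain K where K: "K \<subseteq> \<Omega>" "\<And>x. x \<notin> K \<Longrightarrow> \<eta> x = 0" using test_functionsE[OF \<eta>] by metis
  have e: "(\<lambda>x. partial j \<phi> x * \<eta> x) = (\<lambda>x. partial j \<psi> x * \<eta> x)"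
  proof
    fix x
    show "partial j \<phi> x * \<eta> x = partial j \<psi> x * \<eta> x"
      using partial_cong_open[OF \<Omega>, of x \<phi> \<psi> j] \<psi>(2) K by (cases "x \<in> \<Omega>") auto
  qed
  have "T (twist \<psi> j \<eta>) = T (partial j \<eta>) + T (\<lambda>x. partial j \<psi> x * \<eta> x)"
    using T[unfolded additive_on_tests_def, rule_format, OF test_functions_partial[OF \<eta>, of j]
        test_functions_smooth_mult[OF \<eta> smooth_on_partial[OF \<psi>(1), of j]]]
    unfolding twist_def by simp
  then show "X_op \<phi> j T \<eta> = - T (twist \<psi> j \<eta>)"
    by (simp add: X_op_def D_op_def e)
qed (rule \<psi>(1))

lemma twisted_op_additive:
  assumes Y: "twisted_op \<Omega> \<theta> Y" and T: "additive_on_tests \<Omega> T"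
  shows "additive_on_tests \<Omega> (Y j T)"
  unfolding additive_on_tests_def
proof (intro ballI)
  fix \<eta> \<zeta> assume t: "\<eta> \<in> test_functions \<Omega>" "\<zeta> \<in> test_functions \<Omega>"
  have \<theta>: "smooth_on UNIV \<theta>" using Y by (simp add: twisted_op_def)
  have "Y j T (\<lambda>x. \<eta> x + \<zeta> x) = - T (twist \<theta> j (\<lambda>x. \<eta> x + \<zeta> x))"
    using Y T test_functions_add[OF t] unfolding twisted_op_def by blast
  also have "\<dots> = - T (twist \<theta> j \<eta>) - T (twist \<theta> j \<zeta>)"
    using T twist_test[OF \<theta> t(1)] twist_test[OF \<theta> t(2)] unfolding twist_add[OF t] additive_on_tests_def
        by simp
  finally show "Y j T (\<lambda>x. \<eta> x + \<zeta> x) = Y j T \<eta> + Y j T \<zeta>"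
    using Y T t unfolding twisted_op_def by simp
qed

lemma additive_on_tests_agree: "additive_on_tests \<Omega> T \<Longrightarrow> agree_on_tests \<Omega> T T' \<Longrightarrow> additive_on_tests \<Omega> T'"
  unfolding additive_on_tests_def agree_on_tests_def using test_functions_add by metis

lemma foldr_additive: "twisted_op \<Omega> \<theta> Y \<Longrightarrow> additive_on_tests \<Omega> T \<Longrightarrow> additive_on_tests \<Omega> (foldr Y js T)"
  by (induction js) (auto intro: twisted_op_additive)

text \<open>Transposition reverses the order of the factors, so \<open>foldr\<close> on
  distributions becomes \<open>fold\<close> on test functions.\<close>

lemma foldr_eval:
  assumes Y: "twisted_op \<Omega> \<theta> Y" and T: "additive_on_tests \<Omega> T"
  shows "\<eta> \<in> test_functions \<Omega> \<Longrightarrow> foldr Y js T \<eta> = (-1) ^ length js * T (fold (twist \<theta>) js \<eta>)"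
proof (induction js arbitrary: \<eta>)
  case (Cons j js)
  have \<theta>: "smooth_on UNIV \<theta>" using Y by (simp add: twisted_op_def)
  have "foldr Y (j # js) T \<eta> = - foldr Y js T (twist \<theta> j \<eta>)"
    using Y foldr_additive[OF Y T] Cons.prems unfolding twisted_op_def by simp
  then show ?case using Cons.IH[OF twist_test[OF \<theta> Cons.prems]] by simp
qed simp

lemma foldr_agree:
  assumes "twisted_op \<Omega> \<theta> Y" "additive_on_tests \<Omega> T" "agree_on_tests \<Omega> T T'"
  shows "agree_on_tests \<Omega> (foldr Y js T) (foldr Y js T')"
proof -
  have \<theta>: "smooth_on UNIV \<theta>" using assms by (simp add: twisted_op_def)
  have "fold (twist \<theta>) js \<eta> \<in> test_functions \<Omega>" if "\<eta> \<in> test_functions \<Omega>" for \<eta>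
    using that by (induction js arbitrary: \<eta>) (auto intro: twist_test[OF \<theta>])
  then show ?thesis
    using assms foldr_eval[OF assms(1,2)] foldr_eval[OF assms(1) additive_on_tests_agree[OF assms(2,3)]]
    unfolding agree_on_tests_def by simp
qed

text \<open>Conjugation by e^\<theta> turns \<open>twist\<close> into a partial derivative, so
  twists commute because partial derivatives do.\<close>

lemma twist_exp:
  assumes \<theta>: "smooth_on UNIV \<theta>" and \<eta>: "\<eta> \<in> test_functions \<Omega>"
  shows "exp (\<theta> x) * twist \<theta> j \<eta> x = partial j (\<lambda>x. exp (\<theta> x) * \<eta> x) x"
proof -
  have d\<theta>: "\<theta> differentiable at x" for x using smooth_on_differentiable[OF \<theta>] by simp
  have e: "smooth_on UNIV (\<lambda>x. exp (\<theta> x))" by (intro smooth_on_exp \<theta> open_UNIV)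
  have "((\<lambda>x. exp (\<theta> x)) has_derivative (\<lambda>v. exp (\<theta> x) * (v \<bullet> grad \<theta> x))) (at x)" for x
    by (auto intro!: derivative_eq_intros has_derivative_grad[OF d\<theta>])
  from partial_eqI[OF this] have pe: "partial j (\<lambda>x. exp (\<theta> x)) x = exp (\<theta> x) * partial j \<theta> x" for x
    by (simp add: inner_axis' grad_def)
  have "partial j (\<lambda>x. exp (\<theta> x) * \<eta> x) x = exp (\<theta> x) * partial j \<eta> x
      + partial j (\<lambda>x. exp (\<theta> x)) x * \<eta> x"
    by (rule partial_mult) (use smooth_on_differentiable[OF e, of x] test_differentiable[OF \<eta>, of x] in
        auto)
  then show ?thesis by (simp add: pe twist_def algebra_simps)
qed

lemma twist_commute:
  assumes \<theta>: "smooth_on UNIV \<theta>" and \<eta>: "\<eta> \<in> test_functions \<Omega>"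
  shows "twist \<theta> i (twist \<theta> j \<eta>) = twist \<theta> j (twist \<theta> i \<eta>)"
proof
  fix x
  have s: "smooth_on UNIV (\<lambda>x. exp (\<theta> x) * \<eta> x)"
  proof -
    have "smooth_on UNIV \<eta>" using \<eta> by (simp add: test_functions_def)
    then show ?thesis by (intro smooth_on_mult smooth_on_exp \<theta> open_UNIV)
  qed
  have *: "exp (\<theta> x) * twist \<theta> i (twist \<theta> j \<eta>) x = partial i (partial j (\<lambda>x. exp (\<theta> x) * \<eta> x)) x" for i j
    unfolding twist_exp[OF \<theta> twist_test[OF \<theta> \<eta>]] twist_exp[OF \<theta> \<eta>] ..
  have "exp (\<theta> x) * twist \<theta> i (twist \<theta> j \<eta>) x = exp (\<theta> x) * twist \<theta> j (twist \<theta> i \<eta>) x"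
    unfolding * by (rule partial_commute[OF s])
  then show "twist \<theta> i (twist \<theta> j \<eta>) x = twist \<theta> j (twist \<theta> i \<eta>) x" by simp
qed

text \<open>Makes the particular list chosen in \<open>multi_op\<close> irrelevant.\<close>

lemma foldr_permute:
  assumes Y: "twisted_op \<Omega> \<theta> Y" and T: "additive_on_tests \<Omega> T" and m: "mset js = mset js'"
  shows "agree_on_tests \<Omega> (foldr Y js T) (foldr Y js' T)"
  unfolding agree_on_tests_def
proof
  fix \<eta> assume \<eta>: "\<eta> \<in> test_functions \<Omega>"
  have \<theta>: "smooth_on UNIV \<theta>" using Y by (simp add: twisted_op_def)
  have "fold (twist \<theta>) js \<eta> = fold (twist \<theta>) js' \<eta>"
    by (rule fold_permuted_eq[where P="\<lambda>\<eta>. \<eta> \<in> test_functions \<Omega>"])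
       (use m \<eta> twist_test[OF \<theta>] twist_commute[OF \<theta>] in auto)
  then show "foldr Y js T \<eta> = foldr Y js' T \<eta>"
    using foldr_eval[OF Y T \<eta>] mset_eq_length[OF m] by simp
qed

context weighted_domain
begin

text \<open>The link between the Lebesgue measurable functions on \<Omega> that make up the Sobolev
  spaces and the Borel functions on the whole space used in the analysis.\<close>

definition represented_by :: "(real^'n \<Rightarrow> 'b::euclidean_space) \<Rightarrow> (real^'n \<Rightarrow> 'b) \<Rightarrow> bool" where
  "represented_by f f' \<longleftrightarrow> f \<in> borel_measurable (lebesgue_on \<Omega>) \<and> f' \<in> borel_measurable borel \<and>
     (AE x in lborel. x \<in> \<Omega> \<longrightarrow> f x = f' x)"

lemma dom_lebesgue: "\<Omega> \<in> sets lebesgue"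
  using dom_borel by (simp add: sets_completionI_sets)

lemma borel_lebesgue_on: "u \<in> borel_measurable borel \<Longrightarrow> u \<in> borel_measurable (lebesgue_on \<Omega>)"
  by (intro measurable_restrict_space1 measurable_completion) simp

lemma represented_by_borel: "f \<in> borel_measurable borel \<Longrightarrow> represented_by f f"
  by (simp add: represented_by_def borel_lebesgue_on)

lemma represented_by_ex: "f \<in> borel_measurable (lebesgue_on \<Omega>) \<Longrightarrow> \<exists>f'. represented_by f f'"
  using lebesgue_on_borel_representative[OF _ dom_lebesgue] by (auto simp: represented_by_def)

lemma represented_by_diff:
  assumes "represented_by f f'" "g \<in> borel_measurable borel"
  shows "represented_by (\<lambda>x. f x - g x) (\<lambda>x. f' x - g x)"
  using assms borel_lebesgue_on[OF assms(2)] unfolding represented_by_def by auto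

lemma energy_cong_AE:
  assumes "AE x in lborel. x \<in> \<Omega> \<longrightarrow> f x = g x"
  shows "energy f = energy g"
  unfolding energy_def
  by (rule nn_integral_cong_AE) (use assms in \<open>eventually_elim, auto simp: wsq_def indicator_def\<close>)

lemma nn_integral_weight:
  assumes r: "represented_by f f'" and \<phi>: "\<And>x. x \<in> \<Omega> \<Longrightarrow> \<Phi> x = \<phi> x"
  shows "(\<integral>\<^sup>+x. ennreal ((norm (f x))\<^sup>2 * exp (- \<phi> x)) \<partial>lebesgue_on \<Omega>) = energy f'"
proof -
  have [measurable]: "f' \<in> borel_measurable borel" using r by (simp add: represented_by_def)
  have AE: "AE x in lebesgue. x \<in> \<Omega> \<longrightarrow> f x = f' x" using r
      by (intro AE_completion) (simp add: represented_by_def)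
  have "(\<integral>\<^sup>+x. ennreal ((norm (f x))\<^sup>2 * exp (- \<phi> x)) \<partial>lebesgue_on \<Omega>) =
      (\<integral>\<^sup>+x. ennreal ((norm (f x))\<^sup>2 * exp (- \<phi> x)) * indicator \<Omega> x \<partial>lebesgue)"
    by (rule nn_integral_restrict_space) (use dom_lebesgue in simp)
  also have "\<dots> = (\<integral>\<^sup>+x. indicator \<Omega> x * wsq (\<lambda>x. (norm (f' x))\<^sup>2) x \<partial>lebesgue)"
    by (rule nn_integral_cong_AE) (use AE in \<open>eventually_elim, auto simp: indicator_def wsq_def \<phi>\<close>)
  also have "\<dots> = energy f'" unfolding energy_def by (rule nn_integral_completion)
  finally show ?thesis .
qed

lemma L2w_representative:
  assumes r: "represented_by f f'" and \<phi>: "\<And>x. x \<in> \<Omega> \<Longrightarrow> \<Phi> x = \<phi> x"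
  shows "f \<in> L2w \<Omega> \<phi> \<longleftrightarrow> energy f' < \<infinity>"
    and "f \<in> L2w \<Omega> \<phi> \<Longrightarrow> ennreal ((L2w_norm \<Omega> \<phi> f)\<^sup>2) = energy f'"
proof -
  let ?u = "\<lambda>x. (norm (f x))\<^sup>2 * exp (- \<phi> x)"
  have fm[measurable]: "f \<in> borel_measurable (lebesgue_on \<Omega>)" using r by (simp add: represented_by_def)
  have "\<Phi> \<in> borel_measurable (lebesgue_on \<Omega>)" by (rule borel_lebesgue_on[OF borel_Phi])
  then have [measurable]: "\<phi> \<in> borel_measurable (lebesgue_on \<Omega>)"
    by (subst measurable_cong[of _ _ \<Phi>]) (use \<phi> in auto)
  have um: "?u \<in> borel_measurable (lebesgue_on \<Omega>)" by measurable
  have nn: "(\<integral>\<^sup>+x. ennreal (?u x) \<partial>lebesgue_on \<Omega>) = energy f'" by (rule nn_integral_weight[OF r \<phi>])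
  have "integrable (lebesgue_on \<Omega>) ?u \<longleftrightarrow> energy f' < \<infinity>"
    unfolding integrable_iff_bounded nn[symmetric] using um by simp
  then show iff: "f \<in> L2w \<Omega> \<phi> \<longleftrightarrow> energy f' < \<infinity>" by (simp add: L2w_def fm)
  assume "f \<in> L2w \<Omega> \<phi>"
  then have int: "integrable (lebesgue_on \<Omega>) ?u" by (simp add: L2w_def)
  have "(L2w_norm \<Omega> \<phi> f)\<^sup>2 = integral\<^sup>L (lebesgue_on \<Omega>) ?u"
    unfolding L2w_norm_def by (intro real_sqrt_pow2 integral_nonneg_AE) simp
  then show "ennreal ((L2w_norm \<Omega> \<phi> f)\<^sup>2) = energy f'"
    using nn_integral_eq_integral[OF int] nn by simp
qed

lemma distr_of_representative:
  assumes r: "represented_by f f'" and \<eta>: "\<eta> \<in> test_functions \<Omega>"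
  shows "distr_of \<Omega> f \<eta> = (\<integral>x. \<eta> x *\<^sub>R f' x \<partial>lborel)"
proof -
  have [measurable]: "f' \<in> borel_measurable borel" "\<eta> \<in> borel_measurable borel"
    using r test_functions_borel[OF \<eta>] by (simp_all add: represented_by_def)
  have fm: "f \<in> borel_measurable (lebesgue_on \<Omega>)" using r by (simp add: represented_by_def)
  obtain K where K: "K \<subseteq> \<Omega>" "\<And>x. x \<notin> K \<Longrightarrow> \<eta> x = 0" using test_functionsE[OF \<eta>] by metis
  have z: "\<eta> x = 0" if "x \<notin> \<Omega>" for x using K that by auto
  have AE: "AE x in lebesgue. x \<in> \<Omega> \<longrightarrow> f x = f' x" using r
      by (intro AE_completion) (simp add: represented_by_def)
  have m1: "(\<lambda>x. indicator \<Omega> x *\<^sub>R (\<eta> x *\<^sub>R f x)) \<in> borel_measurable lebesgue"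
  proof -
    have "(\<lambda>x. \<eta> x *\<^sub>R f x) \<in> borel_measurable (lebesgue_on \<Omega>)"
      by (intro borel_measurable_scaleR fm borel_lebesgue_on) simp
    then have "(\<lambda>x. if x \<in> \<Omega> then \<eta> x *\<^sub>R f x else 0) \<in> borel_measurable lebesgue"
      using borel_measurable_if[OF dom_lebesgue, of "\<lambda>x. \<eta> x *\<^sub>R f x"] by simp
    moreover have "(\<lambda>x. if x \<in> \<Omega> then \<eta> x *\<^sub>R f x else 0) = (\<lambda>x. indicator \<Omega> x *\<^sub>R (\<eta> x *\<^sub>R f x))"
      by (auto simp: indicator_def)
    ultimately show ?thesis by simp
  qed
  have m2: "(\<lambda>x. \<eta> x *\<^sub>R f' x) \<in> borel_measurable lborel" by simp
  have "distr_of \<Omega> f \<eta> = integral\<^sup>L lebesgue (\<lambda>x. indicator \<Omega> x *\<^sub>R (\<eta> x *\<^sub>R f x))"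
    unfolding distr_of_def by (rule integral_restrict_space) (use dom_lebesgue in simp)
  also have "\<dots> = integral\<^sup>L lebesgue (\<lambda>x. \<eta> x *\<^sub>R f' x)"
    by (rule integral_cong_AE[OF m1 measurable_completion[OF m2]])
       (use AE in \<open>eventually_elim, auto simp: indicator_def z\<close>)
  also have "\<dots> = (\<integral>x. \<eta> x *\<^sub>R f' x \<partial>lborel)" by (rule integral_completion[OF m2])
  finally show ?thesis .
qed

lemma distr_of_additive:
  assumes r: "represented_by f f'" and fin: "energy f' < \<infinity>"
  shows "additive_on_tests \<Omega> (distr_of \<Omega> (f :: real^'n \<Rightarrow> 'b::{real_normed_field, euclidean_space}))"
  unfolding additive_on_tests_def
proof (intro ballI)
  fix \<eta> \<zeta> :: "real^'n \<Rightarrow> real" assume t: "\<eta> \<in> test_functions \<Omega>" "\<zeta> \<in> test_functions \<Omega>"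
  have l: "loc_integrable \<Omega> f'" using r fin by (intro energy_loc_integrable)
      (auto simp: represented_by_def)
  show "distr_of \<Omega> f (\<lambda>x. \<eta> x + \<zeta> x) = distr_of \<Omega> f \<eta> + distr_of \<Omega> f \<zeta>"
    unfolding distr_of_representative[OF r t(1)] distr_of_representative[OF r t(2)]
        distr_of_representative[OF r test_functions_add[OF t]]
      scaleR_add_left
    by (rule Bochner_Integration.integral_add[OF integrable_test[OF l t(1)] integrable_test[OF l t(2)]])
qed

text \<open>By the fundamental lemma the two functions agree almost everywhere in \<Omega>.\<close>

lemma representative_unique:
  fixes f g :: "real^'n \<Rightarrow> 'b::{real_normed_field, euclidean_space}"
  assumes f: "represented_by f f'" "energy f' < \<infinity>" and g: "represented_by g g'" "energy g' < \<infinity>"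
    and agree: "agree_on_tests \<Omega> (distr_of \<Omega> f) (distr_of \<Omega> g)"
  shows "energy f' = energy g'"
proof (rule energy_cong_AE)
  have m: "f' \<in> borel_measurable borel" "g' \<in> borel_measurable borel" using f g
      by (auto simp: represented_by_def)
  have l: "loc_integrable \<Omega> f'" "loc_integrable \<Omega> g'" using f g m by (auto intro: energy_loc_integrable)
  have ld: "loc_integrable \<Omega> (\<lambda>x. f' x - g' x)"
    using l unfolding loc_integrable_def scaleR_right_diff_distrib by auto
  have "(\<integral>x. \<eta> x *\<^sub>R (f' x - g' x) \<partial>lborel) = 0" if \<eta>: "\<eta> \<in> test_functions \<Omega>" for \<eta>
    using agree \<eta> distr_of_representative[OF f(1) \<eta>] distr_of_representative[OF g(1) \<eta>]
    unfolding scaleR_right_diff_distrib Bochner_Integration.integral_diff[OF integrable_test[OF l(1) \<eta>]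
        integrable_test[OF l(2) \<eta>]]
    by (simp add: agree_on_tests_def)
  then have "AE x in lborel. x \<in> \<Omega> \<longrightarrow> f' x - g' x = 0" by (rule fundamental_lemma[OF open_dom ld])
  then show "AE x in lborel. x \<in> \<Omega> \<longrightarrow> f' x = g' x" by eventually_elim auto
qed

lemma twisted_deriv_iff:
  fixes f g :: "real^'n \<Rightarrow> 'b::{real_normed_field, euclidean_space}"
  assumes Y: "twisted_op \<Omega> \<theta> Y" and f: "represented_by f f'" "energy f' < \<infinity>" and g: "represented_by g g'"
  shows "twisted_deriv \<Omega> \<theta> j f' g' \<longleftrightarrow> agree_on_tests \<Omega> (Y j (distr_of \<Omega> f)) (distr_of \<Omega> g)"
proof -
  have \<theta>: "smooth_on UNIV \<theta>" using Y by (simp add: twisted_op_def)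
  have Yj: "Y j (distr_of \<Omega> f) \<eta> = - (\<integral>x. (partial j \<eta> x + partial j \<theta> x * \<eta> x) *\<^sub>R f' x \<partial>lborel)"
      if \<eta>: "\<eta> \<in> test_functions \<Omega>" for \<eta>
    using Y distr_of_additive[OF f] \<eta> distr_of_representative[OF f(1) twist_test[OF \<theta> \<eta>]]
        unfolding twisted_op_def twist_def by auto
  have "(\<integral>x. (partial j \<eta> x + partial j \<theta> x * \<eta> x) *\<^sub>R f' x \<partial>lborel) = - (\<integral>x. \<eta> x *\<^sub>R g' x \<partial>lborel) \<longleftrightarrow>
      Y j (distr_of \<Omega> f) \<eta> = distr_of \<Omega> g \<eta>" if \<eta>: "\<eta> \<in> test_functions \<Omega>" for \<eta>
    unfolding distr_of_representative[OF g \<eta>] Yj[OF \<eta>] by (subst equation_minus_iff) (rule eq_commute)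
  then show ?thesis unfolding twisted_deriv_def agree_on_tests_def by simp
qed

text \<open>Reverse induction, because the last entry of the list acts first: peeling it off is one
  step of the recursion of \<open>sob_bd\<close>.\<close>

lemma sob_bd_imp_lists:
  fixes f :: "real^'n \<Rightarrow> 'b::{real_normed_field, euclidean_space}"
  assumes Y: "twisted_op \<Omega> \<theta> Y"
  shows "represented_by f f' \<Longrightarrow> sob_bd \<theta> k f' b \<Longrightarrow> length js \<le> k \<Longrightarrow>
    \<exists>g\<in>borel_measurable borel. energy g \<le> ennreal (b\<^sup>2)
        \<and> agree_on_tests \<Omega> (foldr Y js (distr_of \<Omega> f)) (distr_of \<Omega> g)"
proof (induction js arbitrary: f f' k rule: rev_induct)
  case Nil
  have "agree_on_tests \<Omega> (distr_of \<Omega> f) (distr_of \<Omega> f')"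
    using distr_of_representative[OF Nil(1)] distr_of_representative[OF represented_by_borel[of f']]
        sob_bdD[OF Nil(2)]
    by (simp add: agree_on_tests_def)
  then show ?case using sob_bdD[OF Nil(2)] by auto
next
  case (snoc j js)
  then obtain k' where k: "k = Suc k'" by (cases k) auto
  obtain g where g: "twisted_deriv \<Omega> \<theta> j f' g" "sob_bd \<theta> k' g b" using snoc.prems(2)
      unfolding k sob_bd.simps by blast
  have rg: "represented_by g g" using sob_bdD[OF g(2)] by (intro represented_by_borel) simp
  have ef: "energy f' < \<infinity>" using sob_bdD[OF snoc.prems(2)] by (auto intro: le_less_trans)
  have 1: "agree_on_tests \<Omega> (Y j (distr_of \<Omega> f)) (distr_of \<Omega> g)"
    using twisted_deriv_iff[OF Y snoc.prems(1) ef rg] g(1) by blast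
  obtain h where h: "h \<in> borel_measurable borel" "energy h \<le>
      ennreal (b\<^sup>2)" "agree_on_tests \<Omega> (foldr Y js (distr_of \<Omega> g)) (distr_of \<Omega> h)"
    using snoc.IH[OF rg g(2)] snoc.prems(3) k by auto
  have "agree_on_tests \<Omega> (foldr Y js (Y j (distr_of \<Omega> f))) (foldr Y js (distr_of \<Omega> g))"
    by (rule foldr_agree[OF Y twisted_op_additive[OF Y distr_of_additive[OF snoc.prems(1) ef]] 1])
  then have "agree_on_tests \<Omega> (foldr Y (js @ [j]) (distr_of \<Omega> f)) (distr_of \<Omega> h)" using h(3)
      by (simp add: agree_on_tests_def)
  then show ?case using h by blast
qed

text \<open>The list \<open>[j]\<close> provides the derivative in direction \<open>j\<close>, and
  the lists ending in \<open>j\<close> bound the further derivatives of that one. The empty list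
  bounds \<open>f'\<close> itself, by uniqueness of the representing function.\<close>

lemma lists_imp_sob_bd:
  fixes f :: "real^'n \<Rightarrow> 'b::{real_normed_field, euclidean_space}"
  assumes Y: "twisted_op \<Omega> \<theta> Y"
  shows "represented_by f f' \<Longrightarrow> energy f' < \<infinity> \<Longrightarrow> (\<And>js. length js \<le> k \<Longrightarrow>
      \<exists>g\<in>borel_measurable borel. energy g \<le> ennreal (b\<^sup>2)
          \<and> agree_on_tests \<Omega> (foldr Y js (distr_of \<Omega> f)) (distr_of \<Omega> g))
    \<Longrightarrow> sob_bd \<theta> k f' b"
proof (induction k arbitrary: f f')
  case 0
  obtain g where g: "g \<in> borel_measurable borel" "energy g \<le>
      ennreal (b\<^sup>2)" "agree_on_tests \<Omega> (distr_of \<Omega> f) (distr_of \<Omega> g)"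
    using "0.prems"(3)[of "[]"] by auto
  have "energy f' = energy g"
    by (rule representative_unique[OF 0(1,2) represented_by_borel[OF g(1)] _ g(3)])
        (use g(2) in \<open>auto intro: le_less_trans\<close>)
  then show ?case using g(2) 0(1) by (simp add: represented_by_def)
next
  case (Suc k)
  obtain g where g: "g \<in> borel_measurable borel" "energy g \<le>
      ennreal (b\<^sup>2)" "agree_on_tests \<Omega> (distr_of \<Omega> f) (distr_of \<Omega> g)"
    using Suc.prems(3)[of "[]"] by auto
  have "energy f' = energy g"
    by (rule representative_unique[OF Suc.prems(1,2) represented_by_borel[OF g(1)] _ g(3)])
        (use g(2) in \<open>auto intro: le_less_trans\<close>)
  moreover have "\<exists>g. twisted_deriv \<Omega> \<theta> j f' g \<and> sob_bd \<theta> k g b" for j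
  proof -
    obtain h where h: "h \<in> borel_measurable borel" "energy h \<le>
        ennreal (b\<^sup>2)" "agree_on_tests \<Omega> (Y j (distr_of \<Omega> f)) (distr_of \<Omega> h)"
      using Suc.prems(3)[of "[j]"] by auto
    have rh: "represented_by h h" by (rule represented_by_borel[OF h(1)])
    have eh: "energy h < \<infinity>" using h(2) by (auto intro: le_less_trans)
    have "sob_bd \<theta> k h b"
    proof (rule Suc.IH[OF rh eh])
      fix js :: "'n list" assume "length js \<le> k"
      then have "length (js @ [j]) \<le> Suc k" by simp
      from Suc.prems(3)[OF this] obtain u where u: "u \<in> borel_measurable borel" "energy u \<le>
          ennreal (b\<^sup>2)"
        "agree_on_tests \<Omega> (foldr Y js (Y j (distr_of \<Omega> f))) (distr_of \<Omega> u)" by auto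
      have "agree_on_tests \<Omega> (foldr Y js (Y j (distr_of \<Omega> f))) (foldr Y js (distr_of \<Omega> h))"
        by (rule foldr_agree[OF Y twisted_op_additive[OF Y distr_of_additive[OF Suc.prems(1,2)]] h(3)])
      then have "agree_on_tests \<Omega> (foldr Y js (distr_of \<Omega> h)) (distr_of \<Omega> u)" using u(3)
          by (simp add: agree_on_tests_def)
      then show "\<exists>g\<in>borel_measurable borel. energy g \<le> ennreal (b\<^sup>2)
          \<and> agree_on_tests \<Omega> (foldr Y js (distr_of \<Omega> h)) (distr_of \<Omega> g)"
        using u by blast
    qed
    then show ?thesis using twisted_deriv_iff[OF Y Suc.prems(1,2) rh] h(3) by blast
  qed
  ultimately show ?case using g(2) Suc.prems(1) by (simp add: represented_by_def)
qed

end

text \<open>The index type is finite, so a multiset with the prescribed multiplicities exists and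
  the choice in \<open>multi_op\<close> has a witness.\<close>

lemma multi_op_list: "\<exists>js. multi_op Y \<alpha> = foldr Y js \<and> (\<forall>j. count_list js j = \<alpha> j)"
proof -
  obtain js where js: "mset js = Abs_multiset (\<alpha> :: 'a::finite \<Rightarrow> nat)" using ex_mset by blast
  have "count (Abs_multiset \<alpha>) = \<alpha>" by (rule count_Abs_multiset) simp
  then have "\<forall>j. count_list js j = \<alpha> j" using js by (metis count_mset)
  then have "\<forall>j. count_list (SOME js. \<forall>j. count_list js j = \<alpha> j) j = \<alpha> j" by (rule someI)
  then show ?thesis unfolding multi_op_def by blast
qed

lemma sum_count_list: "(\<Sum>j\<in>UNIV. count_list js (j :: 'a::finite)) = length js"
proof (induction js)
  case (Cons a js)
  have "(\<Sum>j\<in>UNIV. count_list (a # js) j) = (\<Sum>j\<in>UNIV. (if j = a then 1 else 0) + count_list js j)"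
    by (intro sum.cong) auto
  then show ?case using Cons by (simp add: sum.distrib)
qed simp

lemma finite_multi_indices: "finite (multi_indices k :: ('n::finite \<Rightarrow> nat) set)"
proof (rule finite_subset)
  show "multi_indices k \<subseteq> (PiE UNIV (\<lambda>_. {..k}) :: ('n \<Rightarrow> nat) set)"
  proof
    fix \<alpha> :: "'n \<Rightarrow> nat" assume "\<alpha> \<in> multi_indices k"
    then have s: "(\<Sum>j\<in>UNIV. \<alpha> j) \<le> k" by (simp add: multi_indices_def)
    have "\<alpha> j \<le> (\<Sum>j\<in>UNIV. \<alpha> j)" for j by (rule member_le_sum) auto
    then show "\<alpha> \<in> PiE UNIV (\<lambda>_. {..k})" using s by (auto intro: order_trans)
  qed
qed (auto intro: finite_PiE)

context weighted_domain
begin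

text \<open>A list of directions and the list chosen for its multi-index are permutations of each
  other, so \<open>foldr_permute\<close> applies; and each summand of the squared norm is at most
  the whole.\<close>

lemma sobolev_imp_sob_bd:
  fixes f :: "real^'n \<Rightarrow> 'b::{real_normed_field, euclidean_space}"
  assumes Y: "twisted_op \<Omega> \<theta> Y" and \<phi>: "\<And>x. x \<in> \<Omega> \<Longrightarrow> \<Phi> x = \<phi> x"
    and f: "f \<in> sobolev k \<Omega> \<phi> Y" and r: "represented_by f f'"
  shows "sob_bd \<theta> k f' (sobolev_norm k \<Omega> \<phi> Y f)"
proof (rule lists_imp_sob_bd[OF Y r])
  have fL: "f \<in> L2w \<Omega> \<phi>" using f by (simp add: sobolev_def)
  show e: "energy f' < \<infinity>" using L2w_representative(1)[OF r \<phi>] fL by simp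
  let ?b = "sobolev_norm k \<Omega> \<phi> Y f"
  fix js :: "'n list" assume js: "length js \<le> k"
  define \<alpha> where "\<alpha> j = count_list js j" for j
  have \<alpha>: "\<alpha> \<in> multi_indices k" using js by (simp add: multi_indices_def \<alpha>_def sum_count_list)
  obtain js' where js': "multi_op Y \<alpha> = foldr Y js'" "\<And>j. count_list js' j = \<alpha> j" using multi_op_list
      by blast
  have m: "mset js = mset js'" by (rule multiset_eqI) (simp add: count_mset js'(2) \<alpha>_def)
  define g where "g = weak_op \<Omega> \<phi> Y \<alpha> f"
  have "\<exists>g. represents \<Omega> \<phi> (multi_op Y \<alpha> (distr_of \<Omega> f)) g" using f \<alpha> by (simp add: sobolev_def)
  then have g: "represents \<Omega> \<phi> (multi_op Y \<alpha> (distr_of \<Omega> f)) g" unfolding g_def weak_op_def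
      by (rule someI_ex)
  then have gL: "g \<in> L2w \<Omega> \<phi>" and ga: "agree_on_tests \<Omega> (foldr Y js' (distr_of \<Omega> f)) (distr_of \<Omega> g)"
    unfolding represents_def js'(1) agree_on_tests_def by auto
  obtain g' where g': "represented_by g g'" using represented_by_ex[of g] gL by (auto simp: L2w_def)
  have "(L2w_norm \<Omega> \<phi> g)\<^sup>2 \<le> (\<Sum>\<alpha>\<in>multi_indices k. (L2w_norm \<Omega> \<phi> (weak_op \<Omega> \<phi> Y \<alpha> f))\<^sup>2)"
    unfolding g_def by (rule member_le_sum[OF \<alpha>]) (auto simp: finite_multi_indices)
  also have "\<dots> = ?b\<^sup>2" unfolding sobolev_norm_def
      by (rule real_sqrt_pow2[symmetric]) (auto intro: sum_nonneg)
  finally have "energy g' \<le> ennreal (?b\<^sup>2)" using L2w_representative(2)[OF g' \<phi> gL]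
      by (metis ennreal_leI)
  moreover have "agree_on_tests \<Omega> (foldr Y js (distr_of \<Omega> f)) (distr_of \<Omega> g')"
  proof -
    have gb: "g' \<in> borel_measurable borel" using g' by (simp add: represented_by_def)
    have "agree_on_tests \<Omega> (foldr Y js (distr_of \<Omega> f)) (foldr Y js' (distr_of \<Omega> f))"
      by (rule foldr_permute[OF Y distr_of_additive[OF r e] m])
    then show ?thesis using ga distr_of_representative[OF g']
        distr_of_representative[OF represented_by_borel[OF gb]]
      by (simp add: agree_on_tests_def)
  qed
  ultimately show "\<exists>g\<in>borel_measurable borel. energy g \<le> ennreal (?b\<^sup>2)
      \<and> agree_on_tests \<Omega> (foldr Y js (distr_of \<Omega> f)) (distr_of \<Omega> g)"
    using g' by (auto simp: represented_by_def)
qed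

text \<open>Each multi-index contributes at most \<open>b\<^sup>2\<close>, whence the square root of
  their number. The function picked by \<open>weak_op\<close> has the same norm as the one supplied
  by \<open>sob_bd_imp_lists\<close>, by uniqueness.\<close>

lemma sob_bd_imp_sobolev:
  fixes f :: "real^'n \<Rightarrow> 'b::{real_normed_field, euclidean_space}"
  assumes Y: "twisted_op \<Omega> \<theta> Y" and \<phi>: "\<And>x. x \<in> \<Omega> \<Longrightarrow> \<Phi> x = \<phi> x"
    and r: "represented_by f f'" and bd: "sob_bd \<theta> k f' b" and b: "b \<ge> 0"
  shows "f \<in> sobolev k \<Omega> \<phi> Y"
    and "sobolev_norm k \<Omega> \<phi> Y f \<le> sqrt (real (card (multi_indices k :: ('n \<Rightarrow> nat) set))) * b"
proof -
  have e: "energy f' < \<infinity>" using sob_bdD[OF bd] by (auto intro: le_less_trans)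
  have main: "\<exists>g\<in>borel_measurable borel. energy g \<le> ennreal (b\<^sup>2)
      \<and> represents \<Omega> \<phi> (multi_op Y \<alpha> (distr_of \<Omega> f)) g"
    if \<alpha>: "\<alpha> \<in> multi_indices k" for \<alpha>
  proof -
    obtain js where js: "multi_op Y \<alpha> = foldr Y js" "\<And>j. count_list js j = \<alpha> j" using multi_op_list
        by blast
    have "length js \<le> k" using \<alpha> sum_count_list[of js] js(2) by (simp add: multi_indices_def)
    from sob_bd_imp_lists[OF Y r bd this] obtain g where g: "g \<in> borel_measurable borel" "energy g \<le>
        ennreal (b\<^sup>2)"
      "agree_on_tests \<Omega> (foldr Y js (distr_of \<Omega> f)) (distr_of \<Omega> g)" by blast
    have "energy g < \<infinity>" using g(2) by (auto intro: le_less_trans)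
    then have "g \<in> L2w \<Omega> \<phi>" using L2w_representative(1)[OF represented_by_borel[OF g(1)] \<phi>] by simp
    then have "represents \<Omega> \<phi> (multi_op Y \<alpha> (distr_of \<Omega> f)) g"
      using g(3) unfolding represents_def js(1) agree_on_tests_def by blast
    then show ?thesis using g by blast
  qed
  have "f \<in> L2w \<Omega> \<phi>" using L2w_representative(1)[OF r \<phi>] e by simp
  then show "f \<in> sobolev k \<Omega> \<phi> Y" using main unfolding sobolev_def by blast
  have "(L2w_norm \<Omega> \<phi> (weak_op \<Omega> \<phi> Y \<alpha> f))\<^sup>2 \<le> b\<^sup>2" if \<alpha>: "\<alpha> \<in> multi_indices k" for \<alpha>
  proof -
    obtain g where g: "g \<in> borel_measurable borel" "energy g \<le>
        ennreal (b\<^sup>2)" "represents \<Omega> \<phi> (multi_op Y \<alpha> (distr_of \<Omega> f)) g"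
      using main[OF \<alpha>] by blast
    define h where "h = weak_op \<Omega> \<phi> Y \<alpha> f"
    have "\<exists>g. represents \<Omega> \<phi> (multi_op Y \<alpha> (distr_of \<Omega> f)) g" using g(3) by blast
    then have h: "represents \<Omega> \<phi> (multi_op Y \<alpha> (distr_of \<Omega> f)) h" unfolding h_def weak_op_def
        by (rule someI_ex)
    then have hL: "h \<in> L2w \<Omega> \<phi>" by (simp add: represents_def)
    then obtain h' where h': "represented_by h h'" using represented_by_ex[of h] by (auto simp: L2w_def)
    have eh: "energy h' < \<infinity>" using L2w_representative(1)[OF h' \<phi>] hL by simp
    have "agree_on_tests \<Omega> (distr_of \<Omega> h) (distr_of \<Omega> g)" using g(3) h
        unfolding represents_def agree_on_tests_def by simp
    then have "energy h' = energy g"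
      by (intro representative_unique[OF h' eh represented_by_borel[OF g(1)]])
          (use g(2) in \<open>auto intro: le_less_trans\<close>)
    then have "ennreal ((L2w_norm \<Omega> \<phi> h)\<^sup>2) \<le> ennreal (b\<^sup>2)" using L2w_representative(2)[OF h' \<phi> hL] g(2)
        by simp
    then show ?thesis by (simp add: h_def)
  qed
  then have "(\<Sum>\<alpha>\<in>multi_indices k. (L2w_norm \<Omega> \<phi> (weak_op \<Omega> \<phi> Y \<alpha> f))\<^sup>2) \<le>
      (\<Sum>\<alpha>\<in>(multi_indices k :: ('n \<Rightarrow> nat) set). b\<^sup>2)"
    by (rule sum_mono)
  then have "sobolev_norm k \<Omega> \<phi> Y f \<le> sqrt (real (card (multi_indices k :: ('n \<Rightarrow> nat) set)) * b\<^sup>2)"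
    unfolding sobolev_norm_def by (intro real_sqrt_le_mono) simp
  then show "sobolev_norm k \<Omega> \<phi> Y f \<le> sqrt (real (card (multi_indices k :: ('n \<Rightarrow> nat) set))) * b"
    using b by (simp add: real_sqrt_mult)
qed

end

section \<open>Unpacking admissibility, and the conclusion\<close>

lemma abs_foldr_partial_le: "\<bar>foldr partial js f x\<bar> \<le> nabla_norm (length js) f x"
proof -
  have "finite {js' :: 'a list. set js' \<subseteq> UNIV \<and> length js' = length js}"
      by (rule finite_lists_length_eq) simp
  then have "finite {js' :: 'a list. length js' = length js}" by simp
  then have "(foldr partial js f x)\<^sup>2 \<le> (\<Sum>js' | length js' = length js. (foldr partial js' f x)\<^sup>2)"
    by (intro member_le_sum) auto
  then have "sqrt ((foldr partial js f x)\<^sup>2) \<le> nabla_norm (length js) f x"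
    unfolding nabla_norm_def by (rule real_sqrt_le_mono)
  then show ?thesis by simp
qed

lemma smooth_on_foldr_partial: "smooth_on U f \<Longrightarrow> smooth_on U (foldr partial js f)"
  by (induction js) (auto intro: smooth_on_partial)

lemma foldr_partial_minus:
  assumes f: "smooth_on UNIV f"
  shows "foldr partial js (\<lambda>x. - f x) = (\<lambda>x. - foldr partial js f x)"
proof (induction js)
  case (Cons j js)
  have "partial j (\<lambda>x. - foldr partial js f x) x = - partial j (foldr partial js f) x" for x
    by (rule partial_minus) (use smooth_on_differentiable[OF smooth_on_foldr_partial[OF f]] in simp)
  then show ?case using Cons by auto
qed simp

text \<open>Adding the two conditions cancels the Laplacian.\<close>

lemma growth_cond_grad:
  assumes "growth_cond 1 UNIV \<psi>" "growth_cond (-1) UNIV \<psi>"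
  shows "filterlim (\<lambda>x. norm (grad \<psi> x)) at_top at_infinity"
proof -
  obtain a where a: "0 < a" "filterlim (\<lambda>x. a * (norm (grad \<psi> x))\<^sup>2
      + 1 * laplacian \<psi> x) at_top at_infinity"
    using assms(1) by (auto simp: growth_cond_def)
  obtain b where b: "0 < b" "filterlim (\<lambda>x. b * (norm (grad \<psi> x))\<^sup>2
      + (- 1) * laplacian \<psi> x) at_top at_infinity"
    using assms(2) by (auto simp: growth_cond_def)
  have s: "filterlim (\<lambda>x. (a + b) * (norm (grad \<psi> x))\<^sup>2) at_top at_infinity"
    using filterlim_at_top_add_at_top[OF a(2) b(2)] by (simp add: algebra_simps)
  show ?thesis
    unfolding filterlim_at_top
  proof
    fix Z :: real
    have "eventually (\<lambda>x. (a + b) * (max Z 0)\<^sup>2 \<le> (a + b) * (norm (grad \<psi> x))\<^sup>2) at_infinity"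
      using s unfolding filterlim_at_top by blast
    then show "eventually (\<lambda>x. Z \<le> norm (grad \<psi> x)) at_infinity"
    proof eventually_elim
      case (elim x)
      then have "(max Z 0)\<^sup>2 \<le> (norm (grad \<psi> x))\<^sup>2" using a(1) b(1) by simp
      then have "max Z 0 \<le> norm (grad \<psi> x)" by (rule power2_le_imp_le) simp
      then show ?case by simp
    qed
  qed
qed

lemma normal_cond_bound:
  assumes "normal_cond \<Omega> \<psi>"
  shows "\<exists>R c. 0 \<le> c \<and> c < 1 \<and> (\<forall>p\<in>frontier \<Omega>. norm p > R \<longrightarrow>
    \<bar>grad \<psi> p \<bullet> outward_normal \<Omega> p\<bar> \<le> c * norm (grad \<psi> p))"
proof -
  let ?q = "\<lambda>x. ereal (inverse (norm (grad \<psi> x)) * \<bar>grad \<psi> x \<bullet> outward_normal \<Omega> x\<bar>)"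
  obtain r where "(SUP x\<in>{x\<in>frontier \<Omega>. norm x > r}. ?q x) < 1"
    using assms unfolding normal_cond_def INF_less_iff by blast
  then obtain c where c: "(SUP x\<in>{x\<in>frontier \<Omega>. norm x > r}. ?q x) < ereal c" "ereal c < 1"
    using ereal_dense2 by blast
  \<comment> \<open>The supremum over an empty set is minus infinity, so \<open>c\<close> may be
    negative; \<open>max c 0\<close> repairs this.\<close>
  have "\<bar>grad \<psi> p \<bullet> outward_normal \<Omega> p\<bar> \<le> max c 0 * norm (grad \<psi> p)" if p: "p \<in> frontier \<Omega>" "norm p > r"
      for p
  proof (cases "grad \<psi> p = 0")
    case False
    have "?q p \<le> (SUP x\<in>{x\<in>frontier \<Omega>. norm x > r}. ?q x)" by (rule SUP_upper) (use p in simp)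
    then have "?q p < ereal c" using c(1) by (rule le_less_trans)
    then have "inverse (norm (grad \<psi> p)) * \<bar>grad \<psi> p \<bullet> outward_normal \<Omega> p\<bar> \<le> max c 0" by simp
    then show ?thesis using False by (simp add: field_simps)
  qed simp
  moreover have "max c 0 < 1" using c(2) by (simp flip: one_ereal_def)
  ultimately show ?thesis by (intro exI[of _ r] exI[of _ "max c 0"]) simp
qed

lemma sobolev_norm_nonneg: "sobolev_norm k \<Omega> \<phi> Y f \<ge> 0"
  unfolding sobolev_norm_def by (intro real_sqrt_ge_zero sum_nonneg) simp

context weighted_domain
begin

lemma sobolev_representative:
  assumes "f \<in> sobolev k \<Omega> \<phi> Y"
  shows "\<exists>f'. represented_by f f'"
  using assms by (intro represented_by_ex) (simp add: sobolev_def L2w_def)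

lemma sobolev_switch:
  fixes f :: "real^'n \<Rightarrow> 'b::{real_normed_field, euclidean_space}"
  assumes Y1: "twisted_op \<Omega> \<theta>1 Y1" and Y2: "twisted_op \<Omega> \<theta>2 Y2" and \<phi>: "\<And>x. x \<in> \<Omega> \<Longrightarrow> \<Phi> x = \<phi> x"
    and D: "D \<ge> 0" "\<And>(f :: real^'n \<Rightarrow> 'b) b. 0 \<le> b \<Longrightarrow> sob_bd \<theta>1 k f b \<Longrightarrow> sob_bd \<theta>2 k f (D * b)"
    and f: "f \<in> sobolev k \<Omega> \<phi> Y1"
  shows "f \<in> sobolev k \<Omega> \<phi> Y2"
    and "sobolev_norm k \<Omega> \<phi> Y2 f \<le> sqrt (real (card (multi_indices k :: ('n \<Rightarrow> nat) set))) * D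
        * sobolev_norm k \<Omega> \<phi> Y1 f"
proof -
  obtain f' where r: "represented_by f f'" using sobolev_representative[OF f] by blast
  let ?N = "sobolev_norm k \<Omega> \<phi> Y1 f"
  have bd: "sob_bd \<theta>2 k f' (D * ?N)"
    by (rule D(2)[OF sobolev_norm_nonneg sobolev_imp_sob_bd[OF Y1 \<phi> f r]])
  have n: "D * ?N \<ge> 0" using D(1) sobolev_norm_nonneg by (rule mult_nonneg_nonneg)
  show "f \<in> sobolev k \<Omega> \<phi> Y2" by (rule sob_bd_imp_sobolev(1)[OF Y2 \<phi> r bd n])
  show "sobolev_norm k \<Omega> \<phi> Y2 f \<le> sqrt (real (card (multi_indices k :: ('n \<Rightarrow> nat) set))) * D * ?N"
    using sob_bd_imp_sobolev(2)[OF Y2 \<phi> r bd n] by (simp add: mult.assoc)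
qed

text \<open>Bounds with respect to \<theta> are converted into bounds on plain derivatives, where
  \<open>sob_compact\<close> applies, and the convergence is converted back.\<close>

lemma sobolev_compactly_embedded:
  assumes Y: "twisted_op \<Omega> \<theta> (Y :: 'n \<Rightarrow> ('n, 'b::{real_normed_field, euclidean_space}) distribution \<Rightarrow>
      ('n, 'b) distribution)"
    and \<phi>: "\<And>x. x \<in> \<Omega> \<Longrightarrow> \<Phi> x = \<phi> x"
    and D1: "D1 \<ge> 0" "\<And>(f :: real^'n \<Rightarrow> 'b) b. 0 \<le> b \<Longrightarrow> sob_bd \<theta> (Suc k) f b \<Longrightarrow>
        sob_bd (\<lambda>x. 0) (Suc k) f (D1 * b)"
    and D2: "D2 \<ge> 0" "\<And>(f :: real^'n \<Rightarrow> 'b) b. 0 \<le> b \<Longrightarrow> sob_bd (\<lambda>x. 0) k f b \<Longrightarrow> sob_bd \<theta> k f (D2 * b)"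
  shows "compactly_embedded (sobolev (Suc k) \<Omega> \<phi> Y :: (real^'n \<Rightarrow> 'b) set) (sobolev_norm (Suc k) \<Omega> \<phi> Y)
    (sobolev k \<Omega> \<phi> Y) (sobolev_norm k \<Omega> \<phi> Y)"
  unfolding compactly_embedded_def
proof (intro conjI allI impI)
  show "(sobolev (Suc k) \<Omega> \<phi> Y :: (real^'n \<Rightarrow> 'b) set) \<subseteq> sobolev k \<Omega> \<phi> Y"
  proof
    fix f assume f: "f \<in> sobolev (Suc k) \<Omega> \<phi> Y"
    obtain f' where r: "represented_by f f'" using sobolev_representative[OF f] by blast
    have b: "sob_bd \<theta> k f' (sobolev_norm (Suc k) \<Omega> \<phi> Y f)"
        by (rule sob_bd_SucD[OF sobolev_imp_sob_bd[OF Y \<phi> f r]])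
    show "f \<in> sobolev k \<Omega> \<phi> Y" by (rule sob_bd_imp_sobolev(1)[OF Y \<phi> r b sobolev_norm_nonneg])
  qed
next
  fix F :: "nat \<Rightarrow> real^'n \<Rightarrow> 'b"
  assume F0: "(\<forall>i. F i \<in> sobolev (Suc k) \<Omega> \<phi> Y) \<and> (\<exists>B. \<forall>i. sobolev_norm (Suc k) \<Omega> \<phi> Y (F i) \<le> B)"
  then obtain B where F: "\<And>i. F i \<in> sobolev (Suc k) \<Omega> \<phi> Y"
      and B: "\<And>i. sobolev_norm (Suc k) \<Omega> \<phi> Y (F i) \<le> B" by blast
  have "B \<ge> 0" using order_trans[OF sobolev_norm_nonneg B[of 0]] .
  have \<theta>: "smooth_on UNIV \<theta>" using Y by (simp add: twisted_op_def)
  obtain F' where r: "\<And>i. represented_by (F i) (F' i)" using sobolev_representative[OF F] by metis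
  have b\<theta>: "sob_bd \<theta> (Suc k) (F' i) B" for i
    by (rule sob_bd_mono[OF sobolev_imp_sob_bd[OF Y \<phi> F r] sobolev_norm_nonneg B])
  have b0: "sob_bd (\<lambda>x. 0) (Suc k) (F' i) (D1 * B)" for i by (rule D1(2)[OF \<open>B \<ge> 0\<close> b\<theta>])
  have "D1 * B \<ge> 0" using D1(1) \<open>B \<ge> 0\<close> by simp
  obtain g and s :: "nat \<Rightarrow> nat" where gs: "strict_mono s \<and> g \<in> borel_measurable borel \<and>
      (\<forall>e>0. \<exists>I. \<forall>i\<ge>I. sob_bd (\<lambda>x. 0) k (\<lambda>x. F' (s i) x - g x) e)"
    using sob_compact[of "D1 * B" k F', OF \<open>D1 * B \<ge> 0\<close> b0] by (elim exE) (rule that)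
  then have s: "strict_mono s" and g: "g \<in> borel_measurable borel" by simp_all
  have conv: "\<exists>I. \<forall>i\<ge>I. sob_bd \<theta> k (\<lambda>x. F' (s i) x - g x) (D2 * e)" if e: "e > 0" for e
  proof -
    obtain I where "\<forall>i\<ge>I. sob_bd (\<lambda>x. 0) k (\<lambda>x. F' (s i) x - g x) e" using gs e by blast
    then show ?thesis using D2(2) e by (intro exI[of _ I]) simp
  qed
  \<comment> \<open>One member whose difference from \<open>g\<close> is bounded with respect to
    \<theta> is enough to place the limit \<open>g\<close> in the space.\<close>
  obtain I where I: "sob_bd \<theta> k (\<lambda>x. F' (s I) x - g x) D2" using conv[of 1] by auto
  have "sob_bd \<theta> k (\<lambda>x. F' (s I) x - (F' (s I) x - g x)) (2 * (B + D2))"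
    by (rule sob_bd_diff[OF \<theta> \<open>B \<ge> 0\<close> D2(1) sob_bd_SucD[OF b\<theta>] I])
  then have bg: "sob_bd \<theta> k g (2 * (B + D2))" by simp
  have nn: "2 * (B + D2) \<ge> 0" using \<open>B \<ge> 0\<close> D2(1) by simp
  have gW: "g \<in> sobolev k \<Omega> \<phi> Y" by (rule sob_bd_imp_sobolev(1)[OF Y \<phi> represented_by_borel[OF g] bg nn])
  let ?K = "sqrt (real (card (multi_indices k :: ('n \<Rightarrow> nat) set)))"
  have "(\<lambda>i. sobolev_norm k \<Omega> \<phi> Y (\<lambda>x. F (s i) x - g x)) \<longlonglongrightarrow> 0"
  proof (rule metric_LIMSEQ_I)
    fix e :: real assume e: "e > 0"
    have K: "?K * D2 \<ge> 0" using D2(1) by simp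
    define d where "d = e / (?K * D2 + 1)"
    have d: "d > 0" using e K by (simp add: d_def)
    then have Dd: "D2 * d \<ge> 0" using D2(1) by simp
    obtain I where I: "\<And>i. i \<ge> I \<Longrightarrow> sob_bd \<theta> k (\<lambda>x. F' (s i) x - g x) (D2 * d)" using conv[OF d] by blast
    have "dist (sobolev_norm k \<Omega> \<phi> Y (\<lambda>x. F (s i) x - g x)) 0 < e" if i: "i \<ge> I" for i
    proof -
      have "sobolev_norm k \<Omega> \<phi> Y (\<lambda>x. F (s i) x - g x) \<le> ?K * (D2 * d)"
        by (rule sob_bd_imp_sobolev(2)[OF Y \<phi> represented_by_diff[OF r g] I[OF i] Dd])
      also have "\<dots> < (?K * D2 + 1) * d" using d by (simp add: algebra_simps)
      also have "\<dots> = e" using K by (simp add: d_def)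
      finally show ?thesis using sobolev_norm_nonneg[of k \<Omega> \<phi> Y "\<lambda>x. F (s i) x - g x"]
          by (simp add: dist_real_def)
    qed
    then show "\<exists>I. \<forall>i\<ge>I. dist (sobolev_norm k \<Omega> \<phi> Y (\<lambda>x. F (s i) x - g x)) 0 < e" by blast
  qed
  then show "\<exists>g\<in>sobolev k \<Omega> \<phi> Y. \<exists>s. strict_mono s
      \<and> (\<lambda>i. sobolev_norm k \<Omega> \<phi> Y (\<lambda>x. F (s i) x - g x)) \<longlonglongrightarrow> 0"
    using gW s by blast
qed

lemma mult_bd_minus: "mult_bd p A a \<Longrightarrow> mult_bd p A (\<lambda>x. - a x)"
  unfolding mult_bd_def by (simp add: foldr_partial_minus smooth_on_minus)

lemma mult_bd_partial_Phi:
  assumes "\<And>k x. 1 \<le> k \<Longrightarrow> k \<le> Suc p \<Longrightarrow> nabla_norm k \<Phi> x \<le> C * (1 + norm (grad \<Phi> x))"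
  shows "mult_bd p C (partial j \<Phi>)"
  unfolding mult_bd_def
proof (intro conjI allI impI ballI smooth_on_partial smooth)
  fix js :: "'n list" and x assume "length js \<le> p"
  then have "nabla_norm (length (js @ [j])) \<Phi> x \<le> C * (1 + norm (grad \<Phi> x))" by (intro assms) auto
  then show "\<bar>foldr partial js (partial j \<Phi>) x\<bar> \<le> C * (1 + norm (grad \<Phi> x))"
    using abs_foldr_partial_le[of "js @ [j]" \<Phi> x] by simp
qed

end

theorem proposition2p5:
  fixes \<Omega> :: "(real^'n) set" and \<phi> :: "real^'n \<Rightarrow> real" and m :: nat
  assumes "m \<ge> 2" and "admissible m \<Omega> \<phi>"
  shows "(\<forall>k\<le>m.
      (sobolev k \<Omega> \<phi> (X_op \<phi>) ::
         (real^'n \<Rightarrow> 'b::{real_normed_field, euclidean_space}) set) = sobolev k \<Omega> \<phi> D_op \<and>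
      equivalent_norms_on
        (sobolev k \<Omega> \<phi> (X_op \<phi>) :: (real^'n \<Rightarrow> 'b) set)
        (sobolev_norm k \<Omega> \<phi> (X_op \<phi>)) (sobolev_norm k \<Omega> \<phi> D_op)) \<and>
    (\<forall>k. 1 \<le> k \<and> k \<le> m - 1 \<longrightarrow>
      compactly_embedded
        (sobolev k \<Omega> \<phi> (X_op \<phi>) :: (real^'n \<Rightarrow> 'b) set) (sobolev_norm k \<Omega> \<phi> (X_op \<phi>))
        (sobolev (k - 1) \<Omega> \<phi> (X_op \<phi>)) (sobolev_norm (k - 1) \<Omega> \<phi> (X_op \<phi>)))"
proof -
  have \<Omega>: "open \<Omega>" and bd: "Ck_boundary m \<Omega>" and reach: "reach (frontier \<Omega>) > 0"
    using assms(2) by (simp_all add: admissible_def)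
  obtain \<psi> where \<psi>: "smooth_on UNIV \<psi>" "\<And>x. x \<in> \<Omega> \<Longrightarrow>
      \<psi> x = \<phi> x" "growth_cond 1 UNIV \<psi>" "growth_cond (-1) UNIV \<psi>"
    "deriv_bound_cond m UNIV \<psi>" "normal_cond \<Omega> \<psi>"
    using assms(2) unfolding admissible_def by blast
  obtain C where C: "C > 0" "\<And>k x. 1 \<le> k \<Longrightarrow> k \<le> m \<Longrightarrow> nabla_norm k \<psi> x \<le> C * (1 + norm (grad \<psi> x))"
    using \<psi>(5) unfolding deriv_bound_cond_def by blast
  obtain R c where c: "0 \<le> c" "c < 1" "\<And>p. p \<in> frontier \<Omega> \<Longrightarrow> norm p > R \<Longrightarrow>
      \<bar>grad \<psi> p \<bullet> outward_normal \<Omega> p\<bar> \<le> c * norm (grad \<psi> p)"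
    using normal_cond_bound[OF \<psi>(6)] by blast
  obtain r where r: "r > 0" "\<And>y. y \<in> frontier \<Omega> \<Longrightarrow> ball y r \<subseteq> unique_nearest (frontier \<Omega>)"
    by (rule reach_posE[OF reach]) (rule that)
  \<comment> \<open>\<open>tangent_balls\<close> asks for a radius strictly below \<open>r\<close>.
    The Hessian bound is the case k = 2 of the derivative bound, available because \<open>m\<close>
    is at least 2.\<close>
  interpret weighted_domain \<Omega> \<psi> "outward_normal \<Omega>" "r / 2" C R c
  proof
    show "norm (outward_normal \<Omega> p) = 1 \<and> ball (p - (r / 2) *\<^sub>R outward_normal \<Omega> p) (r / 2) \<subseteq> \<Omega> \<and>
        ball (p + (r / 2) *\<^sub>R outward_normal \<Omega> p) (r / 2) \<inter> \<Omega> = {}" if "p \<in> frontier \<Omega>" for p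
      by (rule tangent_balls[OF \<Omega> bd _ r(2) _ _ that]) (use assms(1) r(1) in simp_all)
  qed (use \<Omega> \<psi>(1) C assms(1) growth_cond_grad[OF \<psi>(3,4)] r(1) c in simp_all)
  \<comment> \<open>Bounds on the derivatives of \<psi> up to order \<open>m\<close> give bounds on
    \<open>p = m - 1\<close> derivatives of the multipliers, and \<open>sob_bd_switch\<close> then
    reaches order \<open>Suc p = m\<close>.\<close>
  obtain p where p: "m = Suc p" using assms(1) by (cases m) auto
  have a: "mult_bd p C (partial j \<psi>)" for j using C(2) by (intro mult_bd_partial_Phi) (simp add: p)
  have z: "partial j (\<lambda>x. 0) x = 0" for j and x :: "real^'n" by simp
  obtain C1 where C1: "C1 \<ge> 0" "\<And>(f :: real^'n \<Rightarrow> 'b) b. sob_bd (\<lambda>x. 0) (Suc 0) f b \<Longrightarrow>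
      grad_energy f \<le> ennreal ((C1 * b)\<^sup>2)"
    using hardy_D[where 'b='b] by blast
  obtain C2 where C2: "C2 \<ge> 0" "\<And>(f :: real^'n \<Rightarrow> 'b) b. sob_bd \<psi> (Suc 0) f b \<Longrightarrow>
      grad_energy f \<le> ennreal ((C2 * b)\<^sup>2)"
    using hardy_X[where 'b='b] by blast
  have DX: "\<exists>D\<ge>0. \<forall>(f :: real^'n \<Rightarrow> 'b) b. 0 \<le> b \<longrightarrow> sob_bd (\<lambda>x. 0) k f b \<longrightarrow> sob_bd \<psi> k f (D * b)" if "k \<le> m"
      for k
    by (rule sob_bd_switch[where a="\<lambda>j x. - partial j \<psi> x" and A=C and p=p, OF smooth_on_const C1])
       (use C(1) mult_bd_minus[OF a] that in \<open>simp_all add: p\<close>)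
  have XD: "\<exists>D\<ge>0. \<forall>(f :: real^'n \<Rightarrow> 'b) b. 0 \<le> b \<longrightarrow> sob_bd \<psi> k f b \<longrightarrow> sob_bd (\<lambda>x. 0) k f (D * b)" if "k \<le> m"
      for k
    by (rule sob_bd_switch[where a="\<lambda>j. partial j \<psi>" and A=C and p=p, OF \<psi>(1) C2])
       (use C(1) a that in \<open>simp_all add: p\<close>)
  note X = twisted_op_X[OF \<Omega> \<psi>(1,2)]
  have "(sobolev k \<Omega> \<phi> (X_op \<phi>) :: (real^'n \<Rightarrow> 'b) set) = sobolev k \<Omega> \<phi> D_op \<and>
      equivalent_norms_on (sobolev k \<Omega> \<phi> (X_op \<phi>) :: (real^'n \<Rightarrow> 'b) set)
        (sobolev_norm k \<Omega> \<phi> (X_op \<phi>)) (sobolev_norm k \<Omega> \<phi> D_op)" if k: "k \<le> m" for k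
  proof -
    obtain D1 where D1: "D1 \<ge> 0" "\<And>(f :: real^'n \<Rightarrow> 'b) b. 0 \<le> b \<Longrightarrow> sob_bd (\<lambda>x. 0) k f b \<Longrightarrow>
        sob_bd \<psi> k f (D1 * b)"
      using DX[OF k] by blast
    obtain D2 where D2: "D2 \<ge> 0" "\<And>(f :: real^'n \<Rightarrow> 'b) b. 0 \<le> b \<Longrightarrow> sob_bd \<psi> k f b \<Longrightarrow>
        sob_bd (\<lambda>x. 0) k f (D2 * b)"
      using XD[OF k] by blast
    let ?K = "sqrt (real (card (multi_indices k :: ('n \<Rightarrow> nat) set)))"
    let ?NX = "sobolev_norm k \<Omega> \<phi> (X_op \<phi>) :: (real^'n \<Rightarrow> 'b) \<Rightarrow> real"
        and ?ND = "sobolev_norm k \<Omega> \<phi> D_op :: (real^'n \<Rightarrow> 'b) \<Rightarrow> real"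
    have toX: "f \<in> sobolev k \<Omega> \<phi> (X_op \<phi>)" if f: "f \<in> sobolev k \<Omega> \<phi> D_op" for f :: "real^'n \<Rightarrow> 'b"
      by (rule sobolev_switch(1)[OF twisted_op_D X \<psi>(2) D1 f])
    have toX_norm: "?NX f \<le> ?K * D1 * ?ND f" if f: "f \<in> sobolev k \<Omega> \<phi> D_op" for f :: "real^'n \<Rightarrow> 'b"
      by (rule sobolev_switch(2)[OF twisted_op_D X \<psi>(2) D1 f])
    have toD: "f \<in> sobolev k \<Omega> \<phi> D_op" if f: "f \<in> sobolev k \<Omega> \<phi> (X_op \<phi>)" for f :: "real^'n \<Rightarrow> 'b"
      by (rule sobolev_switch(1)[OF X twisted_op_D \<psi>(2) D2 f])
    have toD_norm: "?ND f \<le> ?K * D2 * ?NX f" if f: "f \<in> sobolev k \<Omega> \<phi> (X_op \<phi>)" for f :: "real^'n \<Rightarrow> 'b"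
      by (rule sobolev_switch(2)[OF X twisted_op_D \<psi>(2) D2 f])
    have eq: "(sobolev k \<Omega> \<phi> (X_op \<phi>) :: (real^'n \<Rightarrow> 'b) set) = sobolev k \<Omega> \<phi> D_op"
      using toX toD by blast
    let ?B = "?K * D1 + ?K * D2 + 1"
    have nn: "?K * D1 \<ge> 0" "?K * D2 \<ge> 0" using D1(1) D2(1) by simp_all
    have "?NX f \<le> ?B * ?ND f \<and> ?ND f \<le> ?B * ?NX f" if f: "f \<in> sobolev k \<Omega> \<phi> (X_op \<phi>)" for f
    proof
      have "?K * D1 * ?ND f \<le> ?B * ?ND f" by (intro mult_right_mono sobolev_norm_nonneg) (use nn in simp)
      then show "?NX f \<le> ?B * ?ND f" using toX_norm[OF toD[OF f]] by linarith
      have "?K * D2 * ?NX f \<le> ?B * ?NX f" by (intro mult_right_mono sobolev_norm_nonneg) (use nn in simp)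
      then show "?ND f \<le> ?B * ?NX f" using toD_norm[OF f] by linarith
    qed
    moreover have "?B > 0" using nn by linarith
    ultimately show ?thesis using eq unfolding equivalent_norms_on_def by blast
  qed
  moreover have "compactly_embedded
        (sobolev k \<Omega> \<phi> (X_op \<phi>) :: (real^'n \<Rightarrow> 'b) set) (sobolev_norm k \<Omega> \<phi> (X_op \<phi>))
        (sobolev (k - 1) \<Omega> \<phi> (X_op \<phi>)) (sobolev_norm (k - 1) \<Omega> \<phi> (X_op \<phi>))" if k: "1 \<le> k" "k \<le>
            m - 1" for k
  proof -
    obtain l where l: "k = Suc l" using k(1) by (cases k) auto
    have "Suc l \<le> m" "l \<le> m" using k l by simp_all
    obtain D1 where D1: "D1 \<ge> 0" "\<And>(f :: real^'n \<Rightarrow> 'b) b. 0 \<le> b \<Longrightarrow> sob_bd \<psi> (Suc l) f b \<Longrightarrow>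
        sob_bd (\<lambda>x. 0) (Suc l) f (D1 * b)"
      using XD[OF \<open>Suc l \<le> m\<close>] by blast
    obtain D2 where D2: "D2 \<ge> 0" "\<And>(f :: real^'n \<Rightarrow> 'b) b. 0 \<le> b \<Longrightarrow> sob_bd (\<lambda>x. 0) l f b \<Longrightarrow>
        sob_bd \<psi> l f (D2 * b)"
      using DX[OF \<open>l \<le> m\<close>] by blast
    show ?thesis unfolding l diff_Suc_1
      by (rule sobolev_compactly_embedded[OF X \<psi>(2) D1 D2])
  qed
  ultimately show ?thesis by blast
qed

end
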